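(* Let $k,l\ge 1$ be relatively prime. Then the space $\mathrm H_{k,l}(\mathrm{End}(\xi_k^{univ}))$ is homotopy equivalent to $\mathrm H_{k,l}(A_k^{univ})\times\mathbb CP^\infty$.
   Context: $\mathrm{PU}(k)$ is the projective unitary group, identified with the group of $*$-automorphisms of $M_k(\mathbb C)$. An $M_k(\mathbb C)$-bundle is a locally trivial bundle with fiber $M_k(\mathbb C)$ and structure group $\mathrm{PU}(k)$; $A_k^{univ}\to\mathrm{BPU}(k)$ is the universal one, and $\xi_k^{univ}\to\mathrm{BU}(k)$ is the universal complex vector bundle of rank $k$ (with Hermitian metric), so $\mathrm{End}(\xi_k^{univ})$ is an $M_k(\mathbb C)$-bundle over $\mathrm{BU}(k)$. For an $M_k(\mathbb C)$-bundle $A\to B$, $\mathrm H_{k,l}(A)\to B$ denotes the bundle obtained by applying $\mathrm{Hom}_{alg}(-,M_{kl}(\mathbb C))$ (unital $*$-homomorphisms) fiberwise: its fiber over $x\in B$ is the space of unital $*$-homomorphisms $A_x\to M_{kl}(\mathbb C)$. *)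

theory Defs
  imports "HOL-Analysis.Analysis"
begin

section \<open>Final topologies\<close>

definition final_topology :: "'a set \<Rightarrow> ('b topology \<times> ('b \<Rightarrow> 'a)) set \<Rightarrow> 'a topology" where
  "final_topology S \<F> =
     topology (\<lambda>W. W \<subseteq> S \<and> (\<forall>(X, f)\<in>\<F>. openin X {x \<in> topspace X. f x \<in> W}))"

lemma openin_final_topology:
  "openin (final_topology S \<F>) W \<longleftrightarrow>
     W \<subseteq> S \<and> (\<forall>(X, f)\<in>\<F>. openin X {x \<in> topspace X. f x \<in> W})"
proof -
  let ?P = "\<lambda>W. W \<subseteq> S \<and> (\<forall>(X, f)\<in>\<F>. openin X {x \<in> topspace X. f x \<in> W})"
  have Int: "{x \<in> topspace X. f x \<in> V \<inter> W} = {x \<in> topspace X. f x \<in> V} \<inter> {x \<in> topspace X. f x \<in> W}"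
    and Union: "{x \<in> topspace X. f x \<in> \<Union>\<W>} = (\<Union>W\<in>\<W>. {x \<in> topspace X. f x \<in> W})"
    for X :: "'b topology" and f :: "'b \<Rightarrow> 'a" and V W \<W>
    by auto
  have "istopology ?P"
    unfolding istopology_def case_prod_beta Int Union
    by (intro conjI allI impI ballI openin_Int openin_Union) auto
  then show ?thesis
    by (simp add: final_topology_def topology_inverse')
qed

lemma topspace_final_topology:
  assumes "\<And>X f. (X, f) \<in> \<F> \<Longrightarrow> f ` topspace X \<subseteq> S"
  shows "topspace (final_topology S \<F>) = S"
proof (rule subset_antisym)
  show "topspace (final_topology S \<F>) \<subseteq> S"
    using openin_final_topology[of S \<F> "topspace (final_topology S \<F>)"] by simp
  have "openin X {x \<in> topspace X. f x \<in> S}" if "(X, f) \<in> \<F>" for X f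
  proof -
    have "{x \<in> topspace X. f x \<in> S} = topspace X"
      using assms[OF that] by (auto simp: image_subset_iff)
    then show ?thesis by simp
  qed
  then have "openin (final_topology S \<F>) S"
    by (simp add: openin_final_topology case_prod_beta)
  then show "S \<subseteq> topspace (final_topology S \<F>)"
    by (rule openin_subset)
qed


section \<open>Hermitian spaces and complex *-algebras\<close>

text \<open>The operations are only meaningful on elems.\<close>

record 'a complex_space =
  elems :: "'a set"
  vadd :: "'a \<Rightarrow> 'a \<Rightarrow> 'a"
  vscale :: "complex \<Rightarrow> 'a \<Rightarrow> 'a"

record 'a hermitian_space = "'a complex_space" +
  herm :: "'a \<Rightarrow> 'a \<Rightarrow> complex"

record 'a star_algebra = "'a complex_space" +
  amult :: "'a \<Rightarrow> 'a \<Rightarrow> 'a"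
  aone :: 'a
  astar :: "'a \<Rightarrow> 'a"

definition linear_maps ::
    "('a, 'm) complex_space_scheme \<Rightarrow> ('b, 'n) complex_space_scheme \<Rightarrow> ('a \<Rightarrow> 'b) set" where
  "linear_maps V W = {f \<in> elems V \<rightarrow>\<^sub>E elems W.
     (\<forall>v\<in>elems V. \<forall>w\<in>elems V. f (vadd V v w) = vadd W (f v) (f w)) \<and>
     (\<forall>c. \<forall>v\<in>elems V. f (vscale V c v) = vscale W c (f v))}"

definition unitary_isos :: "'a hermitian_space \<Rightarrow> 'b hermitian_space \<Rightarrow> ('a \<Rightarrow> 'b) set" where
  "unitary_isos V W = {f \<in> linear_maps V W. bij_betw f (elems V) (elems W) \<and>
     (\<forall>v\<in>elems V. \<forall>w\<in>elems V. herm W (f v) (f w) = herm V v w)}"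

definition star_homs :: "'a star_algebra \<Rightarrow> 'b star_algebra \<Rightarrow> ('a \<Rightarrow> 'b) set" where
  "star_homs X Y = {f \<in> linear_maps X Y.
     (\<forall>a\<in>elems X. \<forall>b\<in>elems X. f (amult X a b) = amult Y (f a) (f b)) \<and>
     f (aone X) = aone Y \<and>
     (\<forall>a\<in>elems X. f (astar X a) = astar Y (f a))}"

definition star_isos :: "'a star_algebra \<Rightarrow> 'b star_algebra \<Rightarrow> ('a \<Rightarrow> 'b) set" where
  "star_isos X Y = {f \<in> star_homs X Y. bij_betw f (elems X) (elems Y)}"

definition coordinate_space :: "(complex^'k::finite) hermitian_space" where
  "coordinate_space = \<lparr>elems = UNIV, vadd = (+), vscale = (*s),
     herm = (\<lambda>v w. \<Sum>i\<in>UNIV. cnj (v $ i) * w $ i)\<rparr>"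

definition matrix_algebra :: "(complex^'k::finite^'k) star_algebra" where
  "matrix_algebra = \<lparr>elems = UNIV, vadd = (+), vscale = (\<lambda>c M. \<chi> i j. c * M $ i $ j),
     amult = (**), aone = mat 1, astar = (\<lambda>M. \<chi> i j. cnj (M $ j $ i))\<rparr>"

definition endomorphism_algebra :: "'a hermitian_space \<Rightarrow> ('a \<Rightarrow> 'a) star_algebra" where
  "endomorphism_algebra V = \<lparr>
     elems = linear_maps V V,
     vadd = (\<lambda>S T. \<lambda>v\<in>elems V. vadd V (S v) (T v)),
     vscale = (\<lambda>c T. \<lambda>v\<in>elems V. vscale V c (T v)),
     amult = (\<lambda>S T. compose (elems V) S T),
     aone = (\<lambda>v\<in>elems V. v),
     astar = (\<lambda>T. THE S. S \<in> linear_maps V V \<and>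
       (\<forall>v\<in>elems V. \<forall>w\<in>elems V. herm V (S v) w = herm V v (T w)))\<rparr>"


section \<open>Bundles\<close>

text \<open>
  A bundle is a family of structures over the base together with a topology on the disjoint
  union of the fibres, realised as a set of pairs; the projection is fst.  A bundle given by an
  arbitrary projection p is brought into this form by replacing each point e by (p e, e).
\<close>

record ('b, 'e, 's) fibre_bundle =
  base :: "'b topology"
  fibre :: "'b \<Rightarrow> 's"
  total_space :: "('b \<times> 'e) topology"

text \<open>
  Below, the argument isos assigns to a fibre structure the set of isomorphisms onto it from the
  model fibre.  For finite-dimensional fibres a chart (U, h) thus has transition
  functions that are automatically continuous maps into the automorphism group of the model:
  U(k) for the model \<open>coordinate_space\<close>, PU(k) for the model \<open>matrix_algebra\<close>.
\<close>

definition chart ::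
    "('s \<Rightarrow> ('m::topological_space \<Rightarrow> 'e) set) \<Rightarrow> ('b, 'e, 's) fibre_bundle
      \<Rightarrow> 'b set \<Rightarrow> ('b \<Rightarrow> 'm \<Rightarrow> 'e) \<Rightarrow> bool" where
  "chart isos E U h \<longleftrightarrow>
     openin (base E) U \<and> (\<forall>x\<in>U. h x \<in> isos (fibre E x)) \<and>
     homeomorphic_map (prod_topology (subtopology (base E) U) euclidean)
       (subtopology (total_space E) (U \<times> UNIV)) (\<lambda>(x, v). (x, h x v))"

definition locally_trivial ::
    "('s \<Rightarrow> ('m::topological_space \<Rightarrow> 'e) set) \<Rightarrow> ('b, 'e, 's) fibre_bundle \<Rightarrow> bool" where
  "locally_trivial isos E \<longleftrightarrow>
     continuous_map (total_space E) (base E) fst \<and>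
     (\<forall>x\<in>topspace (base E). \<exists>U h. x \<in> U \<and> chart isos E U h)"

text \<open>A trivialising open cover with a subordinate locally finite partition of unity.\<close>

definition numerable ::
    "('s \<Rightarrow> ('m::topological_space \<Rightarrow> 'e) set) \<Rightarrow> ('b, 'e, 's) fibre_bundle \<Rightarrow> bool" where
  "numerable isos E \<longleftrightarrow>
     (\<exists>\<U> (\<pi> :: 'b set \<Rightarrow> 'b \<Rightarrow> real).
        (\<forall>U\<in>\<U>. \<exists>h. chart isos E U h) \<and>
        (\<forall>U\<in>\<U>. continuous_map (base E) euclideanreal (\<pi> U) \<and>
           (\<forall>x\<in>topspace (base E). 0 \<le> \<pi> U x) \<and>
           base E closure_of {x \<in> topspace (base E). \<pi> U x \<noteq> 0} \<subseteq> U) \<and>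
        (\<forall>x\<in>topspace (base E). \<exists>V. openin (base E) V \<and> x \<in> V \<and>
           finite {U \<in> \<U>. \<exists>y\<in>V. \<pi> U y \<noteq> 0}) \<and>
        (\<forall>x\<in>topspace (base E). (\<Sum>U | U \<in> \<U> \<and> \<pi> U x \<noteq> 0. \<pi> U x) = 1))"

text \<open>
  The topology of a bundle obtained by applying a functor to every fibre: F is the functor
  applied to the model, G x the functor applied to the fibre over x, and \<open>tr x f\<close> the map
  from F to G x induced by an isomorphism f from the model to the fibre over x.
\<close>

definition fibrewise_topology ::
    "('s \<Rightarrow> ('m::topological_space \<Rightarrow> 'e) set) \<Rightarrow> ('b, 'e, 's) fibre_bundle
      \<Rightarrow> 'p topology \<Rightarrow> ('b \<Rightarrow> 'q set) \<Rightarrow> ('b \<Rightarrow> ('m \<Rightarrow> 'e) \<Rightarrow> 'p \<Rightarrow> 'q) \<Rightarrow> ('b \<times> 'q) topology" where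
  "fibrewise_topology isos E F G tr =
     final_topology (SIGMA x:topspace (base E). G x)
       {(prod_topology (subtopology (base E) U) F, \<lambda>(x, t). (x, tr x (h x) t)) | U h.
          chart isos E U h}"

text \<open>
  The associated principal bundle: the fibre over x consists of the isomorphisms from the
  model to the fibre of E over x.  The argument aut is the automorphism group of the model; its
  topology of pointwise convergence (the euclidean topology of a function type) is the usual
  one, because it consists of linear maps of a finite-dimensional space.
\<close>

definition frame_bundle ::
    "('m::topological_space \<Rightarrow> 'm) set \<Rightarrow> ('s \<Rightarrow> ('m \<Rightarrow> 'e) set) \<Rightarrow> ('b, 'e, 's) fibre_bundle
      \<Rightarrow> ('b, 'm \<Rightarrow> 'e, ('m \<Rightarrow> 'e) set) fibre_bundle" where
  "frame_bundle aut isos E = \<lparr>base = base E, fibre = (\<lambda>x. isos (fibre E x)),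
     total_space = fibrewise_topology isos E (top_of_set aut) (\<lambda>x. isos (fibre E x)) (\<lambda>x f g. f \<circ> g)\<rparr>"

text \<open>
  A bundle is universal if it is numerable and the total space of its associated principal
  bundle is contractible.  The empty space counts as contractible in the library.
\<close>

definition universal_bundle ::
    "('m::topological_space \<Rightarrow> 'm) set \<Rightarrow> ('s \<Rightarrow> ('m \<Rightarrow> 'e) set) \<Rightarrow> ('b, 'e, 's) fibre_bundle \<Rightarrow> bool" where
  "universal_bundle aut isos E \<longleftrightarrow>
     locally_trivial isos E \<and> numerable isos E \<and> topspace (base E) \<noteq> {} \<and>
     contractible_space (total_space (frame_bundle aut isos E))"

definition universal_vector_bundle ::
    "'k::finite itself \<Rightarrow> ('b, 'e, 'e hermitian_space) fibre_bundle \<Rightarrow> bool" where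
  "universal_vector_bundle TYPE('k) E \<longleftrightarrow>
     universal_bundle (unitary_isos coordinate_space coordinate_space)
       (unitary_isos (coordinate_space :: (complex^'k) hermitian_space)) E"

definition universal_matrix_bundle ::
    "'k::finite itself \<Rightarrow> ('b, 'e, 'e star_algebra) fibre_bundle \<Rightarrow> bool" where
  "universal_matrix_bundle TYPE('k) A \<longleftrightarrow>
     universal_bundle (star_isos matrix_algebra matrix_algebra)
       (star_isos (matrix_algebra :: (complex^'k^'k) star_algebra)) A"

definition End_bundle ::
    "'k::finite itself \<Rightarrow> ('b, 'e, 'e hermitian_space) fibre_bundle
      \<Rightarrow> ('b, 'e \<Rightarrow> 'e, ('e \<Rightarrow> 'e) star_algebra) fibre_bundle" where
  "End_bundle TYPE('k) E = \<lparr>base = base E, fibre = (\<lambda>x. endomorphism_algebra (fibre E x)),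
     total_space = fibrewise_topology (unitary_isos (coordinate_space :: (complex^'k) hermitian_space)) E
       euclidean (\<lambda>x. elems (endomorphism_algebra (fibre E x)))
       (\<lambda>x f (M :: complex^'k^'k). \<lambda>e\<in>elems (fibre E x). f (M *v inv_into UNIV f e))\<rparr>"

text \<open>
  The type \<open>'k \<times> 'l\<close> has CARD('k) * CARD('l) elements, so the target is the algebra of
  kl by kl matrices.
\<close>

definition H_bundle ::
    "'k::finite itself \<Rightarrow> 'l::finite itself \<Rightarrow> ('b, 'e, 'e star_algebra) fibre_bundle
      \<Rightarrow> ('b, 'e \<Rightarrow> complex^('k \<times> 'l)^('k \<times> 'l), ('e \<Rightarrow> complex^('k \<times> 'l)^('k \<times> 'l)) set) fibre_bundle" where
  "H_bundle TYPE('k) TYPE('l) A = \<lparr>base = base A, fibre = (\<lambda>x. star_homs (fibre A x) matrix_algebra),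
     total_space = fibrewise_topology (star_isos (matrix_algebra :: (complex^'k^'k) star_algebra)) A
       (top_of_set (star_homs matrix_algebra matrix_algebra))
       (\<lambda>x. star_homs (fibre A x) matrix_algebra)
       (\<lambda>x f \<phi>. \<lambda>a\<in>elems (fibre A x). \<phi> (inv_into UNIV f a))\<rparr>"


section \<open>Infinite complex projective space\<close>

text \<open>Finitely supported sequences, with the colimit topology of the subspaces \<open>\<complex>\<^sup>n\<close>.\<close>

definition complex_infinity :: "(nat \<Rightarrow> complex) topology" where
  "complex_infinity = final_topology {z. finite {i. z i \<noteq> 0}}
     {(top_of_set {z. \<forall>i\<ge>n. z i = 0}, \<lambda>z. z) | n. True}"

definition complex_line :: "(nat \<Rightarrow> complex) \<Rightarrow> (nat \<Rightarrow> complex) set" where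
  "complex_line z = range (\<lambda>c i. c * z i)"

definition CP_infinity :: "(nat \<Rightarrow> complex) set topology" where
  "CP_infinity = final_topology (complex_line ` (topspace complex_infinity - {\<lambda>i. 0}))
     {(subtopology complex_infinity (topspace complex_infinity - {\<lambda>i. 0}), complex_line)}"

end

theory Submission
  imports Defs
begin

text \<open>
  Write \<open>W = U(kl)\<close> and let \<open>K = U(k) \<times> U(l)\<close> act on \<open>W\<close> from the right by
  \<open>w \<cdot> (g, h) = w (g \<otimes> h)\<close>.  By the Skolem-Noether theorem every unital star homomorphism from
  k by k to kl by kl matrices has the form \<open>M \<mapsto> w (M \<otimes> 1) w\<^sup>*\<close> (\<open>star_hom_amplification\<close>), so the
  space of these homomorphisms is \<open>W / U(l)\<close>.  Let \<open>X\<close> be the frame bundle of the universal vector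
  bundle and \<open>Y\<close> that of the universal matrix bundle.  Both are contractible, \<open>U(k)\<close> acts on them
  (on \<open>Y\<close> through \<open>PU(k)\<close>), and the two spaces to be compared are \<open>P = (X \<times> W) / K\<close> and
  \<open>Q = (Y \<times> W) / K\<close>.

  The actions differ on the scalars: for \<open>|\<zeta>| = 1\<close> the pair \<open>(\<zeta>, 1/\<zeta>)\<close> acts trivially on \<open>W\<close> and on
  \<open>Y\<close>, but freely on \<open>X\<close>.  This is where coprimality enters.  Choose \<open>a\<close>, \<open>b\<close> with \<open>l b = k a + 1\<close> and
  consider the character \<open>\<kappa>(g, h) = det(g)\<^sup>a det(h)\<^sup>b\<close> of \<open>K\<close>; its value at \<open>(\<zeta>, 1/\<zeta>)\<close> is
  \<open>1/\<zeta>\<close>.  Let \<open>S\<close> be the contractible space of nonzero finitely supported complex sequences, on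
  which \<open>K\<close> acts through \<open>\<kappa>\<close>.  Every nonzero scalar is a positive number times a value of \<open>\<kappa>\<close> on some
  \<open>(\<zeta>, 1/\<zeta>)\<close>, so dividing \<open>S\<close> by all nonzero scalars is the same as dividing by the positive ones and by
  these pairs (\<open>fibre_of_product\<close>).  Hence \<open>Q \<times> CP\<^sup>\<infinity>\<close> is the quotient of \<open>(Y \<times> S) \<times> W\<close> by \<open>K\<close> and
  positive scalings, while \<open>P\<close> is the quotient of \<open>X \<times> W\<close> by \<open>K\<close>.  In both cases \<open>K\<close> acts freely on the product
  of \<open>W\<close> with a contractible space, so both quotients are the homotopy quotient of \<open>W\<close> by \<open>K\<close>.

  To turn this into maps one needs equivariant maps \<open>W \<rightarrow> Y\<close>, \<open>X \<times> W \<rightarrow> S\<close> and \<open>W \<times> S \<rightarrow> X\<close>,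
  and equivariant homotopies between maps into \<open>X\<close>, \<open>Y\<close> and \<open>S\<close>.  All of them come from one principle
  (\<open>equivariant_extension\<close>): equivariant maps into a contractible space exist, and are homotopic,
  as soon as the source is covered by countably many invariant sets, given by functions, over which
  the action on the target can be trivialised.  Such trivialisations exist because
  \<^item> \<open>W\<close> carries a polynomial map \<open>N\<close> to the k by k matrices with
    \<open>N(w (g \<otimes> h)) = \<kappa>(g, h) N(w) g\<close> and \<open>N(1) = 1\<close> (\<open>tensor_covariant_kronecker\<close>), whose translates
    become unitary by Gram-Schmidt (\<open>equivariant_frames\<close>); the existence of \<open>N\<close> again uses
    \<open>l b = k a + 1\<close>;
  \<^item> \<open>X\<close> has countably many coordinate systems by Milnor's rearrangement of a partition of unity
    (\<open>numerable_frame_coordinates\<close>);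
  \<^item> a nonzero coordinate of a vector in \<open>S\<close> has a phase.

  The maps and homotopies descend to the quotients because all quotient maps involved are open
  (\<open>quotient_homotopy\<close>).
\<close>

section \<open>Equivariant maps into contractible spaces\<close>

lemma continuous_map_locally:
  assumes "\<And>x. x \<in> topspace X \<Longrightarrow> \<exists>T. openin X T \<and> x \<in> T \<and> continuous_map (subtopology X T) Y g"
  shows "continuous_map X Y g"
proof -
  let ?I = "{T. openin X T \<and> continuous_map (subtopology X T) Y g}"
  show ?thesis
    by (rule pasting_lemma[where I = ?I and T = id and f = "\<lambda>_. g"]) (use assms in auto)
qed

lemma continuous_map_subtopology_locally:
  assumes "\<And>x. x \<in> topspace X \<Longrightarrow> x \<in> S \<Longrightarrow>
    \<exists>T. openin X T \<and> x \<in> T \<and> T \<subseteq> S \<and> continuous_map (subtopology X T) Y g"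
  shows "continuous_map (subtopology X S) Y g"
proof (rule continuous_map_locally)
  fix x assume "x \<in> topspace (subtopology X S)"
  then obtain T where T: "openin X T" "x \<in> T" "T \<subseteq> S" "continuous_map (subtopology X T) Y g"
    using assms by auto
  show "\<exists>T. openin (subtopology X S) T \<and> x \<in> T \<and> continuous_map (subtopology (subtopology X S) T) Y g"
  proof (intro exI[of _ T] conjI)
    show "openin (subtopology X S) T"
      using T by (auto simp: openin_subtopology)
    show "continuous_map (subtopology (subtopology X S) T) Y g"
      using T by (simp add: subtopology_subtopology Int_absorb1)
  qed (rule T)
qed

lemma openin_positive:
  assumes "continuous_map X euclideanreal u"
  shows "openin X {x \<in> topspace X. u x > 0}"
proof -
  have "openin X {x \<in> topspace X. u x \<in> {0<..}}"
    using assms by (rule openin_continuous_map_preimage) auto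
  then show ?thesis by simp
qed

text \<open>
  Equivariance is encoded by a set \<open>R\<close> of triples \<open>(x, x', \<gamma>)\<close>: the point \<open>x'\<close> is a translate of
  \<open>x\<close>, and \<open>\<gamma>\<close> is the corresponding transformation of \<open>E\<close>. A chart consists of an invariant
  function \<open>u\<close> and, where \<open>u\<close> is positive, of a continuous family \<open>\<theta>\<close> of transformations of \<open>E\<close>
  with inverses \<open>\<theta>'\<close> that turns constant maps to \<open>E\<close> into equivariant ones.
\<close>

definition equivariant_chart ::
    "'x topology \<Rightarrow> 'e topology \<Rightarrow> ('x \<times> 'x \<times> ('e \<Rightarrow> 'e)) set
      \<Rightarrow> ('x \<Rightarrow> real) \<Rightarrow> ('x \<Rightarrow> 'e \<Rightarrow> 'e) \<Rightarrow> ('x \<Rightarrow> 'e \<Rightarrow> 'e) \<Rightarrow> bool" where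
  "equivariant_chart X E R u \<theta> \<theta>' \<longleftrightarrow>
     continuous_map X euclideanreal u \<and> (\<forall>x\<in>topspace X. 0 \<le> u x) \<and>
     continuous_map (prod_topology (subtopology X {x \<in> topspace X. u x > 0}) E) E (\<lambda>(x, e). \<theta> x e) \<and>
     continuous_map (prod_topology (subtopology X {x \<in> topspace X. u x > 0}) E) E (\<lambda>(x, e). \<theta>' x e) \<and>
     (\<forall>x\<in>topspace X. \<forall>e\<in>topspace E. u x > 0 \<longrightarrow> \<theta> x (\<theta>' x e) = e \<and> \<theta>' x (\<theta> x e) = e) \<and>
     (\<forall>(x, x', \<gamma>)\<in>R. u x' = u x \<and> (u x > 0 \<longrightarrow> (\<forall>e\<in>topspace E. \<theta> x' e = \<gamma> (\<theta> x e))))"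

lemma equivariant_chart_continuous:
  assumes "equivariant_chart X E R u \<theta> \<theta>'"
  shows "continuous_map X euclideanreal u"
  using assms unfolding equivariant_chart_def by auto

lemma continuous_map_chart_apply:
  assumes "continuous_map (prod_topology (subtopology X S) E) E (\<lambda>(x, e). \<theta> x e)"
    and "continuous_map (subtopology X T) E f" and "T \<subseteq> S"
  shows "continuous_map (subtopology X T) E (\<lambda>x. \<theta> x (f x))"
proof -
  have "continuous_map (subtopology X T) (prod_topology (subtopology X S) E) (\<lambda>x. (x, f x))"
    using assms(2,3) by (auto simp: continuous_map_paired continuous_map_in_subtopology
        intro: continuous_map_from_subtopology)
  from continuous_map_compose[OF this assms(1)] show ?thesis
    by (simp add: o_def)
qed

text \<open>
  Extends \<open>s\<close> from the set where \<open>v\<close> is positive to the set where \<open>v\<close> or \<open>u\<close> is: read through the chart,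
  the new map is \<open>s\<close> where \<open>v \<ge> u\<close>, the constant \<open>p\<close> where \<open>v \<le> u/3\<close>, and in between it runs along
  the contraction \<open>H\<close> of \<open>E\<close> to \<open>p\<close>.
\<close>

definition extension_step ::
    "(real \<times> 'e \<Rightarrow> 'e) \<Rightarrow> 'e \<Rightarrow> ('x \<Rightarrow> real) \<Rightarrow> ('x \<Rightarrow> 'e \<Rightarrow> 'e) \<Rightarrow> ('x \<Rightarrow> 'e \<Rightarrow> 'e)
      \<Rightarrow> ('x \<Rightarrow> real) \<Rightarrow> ('x \<Rightarrow> 'e) \<Rightarrow> 'x \<Rightarrow> 'e" where
  "extension_step H p u \<theta> \<theta>' v s x =
     (if v x \<ge> u x then s x
      else if v x \<le> u x / 3 then \<theta> x p
      else \<theta> x (H (3 / 2 * (1 - v x / u x), \<theta>' x (s x))))"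

lemma extension_step:
  assumes H: "continuous_map (prod_topology (top_of_set {0..1}) E) E H"
    and H0: "\<And>e. e \<in> topspace E \<Longrightarrow> H (0, e) = e" and H1: "\<And>e. e \<in> topspace E \<Longrightarrow> H (1, e) = p"
    and p: "p \<in> topspace E"
    and chart: "equivariant_chart X E R u \<theta> \<theta>'"
    and v: "continuous_map X euclideanreal v" "\<And>x. x \<in> topspace X \<Longrightarrow> 0 \<le> v x"
    and s: "continuous_map (subtopology X {x \<in> topspace X. v x > 0}) E s"
    and R: "\<And>x x' \<gamma>. (x, x', \<gamma>) \<in> R \<Longrightarrow> x \<in> topspace X \<and> x' \<in> topspace X"
    and v_inv: "\<And>x x' \<gamma>. (x, x', \<gamma>) \<in> R \<Longrightarrow> v x' = v x"
    and s_equiv: "\<And>x x' \<gamma>. (x, x', \<gamma>) \<in> R \<Longrightarrow> v x > 0 \<Longrightarrow> s x' = \<gamma> (s x)"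
  defines "s' \<equiv> extension_step H p u \<theta> \<theta>' v s"
  shows "continuous_map (subtopology X {x \<in> topspace X. max (v x) (u x) > 0}) E s'"
    and "\<And>x x' \<gamma>. (x, x', \<gamma>) \<in> R \<Longrightarrow> max (v x) (u x) > 0 \<Longrightarrow> s' x' = \<gamma> (s' x)"
proof -
  let ?X = "subtopology X {x \<in> topspace X. max (v x) (u x) > 0}"
  have u: "continuous_map X euclideanreal u" "\<And>x. x \<in> topspace X \<Longrightarrow> 0 \<le> u x"
    and \<theta>: "continuous_map (prod_topology (subtopology X {x \<in> topspace X. u x > 0}) E) E (\<lambda>(x, e). \<theta> x e)"
    and \<theta>': "continuous_map (prod_topology (subtopology X {x \<in> topspace X. u x > 0}) E) E (\<lambda>(x, e). \<theta>' x e)"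
    and inv: "\<And>x e. x \<in> topspace X \<Longrightarrow> e \<in> topspace E \<Longrightarrow> u x > 0 \<Longrightarrow> \<theta> x (\<theta>' x e) = e"
      "\<And>x e. x \<in> topspace X \<Longrightarrow> e \<in> topspace E \<Longrightarrow> u x > 0 \<Longrightarrow> \<theta>' x (\<theta> x e) = e"
    and uR: "\<And>x x' \<gamma>. (x, x', \<gamma>) \<in> R \<Longrightarrow> u x' = u x"
    and \<theta>R: "\<And>x x' \<gamma> e. (x, x', \<gamma>) \<in> R \<Longrightarrow> u x > 0 \<Longrightarrow> e \<in> topspace E \<Longrightarrow> \<theta> x' e = \<gamma> (\<theta> x e)"
    using chart unfolding equivariant_chart_def by (blast+)
  let ?T1 = "{x \<in> topspace X. v x - u x > 0}"
  let ?T2 = "{x \<in> topspace X. v x > 0} \<inter> {x \<in> topspace X. u x > 0}"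
  let ?T3 = "{x \<in> topspace X. u x / 3 - v x > 0}"
  let ?\<tau> = "\<lambda>x. max 0 (min 1 (3 / 2 * (1 - v x / u x)))"
  let ?f2 = "\<lambda>x. \<theta> x (H (?\<tau> x, \<theta>' x (s x)))"
  let ?f3 = "\<lambda>x. \<theta> x p"
  have s_in: "s x \<in> topspace E" if "x \<in> topspace X" "v x > 0" for x
    using continuous_map_image_subset_topspace[OF s] that by auto
  have \<theta>'_in: "\<theta>' x e \<in> topspace E" if "x \<in> topspace X" "u x > 0" "e \<in> topspace E" for x e
    using continuous_map_image_subset_topspace[OF \<theta>'] that by auto
  have H_in: "H (t, e) \<in> topspace E" if "t \<in> {0..1}" "e \<in> topspace E" for t e
    using continuous_map_image_subset_topspace[OF H] that by auto
  have c1: "continuous_map (subtopology X ?T1) E s'"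
  proof (rule continuous_map_eq)
    have "?T1 \<subseteq> {x \<in> topspace X. v x > 0}"
      using u(2) by fastforce
    then show "continuous_map (subtopology X ?T1) E s"
      using s continuous_map_from_subtopology_mono by blast
  qed (auto simp: s'_def extension_step_def)
  have c3: "continuous_map (subtopology X ?T3) E s'"
  proof (rule continuous_map_eq)
    have "?T3 \<subseteq> {x \<in> topspace X. u x > 0}"
      using v(2) by fastforce
    then show "continuous_map (subtopology X ?T3) E ?f3"
      by (intro continuous_map_chart_apply[OF \<theta>]) (use p in auto)
  qed (use v(2) in \<open>fastforce simp: s'_def extension_step_def\<close>)
  have c2: "continuous_map (subtopology X ?T2) E s'"
  proof (rule continuous_map_eq)
    have cs: "continuous_map (subtopology X ?T2) E s"
      using s by (rule continuous_map_from_subtopology_mono) auto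
    have "continuous_map (subtopology X ?T2) (top_of_set {0..1}) ?\<tau>"
    proof -
      have "continuous_map (subtopology X ?T2) euclideanreal ?\<tau>"
        using u v by (intro continuous_intros continuous_map_real_max continuous_map_real_min
             continuous_map_from_subtopology) auto
      then show ?thesis by (auto simp: continuous_map_in_subtopology)
    qed
    moreover have "continuous_map (subtopology X ?T2) E (\<lambda>x. \<theta>' x (s x))"
      by (rule continuous_map_chart_apply[OF \<theta>' cs]) auto
    ultimately have "continuous_map (subtopology X ?T2) (prod_topology (top_of_set {0..1}) E) (\<lambda>x. (?\<tau> x, \<theta>' x (s x)))"
      by (simp add: continuous_map_paired)
    from continuous_map_compose[OF this H]
    have "continuous_map (subtopology X ?T2) E (\<lambda>x. H (?\<tau> x, \<theta>' x (s x)))" by (simp add: o_def)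
    then show "continuous_map (subtopology X ?T2) E ?f2"
      by (rule continuous_map_chart_apply[OF \<theta>]) auto
  next
    fix x assume "x \<in> topspace (subtopology X ?T2)"
    then have x: "x \<in> topspace X" "v x > 0" "u x > 0" by auto
    have q: "\<theta>' x (s x) \<in> topspace E" using x s_in \<theta>'_in by simp
    consider "v x \<ge> u x" | "v x \<le> u x / 3" | "u x / 3 < v x" "v x < u x" by linarith
    then show "?f2 x = s' x"
    proof cases
      case 1
      then have "?\<tau> x = 0" using x by (simp add: field_simps)
      then show ?thesis using 1 x q s_in by (simp only: s'_def extension_step_def H0 inv if_True)
    next
      case 2
      then have "?\<tau> x = 1" "\<not> v x \<ge> u x" using x by (auto simp: field_simps)
      then show ?thesis using 2 x q by (simp only: s'_def extension_step_def H1 if_True if_False)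
    next
      case 3
      then have "?\<tau> x = 3 / 2 * (1 - v x / u x)" "\<not> v x \<ge> u x" "\<not> v x \<le> u x / 3" using x by (auto simp: field_simps)
      then show ?thesis by (simp only: s'_def extension_step_def if_False)
    qed
  qed
  show "continuous_map ?X E s'"
  proof (rule continuous_map_subtopology_locally)
    fix x assume x: "x \<in> topspace X" "x \<in> {x \<in> topspace X. max (v x) (u x) > 0}"
    have o1: "openin X ?T1" by (rule openin_positive) (intro continuous_intros u v)
    have o2: "openin X ?T2" by (intro openin_Int openin_positive u v)
    have o3: "openin X ?T3" by (rule openin_positive) (intro continuous_intros u v, auto)
    have t1: "?T1 \<subseteq> {x \<in> topspace X. max (v x) (u x) > 0}" and t2: "?T2 \<subseteq> {x \<in> topspace X. max (v x) (u x) > 0}"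
      and t3: "?T3 \<subseteq> {x \<in> topspace X. max (v x) (u x) > 0}"
      using u(2) v(2) by force+
    have "v x - u x > 0 \<or> (v x > 0 \<and> u x > 0) \<or> u x / 3 - v x > 0"
      using x u(2)[of x] v(2)[of x] by (auto simp: max_def split: if_splits)
    then have "x \<in> ?T1 \<or> x \<in> ?T2 \<or> x \<in> ?T3" using x by blast
    then show "\<exists>T. openin X T \<and> x \<in> T \<and> T \<subseteq> {x \<in> topspace X. max (v x) (u x) > 0} \<and>
        continuous_map (subtopology X T) E s'"
      using o1 o2 o3 t1 t2 t3 c1 c2 c3 by blast
  qed
  show "s' x' = \<gamma> (s' x)" if r: "(x, x', \<gamma>) \<in> R" and pos: "max (v x) (u x) > 0" for x x' \<gamma>
  proof -
    note xx = R[OF r]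
    have uv: "u x' = u x" "v x' = v x" using uR v_inv r by auto
    consider "v x \<ge> u x" | "v x < u x" "v x \<le> u x / 3" | "u x / 3 < v x" "v x < u x" by linarith
    then show ?thesis
    proof cases
      case 1
      then show ?thesis using s_equiv[OF r] uv pos by (simp add: s'_def extension_step_def max_def split: if_splits)
    next
      case 2
      then show ?thesis using \<theta>R[OF r _ p] uv pos by (simp add: s'_def extension_step_def max_def)
    next
      case 3
      then have pos: "v x > 0" "u x > 0" using u(2)[of x] xx by (auto simp: field_simps)
      let ?e = "\<theta>' x (s x)"
      have e: "?e \<in> topspace E" using pos xx s_in \<theta>'_in by simp
      have "\<theta>' x' (s x') = \<theta>' x' (\<gamma> (\<theta> x ?e))" using s_equiv[OF r] pos inv s_in xx by simp
      also have "\<dots> = \<theta>' x' (\<theta> x' ?e)" using \<theta>R[OF r _ e] pos by simp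
      also have "\<dots> = ?e" using inv e pos xx uv by simp
      finally have eq: "\<theta>' x' (s x') = ?e" .
      have "H (3 / 2 * (1 - v x / u x), ?e) \<in> topspace E"
        using 3 pos e by (intro H_in) (auto simp: field_simps)
      from \<theta>R[OF r pos(2) this] show ?thesis
        using 3 uv eq by (simp add: s'_def extension_step_def)
    qed
  qed
qed

text \<open>
  The charts are processed one after the other by \<open>extension_step\<close>. Since the chart functions may
  be replaced by others with the same positivity sets that tend to zero uniformly, near each point
  only finitely many steps change the map; so the limit exists and is continuous.
\<close>

theorem equivariant_extension:
  fixes X :: "'x topology" and E :: "'e topology"
  assumes contr: "contractible_space E" and ne: "topspace E \<noteq> {}"
    and charts: "\<And>n. equivariant_chart X E R (u n) (\<theta> n) (\<theta>' n)"
    and R: "\<And>x x' \<gamma>. (x, x', \<gamma>) \<in> R \<Longrightarrow> x \<in> topspace X \<and> x' \<in> topspace X"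
    and v0: "continuous_map X euclideanreal v0" "\<And>x. x \<in> topspace X \<Longrightarrow> 0 \<le> v0 x"
    and cover: "\<And>x. x \<in> topspace X \<Longrightarrow> v0 x > 0 \<or> (\<exists>n::nat. u n x > 0)"
    and s0: "continuous_map (subtopology X {x \<in> topspace X. v0 x > 0}) E s0"
    and v0_inv: "\<And>x x' \<gamma>. (x, x', \<gamma>) \<in> R \<Longrightarrow> v0 x' = v0 x"
    and s0_equiv: "\<And>x x' \<gamma>. (x, x', \<gamma>) \<in> R \<Longrightarrow> v0 x > 0 \<Longrightarrow> s0 x' = \<gamma> (s0 x)"
  obtains s where "continuous_map X E s"
    and "\<And>x x' \<gamma>. (x, x', \<gamma>) \<in> R \<Longrightarrow> s x' = \<gamma> (s x)"
    and "\<And>x. x \<in> topspace X \<Longrightarrow> v0 x \<ge> 1 \<Longrightarrow> s x = s0 x"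
proof -
  obtain p H where H: "continuous_map (prod_topology (top_of_set {0..1::real}) E) E H"
    and H01: "\<And>e. H (0, e) = e" "\<And>e. H (1, e) = p"
    using contr unfolding contractible_space_def homotopic_with_def by auto
  have p: "p \<in> topspace E"
  proof -
    obtain e where "e \<in> topspace E" using ne by blast
    then have "H (1, e) \<in> topspace E" using continuous_map_image_subset_topspace[OF H] by auto
    then show ?thesis using H01 by simp
  qed
  \<comment> \<open>Scaling down the chart functions makes the construction stationary near every point.\<close>
  define w where "w n x = min (u n x) (1 / (real n + 2))" for n x
  have w_pos: "w n x > 0 \<longleftrightarrow> u n x > 0" for n x by (simp add: w_def)
  have wchart: "equivariant_chart X E R (w n) (\<theta> n) (\<theta>' n)" for n
  proof -
    have "continuous_map X euclideanreal (w n)"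
      unfolding w_def by (intro continuous_map_real_min equivariant_chart_continuous[OF charts]) auto
    then show ?thesis
      using charts[of n] unfolding equivariant_chart_def w_pos by (auto simp: w_def)
  qed
  define v where "v = rec_nat v0 (\<lambda>n v x. max (v x) (w n x))"
  have v_0: "v 0 = v0" and v_Suc: "v (Suc n) x = max (v n x) (w n x)" for n x
    by (simp_all add: v_def)
  define S where "S = rec_nat s0 (\<lambda>n s. extension_step H p (w n) (\<theta> n) (\<theta>' n) (v n) s)"
  have S0: "S 0 = s0" and SSuc: "S (Suc n) = extension_step H p (w n) (\<theta> n) (\<theta>' n) (v n) (S n)" for n
    by (simp_all add: S_def)
  have w_inv: "w n x' = w n x" if "(x, x', \<gamma>) \<in> R" for n x x' \<gamma>
    using wchart[of n] that unfolding equivariant_chart_def by blast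
  have inv: "continuous_map X euclideanreal (v n) \<and> (\<forall>x\<in>topspace X. 0 \<le> v n x) \<and>
     (\<forall>(x, x', \<gamma>)\<in>R. v n x' = v n x) \<and>
     continuous_map (subtopology X {x \<in> topspace X. v n x > 0}) E (S n) \<and>
     (\<forall>(x, x', \<gamma>)\<in>R. v n x > 0 \<longrightarrow> S n x' = \<gamma> (S n x))" for n
  proof (induction n)
    case 0
    show ?case using v0 v0_inv s0 s0_equiv by (auto simp: v_0 S0)
  next
    case (Suc n)
    have a: "continuous_map (subtopology X {x \<in> topspace X. max (v n x) (w n x) > 0}) E (S (Suc n))"
      unfolding SSuc
      by (rule extension_step(1)[where R = R]) (use H H01 p wchart Suc R in \<open>auto simp del: split_paired_All\<close>)
    have b: "S (Suc n) x' = \<gamma> (S (Suc n) x)" if "(x, x', \<gamma>) \<in> R" "max (v n x) (w n x) > 0" for x x' \<gamma>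
      unfolding SSuc
      by (rule extension_step(2)[where R = R]) (use H H01 p wchart Suc R that in \<open>auto simp del: split_paired_All\<close>)
    have c: "continuous_map X euclideanreal (v (Suc n))"
    proof -
      have "v (Suc n) = (\<lambda>x. max (v n x) (w n x))" by (simp add: v_Suc fun_eq_iff)
      then show ?thesis using Suc by (auto intro!: continuous_map_real_max equivariant_chart_continuous[OF wchart])
    qed
    have d: "\<forall>x\<in>topspace X. 0 \<le> v (Suc n) x" "\<forall>(x, x', \<gamma>)\<in>R. v (Suc n) x' = v (Suc n) x"
      using Suc w_inv by (auto simp: v_Suc le_max_iff_disj)
    show ?case
    proof (intro conjI c d)
      show "continuous_map (subtopology X {x \<in> topspace X. v (Suc n) x > 0}) E (S (Suc n))"
        using a by (simp only: v_Suc)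
      show "\<forall>(x, x', \<gamma>)\<in>R. v (Suc n) x > 0 \<longrightarrow> S (Suc n) x' = \<gamma> (S (Suc n) x)"
        using b unfolding v_Suc by blast
    qed
  qed
  have w_le: "w n x \<le> 1 / (real n + 2)" for n x by (simp add: w_def)
  have v_mono: "v n x \<le> v m x" if "n \<le> m" for n m x
    using that by (induction m rule: dec_induct) (auto simp: v_Suc)
  \<comment> \<open>Once \<open>v n\<close> exceeds the bound on all later chart functions, every later step is in the case
     \<open>v \<ge> u\<close>.\<close>
  have stable: "S m x = S n x" if "n \<le> m" "v n x > 1 / (real n + 2)" for n m x
    using that(1)
  proof (induction m rule: dec_induct)
    case (step m)
    have "w m x \<le> 1 / (real m + 2)" by (rule w_le)
    also have "\<dots> \<le> 1 / (real n + 2)" using step by (simp add: frac_le)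
    also have "\<dots> \<le> v m x" using v_mono[OF step(1), of x] that(2) by linarith
    finally show ?case using step by (simp add: SSuc extension_step_def)
  qed simp
  let ?T = "\<lambda>n. {x \<in> topspace X. v n x - 1 / (real n + 2) > 0}"
  have cov: "\<exists>n. x \<in> ?T n" if x: "x \<in> topspace X" for x
  proof -
    obtain n where n: "v n x > 0"
      using cover[OF x]
    proof
      assume "\<exists>n. u n x > 0"
      then obtain n where "w n x > 0" using w_pos by auto
      then have "v (Suc n) x > 0" by (auto simp: v_Suc)
      then show ?thesis by (rule that)
    qed (use v_0 that in metis)
    obtain m where m: "inverse (real (Suc m)) < v n x" using reals_Archimedean[OF n] by blast
    let ?m = "max n m"
    have "1 / (real ?m + 2) \<le> inverse (real (Suc m))" by (simp add: field_simps max_def)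
    also have "\<dots> < v n x" by (rule m)
    also have "\<dots> \<le> v ?m x" by (rule v_mono) simp
    finally show ?thesis using x by (intro exI[of _ ?m]) simp
  qed
  define s where "s x = S (SOME n. x \<in> ?T n) x" for x
  have s_eq: "s x = S n x" if "x \<in> ?T n" for n x
  proof -
    let ?k = "SOME n. x \<in> ?T n"
    have k: "x \<in> ?T ?k" using that by (rule someI)
    then have "S (max n ?k) x = S ?k x" "S (max n ?k) x = S n x"
      using that by (auto intro!: stable)
    then show ?thesis by (simp add: s_def)
  qed
  show thesis
  proof (rule that)
    show "continuous_map X E s"
    proof (rule pasting_lemma[where I = UNIV and T = ?T and f = S])
      show "openin X (?T n)" for n
        using inv[of n] by (intro openin_positive continuous_intros) auto
      have "?T n \<subseteq> {x \<in> topspace X. v n x > 0}" for n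
        by clarsimp (smt (verit) divide_nonneg_nonneg of_nat_0_le_iff)
      then show "continuous_map (subtopology X (?T n)) E (S n)" for n
        using continuous_map_from_subtopology_mono inv[of n] by (metis (no_types, lifting))
      show "S n x = S m x" if "x \<in> topspace X \<inter> ?T n \<inter> ?T m" for n m x
        using that s_eq[of x n] s_eq[of x m] by (metis (lifting) IntD1 IntD2)
      show "\<exists>n. n \<in> UNIV \<and> x \<in> ?T n \<and> s x = S n x" if "x \<in> topspace X" for x
        using cov[OF that] s_eq by blast
    qed
    show "s x' = \<gamma> (s x)" if r: "(x, x', \<gamma>) \<in> R" for x x' \<gamma>
    proof -
      obtain n where n: "x \<in> ?T n" using cov R[OF r] by blast
      have "v n x' = v n x" using inv[of n] r by blast
      then have n': "x' \<in> ?T n" using n R[OF r] by simp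
      have "v n x > 0" using n by (smt (verit) divide_nonneg_nonneg of_nat_0_le_iff mem_Collect_eq)
      then show ?thesis using inv[of n] r s_eq[OF n] s_eq[OF n'] by auto
    qed
    show "s x = s0 x" if "x \<in> topspace X" "v0 x \<ge> 1" for x
      using s_eq[of x 0] that by (simp add: v_0 S0)
  qed
qed

text \<open>
  The case of an empty prescribed part.
\<close>

corollary equivariant_map_exists:
  fixes X :: "'x topology" and E :: "'e topology"
  assumes "contractible_space E" and "topspace E \<noteq> {}"
    and charts: "\<And>n. equivariant_chart X E R (u n) (\<theta> n) (\<theta>' n)"
    and "\<And>x x' \<gamma>. (x, x', \<gamma>) \<in> R \<Longrightarrow> x \<in> topspace X \<and> x' \<in> topspace X"
    and "\<And>x. x \<in> topspace X \<Longrightarrow> \<exists>n::nat. u n x > 0"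
  obtains s where "continuous_map X E s" and "\<And>x x' \<gamma>. (x, x', \<gamma>) \<in> R \<Longrightarrow> s x' = \<gamma> (s x)"
  by (rule equivariant_extension[OF assms(1-4), where ?v0.0 = "\<lambda>_. 0" and ?s0.0 = undefined]) (use assms(5) in auto)

text \<open>
  The homotopy is an equivariant map on \<open>[0,1] \<times> X\<close> extending the one that is \<open>f\<close> for times below
  1/2 and \<open>g\<close> for times above; the function \<open>|2 t - 1|\<close> is positive there and equals 1 at both
  ends.
\<close>

corollary equivariant_maps_homotopic:
  fixes X :: "'x topology" and E :: "'e topology"
  assumes "contractible_space E" and "topspace E \<noteq> {}"
    and charts: "\<And>n. equivariant_chart X E R (u n) (\<theta> n) (\<theta>' n)"
    and R: "\<And>x x' \<gamma>. (x, x', \<gamma>) \<in> R \<Longrightarrow> x \<in> topspace X \<and> x' \<in> topspace X"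
    and cover: "\<And>x. x \<in> topspace X \<Longrightarrow> \<exists>n::nat. u n x > 0"
    and f: "continuous_map X E f" "\<And>x x' \<gamma>. (x, x', \<gamma>) \<in> R \<Longrightarrow> f x' = \<gamma> (f x)"
    and g: "continuous_map X E g" "\<And>x x' \<gamma>. (x, x', \<gamma>) \<in> R \<Longrightarrow> g x' = \<gamma> (g x)"
  obtains h where "continuous_map (prod_topology (top_of_set {0..1::real}) X) E h"
    and "\<And>x. x \<in> topspace X \<Longrightarrow> h (0, x) = f x" and "\<And>x. x \<in> topspace X \<Longrightarrow> h (1, x) = g x"
    and "\<And>t x x' \<gamma>. t \<in> {0..1} \<Longrightarrow> (x, x', \<gamma>) \<in> R \<Longrightarrow> h (t, x') = \<gamma> (h (t, x))"
proof -
  let ?Y = "prod_topology (top_of_set {0..1::real}) X"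
  let ?v = "\<lambda>(t, x). \<bar>2 * t - 1\<bar> :: real"
  let ?s = "\<lambda>(t, x). if t < 1 / 2 then f x else g x"
  let ?R = "{((t, x), (t, x'), \<gamma>) | t x x' \<gamma>. t \<in> {0..1} \<and> (x, x', \<gamma>) \<in> R}"
  have fst: "continuous_map ?Y euclideanreal (\<lambda>z. fst z)"
    using continuous_map_into_fulltopology[OF continuous_map_fst[of "top_of_set {0..1::real}" X]] by simp
  have snd: "continuous_map ?Y X (\<lambda>z. snd z)"
    by (rule continuous_map_snd)
  have chart: "equivariant_chart ?Y E ?R (\<lambda>z. u n (snd z)) (\<lambda>z. \<theta> n (snd z)) (\<lambda>z. \<theta>' n (snd z))" for n
  proof -
    note c = charts[of n, unfolded equivariant_chart_def]
    let ?D = "subtopology ?Y {z \<in> topspace ?Y. u n (snd z) > 0}"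
    let ?D' = "subtopology X {x \<in> topspace X. u n x > 0}"
    have m: "continuous_map (prod_topology ?D E) (prod_topology ?D' E) (\<lambda>(z, e). (snd z, e))"
      by (auto simp: continuous_map_prod_top continuous_map_in_subtopology
          intro!: continuous_map_from_subtopology snd)
    have "continuous_map ?Y euclideanreal (\<lambda>z. u n (snd z))"
      using continuous_map_compose[OF snd equivariant_chart_continuous[OF charts]] by (simp add: o_def)
    moreover have "continuous_map (prod_topology ?D E) E (\<lambda>(z, e). \<theta> n (snd z) e)"
    proof (rule continuous_map_eq)
      show "continuous_map (prod_topology ?D E) E ((\<lambda>(x, e). \<theta> n x e) \<circ> (\<lambda>(z, e). (snd z, e)))"
        by (rule continuous_map_compose[OF m]) (use c in blast)
    qed auto
    moreover have "continuous_map (prod_topology ?D E) E (\<lambda>(z, e). \<theta>' n (snd z) e)"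
    proof (rule continuous_map_eq)
      show "continuous_map (prod_topology ?D E) E ((\<lambda>(x, e). \<theta>' n x e) \<circ> (\<lambda>(z, e). (snd z, e)))"
        by (rule continuous_map_compose[OF m]) (use c in blast)
    qed auto
    moreover have "\<forall>(z, z', \<gamma>)\<in>?R. u n (snd z') = u n (snd z) \<and>
        (u n (snd z) > 0 \<longrightarrow> (\<forall>e\<in>topspace E. \<theta> n (snd z') e = \<gamma> (\<theta> n (snd z) e)))"
      using c by auto
    moreover have "\<forall>z\<in>topspace ?Y. \<forall>e\<in>topspace E. u n (snd z) > 0 \<longrightarrow>
        \<theta> n (snd z) (\<theta>' n (snd z) e) = e \<and> \<theta>' n (snd z) (\<theta> n (snd z) e) = e"
      using c by auto
    moreover have "\<forall>z\<in>topspace ?Y. 0 \<le> u n (snd z)"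
      using c by auto
    ultimately show ?thesis
      unfolding equivariant_chart_def by (intro conjI)
  qed
  let ?P = "{z \<in> topspace ?Y. ?v z > 0}"
  have cs: "continuous_map (subtopology ?Y ?P) E ?s"
  proof (rule continuous_map_subtopology_locally)
    let ?A = "{z \<in> topspace ?Y. 1 / 2 - fst z > 0}" and ?B = "{z \<in> topspace ?Y. fst z - 1 / 2 > 0}"
    have oA: "openin ?Y ?A" by (intro openin_positive continuous_intros fst) auto
    have oB: "openin ?Y ?B" by (intro openin_positive continuous_intros fst) auto
    have cA: "continuous_map (subtopology ?Y ?A) E ?s"
      by (rule continuous_map_eq[where f = "\<lambda>z. f (snd z)"])
        (use continuous_map_compose[OF snd f(1)] in \<open>auto simp: o_def intro: continuous_map_from_subtopology\<close>)
    have cB: "continuous_map (subtopology ?Y ?B) E ?s"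
      by (rule continuous_map_eq[where f = "\<lambda>z. g (snd z)"])
        (use continuous_map_compose[OF snd g(1)] in \<open>auto simp: o_def intro: continuous_map_from_subtopology\<close>)
    fix z assume z: "z \<in> topspace ?Y" "z \<in> ?P"
    have "?A \<subseteq> ?P" "?B \<subseteq> ?P" by auto
    moreover have "z \<in> ?A \<or> z \<in> ?B" using z by (cases z) auto
    ultimately show "\<exists>T. openin ?Y T \<and> z \<in> T \<and> T \<subseteq> ?P \<and> continuous_map (subtopology ?Y T) E ?s"
      using cA cB oA oB by blast
  qed
  show thesis
  proof (rule equivariant_extension[OF assms(1,2) chart, where ?v0.0 = ?v and ?s0.0 = ?s])
    show "continuous_map ?Y euclideanreal ?v"
      unfolding case_prod_beta by (intro continuous_intros fst) auto
  next
    fix h assume "continuous_map ?Y E h" "\<And>x x' \<gamma>. (x, x', \<gamma>) \<in> ?R \<Longrightarrow> h x' = \<gamma> (h x)"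
      "\<And>x. x \<in> topspace ?Y \<Longrightarrow> 1 \<le> ?v x \<Longrightarrow> h x = ?s x"
    then show thesis by (intro that[of h]) auto
  next
    show "(x, x', \<gamma>) \<in> ?R \<Longrightarrow> x \<in> topspace ?Y \<and> x' \<in> topspace ?Y" for x x' \<gamma>
      using R by auto
    show "x \<in> topspace ?Y \<Longrightarrow> 0 < ?v x \<or> (\<exists>n. 0 < u n (snd x))" for x
      using cover by auto
    show "(x, x', \<gamma>) \<in> ?R \<Longrightarrow> ?v x' = ?v x" for x x' \<gamma>
      by auto
    show "(x, x', \<gamma>) \<in> ?R \<Longrightarrow> 0 < ?v x \<Longrightarrow> ?s x' = \<gamma> (?s x)" for x x' \<gamma>
      using f(2) g(2) by auto
  qed (use cs in auto)
qed

section \<open>Finitely supported sequences and projective space\<close>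

text \<open>
  Presents the colimit topology as a quotient of \<open>nat \<times> (nat \<Rightarrow> complex)\<close>; this makes continuity on
  products accessible, since quotient maps are stable under products with locally compact spaces.
\<close>

definition truncate :: "nat \<times> (nat \<Rightarrow> complex) \<Rightarrow> nat \<Rightarrow> complex" where
  "truncate = (\<lambda>(n, z) i. if i < n then z i else 0)"

lemma open_nat_prod_iff:
  fixes A :: "(nat \<times> 'a::topological_space) set"
  shows "open A \<longleftrightarrow> (\<forall>n. open {z. (n, z) \<in> A})"
proof
  assume A: "open A"
  show "\<forall>n. open {z. (n, z) \<in> A}"
  proof
    fix n
    have "open (Pair n -` A)"
      by (rule open_vimage[OF A]) (intro continuous_on_Pair continuous_on_const continuous_on_id)
    then show "open {z. (n, z) \<in> A}" by (simp add: vimage_def)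
  qed
next
  assume *: "\<forall>n. open {z. (n, z) \<in> A}"
  have "A = (\<Union>n. {n} \<times> {z. (n, z) \<in> A})" by auto
  moreover have "open (\<Union>n. {n} \<times> {z. (n, z) \<in> A})"
    using * by (intro open_UN ballI open_Times open_discrete) auto
  ultimately show "open A" by simp
qed

lemma continuous_on_nat_prod:
  fixes f :: "nat \<times> 'a::topological_space \<Rightarrow> 'b::topological_space"
  assumes "\<And>n. continuous_on UNIV (\<lambda>z. f (n, z))"
  shows "continuous_on UNIV f"
  unfolding continuous_on_open_vimage[OF open_UNIV]
proof (intro allI impI)
  fix B :: "'b set" assume "open B"
  then have "open ((\<lambda>z. f (n, z)) -` B)" for n
    using assms by (simp add: continuous_on_open_vimage[OF open_UNIV])
  then show "open (f -` B \<inter> UNIV)"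
    unfolding open_nat_prod_iff by (simp add: vimage_def)
qed

lemma continuous_on_truncate: "continuous_on UNIV (\<lambda>z. truncate (n, z))"
proof (rule continuous_on_coordinatewise_then_product)
  show "continuous_on UNIV (\<lambda>z. truncate (n, z) i)" for i
    by (cases "i < n") (simp_all add: truncate_def continuous_on_product_coordinates)
qed

lemma openin_complex_infinity:
  "openin complex_infinity W \<longleftrightarrow> W \<subseteq> {z. finite {i. z i \<noteq> 0}} \<and> (\<forall>n. open {z. truncate (n, z) \<in> W})"
proof -
  have "openin (top_of_set {z. \<forall>i\<ge>n. z i = 0}) {z. (\<forall>i\<ge>n. z i = 0) \<and> z \<in> W}
      \<longleftrightarrow> open {z. truncate (n, z) \<in> W}" for n
  proof
    assume "openin (top_of_set {z. \<forall>i\<ge>n. z i = 0}) {z. (\<forall>i\<ge>n. z i = 0) \<and> z \<in> W}"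
    then obtain T where T: "open T" "{z. (\<forall>i\<ge>n. z i = 0) \<and> z \<in> W} = {z. \<forall>i\<ge>n. z i = 0} \<inter> T"
      by (auto simp: openin_open)
    have "{z. truncate (n, z) \<in> W} = {z. truncate (n, z) \<in> T}"
      using T(2) by (auto simp: set_eq_iff truncate_def)
    also have "open \<dots>"
      using continuous_on_truncate[of n] T(1) by (simp add: continuous_on_open_vimage[OF open_UNIV] vimage_def)
    finally show "open {z. truncate (n, z) \<in> W}" .
  next
    assume "open {z. truncate (n, z) \<in> W}"
    moreover have "{z. (\<forall>i\<ge>n. z i = 0) \<and> z \<in> W} = {z. \<forall>i\<ge>n. z i = 0} \<inter> {z. truncate (n, z) \<in> W}"
    proof -
      have "truncate (n, z) = z" if "\<forall>i\<ge>n. z i = 0" for z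
        using that by (auto simp: truncate_def)
      then show ?thesis by auto
    qed
    ultimately show "openin (top_of_set {z. \<forall>i\<ge>n. z i = 0}) {z. (\<forall>i\<ge>n. z i = 0) \<and> z \<in> W}"
      by (auto simp: openin_open)
  qed
  then show ?thesis
    unfolding complex_infinity_def openin_final_topology by auto
qed

lemma finite_support_iff: "finite {i. z i \<noteq> 0} \<longleftrightarrow> (\<exists>n. \<forall>i\<ge>n. z i = 0)" for z :: "nat \<Rightarrow> complex"
  by (metis (mono_tags, lifting) finite_nat_set_iff_bounded mem_Collect_eq not_le)

lemma topspace_complex_infinity: "topspace complex_infinity = {z. finite {i. z i \<noteq> 0}}"
  unfolding complex_infinity_def by (rule topspace_final_topology) (force simp: finite_support_iff)

lemma truncate_in: "truncate p \<in> topspace complex_infinity"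
  by (cases p) (auto simp: topspace_complex_infinity truncate_def)

lemma truncate_id: "\<forall>i\<ge>n. z i = 0 \<Longrightarrow> truncate (n, z) = z"
  by (auto simp: truncate_def)

lemma quotient_map_truncate: "quotient_map euclidean complex_infinity truncate"
  unfolding quotient_map_def
proof (intro conjI allI impI)
  have "z \<in> truncate ` UNIV" if "finite {i. z i \<noteq> 0}" for z
    using that truncate_id unfolding finite_support_iff by (metis UNIV_I image_eqI)
  then show "truncate ` topspace euclidean = topspace complex_infinity"
    using truncate_in by (auto simp: topspace_complex_infinity)
next
  fix U assume "U \<subseteq> topspace complex_infinity"
  then show "openin euclidean {x \<in> topspace euclidean. truncate x \<in> U} = openin complex_infinity U"
    by (simp add: openin_complex_infinity topspace_complex_infinity open_nat_prod_iff)
qed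

lemma continuous_map_complex_infinity:
  fixes f :: "(nat \<Rightarrow> complex) \<Rightarrow> 'a::topological_space"
  assumes "\<And>n. continuous_on UNIV (\<lambda>z. f (truncate (n, z)))"
  shows "continuous_map complex_infinity euclidean f"
proof (rule continuous_compose_quotient_map[OF quotient_map_truncate])
  show "continuous_map euclidean euclidean (f \<circ> truncate)"
    using continuous_on_nat_prod[of "f \<circ> truncate"] assms by simp
qed

lemma continuous_map_coordinate: "continuous_map complex_infinity euclidean (\<lambda>z. z i)"
proof (rule continuous_map_complex_infinity)
  show "continuous_on UNIV (\<lambda>z. truncate (n, z) i)" for n
    by (cases "i < n") (simp_all add: truncate_def continuous_on_product_coordinates)
qed

lemma continuous_map_compose_lambda:
  assumes "continuous_map X Y f" "continuous_map Y Z g"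
  shows "continuous_map X Z (\<lambda>x. g (f x))"
  using continuous_map_compose[OF assms] by (simp add: o_def)

lemma continuous_map_swap:
  fixes X :: "'a topology" and Y :: "'b topology"
  shows "continuous_map (prod_topology X Y) (prod_topology Y X) prod.swap"
proof -
  have "prod.swap = (\<lambda>p :: 'a \<times> 'b. (snd p, fst p))" by auto
  then show ?thesis
    using continuous_map_pairedI[OF continuous_map_snd[of X Y] continuous_map_fst[of X Y]] by simp
qed

lemma continuous_map_euclidean_mult:
  fixes f g :: "'a \<Rightarrow> 'b::topological_semigroup_mult"
  assumes "continuous_map X euclidean f" "continuous_map X euclidean g"
  shows "continuous_map X euclidean (\<lambda>x. f x * g x)"
proof -
  have "continuous_map X euclidean (\<lambda>x. (f x, g x))"
    using assms by (simp add: continuous_map_pairedI flip: prod_topology_euclidean)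
  moreover have "continuous_map euclidean euclidean (\<lambda>p :: 'b \<times> 'b. fst p * snd p)"
    by (simp add: continuous_intros)
  ultimately have "continuous_map X euclidean (\<lambda>x. fst (f x, g x) * snd (f x, g x))"
    by (rule continuous_map_compose_lambda)
  then show ?thesis by simp
qed

text \<open>
  In general coordinatewise continuity does not suffice for the colimit topology. It does if,
  uniformly in the parameter, vectors supported below \<open>n\<close> go to vectors supported below \<open>b n\<close>.
\<close>

lemma continuous_map_into_complex_infinity:
  fixes F :: "(nat \<Rightarrow> complex) \<times> 'a \<Rightarrow> nat \<Rightarrow> complex"
  assumes Z: "locally_compact_space Z" "Hausdorff_space Z"
    and F: "\<And>i. continuous_map (prod_topology complex_infinity Z) euclidean (\<lambda>p. F p i)"
    and bound: "\<And>n z t. \<forall>i\<ge>n. z i = 0 \<Longrightarrow> \<forall>i\<ge>b n. F (z, t) i = 0"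
  shows "continuous_map (prod_topology complex_infinity Z) complex_infinity F"
proof (rule continuous_compose_quotient_map)
  let ?q = "\<lambda>(p, t). (truncate p, t)"
  show q: "quotient_map (prod_topology euclidean Z) (prod_topology complex_infinity Z) ?q"
    using Z quotient_map_truncate by (intro quotient_map_prod_left) auto
  have "F \<circ> ?q = truncate \<circ> (\<lambda>(p, t). (b (fst p), F (truncate p, t)))"
    using truncate_id[OF bound] by (auto simp: fun_eq_iff truncate_def)
  moreover have "continuous_map (prod_topology euclidean Z) complex_infinity
      (truncate \<circ> (\<lambda>(p, t). (b (fst p), F (truncate p, t))))"
  proof (rule continuous_map_compose)
    have "continuous_map (prod_topology (euclidean :: (nat \<times> (nat \<Rightarrow> complex)) topology) Z) euclidean (\<lambda>(p, t). b (fst p))"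
    proof -
      have "continuous_map euclidean euclidean (\<lambda>p :: nat \<times> (nat \<Rightarrow> complex). b (fst p))"
        by (simp add: continuous_on_nat_prod)
      from continuous_map_compose[OF continuous_map_fst this]
      show ?thesis by (simp add: o_def case_prod_unfold)
    qed
    moreover have "continuous_map (prod_topology euclidean Z) euclidean (\<lambda>(p, t). F (truncate p, t))"
    proof -
      have "continuous_map (prod_topology euclidean Z) (product_topology (\<lambda>_. euclidean) UNIV) (\<lambda>(p, t). F (truncate p, t))"
        unfolding continuous_map_componentwise_UNIV
      proof
        fix i
        from continuous_map_compose[OF quotient_imp_continuous_map[OF q] F[of i]]
        show "continuous_map (prod_topology euclidean Z) euclidean (\<lambda>x. (case x of (p, t) \<Rightarrow> F (truncate p, t)) i)"
          by (simp add: o_def case_prod_unfold)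
      qed
      then show ?thesis by (simp add: euclidean_product_topology)
    qed
    ultimately show "continuous_map (prod_topology euclidean Z) euclidean (\<lambda>(p, t). (b (fst p), F (truncate p, t)))"
      by (simp add: case_prod_unfold continuous_map_pairedI flip: prod_topology_euclidean)
    show "continuous_map euclidean complex_infinity truncate"
      by (rule quotient_imp_continuous_map[OF quotient_map_truncate])
  qed
  ultimately show "continuous_map (prod_topology euclidean Z) complex_infinity (F \<circ> ?q)"
    by (simp only:)
qed

lemma continuous_map_scale:
  "continuous_map (prod_topology complex_infinity euclidean) complex_infinity (\<lambda>(z, c) i. c * z i)"
proof (rule continuous_map_into_complex_infinity[where b = id])
  show "locally_compact_space (euclidean :: complex topology)"
    by (simp add: locally_compact_space_euclidean)
  show "continuous_map (prod_topology complex_infinity euclidean) euclidean (\<lambda>p. (case p of (z, c) \<Rightarrow> \<lambda>i. c * z i) i)" for i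
    unfolding case_prod_unfold
    by (intro continuous_map_euclidean_mult continuous_map_snd
        continuous_map_compose[OF continuous_map_fst continuous_map_coordinate, unfolded o_def])
qed auto

definition punctured_space :: "(nat \<Rightarrow> complex) topology" where
  "punctured_space = subtopology complex_infinity (topspace complex_infinity - {\<lambda>i. 0})"

lemma topspace_punctured_space: "topspace punctured_space = {z. finite {i. z i \<noteq> 0} \<and> (\<exists>i. z i \<noteq> 0)}"
  by (auto simp: punctured_space_def topspace_complex_infinity)

lemma continuous_map_scale_punctured:
  "continuous_map (prod_topology (top_of_set (- {0})) punctured_space) punctured_space (\<lambda>(c, z) i. c * z i)"
proof -
  have "(\<lambda>(z :: nat \<Rightarrow> complex, c) i. c * z i) \<circ> prod.swap = (\<lambda>(c, z) i. c * z i)"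
    by auto
  with continuous_map_compose[OF continuous_map_swap continuous_map_scale]
  have "continuous_map (prod_topology (euclidean :: complex topology) complex_infinity) complex_infinity
      (\<lambda>(c, z) i. c * z i)"
    by (simp only:)
  then have "continuous_map (prod_topology (top_of_set (- {0})) punctured_space) complex_infinity (\<lambda>(c, z) i. c * z i)"
    unfolding punctured_space_def prod_topology_subtopology by (simp add: continuous_map_from_subtopology)
  moreover have "(\<lambda>(c, z) i. c * z i) ` topspace (prod_topology (top_of_set (- {0})) punctured_space)
      \<subseteq> topspace complex_infinity - {\<lambda>i. 0}"
    by (auto simp: topspace_punctured_space topspace_complex_infinity fun_eq_iff)
  ultimately show ?thesis
    unfolding punctured_space_def by (simp add: continuous_map_in_subtopology image_subset_iff_funcset)
qed

text \<open>
  Continuous on the colimit and homogeneous, so division by it removes positive factors.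
\<close>

definition l1_norm :: "(nat \<Rightarrow> complex) \<Rightarrow> real" where
  "l1_norm z = (\<Sum>i | z i \<noteq> 0. norm (z i))"

lemma l1_norm_truncate: "l1_norm (truncate (n, z)) = (\<Sum>i<n. norm (z i))"
  unfolding l1_norm_def by (rule sum.mono_neutral_cong_left) (auto simp: truncate_def)

lemma continuous_map_l1_norm: "continuous_map complex_infinity euclideanreal l1_norm"
  by (rule continuous_map_complex_infinity)
    (auto simp: l1_norm_truncate intro!: continuous_on_sum continuous_on_norm continuous_on_product_coordinates)

lemma l1_norm_pos: "z \<in> topspace punctured_space \<Longrightarrow> l1_norm z > 0"
  unfolding l1_norm_def topspace_punctured_space by (intro sum_pos) auto

lemma l1_norm_scale: "l1_norm (\<lambda>i. c * z i) = norm c * l1_norm z"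
  by (cases "c = 0") (simp_all add: l1_norm_def norm_mult sum_distrib_left)

text \<open>
  A straight line leads from the identity to the shift, and another one from the shift to the
  constant first unit vector. Neither passes through zero: a vector and its shift have different
  leading positions, and the first coordinate of the shift vanishes.
\<close>

lemma contractible_punctured_space: "contractible_space punctured_space"
proof -
  let ?I = "top_of_set {0..1::real}"
  let ?S = "topspace complex_infinity - {\<lambda>i. 0 :: complex}"
  let ?shift = "\<lambda>z i. if i = 0 then 0 else z (i - 1) :: complex"
  let ?e = "\<lambda>i::nat. if i = 0 then 1 else 0 :: complex"
  have lc: "locally_compact_space ?I" "Hausdorff_space ?I"
    by (simp_all add: compact_space_subtopology compact_imp_locally_compact_space Hausdorff_space_subtopology)
  have coord: "continuous_map (prod_topology complex_infinity ?I) euclidean (\<lambda>p. fst p i)" for i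
    using continuous_map_compose[OF continuous_map_fst continuous_map_coordinate[of i]] by (simp add: o_def)
  have time: "continuous_map (prod_topology complex_infinity ?I) euclidean (\<lambda>p. complex_of_real (snd p))"
  proof -
    have "continuous_map ?I euclidean complex_of_real" by (simp add: continuous_intros)
    from continuous_map_compose[OF continuous_map_snd this] show ?thesis by (simp add: o_def)
  qed
  have homotopy: "homotopic_with (\<lambda>x. True) punctured_space punctured_space (\<lambda>z. F (z, 0)) (\<lambda>z. F (z, 1))"
    if F: "\<And>i. continuous_map (prod_topology complex_infinity ?I) euclidean (\<lambda>p. F p i)"
      and b: "\<And>n z t. \<forall>i\<ge>n. z i = 0 \<Longrightarrow> \<forall>i\<ge>Suc n. F (z, t) i = 0"
      and nz: "\<And>z t. t \<in> {0..1} \<Longrightarrow> z \<in> ?S \<Longrightarrow> F (z, t) \<noteq> (\<lambda>i. 0)"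
    for F :: "(nat \<Rightarrow> complex) \<times> real \<Rightarrow> nat \<Rightarrow> complex"
  proof -
    have c: "continuous_map (prod_topology complex_infinity ?I) complex_infinity F"
      by (rule continuous_map_into_complex_infinity[where b = Suc, OF lc F b])
    have "continuous_map punctured_space complex_infinity (\<lambda>z. z)"
      unfolding punctured_space_def by (simp add: continuous_map_from_subtopology)
    then have incl: "continuous_map (prod_topology punctured_space ?I) (prod_topology complex_infinity ?I) (\<lambda>(z, t). (z, t))"
      unfolding continuous_map_prod_top by simp
    have "F \<circ> ((\<lambda>(z, t). (z, t)) \<circ> prod.swap) = (\<lambda>(t, z). F (z, t))" by auto
    with continuous_map_compose[OF continuous_map_compose[OF continuous_map_swap incl] c]
    have "continuous_map (prod_topology ?I punctured_space) complex_infinity (\<lambda>(t, z). F (z, t))"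
      by (simp only:)
    moreover have "F (z, t) \<in> ?S" if "t \<in> {0..1}" "z \<in> topspace punctured_space" for t z
    proof -
      have z: "z \<in> ?S" using that by (simp add: punctured_space_def)
      have "(z, t) \<in> topspace (prod_topology complex_infinity ?I)" using z that by simp
      then have "F (z, t) \<in> topspace complex_infinity" 
        using continuous_map_image_subset_topspace[OF c] by blast
      then show ?thesis using nz[OF that(1) z] by simp
    qed
    then have "(\<lambda>(t, z). F (z, t)) ` topspace (prod_topology ?I punctured_space) \<subseteq> ?S"
      by auto
    ultimately have "continuous_map (prod_topology ?I punctured_space) punctured_space (\<lambda>(t, z). F (z, t))"
      unfolding punctured_space_def by (simp add: continuous_map_in_subtopology image_subset_iff_funcset)
    then show ?thesis
      unfolding homotopic_with_def by (intro exI[of _ "\<lambda>(t, z). F (z, t)"]) auto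
  qed
  have 1: "homotopic_with (\<lambda>x. True) punctured_space punctured_space
      (\<lambda>z. (\<lambda>(z, t) i. (1 - complex_of_real t) * z i + complex_of_real t * ?shift z i) (z, 0))
      (\<lambda>z. (\<lambda>(z, t) i. (1 - complex_of_real t) * z i + complex_of_real t * ?shift z i) (z, 1))"
  proof (rule homotopy)
    show "continuous_map (prod_topology complex_infinity ?I) euclidean
        (\<lambda>p. (\<lambda>(z, t) i. (1 - complex_of_real t) * z i + complex_of_real t * ?shift z i) p i)" for i
      unfolding case_prod_unfold by (cases "i = 0") (auto intro!: continuous_map_add continuous_map_diff continuous_map_euclidean_mult coord time)
    fix z t assume t: "t \<in> {0..1::real}" and z: "z \<in> ?S"
    then have ex: "\<exists>i. z i \<noteq> 0" by auto
    define i where "i = (LEAST i. z i \<noteq> 0)"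
    have i: "z i \<noteq> 0" unfolding i_def by (rule LeastI_ex[OF ex])
    have "?shift z i = 0"
      using not_less_Least[of "i - 1" "\<lambda>i. z i \<noteq> 0", folded i_def] by auto
    then have "t \<noteq> 1 \<Longrightarrow> (1 - complex_of_real t) * z i + complex_of_real t * ?shift z i \<noteq> 0"
      using i by simp
    moreover have "t = 1 \<Longrightarrow> (1 - complex_of_real t) * z (Suc i) + complex_of_real t * ?shift z (Suc i) \<noteq> 0"
      using i by simp
    ultimately show "(\<lambda>(z, t) i. (1 - complex_of_real t) * z i + complex_of_real t * ?shift z i) (z, t) \<noteq> (\<lambda>i. 0)"
      unfolding case_prod_conv fun_eq_iff by blast
  qed auto
  have 2: "homotopic_with (\<lambda>x. True) punctured_space punctured_space
      (\<lambda>z. (\<lambda>(z, t) i. (1 - complex_of_real t) * ?shift z i + complex_of_real t * ?e i) (z, 0))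
      (\<lambda>z. (\<lambda>(z, t) i. (1 - complex_of_real t) * ?shift z i + complex_of_real t * ?e i) (z, 1))"
  proof (rule homotopy)
    show "continuous_map (prod_topology complex_infinity ?I) euclidean
        (\<lambda>p. (\<lambda>(z, t) i. (1 - complex_of_real t) * ?shift z i + complex_of_real t * ?e i) p i)" for i
      unfolding case_prod_unfold by (cases "i = 0") (auto intro!: continuous_map_add continuous_map_diff continuous_map_euclidean_mult coord time)
    fix z t assume t: "t \<in> {0..1::real}" and z: "z \<in> ?S"
    then obtain i where i: "z i \<noteq> 0" by auto
    have "t \<noteq> 0 \<Longrightarrow> (1 - complex_of_real t) * ?shift z 0 + complex_of_real t * ?e 0 \<noteq> 0"
      by simp
    moreover have "t = 0 \<Longrightarrow> (1 - complex_of_real t) * ?shift z (Suc i) + complex_of_real t * ?e (Suc i) \<noteq> 0"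
      using i by simp
    ultimately show "(\<lambda>(z, t) i. (1 - complex_of_real t) * ?shift z i + complex_of_real t * ?e i) (z, t) \<noteq> (\<lambda>i. 0)"
      unfolding case_prod_conv fun_eq_iff by blast
  qed auto
  have "homotopic_with (\<lambda>x. True) punctured_space punctured_space (\<lambda>z. z) (\<lambda>z. ?e)"
    by (rule homotopic_with_trans) (use 1 2 in simp_all)
  then show ?thesis
    unfolding contractible_space_def id_def by blast
qed

lemma topspace_CP_infinity: "topspace CP_infinity = complex_line ` topspace punctured_space"
  unfolding CP_infinity_def punctured_space_def by (subst topspace_final_topology) auto

lemma complex_line_eq_iff:
  assumes "z \<in> topspace punctured_space"
  shows "complex_line z = complex_line z' \<longleftrightarrow> (\<exists>c. c \<noteq> 0 \<and> z' = (\<lambda>i. c * z i))"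
proof
  assume eq: "complex_line z = complex_line z'"
  have "z = (\<lambda>i. 1 * z i)" by simp
  then have "z \<in> complex_line z" unfolding complex_line_def by blast
  then obtain d where d: "z = (\<lambda>i. d * z' i)" using eq unfolding complex_line_def by blast
  moreover have "d \<noteq> 0" using d assms by (auto simp: topspace_punctured_space)
  ultimately show "\<exists>c. c \<noteq> 0 \<and> z' = (\<lambda>i. c * z i)"
    by (intro exI[of _ "1 / d"]) auto
next
  assume "\<exists>c. c \<noteq> 0 \<and> z' = (\<lambda>i. c * z i)"
  then obtain c where c: "c \<noteq> 0" "z' = (\<lambda>i. c * z i)" by blast
  have "(\<lambda>i. a * z i) = (\<lambda>i. a / c * z' i)" for a using c by auto
  moreover have "(\<lambda>i. a * z' i) = (\<lambda>i. a * c * z i)" for a using c by auto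
  ultimately show "complex_line z = complex_line z'" unfolding complex_line_def by blast
qed

lemma openin_CP_infinity:
  "openin CP_infinity V \<longleftrightarrow> V \<subseteq> complex_line ` topspace punctured_space \<and>
     openin punctured_space {z \<in> topspace punctured_space. complex_line z \<in> V}"
  proof -
  have "topspace punctured_space = topspace complex_infinity - {\<lambda>i. 0}"
    by (auto simp: punctured_space_def)
  then show ?thesis
    unfolding CP_infinity_def openin_final_topology by (simp add: punctured_space_def[symmetric])
qed

lemma continuous_map_complex_line: "continuous_map punctured_space CP_infinity complex_line"
  unfolding continuous_map_def by (auto simp: topspace_CP_infinity openin_CP_infinity)

text \<open>
  The saturation of an open set is the union of its multiples by nonzero scalars.
\<close>

lemma open_map_complex_line: "open_map punctured_space CP_infinity complex_line"
  unfolding open_map_def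
proof (intro allI impI)
  fix U assume U: "openin punctured_space U"
  then have sub: "U \<subseteq> topspace punctured_space" by (rule openin_subset)
  then have im: "complex_line ` U \<subseteq> complex_line ` topspace punctured_space" by blast
  have "{z \<in> topspace punctured_space. complex_line z \<in> complex_line ` U} =
      (\<Union>c\<in>- {0}. {z \<in> topspace punctured_space. (\<lambda>i. c * z i) \<in> U})"
  proof (intro set_eqI iffI)
    fix z assume "z \<in> {z \<in> topspace punctured_space. complex_line z \<in> complex_line ` U}"
    then obtain z' where z: "z \<in> topspace punctured_space" "z' \<in> U" "complex_line z = complex_line z'" by blast
    then show "z \<in> (\<Union>c\<in>- {0}. {z \<in> topspace punctured_space. (\<lambda>i. c * z i) \<in> U})"
      using complex_line_eq_iff[of z z'] by auto
  next
    fix z assume "z \<in> (\<Union>c\<in>- {0}. {z \<in> topspace punctured_space. (\<lambda>i. c * z i) \<in> U})"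
    then obtain c where c: "z \<in> topspace punctured_space" "c \<noteq> 0" "(\<lambda>i. c * z i) \<in> U" by blast
    then have "complex_line z = complex_line (\<lambda>i. c * z i)"
      using complex_line_eq_iff by blast
    then show "z \<in> {z \<in> topspace punctured_space. complex_line z \<in> complex_line ` U}"
      using c by blast
  qed
  also have "openin punctured_space \<dots>"
  proof (rule openin_Union)
    fix S assume "S \<in> (\<lambda>c. {z \<in> topspace punctured_space. (\<lambda>i. c * z i) \<in> U}) ` (- {0})"
    then obtain c where c: "c \<noteq> 0" and S: "S = {z \<in> topspace punctured_space. (\<lambda>i. c * z i) \<in> U}" by blast
    have "continuous_map punctured_space (prod_topology (top_of_set (- {0})) punctured_space) (\<lambda>z. (c, z))"
      using c by (simp add: continuous_map_pairedI)
    from continuous_map_compose[OF this continuous_map_scale_punctured]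
    have "continuous_map punctured_space punctured_space (\<lambda>z i. c * z i)" by (simp add: o_def)
    then show "openin punctured_space S"
      unfolding S using U by (rule openin_continuous_map_preimage)
  qed
  finally have "openin punctured_space {z \<in> topspace punctured_space. complex_line z \<in> complex_line ` U}" .
  with im show "openin CP_infinity (complex_line ` U)"
    unfolding openin_CP_infinity ..
qed

lemma continuous_map_normalize:
  "continuous_map punctured_space punctured_space (\<lambda>z i. z i / l1_norm z)"
proof -
  have n: "continuous_map punctured_space euclideanreal l1_norm"
    unfolding punctured_space_def by (intro continuous_map_from_subtopology continuous_map_l1_norm)
  have "continuous_map punctured_space (top_of_set {0<..}) l1_norm"
    using n l1_norm_pos by (auto simp: continuous_map_in_subtopology)
  moreover have "continuous_map (top_of_set {0<..}) (top_of_set (- {0})) (\<lambda>r. 1 / complex_of_real r)"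
    by (auto simp: continuous_map_in_subtopology intro!: continuous_intros)
  ultimately have "continuous_map punctured_space (top_of_set (- {0})) (\<lambda>z. 1 / complex_of_real (l1_norm z))"
    by (rule continuous_map_compose_lambda)
  then have "continuous_map punctured_space (prod_topology (top_of_set (- {0})) punctured_space)
     (\<lambda>z. (1 / complex_of_real (l1_norm z), z))"
    by (simp add: continuous_map_pairedI)
  from continuous_map_compose[OF this continuous_map_scale_punctured]
  show ?thesis by (simp add: o_def)
qed

section \<open>Unitary matrices, Kronecker products and amplifications\<close>

definition adjoint_matrix :: "complex^'n^'m \<Rightarrow> complex^'m^'n" where
  "adjoint_matrix M = (\<chi> i j. cnj (M $ j $ i))"

definition unitary_matrices :: "(complex^'n::finite^'n) set" where
  "unitary_matrices = {M. adjoint_matrix M ** M = mat 1}"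

definition kronecker ::
    "complex^'k::finite^'k \<Rightarrow> complex^'l::finite^'l \<Rightarrow> complex^('k \<times> 'l)^('k \<times> 'l)" where
  "kronecker g h = (\<chi> r c. g $ fst r $ fst c * h $ snd r $ snd c)"

definition conjugation :: "complex^'n::finite^'n \<Rightarrow> complex^'n^'n \<Rightarrow> complex^'n^'n" where
  "conjugation g M = g ** M ** adjoint_matrix g"

definition amplification ::
    "complex^('k::finite \<times> 'l::finite)^('k \<times> 'l) \<Rightarrow> complex^'k^'k \<Rightarrow> complex^('k \<times> 'l)^('k \<times> 'l)" where
  "amplification w M = conjugation w (kronecker M (mat 1))"

definition matrix_unit :: "'n::finite \<Rightarrow> 'n \<Rightarrow> complex^'n^'n" where
  "matrix_unit i j = (\<chi> a b. if a = i \<and> b = j then 1 else 0)"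

lemma adjoint_adjoint [simp]: "adjoint_matrix (adjoint_matrix M) = M"
  by (simp add: adjoint_matrix_def vec_eq_iff)

lemma adjoint_mult: "adjoint_matrix (A ** B) = adjoint_matrix B ** adjoint_matrix A"
  by (simp add: adjoint_matrix_def matrix_matrix_mult_def vec_eq_iff mult.commute)

lemma adjoint_mat [simp]: "adjoint_matrix (mat c) = mat (cnj c)"
  by (simp add: adjoint_matrix_def mat_def vec_eq_iff)

lemma matrix_add_rdistrib': "(A + B) ** C = A ** C + B ** (C :: complex^'n^'m)"
  by (simp add: matrix_matrix_mult_def vec_eq_iff distrib_right sum.distrib)

lemma mat_mult_component: "(mat (c :: complex) ** M) $ i $ j = c * M $ i $ j"
  by (simp add: matrix_matrix_mult_def mat_def if_distrib if_distribR cong: if_cong)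

lemma mat_mult_mat: "mat (c :: complex) ** mat d = (mat (c * d) :: complex^'n::finite^'n)"
  by (simp add: vec_eq_iff mat_mult_component) (simp add: mat_def)

lemma mat_commute: "mat (c :: complex) ** M = M ** mat c"
  by (simp add: matrix_matrix_mult_def mat_def vec_eq_iff if_distrib if_distribR mult.commute cong: if_cong)

lemma mat_left_commute: "A ** (mat c ** B) = mat (c :: complex) ** (A ** B)"
proof -
  have "A ** (mat c ** B) = (A ** mat c) ** B" by (rule matrix_mul_assoc)
  also have "\<dots> = (mat c ** A) ** B" by (simp only: mat_commute)
  finally show ?thesis by (simp only: matrix_mul_assoc)
qed

lemma unitary_left: "g \<in> unitary_matrices \<Longrightarrow> adjoint_matrix g ** g = mat 1"
  by (simp add: unitary_matrices_def)

lemma unitary_right: "g \<in> unitary_matrices \<Longrightarrow> g ** adjoint_matrix g = mat 1"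
  by (simp add: unitary_matrices_def matrix_left_right_inverse)

lemma unitaryI: "g ** adjoint_matrix g = mat 1 \<Longrightarrow> g \<in> unitary_matrices"
  by (simp add: unitary_matrices_def matrix_left_right_inverse)

lemma unitary_cancel:
  assumes "g \<in> unitary_matrices"
  shows "adjoint_matrix g ** (g ** M) = M" "g ** (adjoint_matrix g ** M) = M"
    "M ** adjoint_matrix g ** g = M" "M ** g ** adjoint_matrix g = M"
  using assms by (simp_all add: matrix_mul_assoc unitary_left unitary_right)
    (simp_all add: unitary_left unitary_right flip: matrix_mul_assoc)

lemma unitary_mult: "g \<in> unitary_matrices \<Longrightarrow> h \<in> unitary_matrices \<Longrightarrow> g ** h \<in> unitary_matrices"
  by (rule unitaryI) (simp add: adjoint_mult matrix_mul_assoc unitary_cancel unitary_right)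

lemma unitary_adjoint: "g \<in> unitary_matrices \<Longrightarrow> adjoint_matrix g \<in> unitary_matrices"
  by (rule unitaryI) (simp add: unitary_left)

lemma sum_cnj_mult: "(\<Sum>x\<in>A. cnj (f x) * f x) = of_real (\<Sum>x\<in>A. (norm (f x))\<^sup>2)"
proof -
  have "cnj z * z = of_real ((norm z)\<^sup>2)" for z
    by (metis complex_norm_square mult.commute of_real_power)
  then show ?thesis by simp
qed

lemma unitary_mat: "mat c \<in> (unitary_matrices :: (complex^'n::finite^'n) set) \<longleftrightarrow> norm c = 1"
proof -
  have "cnj c * c = of_real ((norm c)\<^sup>2)"
    using sum_cnj_mult[of "\<lambda>_. c" "{0}"] by simp
  then have "cnj c * c = 1 \<longleftrightarrow> (norm c)\<^sup>2 = 1"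
    by (simp only: of_real_eq_1_iff)
  also have "\<dots> \<longleftrightarrow> norm c = 1"
    using norm_ge_zero[of c] unfolding power2_eq_1_iff by linarith
  finally have n: "cnj c * c = 1 \<longleftrightarrow> norm c = 1" .
  have "mat (cnj c * c) = (mat 1 :: complex^'n^'n) \<longleftrightarrow> cnj c * c = 1"
    by (auto simp: mat_def vec_eq_iff)
  then show ?thesis
    unfolding unitary_matrices_def mem_Collect_eq adjoint_mat mat_mult_mat n .
qed

lemma unitary_one [simp]: "mat 1 \<in> unitary_matrices"
  by (simp add: unitary_mat)

lemma det_adjoint: "det (adjoint_matrix M) = cnj (det M)" for M :: "complex^'n::finite^'n"
proof -
  have "det (adjoint_matrix M) = det (transpose (\<chi> i j. cnj (M $ i $ j)))"
    by (rule arg_cong[where f = det]) (simp add: adjoint_matrix_def transpose_def vec_eq_iff)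
  also have "\<dots> = cnj (det M)"
    unfolding det_transpose by (simp add: det_def cnj_sum)
  finally show ?thesis .
qed

lemma norm_det_unitary: "g \<in> unitary_matrices \<Longrightarrow> norm (det g) = 1"
proof -
  assume "g \<in> unitary_matrices"
  then have "det (adjoint_matrix g) * det g = 1"
    by (simp add: unitary_left flip: det_mul)
  then have "cnj (det g) * det g = 1" by (simp add: det_adjoint)
  then have "norm (cnj (det g)) * norm (det g) = 1" by (metis norm_mult norm_one)
  then have "(norm (det g))\<^sup>2 = 1" by (simp add: power2_eq_square)
  then show ?thesis
    using norm_ge_zero[of "det g"] unfolding power2_eq_1_iff by linarith
qed

lemma sum_UNIV_prod:
  "(\<Sum>p\<in>UNIV. f p) = (\<Sum>i\<in>UNIV. \<Sum>j\<in>UNIV. f (i, j))" for f :: "'a::finite \<times> 'b::finite \<Rightarrow> 'c::comm_monoid_add"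
  by (simp add: sum.cartesian_product)

lemma kronecker_mult: "kronecker a c ** kronecker b d = kronecker (a ** b) (c ** d)"
  by (simp add: kronecker_def matrix_matrix_mult_def vec_eq_iff sum_UNIV_prod sum_product algebra_simps)

lemma kronecker_adjoint: "adjoint_matrix (kronecker g h) = kronecker (adjoint_matrix g) (adjoint_matrix h)"
  by (simp add: kronecker_def adjoint_matrix_def vec_eq_iff)

lemma kronecker_mat: "kronecker (mat c) (mat d) = mat (c * d)"
  by (auto simp: kronecker_def mat_def vec_eq_iff prod_eq_iff)

lemma kronecker_unitary:
  "g \<in> unitary_matrices \<Longrightarrow> h \<in> unitary_matrices \<Longrightarrow> kronecker g h \<in> unitary_matrices"
  by (simp add: unitary_matrices_def kronecker_adjoint kronecker_mult kronecker_mat)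

lemma kronecker_one_inj: "kronecker (mat 1) h = kronecker (mat 1) h' \<Longrightarrow> h = h'"
proof -
  assume eq: "kronecker (mat 1 :: complex^'a^'a) h = kronecker (mat 1) h'"
  have "h $ i $ j = h' $ i $ j" for i j
    using arg_cong[OF eq, of "\<lambda>M. M $ (undefined, i) $ (undefined, j)"] by (simp add: kronecker_def mat_def)
  then show ?thesis by (simp add: vec_eq_iff)
qed

lemma conjugation_mult: "conjugation (g ** h) M = conjugation g (conjugation h M)"
  by (simp add: conjugation_def adjoint_mult matrix_mul_assoc)

lemma conjugation_one [simp]: "conjugation (mat 1) M = M"
  by (simp add: conjugation_def)

text \<open>
  Conjugation depends only on the class of the unitary matrix in the projective unitary group.
\<close>

lemma conjugation_scalar:
  assumes "norm c = 1"
  shows "conjugation (mat c ** g) M = conjugation g M"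
proof -
  have c: "cnj c * c = 1"
    using sum_cnj_mult[of "\<lambda>_. c" "{0}"] assms by simp
  have "conjugation (mat c ** g) M = (mat c ** g) ** M ** (mat (cnj c) ** adjoint_matrix g)"
    by (simp only: conjugation_def adjoint_mult adjoint_mat mat_commute)
  also have "\<dots> = mat c ** (g ** M ** (mat (cnj c) ** adjoint_matrix g))"
    by (simp only: matrix_mul_assoc)
  also have "\<dots> = mat c ** (mat (cnj c) ** (g ** M ** adjoint_matrix g))"
    by (simp only: mat_left_commute[of "g ** M"])
  also have "\<dots> = (mat c ** mat (cnj c)) ** conjugation g M"
    by (simp only: matrix_mul_assoc conjugation_def)
  also have "\<dots> = conjugation g M"
    by (simp only: mat_mult_mat mult.commute[of c] c matrix_mul_lid)
  finally show ?thesis .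
qed

text \<open>
  Restricted to \<open>g = 1\<close> this says that amplifications only depend on the class modulo \<open>U(l)\<close>.
\<close>

lemma amplification_kronecker:
  assumes "h \<in> unitary_matrices"
  shows "amplification (w ** kronecker g h) M = amplification w (conjugation g M)"
  using assms
  by (simp add: amplification_def conjugation_mult)
    (simp add: conjugation_def kronecker_mult kronecker_adjoint unitary_right)

lemma star_homs_matrix_iff:
  "f \<in> star_homs (matrix_algebra :: (complex^'n::finite^'n) star_algebra) (matrix_algebra :: (complex^'m::finite^'m) star_algebra) \<longleftrightarrow>
     (\<forall>A B. f (A + B) = f A + f B) \<and> (\<forall>c A. f (mat c ** A) = mat c ** f A) \<and>
     (\<forall>A B. f (A ** B) = f A ** f B) \<and> f (mat 1) = mat 1 \<and>
     (\<forall>A. f (adjoint_matrix A) = adjoint_matrix (f A))"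
proof -
  have s: "(\<chi> i j. c * M $ i $ j) = mat c ** M" for c and M :: "complex^'p::finite^'p"
    by (simp add: vec_eq_iff mat_mult_component)
  show ?thesis
    unfolding star_homs_def linear_maps_def matrix_algebra_def adjoint_matrix_def[symmetric] s
    by (auto simp: adjoint_matrix_def)
qed

lemma amplification_star_hom:
  assumes "w \<in> unitary_matrices"
  shows "amplification w \<in> star_homs matrix_algebra matrix_algebra"
proof -
  have k: "kronecker (A + B) C = kronecker A C + kronecker B C" for A B :: "complex^'a^'a" and C :: "complex^'b^'b"
    by (simp add: kronecker_def vec_eq_iff algebra_simps)
  have m: "kronecker (mat c ** A) (mat 1) = mat c ** kronecker A (mat 1 :: complex^'b^'b)" for c and A :: "complex^'a^'a"
    by (simp add: kronecker_def vec_eq_iff mat_mult_component)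
  have u: "kronecker (A ** B) (mat 1) = kronecker A (mat 1) ** kronecker B (mat 1 :: complex^'b^'b)" for A B :: "complex^'a^'a"
    by (simp add: kronecker_mult)
  show ?thesis
    unfolding star_homs_matrix_iff
  proof (intro conjI allI)
    fix A B :: "complex^'a^'a" and c
    show "amplification w (A + B) = amplification w A + amplification w B"
      unfolding amplification_def conjugation_def k by (simp add: matrix_add_ldistrib matrix_add_rdistrib')
    show "amplification w (mat c ** A) = mat c ** amplification w A"
      unfolding amplification_def conjugation_def m by (simp add: mat_left_commute flip: matrix_mul_assoc)
    show "amplification w (A ** B) = amplification w A ** amplification w B"
      unfolding amplification_def conjugation_def u by (simp add: unitary_cancel assms flip: matrix_mul_assoc)
    show "amplification w (mat 1) = mat 1"
      unfolding amplification_def conjugation_def by (simp add: kronecker_mat unitary_right assms)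
    show "amplification w (adjoint_matrix A) = adjoint_matrix (amplification w A)"
      unfolding amplification_def conjugation_def by (simp add: adjoint_mult kronecker_adjoint matrix_mul_assoc)
  qed
qed

section \<open>Star homomorphisms of matrix algebras\<close>

lemma matrix_unit_mult_left: "(matrix_unit a b ** X) $ c $ d = (if c = a then X $ b $ d else 0)"
  by (cases "c = a") (simp_all add: matrix_unit_def matrix_matrix_mult_def if_distrib if_distribR cong: if_cong)

lemma matrix_unit_mult: "matrix_unit i j ** matrix_unit i' j' = (if j = i' then matrix_unit i j' else 0)"
  by (simp add: vec_eq_iff matrix_unit_mult_left) (simp add: matrix_unit_def)

lemma adjoint_matrix_unit: "adjoint_matrix (matrix_unit i j) = matrix_unit j i"
  by (auto simp: matrix_unit_def adjoint_matrix_def vec_eq_iff)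

lemma sum_matrix_unit: "(\<Sum>i\<in>UNIV. matrix_unit i i) = mat 1"
proof -
  have "(\<Sum>x\<in>UNIV. if i = x \<and> j = x then 1 else 0) = (if i = j then 1 else 0 :: complex)" for i j :: 'a
    by (cases "i = j") (auto intro: sum.neutral)
  then show ?thesis
    by (simp add: matrix_unit_def mat_def vec_eq_iff)
qed

lemma star_hom_sum:
  assumes "f \<in> star_homs (matrix_algebra :: (complex^'n::finite^'n) star_algebra) (matrix_algebra :: (complex^'m::finite^'m) star_algebra)"
  shows "f (sum g A) = (\<Sum>a\<in>A. f (g a))"
proof -
  have 0: "f 0 = 0"
    using assms unfolding star_homs_matrix_iff by (metis add_cancel_right_right)
  show ?thesis
    using assms by (induction A rule: infinite_finite_induct) (auto simp: 0 star_homs_matrix_iff)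
qed

text \<open>
  Compare the entries of the products with the matrix units.
\<close>

lemma commutant_matrix:
  fixes X :: "complex^'n::finite^'n"
  assumes "\<And>M. X ** M = M ** X"
  shows "X = mat (X $ i $ i)"
proof -
  have "(X ** matrix_unit a b) $ c $ d = (if d = b then X $ c $ a else 0)"
    "(matrix_unit a b ** X) $ c $ d = (if c = a then X $ b $ d else 0)" for a b c d
    by (simp_all add: matrix_unit_def matrix_matrix_mult_def if_distrib if_distribR cong: if_cong)
  then have *: "(if d = b then X $ c $ a else 0) = (if c = a then X $ b $ d else 0)" for a b c d
    using assms by metis
  have "X $ c $ d = mat (X $ i $ i) $ c $ d" for c d
    using *[of d d c d] *[of i i d d] by (auto simp: mat_def)
  then show ?thesis unfolding vec_eq_iff by blast
qed

text \<open>
  A kl by kl matrix, viewed as an l by l matrix of k by k blocks.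
\<close>

definition block :: "complex^('k::finite \<times> 'l::finite)^('k \<times> 'l) \<Rightarrow> 'l \<Rightarrow> 'l \<Rightarrow> complex^'k^'k" where
  "block v j j' = (\<chi> i i'. v $ (i, j) $ (i', j'))"

lemma block_kronecker_right: "block (v ** kronecker M (mat 1)) j j' = block v j j' ** M"
  by (auto simp: block_def kronecker_def matrix_matrix_mult_def mat_def vec_eq_iff sum_UNIV_prod
      if_distrib if_distribR cong: if_cong)

lemma block_kronecker_left: "block (kronecker M (mat 1) ** v) j j' = M ** block v j j'"
  by (auto simp: block_def kronecker_def matrix_matrix_mult_def mat_def vec_eq_iff sum_UNIV_prod
      if_distrib if_distribR cong: if_cong)

text \<open>
  All blocks of such a matrix commute with every k by k matrix, so they are scalar.
\<close>

lemma commutant_amplification: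
  assumes "\<And>M. v ** kronecker M (mat 1) = kronecker M (mat 1) ** v"
  obtains h where "v = kronecker (mat 1) h"
proof
  define h where "h = (\<chi> j j'. block v j j' $ undefined $ undefined)"
  have "block v j j' ** M = M ** block v j j'" for j j' M
    by (metis assms block_kronecker_left block_kronecker_right)
  then have "block v j j' = mat (h $ j $ j')" for j j'
    using commutant_matrix[of "block v j j'" undefined] by (simp add: h_def)
  then have "block v j j' $ i $ i' = (mat (h $ j $ j') :: complex^'a^'a) $ i $ i'" for j j' i i'
    by simp
  then show "v = kronecker (mat 1) h"
    by (auto simp: vec_eq_iff kronecker_def block_def mat_def)
qed

text \<open>
  The matrix \<open>v = w\<^sup>* w'\<close> intertwines \<open>M \<otimes> 1\<close> with \<open>\<alpha> M \<otimes> 1\<close>, hence so does each block \<open>B\<close> of \<open>v\<close>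
  with \<open>M\<close> and \<open>\<alpha> M\<close>. For a nonzero block, \<open>B\<^sup>* B\<close> is central, so \<open>B\<close> is a multiple of a unitary
  matrix, which implements \<open>\<alpha>\<close>.
\<close>

lemma amplification_intertwined_inner:
  fixes w w' :: "complex^('k::finite \<times> 'l::finite)^('k \<times> 'l)"
  assumes w: "w \<in> unitary_matrices" and w': "w' \<in> unitary_matrices"
    and \<alpha>: "\<alpha> \<in> star_homs matrix_algebra matrix_algebra"
    and eq: "\<And>M. amplification w' M = amplification w (\<alpha> M)"
  obtains g where "g \<in> unitary_matrices" "\<alpha> = conjugation g"
proof -
  define v where "v = adjoint_matrix w ** w'"
  have v: "v \<in> unitary_matrices" using w w' by (simp add: v_def unitary_mult unitary_adjoint)
  have intertwine: "v ** kronecker M (mat 1) = kronecker (\<alpha> M) (mat 1) ** v" for M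
  proof -
    have "adjoint_matrix w ** amplification w' M ** w' = adjoint_matrix w ** amplification w (\<alpha> M) ** w'"
      by (simp add: eq)
    then show ?thesis
      using w w' by (simp add: amplification_def conjugation_def matrix_mul_assoc unitary_cancel unitary_left v_def)
  qed
  obtain j j' where nz: "block v j j' \<noteq> 0"
  proof -
    have "v \<noteq> 0"
    proof
      assume "v = 0"
      then have "(mat 1 :: complex^('k \<times> 'l)^('k \<times> 'l)) = 0" using unitary_left[OF v] by simp
      then show False by (simp add: mat_def vec_eq_iff split: if_splits)
    qed
    then obtain i j i' j' where "v $ (i, j) $ (i', j') \<noteq> 0" by (auto simp: vec_eq_iff)
    then have "block v j j' \<noteq> 0" by (auto simp: block_def vec_eq_iff)
    then show thesis by (rule that)
  qed
  define B where "B = block v j j'"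
  have B: "B ** M = \<alpha> M ** B" for M
    by (metis B_def block_kronecker_left block_kronecker_right intertwine)
  define C where "C = adjoint_matrix B ** B"
  have "C ** M = M ** C" for M
  proof -
    have "adjoint_matrix B ** \<alpha> M = adjoint_matrix (\<alpha> (adjoint_matrix M) ** B)"
      using \<alpha> by (simp add: star_homs_matrix_iff adjoint_mult)
    also have "\<dots> = M ** adjoint_matrix B"
      unfolding B[symmetric] by (simp add: adjoint_mult)
    finally show ?thesis
      unfolding C_def by (metis B matrix_mul_assoc)
  qed
  from commutant_matrix[OF this] have C: "C = mat (C $ i $ i)" for i .
  have C_diag: "C $ i $ i = of_real (\<Sum>a\<in>UNIV. (norm (B $ a $ i))\<^sup>2)" for i
    unfolding sum_cnj_mult[symmetric] by (simp add: C_def matrix_matrix_mult_def adjoint_matrix_def)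
  obtain a i where ai: "B $ a $ i \<noteq> 0"
    using nz by (auto simp: B_def vec_eq_iff)
  define c where "c = (\<Sum>a\<in>UNIV. (norm (B $ a $ i))\<^sup>2)"
  have c: "c > 0"
    unfolding c_def by (rule sum_pos2[of _ a]) (use ai in auto)
  have Cc: "C = mat (of_real c)" using C[of i] C_diag[of i] by (simp add: c_def)
  define r where "r = complex_of_real (1 / sqrt c)"
  have r: "cnj r * r * of_real c = 1" "r \<noteq> 0"
    using c by (simp_all add: r_def flip: of_real_mult)
  define g where "g = mat r ** B"
  have g: "g \<in> unitary_matrices"
  proof -
    have "adjoint_matrix g ** g = mat (cnj r) ** mat r ** C"
      unfolding g_def C_def adjoint_mult adjoint_mat by (metis mat_commute matrix_mul_assoc)
    then show ?thesis
      by (simp add: unitary_matrices_def Cc mat_mult_mat r)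
  qed
  have "g ** M = \<alpha> M ** g" for M
    unfolding g_def by (metis B mat_commute matrix_mul_assoc)
  then have \<alpha>g: "\<alpha> M = conjugation g M" for M
    using g by (simp add: conjugation_def unitary_cancel)
  show thesis by (rule that[OF g ext[OF \<alpha>g]])
qed

text \<open>
  As long as fewer than \<open>trace P\<close> vectors have been found, the projection minus the projection
  onto their span has positive trace; any nonzero column of it, normalised, is the next vector.
\<close>

lemma projection_orthonormal_family:
  fixes P :: "complex^'n::finite^'n"
  assumes P: "P ** P = P" "adjoint_matrix P = P"
  shows "real n \<le> Re (trace P) \<Longrightarrow> \<exists>b :: nat \<Rightarrow> complex^'n.
    (\<forall>i<n. P *v b i = b i) \<and> (\<forall>i<n. \<forall>j<n. (\<Sum>x\<in>UNIV. cnj (b i $ x) * b j $ x) = (if i = j then 1 else 0))"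
proof (induction n)
  case (Suc n)
  then obtain b where b: "\<And>i. i < n \<Longrightarrow> P *v b i = b i"
    and on: "\<And>i j. i < n \<Longrightarrow> j < n \<Longrightarrow> (\<Sum>x\<in>UNIV. cnj (b i $ x) * b j $ x) = (if i = j then 1 else 0)"
    by auto
  \<comment> \<open>The projection onto the complement, in the range of \<open>P\<close>, of the vectors found so far.\<close>
  define Q where "Q = P - (\<chi> x y. \<Sum>i<n. b i $ x * cnj (b i $ y))"
  have "trace Q = trace P - (\<Sum>x\<in>UNIV. \<Sum>i<n. b i $ x * cnj (b i $ x))"
    by (simp add: Q_def trace_def sum_subtractf)
  also have "(\<Sum>x\<in>UNIV. \<Sum>i<n. b i $ x * cnj (b i $ x)) = (\<Sum>i<n. \<Sum>x\<in>UNIV. cnj (b i $ x) * b i $ x)"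
    by (subst sum.swap) (simp add: mult.commute)
  also have "\<dots> = of_nat n" using on by simp
  finally have "Re (trace Q) > 0" using Suc.prems by simp
  then have "Q \<noteq> 0" by (auto simp: trace_def)
  then obtain x y where xy: "Q $ x $ y \<noteq> 0" by (auto simp: vec_eq_iff)
  define q where "q = (\<chi> x. Q $ x $ y)"
  have Pb: "(\<Sum>z\<in>UNIV. P $ x $ z * b i $ z) = b i $ x" if "i < n" for i x
    using b[OF that] by (simp add: matrix_vector_mult_def vec_eq_iff)
  have Pq: "P *v q = q"
  proof -
    have "(P *v q) $ x = q $ x" for x
    proof -
      have "(\<Sum>z\<in>UNIV. P $ x $ z * P $ z $ y) = P $ x $ y"
        using arg_cong[OF P(1), of "\<lambda>M. M $ x $ y"] by (simp add: matrix_matrix_mult_def)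
      moreover have "(\<Sum>z\<in>UNIV. P $ x $ z * (\<Sum>i<n. b i $ z * cnj (b i $ y))) = (\<Sum>i<n. b i $ x * cnj (b i $ y))"
        unfolding sum_distrib_left
        by (subst sum.swap) (rule sum.cong, simp, simp add: Pb flip: mult.assoc sum_distrib_right)
      ultimately show ?thesis
        by (simp add: matrix_vector_mult_def q_def Q_def right_diff_distrib sum_subtractf)
    qed
    then show ?thesis by (simp add: vec_eq_iff)
  qed
  have bq: "(\<Sum>x\<in>UNIV. cnj (b i $ x) * q $ x) = 0" if i: "i < n" for i
  proof -
    have "(\<Sum>x\<in>UNIV. cnj (b i $ x) * P $ x $ y) = cnj (\<Sum>x\<in>UNIV. P $ y $ x * b i $ x)"
    proof -
      have "P $ x $ y = cnj (P $ y $ x)" for x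
        using arg_cong[OF P(2), of "\<lambda>M. M $ x $ y"] by (simp add: adjoint_matrix_def)
      then show ?thesis by (simp add: cnj_sum mult.commute)
    qed
    also have "\<dots> = cnj (b i $ y)" by (simp add: Pb i)
    finally have 1: "(\<Sum>x\<in>UNIV. cnj (b i $ x) * P $ x $ y) = cnj (b i $ y)" .
    have "(\<Sum>x\<in>UNIV. cnj (b i $ x) * (\<Sum>j<n. b j $ x * cnj (b j $ y))) = (\<Sum>j<n. (\<Sum>x\<in>UNIV. cnj (b i $ x) * b j $ x) * cnj (b j $ y))"
      unfolding sum_distrib_left sum_distrib_right by (subst sum.swap) (simp add: mult.assoc)
    also have "\<dots> = cnj (b i $ y)"
      using i by (simp add: on if_distribR if_distrib sum.delta' cong: if_cong)
    finally show ?thesis using 1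
      by (simp add: q_def Q_def right_diff_distrib sum_subtractf)
  qed
  define c where "c = (\<Sum>x\<in>UNIV. (norm (q $ x))\<^sup>2)"
  have c: "c > 0"
    unfolding c_def by (rule sum_pos2[of _ x]) (use xy in \<open>auto simp: q_def\<close>)
  define r where "r = complex_of_real (1 / sqrt c)"
  have r: "cnj r * r * of_real c = 1" "cnj r = r"
    using c by (simp_all add: r_def flip: of_real_mult)
  define b' where "b' = b(n := r *s q)"
  have qq: "(\<Sum>x\<in>UNIV. cnj (q $ x) * q $ x) = of_real c"
    by (simp only: c_def sum_cnj_mult)
  have nn: "(\<Sum>x\<in>UNIV. cnj (b' n $ x) * b' n $ x) = 1"
  proof -
    have "(\<Sum>x\<in>UNIV. cnj (b' n $ x) * b' n $ x) = cnj r * r * (\<Sum>x\<in>UNIV. cnj (q $ x) * q $ x)"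
      by (simp add: b'_def sum_distrib_left mult_ac)
    then show ?thesis using qq r by simp
  qed
  have on': "(\<Sum>x\<in>UNIV. cnj (b' i $ x) * b' n $ x) = 0" "(\<Sum>x\<in>UNIV. cnj (b' n $ x) * b' i $ x) = 0" if "i < n" for i
  proof -
    have "(\<Sum>x\<in>UNIV. cnj (b' i $ x) * b' n $ x) = r * (\<Sum>x\<in>UNIV. cnj (b i $ x) * q $ x)"
      using that by (simp add: b'_def sum_distrib_left mult_ac)
    then show z: "(\<Sum>x\<in>UNIV. cnj (b' i $ x) * b' n $ x) = 0" using bq that by simp
    have "(\<Sum>x\<in>UNIV. cnj (b' n $ x) * b' i $ x) = cnj (\<Sum>x\<in>UNIV. cnj (b' i $ x) * b' n $ x)"
      by (simp add: cnj_sum mult.commute)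
    then show "(\<Sum>x\<in>UNIV. cnj (b' n $ x) * b' i $ x) = 0" using z by simp
  qed
  have "(\<Sum>x\<in>UNIV. cnj (b' i $ x) * b' j $ x) = (if i = j then 1 else 0)" if lt: "i < Suc n" "j < Suc n" for i j
  proof -
    consider "i < n" "j < n" | "i = n" "j < n" | "i < n" "j = n" | "i = n" "j = n"
      using lt unfolding less_Suc_eq by blast
    then show ?thesis
    proof cases
      case 1
      then show ?thesis using on by (simp add: b'_def)
    qed (use nn on' in auto)
  qed
  moreover have "P *v b' i = b' i" if "i < Suc n" for i
    using that b Pq by (cases "i = n") (auto simp: b'_def vector_scalar_commute)
  ultimately show ?case by blast
qed auto

text \<open>
  The images of the diagonal matrix units are projections with the same trace, which therefore
  equals l. An orthonormal family of l vectors in the image of one of them, moved around by the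
  images of the other matrix units, gives the columns of \<open>w\<close>.
\<close>

theorem star_hom_amplification:
  fixes \<phi> :: "complex^'k::finite^'k \<Rightarrow> complex^('k \<times> 'l::finite)^('k \<times> 'l)"
  assumes \<phi>: "\<phi> \<in> star_homs matrix_algebra matrix_algebra"
  obtains w where "w \<in> unitary_matrices" "\<phi> = amplification w"
proof -
  have scal: "\<phi> (mat c ** A) = mat c ** \<phi> A" for A c
    using \<phi> unfolding star_homs_matrix_iff by blast
  have mult: "\<phi> A ** \<phi> B = \<phi> (A ** B)" and one: "\<phi> (mat 1) = mat 1"
    and adj: "adjoint_matrix (\<phi> A) = \<phi> (adjoint_matrix A)" for A B
    using \<phi> unfolding star_homs_matrix_iff by simp_all
  have zero: "\<phi> 0 = 0" using star_hom_sum[OF \<phi>, of "\<lambda>_. 0" "{} :: unit set"] by simp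
  define o' :: 'k where "o' = undefined"
  let ?P = "\<phi> (matrix_unit o' o')"
  have tr: "trace (\<phi> (matrix_unit i i)) = trace ?P" for i
  proof -
    have "trace (\<phi> (matrix_unit i i)) = trace (\<phi> (matrix_unit i o') ** \<phi> (matrix_unit o' i))"
      by (simp add: mult matrix_unit_mult)
    also have "\<dots> = trace (\<phi> (matrix_unit o' i) ** \<phi> (matrix_unit i o'))" by (rule trace_mul_sym)
    finally show ?thesis by (simp add: mult matrix_unit_mult)
  qed
  have "of_nat CARD('k \<times> 'l) = trace (mat 1 :: complex^('k \<times> 'l)^('k \<times> 'l))" by (simp add: trace_I)
  also have "\<dots> = trace (\<Sum>i\<in>UNIV. \<phi> (matrix_unit i i))"
    by (simp add: sum_matrix_unit one flip: star_hom_sum[OF \<phi>])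
  also have "\<dots> = (\<Sum>i\<in>UNIV. trace (\<phi> (matrix_unit i i)))"
    by (simp add: trace_def) (rule sum.swap)
  also have "\<dots> = of_nat CARD('k) * trace ?P" 
    using sum.cong[OF refl, of UNIV "\<lambda>i. trace (\<phi> (matrix_unit i i))", OF tr] by simp
  finally have "trace ?P = of_nat CARD('l)" by (simp add: card_prod)
  then have "real CARD('l) \<le> Re (trace ?P)" by simp
  from projection_orthonormal_family[OF _ _ this]
  obtain b where b: "\<And>i. i < CARD('l) \<Longrightarrow> ?P *v b i = b i"
    and on: "\<And>i j. i < CARD('l) \<Longrightarrow> j < CARD('l) \<Longrightarrow> (\<Sum>x\<in>UNIV. cnj (b i $ x) * b j $ x) = (if i = j then 1 else 0)"
    by (auto simp: mult adj matrix_unit_mult adjoint_matrix_unit)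
  obtain e :: "'l \<Rightarrow> nat" where e: "bij_betw e UNIV {0..<CARD('l)}"
    using ex_bij_betw_finite_nat[of "UNIV :: 'l set"] by auto
  have e_lt: "e j < CARD('l)" for j using e by (auto simp: bij_betw_def)
  have e_inj: "e i = e j \<longleftrightarrow> i = j" for i j using e by (auto simp: bij_betw_def inj_def)
  define col where "col = (\<lambda>(i, j). \<phi> (matrix_unit i o') *v b (e j))"
  define w where "w = (\<chi> r c. col c $ r)"
  have w_col: "\<phi> M *v col (i, j) = (\<Sum>i'\<in>UNIV. M $ i' $ i *s col (i', j))" for M i j
  proof -
    have "M ** matrix_unit i o' = (\<Sum>i'\<in>UNIV. mat (M $ i' $ i) ** matrix_unit i' o')"
    proof -
      have "(M ** matrix_unit i o') $ a $ c = (\<Sum>i'\<in>UNIV. mat (M $ i' $ i) ** matrix_unit i' o') $ a $ c" for a c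
        by (cases "c = o'") (simp_all add: mat_mult_component, simp_all add: matrix_unit_def matrix_matrix_mult_def if_distrib if_distribR cong: if_cong)
      then show ?thesis by (simp only: vec_eq_iff) blast
    qed
    then have "\<phi> M ** \<phi> (matrix_unit i o') = (\<Sum>i'\<in>UNIV. mat (M $ i' $ i) ** \<phi> (matrix_unit i' o'))"
      by (simp add: mult star_hom_sum[OF \<phi>] scal)
    moreover have "(\<Sum>i'\<in>UNIV. mat (M $ i' $ i) ** \<phi> (matrix_unit i' o')) *v b (e j) =
        (\<Sum>i'\<in>UNIV. M $ i' $ i *s (\<phi> (matrix_unit i' o') *v b (e j)))"
      by (simp add: vec_eq_iff matrix_vector_mult_def mat_mult_component sum_distrib_left sum_distrib_right mult.assoc)
        (intro allI sum.swap)
    ultimately show ?thesis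
      by (simp add: col_def matrix_vector_mul_assoc)
  qed
  have "adjoint_matrix w ** w = mat 1"
  proof -
    have "(\<Sum>x\<in>UNIV. cnj (col c $ x) * col d $ x) = (if c = d then 1 else 0)" for c d
    proof -
      obtain i j i' j' where cd: "c = (i, j)" "d = (i', j')" by fastforce
      have herm: "(\<Sum>x\<in>UNIV. cnj ((A *v u) $ x) * v $ x) = (\<Sum>x\<in>UNIV. cnj (u $ x) * (adjoint_matrix A *v v) $ x)"
        for A :: "complex^('k \<times> 'l)^('k \<times> 'l)" and u v
        by (simp add: matrix_vector_mult_def adjoint_matrix_def cnj_sum sum_distrib_left sum_distrib_right mult_ac)
          (rule sum.swap)
      have "(\<Sum>x\<in>UNIV. cnj (col c $ x) * col d $ x) =
          (\<Sum>x\<in>UNIV. cnj (b (e j) $ x) * (\<phi> (if i = i' then matrix_unit o' o' else 0) *v b (e j')) $ x)"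
        unfolding cd col_def case_prod_conv herm
        by (simp add: matrix_vector_mul_assoc adj adjoint_matrix_unit mult matrix_unit_mult)
      also have "\<dots> = (if i = i' \<and> j = j' then 1 else 0)"
        using on[OF e_lt e_lt, of j j'] b[OF e_lt, of j'] by (auto simp: zero e_inj)
      finally show ?thesis by (simp add: cd)
    qed
    then show ?thesis
      by (simp add: vec_eq_iff matrix_matrix_mult_def adjoint_matrix_def w_def mat_def)
  qed
  then have w: "w \<in> unitary_matrices" by (simp add: unitary_matrices_def)
  have "\<phi> M ** w = w ** kronecker M (mat 1)" for M
  proof -
    have "(\<phi> M ** w) $ r $ (i, j) = (w ** kronecker M (mat 1)) $ r $ (i, j)" for r i j
    proof -
      have "(\<phi> M ** w) $ r $ (i, j) = (\<phi> M *v col (i, j)) $ r"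
        by (simp add: matrix_matrix_mult_def matrix_vector_mult_def w_def)
      also have "\<dots> = (\<Sum>i'\<in>UNIV. M $ i' $ i * col (i', j) $ r)" by (simp add: w_col)
      also have "\<dots> = (w ** kronecker M (mat 1)) $ r $ (i, j)"
        by (simp add: matrix_matrix_mult_def w_def kronecker_def mat_def sum_UNIV_prod if_distrib if_distribR mult.commute cong: if_cong)
      finally show ?thesis .
    qed
    then show ?thesis by (simp add: vec_eq_iff)
  qed
  then have "\<phi> M = amplification w M" for M
    using w by (metis amplification_def conjugation_def unitary_cancel(4))
  then show thesis using that w by blast
qed

section \<open>A polynomial covariant on matrices of coprime block sizes\<close>

lemma prod_sum_functions:
  fixes f :: "'p::finite \<Rightarrow> 'x::finite \<Rightarrow> 'c::comm_semiring_1"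
  shows "(\<Prod>p\<in>UNIV. \<Sum>x\<in>UNIV. f p x) = (\<Sum>g\<in>UNIV. \<Prod>p\<in>UNIV. f p (g p))"
proof -
  have "(\<Prod>p\<in>UNIV. \<Sum>x\<in>UNIV. f p x) = (\<Sum>g\<in>PiE UNIV (\<lambda>_. UNIV). \<Prod>p\<in>UNIV. f p (g p))"
    by (rule prod_sum_PiE) auto
  also have "PiE UNIV (\<lambda>_. UNIV) = (UNIV :: ('p \<Rightarrow> 'x) set)" by auto
  finally show ?thesis .
qed

text \<open>
  Distributivity, with the choices for all factors merged into a single function on the index set
  that \<open>pos\<close> splits into blocks.
\<close>

lemma prod_sum_blocks:
  fixes G :: "'t \<Rightarrow> ('p::finite \<Rightarrow> 'x::finite) \<Rightarrow> 'c::comm_semiring_1"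
  assumes "finite T" and pos: "bij_betw pos (T \<times> UNIV) I"
  shows "(\<Prod>t\<in>T. \<Sum>f\<in>UNIV. G t f) = (\<Sum>i\<in>PiE I (\<lambda>_. UNIV). \<Prod>t\<in>T. G t (\<lambda>p. i (pos (t, p))))"
proof -
  let ?inv = "inv_into (T \<times> UNIV) pos"
  have inv: "?inv (pos (t, p)) = (t, p)" if "t \<in> T" for t p
    using pos that by (simp add: bij_betw_def)
  have mem: "pos (t, p) \<in> I" if "t \<in> T" for t p
    using pos that by (auto simp: bij_betw_def)
  have inv_mem: "fst (?inv x) \<in> T" "pos (?inv x) = x" if "x \<in> I" for x
    using pos that by (auto simp: bij_betw_def inv_into_into f_inv_into_f dest: inv_into_into[of x pos "T \<times> UNIV"])
  have "(\<Prod>t\<in>T. \<Sum>f\<in>UNIV. G t f) = (\<Sum>F\<in>PiE T (\<lambda>_. UNIV). \<Prod>t\<in>T. G t (F t))"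
    using assms(1) by (intro prod_sum_PiE) auto
  also have "\<dots> = (\<Sum>i\<in>PiE I (\<lambda>_. UNIV). \<Prod>t\<in>T. G t (\<lambda>p. i (pos (t, p))))"
  proof (rule sum.reindex_bij_witness[where
        i = "\<lambda>i. \<lambda>t\<in>T. \<lambda>p. i (pos (t, p))" and j = "\<lambda>F. \<lambda>x\<in>I. F (fst (?inv x)) (snd (?inv x))"])
    fix F assume F: "F \<in> PiE T (\<lambda>_. UNIV :: ('p \<Rightarrow> 'x) set)"
    have *: "(\<lambda>x\<in>I. F (fst (?inv x)) (snd (?inv x))) (pos (t, p)) = F t p" if "t \<in> T" for t p
      using that mem inv by simp
    then show "(\<lambda>t\<in>T. \<lambda>p. (\<lambda>x\<in>I. F (fst (?inv x)) (snd (?inv x))) (pos (t, p))) = F"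
      using F by (auto simp: PiE_def extensional_def fun_eq_iff restrict_def)
    show "(\<Prod>t\<in>T. G t (\<lambda>p. (\<lambda>x\<in>I. F (fst (?inv x)) (snd (?inv x))) (pos (t, p)))) = (\<Prod>t\<in>T. G t (F t))"
      using * by (intro prod.cong) auto
  next
    fix i assume i: "i \<in> PiE I (\<lambda>_. UNIV :: 'x set)"
    show "(\<lambda>x\<in>I. (\<lambda>t\<in>T. \<lambda>p. i (pos (t, p))) (fst (?inv x)) (snd (?inv x))) = i"
      using i inv_mem by (auto simp: fun_eq_iff PiE_def extensional_def restrict_def)
  qed auto
  finally show ?thesis .
qed

lemma det_row_expansion:
  fixes v :: "'n::finite \<Rightarrow> 'x::finite \<Rightarrow> complex^'n"
  shows "det (\<chi> p. \<Sum>x\<in>UNIV. c p x *s v p x) =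
    (\<Sum>f\<in>UNIV. (\<Prod>p\<in>UNIV. c p (f p)) * det (\<chi> p. v p (f p)))"
proof -
  have "det (\<chi> p. \<Sum>x\<in>UNIV. c p x *s v p x) =
      (\<Sum>\<sigma> | \<sigma> permutes UNIV. of_int (sign \<sigma>) * (\<Sum>f\<in>UNIV. \<Prod>p\<in>UNIV. c p (f p) * v p (f p) $ \<sigma> p))"
    by (simp add: det_def prod_sum_functions)
  also have "\<dots> = (\<Sum>f\<in>UNIV. \<Sum>\<sigma> | \<sigma> permutes UNIV. of_int (sign \<sigma>) * (\<Prod>p\<in>UNIV. c p (f p) * v p (f p) $ \<sigma> p))"
    unfolding sum_distrib_left by (rule sum.swap)
  also have "\<dots> = (\<Sum>f\<in>UNIV. (\<Prod>p\<in>UNIV. c p (f p)) * det (\<chi> p. v p (f p)))"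
    by (simp add: det_def prod.distrib sum_distrib_left mult_ac)
  finally show ?thesis .
qed

text \<open>
  The determinant of the l by l matrix whose row \<open>p\<close> is the part of the row \<open>(s p, p)\<close> of \<open>w\<close> in
  the columns with first component \<open>i p\<close>. As a function of \<open>i\<close> it is a tensor on l copies of
  \<open>\<complex>\<^sup>k\<close>; the factors \<open>\<complex>\<^sup>l\<close> are used up by the determinant.
\<close>

definition row_minor :: "complex^('k::finite \<times> 'l::finite)^('k \<times> 'l) \<Rightarrow> ('l \<Rightarrow> 'k) \<Rightarrow> ('l \<Rightarrow> 'k) \<Rightarrow> complex" where
  "row_minor w s i = det (\<chi> p j. w $ (s p, p) $ (i p, j))"

text \<open>
  The determinant is alternating in the \<open>\<complex>\<^sup>l\<close> factors, so \<open>h\<close> contributes \<open>det h\<close>, and it is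
  multilinear in the rows, which is how \<open>g\<close> acts on the tensor.
\<close>

lemma row_minor_kronecker:
  "row_minor (w ** kronecker g h) s i =
     det h * (\<Sum>f\<in>UNIV. (\<Prod>p\<in>UNIV. g $ f p $ i p) * row_minor w s f)"
proof -
  have "(\<chi> p j. (w ** kronecker g h) $ (s p, p) $ (i p, j)) =
      (\<chi> p. \<Sum>x\<in>UNIV. g $ x $ i p *s (\<chi> z. w $ (s p, p) $ (x, z))) ** h"
    by (simp add: vec_eq_iff matrix_matrix_mult_def kronecker_def sum_UNIV_prod sum_distrib_right mult_ac)
      (intro allI, subst sum.swap, simp add: sum_distrib_left mult_ac)
  then show ?thesis
    by (simp add: row_minor_def det_mul det_row_expansion mult.commute)
qed

lemma sum_PiE_insert:
  assumes "n \<notin> A"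
  shows "(\<Sum>i\<in>PiE (insert n A) (\<lambda>_. UNIV :: 'x set). F i) = (\<Sum>x\<in>UNIV. \<Sum>i\<in>PiE A (\<lambda>_. UNIV). F (i(n := x)))"
proof -
  have "(\<Sum>i\<in>PiE (insert n A) (\<lambda>_. UNIV :: 'x set). F i) = (\<Sum>(x, i)\<in>UNIV \<times> PiE A (\<lambda>_. UNIV). F (i(n := x)))"
    unfolding PiE_insert_eq by (subst sum.reindex[OF inj_combinator[OF assms]]) (simp add: case_prod_unfold o_def)
  then show ?thesis by (simp add: sum.cartesian_product)
qed

text \<open>
  The tensor on \<open>n + 1 = k a + 1\<close> copies of \<open>\<complex>\<^sup>k\<close> that applies the determinant to \<open>a\<close> groups of k
  positions, grouped by \<open>pk\<close>, and the m-th coordinate to the remaining position \<open>n\<close>.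
\<close>

definition alternator :: "nat \<Rightarrow> nat \<Rightarrow> (nat \<times> 'k::finite \<Rightarrow> nat) \<Rightarrow> 'k \<Rightarrow> (nat \<Rightarrow> 'k) \<Rightarrow> complex" where
  "alternator a n pk m i = (if i n = m then 1 else 0) *
     (\<Prod>y<a. det (\<chi> q r. if i (pk (y, q)) = r then (1::complex) else 0))"

text \<open>
  Each of the \<open>a\<close> determinants produces a factor \<open>det g\<close>, and the free position transforms like a
  vector.
\<close>

lemma alternator_covariant:
  fixes g :: "complex^'k::finite^'k"
  assumes pk: "bij_betw pk ({..<a} \<times> UNIV) {..<n}"
  shows "(\<Sum>i\<in>PiE {..<Suc n} (\<lambda>_. UNIV). alternator a n pk m i * (\<Prod>x<Suc n. g $ f x $ i x)) =
    det g ^ a * (\<Sum>m'\<in>UNIV. alternator a n pk m' f * g $ m' $ m)"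
proof -
  define G where "G y c = det (\<chi> q r. if c q = r then (1::complex) else 0) * (\<Prod>q\<in>UNIV. g $ f (pk (y, q)) $ c q)"
    for y and c :: "'k \<Rightarrow> 'k"
  have prod_pk: "(\<Prod>x<n. F x) = (\<Prod>y<a. \<Prod>q\<in>UNIV. F (pk (y, q)))" for F :: "nat \<Rightarrow> complex"
    using prod.reindex_bij_betw[OF pk, of F] by (simp add: prod.cartesian_product case_prod_unfold)
  have pk_lt: "pk (y, q) < n" if "y < a" for y q
    using pk that by (auto simp: bij_betw_def)
  have block: "(\<Sum>c\<in>UNIV. G y c) = det g * det (\<chi> q r. if f (pk (y, q)) = r then (1::complex) else 0)" for y
  proof -
    have "(\<Sum>c\<in>UNIV. G y c) = det (\<chi> q. \<Sum>x\<in>UNIV. g $ f (pk (y, q)) $ x *s (\<chi> r. if x = r then 1 else 0))"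
      unfolding det_row_expansion G_def by (simp add: mult.commute)
    also have "(\<chi> q. \<Sum>x\<in>UNIV. g $ f (pk (y, q)) $ x *s (\<chi> r. if x = r then 1 else 0)) =
        (\<chi> q r. if f (pk (y, q)) = r then 1 else 0) ** g"
      by (simp add: vec_eq_iff matrix_matrix_mult_def if_distrib if_distribR cong: if_cong)
    finally show ?thesis by (simp add: det_mul mult.commute)
  qed
  have "(\<Sum>i\<in>PiE {..<Suc n} (\<lambda>_. UNIV). alternator a n pk m i * (\<Prod>x<Suc n. g $ f x $ i x)) =
      (\<Sum>x\<in>UNIV. \<Sum>i\<in>PiE {..<n} (\<lambda>_. UNIV). (if x = m then g $ f n $ x else 0) * (\<Prod>y<a. G y (\<lambda>q. i (pk (y, q)))))"
    unfolding lessThan_Suc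
  proof (subst sum_PiE_insert, simp, intro sum.cong refl)
    fix x i
    have "alternator a n pk m (i(n := x)) = (if x = m then 1 else 0) *
        (\<Prod>y<a. det (\<chi> q r. if i (pk (y, q)) = r then (1::complex) else 0))"
    proof -
      have "(i(n := x)) (pk (y, q)) = i (pk (y, q))" if "y < a" for y q
        using pk_lt[OF that, of q] by auto
      then have "(\<Prod>y<a. det (\<chi> q r. if (i(n := x)) (pk (y, q)) = r then (1::complex) else 0)) =
          (\<Prod>y<a. det (\<chi> q r. if i (pk (y, q)) = r then (1::complex) else 0))"
        by (intro prod.cong refl) simp
      then show ?thesis
        unfolding alternator_def by (simp only: fun_upd_same)
    qed
    moreover have "(\<Prod>x'\<in>insert n {..<n}. g $ f x' $ (i(n := x)) x') = g $ f n $ x * (\<Prod>x'<n. g $ f x' $ i x')"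
      by (subst prod.insert) (auto intro!: prod.cong)
    ultimately show "alternator a n pk m (i(n := x)) * (\<Prod>x'\<in>insert n {..<n}. g $ f x' $ (i(n := x)) x') =
        (if x = m then g $ f n $ x else 0) * (\<Prod>y<a. G y (\<lambda>q. i (pk (y, q))))"
      by (simp add: G_def prod.distrib prod_pk)
  qed
  also have "\<dots> = g $ f n $ m * (\<Sum>i\<in>PiE {..<n} (\<lambda>_. UNIV). \<Prod>y<a. G y (\<lambda>q. i (pk (y, q))))"
    unfolding sum_distrib_left[symmetric] sum_distrib_right[symmetric] by simp
  also have "(\<Sum>i\<in>PiE {..<n} (\<lambda>_. UNIV). \<Prod>y<a. G y (\<lambda>q. i (pk (y, q)))) = (\<Prod>y<a. \<Sum>c\<in>UNIV. G y c)"
    by (rule prod_sum_blocks[OF _ pk, symmetric]) simp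
  also have "\<dots> = det g ^ a * (\<Prod>y<a. det (\<chi> q r. if f (pk (y, q)) = r then (1::complex) else 0))"
    by (simp add: block prod.distrib)
  finally show ?thesis
    by (simp add: prod.distrib alternator_def if_distrib if_distribR mult_ac cong: if_cong)
qed

text \<open>
  Contracts \<open>b\<close> minors, i.e. a tensor on \<open>l b\<close> copies of \<open>\<complex>\<^sup>k\<close> grouped by \<open>pl\<close>, with the
  alternator on \<open>k a + 1\<close> copies; this is possible because the two numbers agree. The row index of
  the result is the first component of the row taken at position \<open>n\<close>; at the other positions it is
  fixed by \<open>pk\<close> in such a way that the identity matrix goes to the identity.
\<close>

definition tensor_covariant ::
    "nat \<Rightarrow> nat \<Rightarrow> nat \<Rightarrow> (nat \<times> 'k::finite \<Rightarrow> nat) \<Rightarrow> (nat \<times> 'l::finite \<Rightarrow> nat)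
      \<Rightarrow> complex^('k \<times> 'l)^('k \<times> 'l) \<Rightarrow> complex^'k^'k" where
  "tensor_covariant a b n pk pl w = (\<chi> m m'. \<Sum>i\<in>PiE {..<Suc n} (\<lambda>_. UNIV). alternator a n pk m' i *
     (\<Prod>t<b. row_minor w (\<lambda>q. if pl (t, q) = n then m else snd (inv_into ({..<a} \<times> UNIV) pk (pl (t, q))))
       (\<lambda>q. i (pl (t, q)))))"

text \<open>
  The \<open>b\<close> minors contribute \<open>det(h)\<^sup>b\<close>, the \<open>a\<close> determinants contribute \<open>det(g)\<^sup>a\<close>, and the free
  position contributes the factor \<open>g\<close> on the right.
\<close>

lemma tensor_covariant_kronecker:
  fixes w :: "complex^('k::finite \<times> 'l::finite)^('k \<times> 'l)"
  assumes pk: "bij_betw pk ({..<a} \<times> UNIV) {..<n}" and pl: "bij_betw pl ({..<b} \<times> UNIV) {..<Suc n}"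
  shows "tensor_covariant a b n pk pl (w ** kronecker g h) =
    mat (det g ^ a * det h ^ b) ** tensor_covariant a b n pk pl w ** g"
proof -
  let ?I = "PiE {..<Suc n} (\<lambda>_. UNIV :: 'k set)"
  define s where "s m t = (\<lambda>q. if pl (t, q) = n then m else snd (inv_into ({..<a} \<times> UNIV) pk (pl (t, q))))"
    for m :: 'k and t and q :: 'l
  have "tensor_covariant a b n pk pl (w ** kronecker g h) $ m $ m' =
      det g ^ a * det h ^ b * (\<Sum>m''\<in>UNIV. tensor_covariant a b n pk pl w $ m $ m'' * g $ m'' $ m')" for m m'
  proof -
    have minors: "(\<Prod>t<b. row_minor (w ** kronecker g h) (s m t) (\<lambda>q. i (pl (t, q)))) =
        det h ^ b * (\<Sum>f\<in>?I. (\<Prod>x<Suc n. g $ f x $ i x) * (\<Prod>t<b. row_minor w (s m t) (\<lambda>q. f (pl (t, q)))))" for i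
    proof -
      have prod_pl: "(\<Prod>x<Suc n. F x) = (\<Prod>t<b. \<Prod>q\<in>UNIV. F (pl (t, q)))" for F :: "nat \<Rightarrow> complex"
        using prod.reindex_bij_betw[OF pl, of F] by (simp add: prod.cartesian_product case_prod_unfold)
      show ?thesis
        unfolding row_minor_kronecker prod.distrib prod_pl
        by (subst prod_sum_blocks[OF _ pl]) (simp_all add: prod.distrib)
    qed
    have "tensor_covariant a b n pk pl (w ** kronecker g h) $ m $ m' =
        det h ^ b * (\<Sum>i\<in>?I. \<Sum>f\<in>?I. (alternator a n pk m' i * (\<Prod>x<Suc n. g $ f x $ i x)) *
          (\<Prod>t<b. row_minor w (s m t) (\<lambda>q. f (pl (t, q)))))"
      by (simp add: tensor_covariant_def s_def[symmetric] minors sum_distrib_left mult_ac del: prod.lessThan_Suc)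
    also have "(\<Sum>i\<in>?I. \<Sum>f\<in>?I. (alternator a n pk m' i * (\<Prod>x<Suc n. g $ f x $ i x)) *
          (\<Prod>t<b. row_minor w (s m t) (\<lambda>q. f (pl (t, q))))) =
        (\<Sum>f\<in>?I. (\<Sum>i\<in>?I. alternator a n pk m' i * (\<Prod>x<Suc n. g $ f x $ i x)) *
          (\<Prod>t<b. row_minor w (s m t) (\<lambda>q. f (pl (t, q)))))"
      unfolding sum_distrib_right by (rule sum.swap)
    also have "\<dots> = (\<Sum>f\<in>?I. \<Sum>m''\<in>UNIV. det g ^ a * (alternator a n pk m'' f *
          (\<Prod>t<b. row_minor w (s m t) (\<lambda>q. f (pl (t, q)))) * g $ m'' $ m'))"
      unfolding alternator_covariant[OF pk] by (simp add: sum_distrib_left sum_distrib_right mult_ac)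
    also have "\<dots> = det g ^ a * (\<Sum>m''\<in>UNIV. tensor_covariant a b n pk pl w $ m $ m'' * g $ m'' $ m')"
      by (subst sum.swap) (simp add: tensor_covariant_def s_def[symmetric] sum_distrib_left sum_distrib_right mult_ac)
    finally show ?thesis by (simp add: mult_ac)
  qed
  then show ?thesis
    unfolding vec_eq_iff matrix_mul_assoc[symmetric] mat_mult_component
    by (simp add: matrix_matrix_mult_def)
qed

text \<open>
  The minors of the identity are Kronecker symbols, so only one summand survives, and its
  determinants are determinants of identity matrices.
\<close>

lemma tensor_covariant_one:
  assumes pk: "bij_betw pk ({..<a} \<times> UNIV) {..<n}" and pl: "bij_betw pl ({..<b} \<times> UNIV) {..<Suc n}"
  shows "tensor_covariant a b n pk (pl :: nat \<times> 'l::finite \<Rightarrow> nat) (mat 1) = (mat 1 :: complex^'k::finite^'k)"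
proof -
  let ?I = "PiE {..<Suc n} (\<lambda>_. UNIV :: 'k set)"
  define s where "s m x = (if x = n then m else snd (inv_into ({..<a} \<times> UNIV) pk x))" for m :: 'k and x
  have minor: "row_minor (mat 1) \<sigma> \<tau> = (if \<sigma> = \<tau> then 1 else 0)" for \<sigma> \<tau> :: "'l \<Rightarrow> 'k"
  proof -
    have "row_minor (mat 1) \<sigma> \<tau> = (\<Prod>q\<in>UNIV. if \<sigma> q = \<tau> q then 1 else 0)"
      unfolding row_minor_def by (subst det_diagonal) (auto simp: mat_def)
    also have "\<dots> = (if \<sigma> = \<tau> then 1 else 0)"
      by (auto simp: fun_eq_iff)
    finally show ?thesis .
  qed
  have "tensor_covariant a b n pk pl (mat 1) $ m $ m' = (mat 1 :: complex^'k^'k) $ m $ m'" for m m'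
  proof -
    have prod_minor: "(\<Prod>t<b. row_minor (mat 1) (\<lambda>q. s m (pl (t, q))) (\<lambda>q. i (pl (t, q)))) =
        (if i = restrict (s m) {..<Suc n} then (1::complex) else 0)" if "i \<in> ?I" for i
    proof -
      have "(\<forall>t<b. (\<lambda>q. s m (pl (t, q))) = (\<lambda>q. i (pl (t, q)))) \<longleftrightarrow> (\<forall>x\<in>pl ` ({..<b} \<times> UNIV). s m x = i x)"
        by (auto simp: fun_eq_iff)
      also have "pl ` ({..<b} \<times> UNIV) = {..<Suc n}" using pl by (simp add: bij_betw_def)
      also have "(\<forall>x\<in>{..<Suc n}. s m x = i x) \<longleftrightarrow> i = restrict (s m) {..<Suc n}"
        using that by (auto simp: PiE_def extensional_def fun_eq_iff restrict_def)
      finally have "(\<forall>t<b. (\<lambda>q. s m (pl (t, q))) = (\<lambda>q. i (pl (t, q)))) \<longleftrightarrow> i = restrict (s m) {..<Suc n}" .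
      then show ?thesis unfolding minor
        by (cases "i = restrict (s m) {..<Suc n}") (auto simp: prod_zero_iff)
    qed
    have "tensor_covariant a b n pk pl (mat 1) $ m $ m' =
        (\<Sum>i\<in>?I. alternator a n pk m' i * (if i = restrict (s m) {..<Suc n} then 1 else 0))"
      unfolding tensor_covariant_def vec_lambda_beta s_def[symmetric]
      by (intro sum.cong refl arg_cong2[where f = "(*)"] prod_minor)
    also have "\<dots> = alternator a n pk m' (restrict (s m) {..<Suc n})"
    proof -
      have "finite ?I" by (intro finite_PiE) auto
      moreover have "restrict (s m) {..<Suc n} \<in> ?I" by simp
      ultimately show ?thesis by (simp add: if_distrib sum.delta cong: if_cong)
    qed
    also have "\<dots> = (if m = m' then 1 else 0)"
    proof -
      have "restrict (s m) {..<Suc n} (pk (y, q)) = q" if "y < a" for y q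
      proof -
        have "pk (y, q) < n" using pk that by (auto simp: bij_betw_def)
        moreover have "inv_into ({..<a} \<times> UNIV) pk (pk (y, q)) = (y, q)"
          using pk that by (simp add: bij_betw_def)
        ultimately show ?thesis by (simp add: s_def)
      qed
      then have "(\<Prod>y<a. det (\<chi> q r. if restrict (s m) {..<Suc n} (pk (y, q)) = r then (1::complex) else 0)) = 1"
        by (intro prod.neutral) (simp flip: mat_def)
      then show ?thesis unfolding alternator_def by (simp add: s_def)
    qed
    finally show ?thesis by (simp add: mat_def)
  qed
  then show ?thesis unfolding vec_eq_iff by blast
qed

lemma continuous_on_det [continuous_intros]:
  fixes f :: "'a::topological_space \<Rightarrow> complex^'n::finite^'n"
  shows "continuous_on S f \<Longrightarrow> continuous_on S (\<lambda>x. det (f x))"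
  unfolding det_def by (intro continuous_intros)

lemma continuous_on_matrix_mult [continuous_intros]:
  fixes f :: "'a::topological_space \<Rightarrow> complex^'n::finite^'m::finite" and g :: "'a \<Rightarrow> complex^'p::finite^'n"
  shows "continuous_on S f \<Longrightarrow> continuous_on S g \<Longrightarrow> continuous_on S (\<lambda>x. f x ** g x)"
  unfolding matrix_matrix_mult_def by (intro continuous_intros)

lemma continuous_on_adjoint [continuous_intros]:
  fixes f :: "'a::topological_space \<Rightarrow> complex^'n::finite^'m::finite"
  shows "continuous_on S f \<Longrightarrow> continuous_on S (\<lambda>x. adjoint_matrix (f x))"
  unfolding adjoint_matrix_def by (intro continuous_intros)

lemma continuous_tensor_covariant: "continuous_on UNIV (tensor_covariant a b n pk pl)"
  unfolding tensor_covariant_def[abs_def] row_minor_def by (intro continuous_intros)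

section \<open>Gram-Schmidt and equivariant frames on the unitary group\<close>

definition hermitian_product :: "complex^'n::finite \<Rightarrow> complex^'n \<Rightarrow> complex" where
  "hermitian_product x y = (\<Sum>i\<in>UNIV. cnj (x $ i) * y $ i)"

definition unit_vector :: "complex^'n::finite \<Rightarrow> complex^'n" where
  "unit_vector y = of_real (1 / norm y) *s y"

fun gram_schmidt :: "(nat \<Rightarrow> complex^'n::finite) \<Rightarrow> nat \<Rightarrow> complex^'n" where
  "gram_schmidt v n = unit_vector (v n - (\<Sum>m\<in>{..<n}. hermitian_product (gram_schmidt v m) (v n) *s gram_schmidt v m))"

declare gram_schmidt.simps [simp del]

lemma hermitian_product_diff: "hermitian_product x (y - z) = hermitian_product x y - hermitian_product x z"
  by (simp add: hermitian_product_def right_diff_distrib sum_subtractf)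

lemma hermitian_product_sum: "hermitian_product x (\<Sum>a\<in>A. f a) = (\<Sum>a\<in>A. hermitian_product x (f a))"
  by (simp add: hermitian_product_def sum_distrib_left) (rule sum.swap)

lemma hermitian_product_scale: "hermitian_product x (c *s y) = c * hermitian_product x y"
  by (simp add: hermitian_product_def sum_distrib_left mult_ac)

lemma hermitian_product_self: "hermitian_product x x = of_real ((norm x)\<^sup>2)"
  unfolding hermitian_product_def sum_cnj_mult by (simp add: norm_vec_def L2_set_def sum_nonneg)

lemma hermitian_product_sym: "hermitian_product y x = cnj (hermitian_product x y)"
  by (simp add: hermitian_product_def cnj_sum mult.commute)

lemma hermitian_product_unitary:
  assumes "u \<in> unitary_matrices"
  shows "hermitian_product (x v* u) (y v* u) = hermitian_product x y"
proof -
  have "hermitian_product (x v* u) (y v* u) = (\<Sum>i\<in>UNIV. \<Sum>a\<in>UNIV. \<Sum>b\<in>UNIV. cnj (x $ a) * y $ b * (u $ b $ i * cnj (u $ a $ i)))"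
    unfolding hermitian_product_def vector_matrix_mult_def vec_lambda_beta cnj_sum sum_product by (simp add: mult_ac)
  also have "\<dots> = (\<Sum>a\<in>UNIV. \<Sum>b\<in>UNIV. cnj (x $ a) * y $ b * (\<Sum>i\<in>UNIV. u $ b $ i * cnj (u $ a $ i)))"
    unfolding sum_distrib_left by (subst sum.swap) (intro sum.cong refl sum.swap)
  also have "\<dots> = (\<Sum>a\<in>UNIV. \<Sum>b\<in>UNIV. cnj (x $ a) * y $ b * (if b = a then 1 else 0))"
  proof -
    have "(\<Sum>i\<in>UNIV. u $ b $ i * cnj (u $ a $ i)) = (if b = a then 1 else 0)" for a b
      using arg_cong[OF unitary_right[OF assms], of "\<lambda>M. M $ b $ a"]
      by (simp add: matrix_matrix_mult_def adjoint_matrix_def mat_def)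
    then show ?thesis by simp
  qed
  also have "\<dots> = hermitian_product x y"
    by (simp add: hermitian_product_def if_distrib cong: if_cong)
  finally show ?thesis .
qed

lemma norm_unitary:
  assumes "u \<in> unitary_matrices"
  shows "norm (x v* u) = norm x"
proof -
  have "complex_of_real ((norm (x v* u))\<^sup>2) = of_real ((norm x)\<^sup>2)"
    using hermitian_product_unitary[OF assms, of x x] by (simp only: hermitian_product_self)
  then show ?thesis by (simp only: of_real_eq_iff power2_eq_iff_nonneg norm_ge_zero)
qed

lemma vector_matrix_linear:
  fixes u :: "complex^'n::finite^'m::finite"
  shows "(x - y) v* u = x v* u - y v* u" "(c *s x) v* u = c *s (x v* u)" "(\<Sum>a\<in>A. f a) v* u = (\<Sum>a\<in>A. f a v* u)"
  by (simp_all add: vector_matrix_mult_def vec_eq_iff sum_subtractf algebra_simps sum_distrib_left sum_distrib_right)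
    (intro allI sum.swap)

lemma unit_vector_unitary:
  "u \<in> unitary_matrices \<Longrightarrow> unit_vector (x v* u) = unit_vector x v* u"
  by (simp add: unit_vector_def vector_matrix_linear norm_unitary)

text \<open>
  Gram-Schmidt only uses scalar products, so it commutes with unitary transformations.
\<close>

lemma gram_schmidt_unitary:
  assumes "u \<in> unitary_matrices"
  shows "gram_schmidt (\<lambda>n. v n v* u) n = gram_schmidt v n v* u"
proof (induction n rule: less_induct)
  case (less n)
  have "(\<Sum>m\<in>{..<n}. hermitian_product (gram_schmidt (\<lambda>n. v n v* u) m) (v n v* u) *s gram_schmidt (\<lambda>n. v n v* u) m) =
      (\<Sum>m\<in>{..<n}. hermitian_product (gram_schmidt v m) (v n) *s gram_schmidt v m) v* u"
    unfolding vector_matrix_linear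
    by (intro sum.cong refl) (simp add: less hermitian_product_unitary[OF assms])
  then show ?case
    by (simp add: gram_schmidt.simps[of _ n] unit_vector_unitary[OF assms] flip: vector_matrix_linear)
qed

lemma gram_schmidt_orthonormal:
  assumes "\<And>n. n < N \<Longrightarrow> gram_schmidt v n \<noteq> 0"
  shows "n < N \<Longrightarrow> m \<le> n \<Longrightarrow> hermitian_product (gram_schmidt v m) (gram_schmidt v n) = (if m = n then 1 else 0)"
proof (induction n arbitrary: m rule: less_induct)
  case (less n)
  define y where "y = v n - (\<Sum>m\<in>{..<n}. hermitian_product (gram_schmidt v m) (v n) *s gram_schmidt v m)"
  have q: "gram_schmidt v n = unit_vector y" by (simp add: gram_schmidt.simps[of v n] y_def)
  have y: "y \<noteq> 0" using assms[OF less.prems(1)] q by (auto simp: unit_vector_def)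
  show ?case
  proof (cases "m = n")
    case True
    have "norm (unit_vector y) = 1"
    proof -
      have "unit_vector y = (1 / norm y) *\<^sub>R y"
        unfolding unit_vector_def vec_eq_iff vector_scaleR_component by (simp add: scaleR_conv_of_real)
      then show ?thesis using y by simp
    qed
    then show ?thesis using True by (simp add: q hermitian_product_self)
  next
    case False
    then have m: "m < n" using less.prems by simp
    have orth: "hermitian_product (gram_schmidt v m) (gram_schmidt v j) = (if j = m then 1 else 0)" if "j < n" for j
    proof (cases "m \<le> j")
      case True
      then show ?thesis using less.IH[of j m] less.prems that by auto
    next
      case False
      then have "hermitian_product (gram_schmidt v j) (gram_schmidt v m) = 0"
        using less.IH[of m j] less.prems m by auto
      then show ?thesis using False hermitian_product_sym[of "gram_schmidt v m" "gram_schmidt v j"] by auto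
    qed
    have "hermitian_product (gram_schmidt v m) y = 0"
      unfolding y_def hermitian_product_diff hermitian_product_sum hermitian_product_scale
      using m by (simp add: orth if_distrib cong: if_cong)
    then show ?thesis using False by (simp add: q unit_vector_def hermitian_product_scale)
  qed
qed

lemma gram_schmidt_span: "gram_schmidt v n \<in> vec.span (v ` {..n})"
proof (induction n rule: less_induct)
  case (less n)
  have "gram_schmidt v m \<in> vec.span (v ` {..n})" if "m < n" for m
    using less[OF that] vec.span_mono[of "v ` {..m}" "v ` {..n}"] that by fastforce
  moreover have "v n \<in> vec.span (v ` {..n})" by (intro vec.span_base) auto
  ultimately show ?case
    unfolding gram_schmidt.simps[of v n] unit_vector_def
    by (intro vec.span_scale vec.span_diff vec.span_sum) auto
qed

text \<open>
  Otherwise some row of \<open>A\<close> would lie in the span of the others.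
\<close>

lemma gram_schmidt_nonzero:
  fixes A :: "complex^'n::finite^'n"
  assumes A: "det A \<noteq> 0" and e: "inj_on e {..n}"
  shows "gram_schmidt (\<lambda>i. A $ e i) n \<noteq> 0"
proof
  let ?v = "\<lambda>i. A $ e i"
  assume "gram_schmidt ?v n = 0"
  then have "?v n = (\<Sum>m\<in>{..<n}. hermitian_product (gram_schmidt ?v m) (?v n) *s gram_schmidt ?v m)"
    by (auto simp: gram_schmidt.simps[of ?v n] unit_vector_def vec_eq_iff)
  moreover have "\<dots> \<in> vec.span (?v ` {..<n})"
  proof (intro vec.span_sum vec.span_scale)
    fix m assume "m \<in> {..<n}"
    then show "gram_schmidt ?v m \<in> vec.span (?v ` {..<n})"
      using gram_schmidt_span[of ?v m] vec.span_mono[of "?v ` {..m}" "?v ` {..<n}"] by fastforce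
  qed
  moreover have sub: "?v ` {..<n} \<subseteq> {row j A |j. j \<noteq> e n}"
  proof clarify
    fix m assume m: "m < n"
    then have "e m \<noteq> e n" using e by (auto simp: inj_on_def)
    moreover have "A $ e m = row (e m) A" by (simp add: row_def vec_eq_iff)
    ultimately show "\<exists>j. A $ e m = row j A \<and> j \<noteq> e n" by blast
  qed
  ultimately have "?v n \<in> vec.span {row j A |j. j \<noteq> e n}"
    using vec.span_mono[OF sub] by auto
  then have "- row (e n) A \<in> vec.span {row j A |j. j \<noteq> e n}"
    by (simp add: row_def vec.span_neg)
  from det_row_span[OF this] have "det A = det (\<chi> k. if k = e n then row (e n) A + - row (e n) A else row k A)" by simp
  also have "\<dots> = 0" by (rule det_zero_row(1)[of "e n"]) (simp add: row_def vec_eq_iff)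
  finally show False using A by simp
qed

lemma continuous_on_hermitian_product [continuous_intros]:
  "continuous_on S f \<Longrightarrow> continuous_on S g \<Longrightarrow> continuous_on S (\<lambda>x. hermitian_product (f x) (g x))"
  unfolding hermitian_product_def by (intro continuous_intros)

lemma continuous_on_vector_scale [continuous_intros]:
  fixes g :: "'a::topological_space \<Rightarrow> complex^'n::finite"
  shows "continuous_on S f \<Longrightarrow> continuous_on S g \<Longrightarrow> continuous_on S (\<lambda>x. f x *s g x)"
  unfolding vector_scalar_mult_def by (intro continuous_intros)

lemma continuous_on_gram_schmidt:
  fixes e :: "nat \<Rightarrow> 'n::finite"
  assumes e: "inj_on e {..<N}"
  shows "n < N \<Longrightarrow> continuous_on {A :: complex^'n^'n. det A \<noteq> 0} (\<lambda>A. gram_schmidt (\<lambda>i. A $ e i) n)"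
proof (induction n rule: less_induct)
  case (less n)
  let ?y = "\<lambda>A. A $ e n - (\<Sum>m\<in>{..<n}. hermitian_product (gram_schmidt (\<lambda>i. A $ e i) m) (A $ e n) *s gram_schmidt (\<lambda>i. A $ e i) m)"
  have y: "continuous_on {A :: complex^'n^'n. det A \<noteq> 0} ?y"
    using less by (intro continuous_intros) auto
  have "?y A \<noteq> 0" if "det A \<noteq> 0" for A
  proof -
    have "inj_on e {..n}" using e less.prems by (auto simp: inj_on_def)
    from gram_schmidt_nonzero[OF that this] show ?thesis
      by (auto simp: gram_schmidt.simps[of _ n] unit_vector_def)
  qed
  then show ?case
    unfolding gram_schmidt.simps[of _ n] unit_vector_def
    by (intro continuous_intros y) auto
qed

text \<open>
  Apply Gram-Schmidt to the rows; right multiplication by a unitary matrix acts on the rows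
  isometrically.
\<close>

theorem unitary_retraction:
  obtains Q :: "complex^'n::finite^'n \<Rightarrow> complex^'n^'n" where
    "continuous_on {A. det A \<noteq> 0} Q" "\<And>A. det A \<noteq> 0 \<Longrightarrow> Q A \<in> unitary_matrices"
    "\<And>A u. u \<in> unitary_matrices \<Longrightarrow> Q (A ** u) = Q A ** u"
proof -
  obtain e :: "nat \<Rightarrow> 'n" where e: "bij_betw e {0..<CARD('n)} UNIV"
    using ex_bij_betw_nat_finite[of "UNIV :: 'n set"] by auto
  define N where "N = CARD('n)"
  have inj: "inj_on e {..<N}" using e by (simp add: bij_betw_def N_def atLeast0LessThan)
  define d where "d = inv_into {0..<N} e"
  have ed: "e (d i) = i" and dN: "d i < N" for i
    using e by (auto simp: d_def N_def bij_betw_def f_inv_into_f inv_into_into intro: inv_into_into[of i e "{0..<CARD('n)}", simplified])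
  have d_inj: "d i = d j \<longleftrightarrow> i = j" for i j using ed by metis
  define Q :: "complex^'n^'n \<Rightarrow> complex^'n^'n" where "Q A = (\<chi> i. gram_schmidt (\<lambda>n. A $ e n) (d i))" for A
  show thesis
  proof
    show "continuous_on {A. det A \<noteq> 0} Q"
      unfolding Q_def by (intro continuous_on_vec_lambda continuous_on_gram_schmidt[OF inj] dN)
    show "Q A \<in> unitary_matrices" if A: "det A \<noteq> 0" for A
    proof (rule unitaryI)
      have nz: "gram_schmidt (\<lambda>n. A $ e n) n \<noteq> 0" if "n < N" for n
        by (rule gram_schmidt_nonzero[OF A]) (use inj that in \<open>auto simp: inj_on_def\<close>)
      have on: "hermitian_product (Q A $ j) (Q A $ i) = (if i = j then 1 else 0)" for i j
      proof (cases "d j \<le> d i")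
        case True
        then show ?thesis using gram_schmidt_orthonormal[OF nz dN True] by (auto simp: Q_def d_inj)
      next
        case False
        then have "hermitian_product (Q A $ i) (Q A $ j) = 0"
          using gram_schmidt_orthonormal[OF nz dN, of "d i" j] by (auto simp: Q_def)
        then show ?thesis using False hermitian_product_sym[of "Q A $ j" "Q A $ i"] by auto
      qed
      have "(Q A ** adjoint_matrix (Q A)) $ i $ j = hermitian_product (Q A $ j) (Q A $ i)" for i j
        by (simp add: matrix_matrix_mult_def adjoint_matrix_def hermitian_product_def mult.commute)
      then show "Q A ** adjoint_matrix (Q A) = mat 1"
        by (simp add: vec_eq_iff on mat_def)
    qed
    show "Q (A ** u) = Q A ** u" if u: "u \<in> unitary_matrices" for A u
    proof -
      have row: "(B ** u) $ i = B $ i v* u" for B :: "complex^'n^'n" and i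
        by (simp add: matrix_matrix_mult_def vector_matrix_mult_def vec_eq_iff mult.commute)
      have "Q (A ** u) $ i = (Q A ** u) $ i" for i
        unfolding row by (simp add: Q_def row gram_schmidt_unitary[OF u])
      then show ?thesis by (simp only: vec_eq_iff) blast
    qed
  qed
qed

lemma compact_unitary_matrices: "compact (unitary_matrices :: (complex^'n::finite^'n) set)"
  unfolding compact_eq_bounded_closed
proof
  have "norm M = L2_set (\<lambda>_. 1) (UNIV :: 'n set)" if "M \<in> unitary_matrices" for M :: "complex^'n^'n"
  proof -
    have "norm (M $ i) = 1" for i
    proof -
      have "complex_of_real ((norm (M $ i))\<^sup>2) = (M ** adjoint_matrix M) $ i $ i"
        unfolding hermitian_product_self[symmetric]
        by (simp add: matrix_matrix_mult_def adjoint_matrix_def hermitian_product_def mult.commute)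
      then have "complex_of_real ((norm (M $ i))\<^sup>2) = 1"
        by (simp add: unitary_right[OF that] mat_def)
      then have "(norm (M $ i))\<^sup>2 = 1" by (simp only: of_real_eq_1_iff)
      then show ?thesis using norm_ge_zero[of "M $ i"] unfolding power2_eq_1_iff by linarith
    qed
    then show ?thesis by (simp add: norm_vec_def)
  qed
  then show "bounded (unitary_matrices :: (complex^'n^'n) set)"
    unfolding bounded_iff by (intro exI[of _ "L2_set (\<lambda>_. 1) (UNIV :: 'n set)"]) auto
  show "closed (unitary_matrices :: (complex^'n^'n) set)"
    unfolding unitary_matrices_def by (intro closed_Collect_eq continuous_intros)
qed

text \<open>
  The covariant \<open>N\<close> is invertible at the identity, so \<open>w \<mapsto> N(v\<^sup>* w)\<close> is invertible near \<open>v\<close>, and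
  finitely many \<open>v\<close> suffice by compactness. Left translation does not disturb the behaviour under
  right multiplication, and neither does Gram-Schmidt.
\<close>

theorem equivariant_frames:
  assumes "coprime CARD('k::finite) CARD('l::finite)"
  obtains a b and u :: "nat \<Rightarrow> complex^('k::finite \<times> 'l::finite)^('k::finite \<times> 'l::finite) \<Rightarrow> real"
    and f :: "nat \<Rightarrow> complex^('k::finite \<times> 'l::finite)^('k::finite \<times> 'l::finite) \<Rightarrow> complex^'k::finite^'k::finite"
  where "CARD('l::finite) * b = CARD('k::finite) * a + 1"
    and "\<And>c. continuous_on UNIV (u c)" and "\<And>c w. 0 \<le> u c w"
    and "\<And>w. w \<in> unitary_matrices \<Longrightarrow> \<exists>c. u c w > 0"
    and "\<And>c. continuous_on {w. u c w > 0} (f c)"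
    and "\<And>c w. u c w > 0 \<Longrightarrow> f c w \<in> unitary_matrices"
    and "\<And>c w g h. g \<in> unitary_matrices \<Longrightarrow> h \<in> unitary_matrices \<Longrightarrow> u c (w ** kronecker g h) = u c w"
    and "\<And>c w g h. g \<in> unitary_matrices \<Longrightarrow> h \<in> unitary_matrices \<Longrightarrow>
      f c (w ** kronecker g h) = mat (det g ^ a * det h ^ b) ** f c w ** g"
proof -
  obtain a b where ab: "CARD('l) * b = CARD('k) * a + 1"
    using bezout_nat[of "CARD('l)" "CARD('k)"] assms by (auto simp: coprime_iff_gcd_eq_1 gcd.commute)
  define n where "n = CARD('k) * a"
  obtain pk :: "nat \<times> 'k \<Rightarrow> nat" where pk: "bij_betw pk ({..<a} \<times> UNIV) {..<n}"
    using finite_same_card_bij[of "{..<a} \<times> (UNIV :: 'k set)" "{..<n}"]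
    by (auto simp: n_def card_cartesian_product mult.commute)
  obtain pl :: "nat \<times> 'l \<Rightarrow> nat" where pl: "bij_betw pl ({..<b} \<times> UNIV) {..<Suc n}"
    using finite_same_card_bij[of "{..<b} \<times> (UNIV :: 'l set)" "{..<Suc n}"] ab
    by (auto simp: n_def card_cartesian_product mult.commute)
  define N where "N = (tensor_covariant a b n pk pl :: complex^('k \<times> 'l)^('k \<times> 'l) \<Rightarrow> complex^'k^'k)"
  have N: "N (w ** kronecker g h) = mat (det g ^ a * det h ^ b) ** N w ** g" for w g h
    unfolding N_def by (rule tensor_covariant_kronecker[OF pk pl])
  have N1: "N (mat 1) = mat 1" unfolding N_def by (rule tensor_covariant_one[OF pk pl])
  have contN: "continuous_on UNIV N" unfolding N_def by (rule continuous_tensor_covariant)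
  obtain Q :: "complex^'k^'k \<Rightarrow> complex^'k^'k" where
    Q: "continuous_on {A. det A \<noteq> 0} Q" "\<And>A. det A \<noteq> 0 \<Longrightarrow> Q A \<in> unitary_matrices"
    "\<And>A u. u \<in> unitary_matrices \<Longrightarrow> Q (A ** u) = Q A ** u"
    by (rule unitary_retraction) blast
  \<comment> \<open>Translates of the covariant, indexed by the point near which they are invertible.\<close>
  define u' where "u' v w = norm (det (N (adjoint_matrix v ** w)))" for v w :: "complex^('k \<times> 'l)^('k \<times> 'l)"
  define f' where "f' v w = Q (N (adjoint_matrix v ** w))" for v w :: "complex^('k \<times> 'l)^('k \<times> 'l)"
  have contN': "continuous_on UNIV (\<lambda>w. N (adjoint_matrix v ** w))" for v :: "complex^('k \<times> 'l)^('k \<times> 'l)"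
    by (intro continuous_on_compose2[OF contN] continuous_on_matrix_mult continuous_on_const continuous_on_id subset_UNIV)
  have cont_u: "continuous_on UNIV (u' v)" for v
    unfolding u'_def by (intro continuous_intros contN')
  have cont_f: "continuous_on {w. u' v w > 0} (f' v)" for v
    unfolding f'_def
    by (rule continuous_on_compose2[OF Q(1)]) (auto simp: u'_def intro: continuous_on_subset[OF contN'])
  have u_pos: "u' w w > 0" if "w \<in> unitary_matrices" for w
    using that by (simp add: u'_def unitary_left N1)
  obtain V where V: "finite V" "V \<subseteq> unitary_matrices" "unitary_matrices \<subseteq> (\<Union>v\<in>V. {w. u' v w > 0})"
  proof -
    have "compact (unitary_matrices :: (complex^('k \<times> 'l)^('k \<times> 'l)) set)"
      by (rule compact_unitary_matrices)
    moreover have "open {w. u' v w > 0}" for v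
      using cont_u by (intro open_Collect_less) (auto intro: continuous_intros)
    moreover have "unitary_matrices \<subseteq> (\<Union>v\<in>unitary_matrices. {w. u' v w > 0})"
      using u_pos by auto
    ultimately show thesis
      using compactE_image[of unitary_matrices unitary_matrices "\<lambda>v. {w. u' v w > 0}"] that by metis
  qed
  have "V \<noteq> {}" using V(3) unitary_one by blast
  then obtain vs :: "nat \<Rightarrow> complex^('k \<times> 'l)^('k \<times> 'l)" where vs: "range vs = V"
    using range_from_nat_into[of V] countable_finite[OF V(1)] by blast
  show thesis
  proof (rule that[of b a "\<lambda>c. u' (vs c)" "\<lambda>c. f' (vs c)"])
    show "\<exists>c. u' (vs c) w > 0" if "w \<in> unitary_matrices" for w
      using V(3) vs that by blast
    fix c and w :: "complex^('k \<times> 'l)^('k \<times> 'l)" and g :: "complex^'k^'k" and h :: "complex^'l^'l"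
    assume gh: "g \<in> unitary_matrices" "h \<in> unitary_matrices"
    let ?\<chi> = "det g ^ a * det h ^ b"
    have \<chi>: "mat ?\<chi> \<in> (unitary_matrices :: (complex^'k^'k) set)"
      using gh by (simp add: unitary_mat norm_mult norm_power norm_det_unitary)
    have N': "N (adjoint_matrix (vs c) ** (w ** kronecker g h)) = mat ?\<chi> ** N (adjoint_matrix (vs c) ** w) ** g"
      by (simp add: matrix_mul_assoc N)
    show "u' (vs c) (w ** kronecker g h) = u' (vs c) w"
      unfolding u'_def N' det_mul norm_mult using gh \<chi> by (simp add: norm_det_unitary)
    have move: "mat ?\<chi> ** X ** g = X ** (mat ?\<chi> ** g)" for X :: "complex^'k^'k"
      by (simp only: matrix_mul_assoc mat_commute[of _ X])
    have "f' (vs c) (w ** kronecker g h) = Q (N (adjoint_matrix (vs c) ** w) ** (mat ?\<chi> ** g))"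
      unfolding f'_def N' move ..
    also have "\<dots> = mat ?\<chi> ** f' (vs c) w ** g"
      unfolding Q(3)[OF unitary_mult[OF \<chi> gh(1)]] f'_def move ..
    finally show "f' (vs c) (w ** kronecker g h) = mat ?\<chi> ** f' (vs c) w ** g" .
  qed (use ab cont_u cont_f in \<open>auto simp: u'_def f'_def intro: Q(2)\<close>)
qed

section \<open>Open maps and open covers\<close>

lemma open_map_prod:
  assumes f: "open_map X X' f" and g: "open_map Y Y' g"
  shows "open_map (prod_topology X Y) (prod_topology X' Y') (\<lambda>(x, y). (f x, g y))"
  unfolding open_map_def
proof (intro allI impI)
  fix W assume W: "openin (prod_topology X Y) W"
  show "openin (prod_topology X' Y') ((\<lambda>(x, y). (f x, g y)) ` W)"
    unfolding openin_prod_topology_alt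
  proof (intro allI impI)
    fix x' y' assume "(x', y') \<in> (\<lambda>(x, y). (f x, g y)) ` W"
    then obtain x y where xy: "(x, y) \<in> W" "x' = f x" "y' = g y" by auto
    have "\<exists>U V. openin X U \<and> openin Y V \<and> x \<in> U \<and> y \<in> V \<and> U \<times> V \<subseteq> W"
      using W xy(1) by (simp only: openin_prod_topology_alt)
    then obtain U V where UV: "openin X U" "openin Y V" "x \<in> U" "y \<in> V" "U \<times> V \<subseteq> W"
      by (elim exE conjE)
    have "f ` U \<times> g ` V \<subseteq> (\<lambda>(x, y). (f x, g y)) ` W"
      using UV(5) by auto
    moreover have "openin X' (f ` U)" "openin Y' (g ` V)"
      using UV f g by (simp_all add: open_map_def)
    ultimately show "\<exists>U V. openin X' U \<and> openin Y' V \<and> x' \<in> U \<and> y' \<in> V \<and> U \<times> V \<subseteq> (\<lambda>(x, y). (f x, g y)) ` W"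
      using UV xy by (intro exI[of _ "f ` U"] exI[of _ "g ` V"]) simp
  qed
qed

lemma open_map_id: "open_map X X (\<lambda>x. x)"
  by (simp add: open_map_def)

lemma continuous_map_prod:
  assumes "continuous_map X X' f" "continuous_map Y Y' g"
  shows "continuous_map (prod_topology X Y) (prod_topology X' Y') (\<lambda>(x, y). (f x, g y))"
  using assms by (simp add: continuous_map_prod_top)

text \<open>
  A jointly surjective family of open maps detects continuity.
\<close>

lemma continuous_map_from_open_cover:
  assumes "\<And>i. i \<in> I \<Longrightarrow> open_map (X i) Y (p i)"
    and "\<And>y. y \<in> topspace Y \<Longrightarrow> \<exists>i\<in>I. y \<in> p i ` topspace (X i)"
    and "\<And>i. i \<in> I \<Longrightarrow> continuous_map (X i) Z (\<lambda>x. f (p i x))"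
  shows "continuous_map Y Z f"
  unfolding continuous_map_def
proof (intro conjI allI impI)
  show "f \<in> topspace Y \<rightarrow> topspace Z"
  proof
    fix y assume "y \<in> topspace Y"
    then obtain i x where "i \<in> I" "x \<in> topspace (X i)" "y = p i x" using assms(2) by blast
    then show "f y \<in> topspace Z"
      using continuous_map_image_subset_topspace[OF assms(3)] by blast
  qed
  fix W assume W: "openin Z W"
  have p_in: "p i x \<in> topspace Y" if "i \<in> I" "x \<in> topspace (X i)" for i x
    using open_map_imp_subset_topspace[OF assms(1)] that by blast
  have "{y \<in> topspace Y. f y \<in> W} = (\<Union>i\<in>I. p i ` {x \<in> topspace (X i). f (p i x) \<in> W})"
    using assms(2) p_in by fastforce
  also have "openin Y \<dots>"
  proof (rule openin_Union)
    fix S assume "S \<in> (\<lambda>i. p i ` {x \<in> topspace (X i). f (p i x) \<in> W}) ` I"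
    then obtain i where i: "i \<in> I" "S = p i ` {x \<in> topspace (X i). f (p i x) \<in> W}" by blast
    show "openin Y S"
      using assms(1)[OF i(1)] openin_continuous_map_preimage[OF assms(3)[OF i(1)] W]
      unfolding i(2) open_map_def by blast
  qed
  finally show "openin Y {y \<in> topspace Y. f y \<in> W}" .
qed

text \<open>
  Dually, a jointly surjective family of continuous maps detects openness.
\<close>

lemma open_map_from_cover:
  assumes "\<And>i. i \<in> I \<Longrightarrow> continuous_map (X i) Y (p i)"
    and "\<And>y. y \<in> topspace Y \<Longrightarrow> \<exists>i\<in>I. y \<in> p i ` topspace (X i)"
    and "\<And>i. i \<in> I \<Longrightarrow> open_map (X i) Z (\<lambda>x. f (p i x))"
  shows "open_map Y Z f"
  unfolding open_map_def
proof (intro allI impI)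
  fix W assume W: "openin Y W"
  have "f ` W = (\<Union>i\<in>I. (\<lambda>x. f (p i x)) ` {x \<in> topspace (X i). p i x \<in> W})"
    using assms(2) openin_subset[OF W] by fastforce
  also have "openin Z \<dots>"
  proof (rule openin_Union)
    fix S assume "S \<in> (\<lambda>i. (\<lambda>x. f (p i x)) ` {x \<in> topspace (X i). p i x \<in> W}) ` I"
    then obtain i where i: "i \<in> I" "S = (\<lambda>x. f (p i x)) ` {x \<in> topspace (X i). p i x \<in> W}" by blast
    show "openin Z S"
      using assms(3)[OF i(1)] openin_continuous_map_preimage[OF assms(1)[OF i(1)] W]
      unfolding i(2) open_map_def by blast
  qed
  finally show "openin Z (f ` W)" .
qed

lemma topology_eq_by_cover:
  assumes "\<And>i. i \<in> I \<Longrightarrow> open_map (X i) Y (p i) \<and> continuous_map (X i) Y (p i)"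
    and "\<And>i. i \<in> I \<Longrightarrow> open_map (X i) Y' (p i) \<and> continuous_map (X i) Y' (p i)"
    and "\<And>y. y \<in> topspace Y \<Longrightarrow> \<exists>i\<in>I. y \<in> p i ` topspace (X i)"
    and "\<And>y. y \<in> topspace Y' \<Longrightarrow> \<exists>i\<in>I. y \<in> p i ` topspace (X i)"
  shows "Y = Y'"
proof -
  have "continuous_map Y Y' (\<lambda>y. y)"
    by (rule continuous_map_from_open_cover[where X = X and p = p and I = I]) (use assms in auto)
  moreover have "continuous_map Y' Y (\<lambda>y. y)"
    by (rule continuous_map_from_open_cover[where X = X and p = p and I = I]) (use assms in auto)
  ultimately have id: "continuous_map Y Y' id" "continuous_map Y' Y id"
    by (simp_all add: id_def)
  then have "topspace Y = topspace Y'"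
    using continuous_map_image_subset_topspace[of Y Y' id] continuous_map_image_subset_topspace[of Y' Y id] by auto
  with id show ?thesis
    by (metis topology_eq topology_finer_continuous_id)
qed

lemma continuous_map_subtopology_inclusion:
  assumes "S \<subseteq> T"
  shows "continuous_map (subtopology X S) (subtopology X T) (\<lambda>x. x)"
proof -
  have "continuous_map (subtopology X S) X (\<lambda>x. x)"
    by (rule continuous_map_from_subtopology) simp
  then show ?thesis using assms by (auto simp: continuous_map_in_subtopology)
qed

section \<open>Frame bundles and associated bundles\<close>

text \<open>
  A locally trivial bundle whose isomorphisms from the model to each fibre form a torsor under the
  topological group \<open>aut\<close>.
\<close>

locale frame_structure =
  fixes isos :: "'s \<Rightarrow> ('m::topological_space \<Rightarrow> 'e) set"
    and E :: "('b, 'e, 's) fibre_bundle"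
    and aut :: "('m \<Rightarrow> 'm) set"
  assumes local_charts: "x \<in> topspace (base E) \<Longrightarrow> \<exists>U h. x \<in> U \<and> chart isos E U h"
    and iso_inj: "x \<in> topspace (base E) \<Longrightarrow> f \<in> isos (fibre E x) \<Longrightarrow> inj f"
    and iso_range: "x \<in> topspace (base E) \<Longrightarrow> f \<in> isos (fibre E x) \<Longrightarrow> f' \<in> isos (fibre E x) \<Longrightarrow> range f = range f'"
    and iso_comp: "x \<in> topspace (base E) \<Longrightarrow> f \<in> isos (fibre E x) \<Longrightarrow> g \<in> aut \<Longrightarrow> f \<circ> g \<in> isos (fibre E x)"
    and iso_trans: "x \<in> topspace (base E) \<Longrightarrow> f \<in> isos (fibre E x) \<Longrightarrow> f' \<in> isos (fibre E x) \<Longrightarrow> inv f' \<circ> f \<in> aut"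
    and aut_bij: "g \<in> aut \<Longrightarrow> bij g"
    and aut_inv: "g \<in> aut \<Longrightarrow> inv g \<in> aut"
    and aut_comp: "g \<in> aut \<Longrightarrow> g' \<in> aut \<Longrightarrow> g \<circ> g' \<in> aut"
    and aut_comp_continuous:
      "continuous_map (prod_topology (top_of_set aut) (top_of_set aut)) (top_of_set aut) (\<lambda>(g, g'). g \<circ> g')"
begin

lemma chart_base: "chart isos E U h \<Longrightarrow> openin (base E) U"
  by (simp add: chart_def)

lemma chart_subset: "chart isos E U h \<Longrightarrow> x \<in> U \<Longrightarrow> x \<in> topspace (base E)"
  using chart_base openin_subset by blast

lemma chart_iso: "chart isos E U h \<Longrightarrow> x \<in> U \<Longrightarrow> h x \<in> isos (fibre E x)"
  by (simp add: chart_def)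

lemma iso_factor:
  assumes "x \<in> topspace (base E)" "f \<in> isos (fibre E x)" "f' \<in> isos (fibre E x)"
  shows "f = f' \<circ> (inv f' \<circ> f)"
proof
  fix v
  have "f v \<in> range f'" using iso_range[OF assms] by blast
  then show "f v = (f' \<circ> (inv f' \<circ> f)) v" by (simp add: f_inv_into_f)
qed

lemma inv_iso_comp:
  assumes "x \<in> topspace (base E)" "f \<in> isos (fibre E x)"
  shows "inv f \<circ> (f \<circ> g) = g"
  using iso_inj[OF assms] by (auto simp: fun_eq_iff)

text \<open>
  Evaluated at a vector of the model, the transition function is the second component of one chart
  followed by the inverse of the other; the topology of \<open>aut\<close> is that of pointwise convergence.
\<close>

lemma transition_continuous:
  assumes c: "chart isos E U h" and c': "chart isos E U' h'"
  shows "continuous_map (subtopology (base E) (U \<inter> U')) (top_of_set aut) (\<lambda>x. inv (h' x) \<circ> h x)"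
proof -
  have in_aut: "inv (h' x) \<circ> h x \<in> aut" if "x \<in> U \<inter> U'" for x
    using that chart_iso[OF c] chart_iso[OF c'] chart_subset[OF c] by (intro iso_trans[of x]) auto
  have "continuous_map (subtopology (base E) (U \<inter> U')) euclidean (\<lambda>x. inv (h' x) (h x v))" for v
  proof -
    have hom: "homeomorphic_map (prod_topology (subtopology (base E) U) euclidean)
       (subtopology (total_space E) (U \<times> UNIV)) (\<lambda>(x, v). (x, h x v))"
      and hom': "homeomorphic_map (prod_topology (subtopology (base E) U') euclidean)
       (subtopology (total_space E) (U' \<times> UNIV)) (\<lambda>(x, v). (x, h' x v))"
      using c c' by (auto simp: chart_def)
    obtain k where k: "homeomorphic_maps (prod_topology (subtopology (base E) U') euclidean)
       (subtopology (total_space E) (U' \<times> UNIV)) (\<lambda>(x, v). (x, h' x v)) k"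
      using hom' homeomorphic_map_maps by blast
    have "continuous_map (subtopology (base E) (U \<inter> U')) (prod_topology (subtopology (base E) U) euclidean) (\<lambda>x. (x, v))"
      by (intro continuous_map_pairedI continuous_map_subtopology_inclusion) simp_all
    from continuous_map_compose_lambda[OF this homeomorphic_imp_continuous_map[OF hom]]
    have "continuous_map (subtopology (base E) (U \<inter> U')) (total_space E) (\<lambda>x. (x, h x v))"
      by (simp add: continuous_map_in_subtopology)
    then have "continuous_map (subtopology (base E) (U \<inter> U')) (subtopology (total_space E) (U' \<times> UNIV)) (\<lambda>x. (x, h x v))"
      by (auto simp: continuous_map_in_subtopology)
    from continuous_map_compose[OF this, of _ k] k
    have "continuous_map (subtopology (base E) (U \<inter> U')) (prod_topology (subtopology (base E) U') euclidean) (\<lambda>x. k (x, h x v))"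
      by (simp add: o_def homeomorphic_maps_def)
    from continuous_map_compose[OF this continuous_map_snd]
    have *: "continuous_map (subtopology (base E) (U \<inter> U')) euclidean (\<lambda>x. snd (k (x, h x v)))"
      by (simp add: o_def)
    show ?thesis
    proof (rule continuous_map_eq[OF *])
      fix x assume "x \<in> topspace (subtopology (base E) (U \<inter> U'))"
      then have x: "x \<in> topspace (base E)" "x \<in> U" "x \<in> U'" by auto
      have "h x v = h' x (inv (h' x) (h x v))"
        using fun_cong[OF iso_factor[OF x(1) chart_iso[OF c x(2)] chart_iso[OF c' x(3)]], of v] by simp
      moreover have "k (x, h' x v') = (x, v')" for v'
        using k x by (auto simp: homeomorphic_maps_def)
      ultimately show "snd (k (x, h x v)) = inv (h' x) (h x v)"
        by (metis snd_conv)
    qed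
  qed
  then have "continuous_map (subtopology (base E) (U \<inter> U')) (product_topology (\<lambda>_. euclidean) UNIV) (\<lambda>x. inv (h' x) \<circ> h x)"
    unfolding continuous_map_componentwise_UNIV by simp
  then show ?thesis
    using in_aut by (auto simp: euclidean_product_topology continuous_map_in_subtopology)
qed

end

text \<open>
  The bundle with model fibre \<open>F\<close> and fibres \<open>G x\<close> obtained from the frames by an action of \<open>aut\<close>
  on \<open>F\<close>; a frame \<open>f\<close> at \<open>x\<close> identifies the model with the fibre by \<open>tr x f\<close>.
\<close>

locale associated_bundle = frame_structure isos E aut
  for isos :: "'s \<Rightarrow> ('m::topological_space \<Rightarrow> 'e) set"
    and E :: "('b, 'e, 's) fibre_bundle" and aut +
  fixes F :: "'p topology" and G :: "'b \<Rightarrow> 'q set"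
    and act :: "('m \<Rightarrow> 'm) \<Rightarrow> 'p \<Rightarrow> 'p" and tr :: "'b \<Rightarrow> ('m \<Rightarrow> 'e) \<Rightarrow> 'p \<Rightarrow> 'q"
  assumes act_continuous: "continuous_map (prod_topology (top_of_set aut) F) F (\<lambda>(g, t). act g t)"
    and act_inv: "g \<in> aut \<Longrightarrow> t \<in> topspace F \<Longrightarrow> act g (act (inv g) t) = t"
    and tr_act: "x \<in> topspace (base E) \<Longrightarrow> f \<in> isos (fibre E x) \<Longrightarrow> g \<in> aut \<Longrightarrow> t \<in> topspace F \<Longrightarrow>
      tr x (f \<circ> g) t = tr x f (act g t)"
    and tr_bij: "x \<in> topspace (base E) \<Longrightarrow> f \<in> isos (fibre E x) \<Longrightarrow> bij_betw (tr x f) (topspace F) (G x)"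
begin

definition total :: "('b \<times> 'q) topology" where
  "total = fibrewise_topology isos E F G tr"

definition chart_map :: "('b \<Rightarrow> 'm \<Rightarrow> 'e) \<Rightarrow> 'b \<times> 'p \<Rightarrow> 'b \<times> 'q" where
  "chart_map h = (\<lambda>(x, t). (x, tr x (h x) t))"

lemma openin_total:
  "openin total W \<longleftrightarrow> W \<subseteq> (SIGMA x:topspace (base E). G x) \<and>
    (\<forall>U h. chart isos E U h \<longrightarrow> openin (prod_topology (subtopology (base E) U) F)
      {p \<in> topspace (prod_topology (subtopology (base E) U) F). chart_map h p \<in> W})"
  unfolding total_def fibrewise_topology_def openin_final_topology chart_map_def by fastforce

lemma tr_in:
  "x \<in> topspace (base E) \<Longrightarrow> f \<in> isos (fibre E x) \<Longrightarrow> t \<in> topspace F \<Longrightarrow> tr x f t \<in> G x"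
  using tr_bij by (auto simp: bij_betw_def)

lemma tr_inj:
  "x \<in> topspace (base E) \<Longrightarrow> f \<in> isos (fibre E x) \<Longrightarrow> t \<in> topspace F \<Longrightarrow> t' \<in> topspace F \<Longrightarrow>
    tr x f t = tr x f t' \<Longrightarrow> t = t'"
  using tr_bij[of x f] by (auto simp: bij_betw_def inj_on_def)

lemma topspace_total: "topspace total = (SIGMA x:topspace (base E). G x)"
  unfolding total_def fibrewise_topology_def
proof (rule topspace_final_topology)
  fix X and f :: "'b \<times> 'p \<Rightarrow> 'b \<times> 'q"
  assume "(X, f) \<in> {(prod_topology (subtopology (base E) U) F, \<lambda>(x, t). (x, tr x (h x) t)) | U h. chart isos E U h}"
  then obtain U h where *: "chart isos E U h" "X = prod_topology (subtopology (base E) U) F" "f = (\<lambda>(x, t). (x, tr x (h x) t))"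
    by blast
  then show "f ` topspace X \<subseteq> (SIGMA x:topspace (base E). G x)"
    using tr_in chart_iso by fastforce
qed

lemma chart_map_continuous:
  assumes "chart isos E U h"
  shows "continuous_map (prod_topology (subtopology (base E) U) F) total (chart_map h)"
  unfolding continuous_map_def
proof (intro conjI allI impI)
  show "chart_map h \<in> topspace (prod_topology (subtopology (base E) U) F) \<rightarrow> topspace total"
    using chart_iso[OF assms] tr_in by (auto simp: topspace_total chart_map_def)
qed (use assms openin_total in blast)

lemma act_in: "g \<in> aut \<Longrightarrow> t \<in> topspace F \<Longrightarrow> act g t \<in> topspace F"
  using continuous_map_image_subset_topspace[OF act_continuous] by auto

text \<open>
  The total space has the final topology for all charts together. An open set of one chart is open
  in it because in any other chart it becomes the preimage of that set under a transition map,
  which is continuous.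
\<close>

lemma chart_map_open:
  assumes c: "chart isos E U h"
  shows "open_map (prod_topology (subtopology (base E) U) F) total (chart_map h)"
  unfolding open_map_def
proof (intro allI impI)
  fix W assume W: "openin (prod_topology (subtopology (base E) U) F) W"
  have W_sub: "W \<subseteq> (topspace (base E) \<inter> U) \<times> topspace F" using openin_subset[OF W] by simp
  show "openin total (chart_map h ` W)"
    unfolding openin_total
  proof (intro conjI allI impI)
    show "chart_map h ` W \<subseteq> (SIGMA x:topspace (base E). G x)"
      using W_sub chart_iso[OF c] tr_in by (fastforce simp: chart_map_def)
    fix U' h' assume c': "chart isos E U' h'"
    let ?B = "prod_topology (subtopology (base E) (U \<inter> U')) F"
    let ?\<tau> = "\<lambda>(x, t). (x, act (inv (h x) \<circ> h' x) t)"
    have "continuous_map ?B (prod_topology (subtopology (base E) U) F) ?\<tau>"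
    proof -
      have "continuous_map ?B (top_of_set aut) (\<lambda>p. inv (h (fst p)) \<circ> h' (fst p))"
        using continuous_map_compose[OF continuous_map_fst transition_continuous[OF c' c]]
        by (simp add: o_def Int_commute)
      then have "continuous_map ?B (prod_topology (top_of_set aut) F) (\<lambda>p. (inv (h (fst p)) \<circ> h' (fst p), snd p))"
        by (intro continuous_map_pairedI continuous_map_snd)
      from continuous_map_compose[OF this act_continuous]
      have 1: "continuous_map ?B F (\<lambda>p. act (inv (h (fst p)) \<circ> h' (fst p)) (snd p))"
        by (simp add: o_def)
      have "continuous_map ?B (subtopology (base E) (U \<inter> U')) (\<lambda>p. fst p)"
        by (rule continuous_map_fst)
      then have "continuous_map ?B (subtopology (base E) U) (\<lambda>p. fst p)"
        by (auto simp: continuous_map_in_subtopology)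
      then show ?thesis
        using 1 by (simp add: case_prod_unfold continuous_map_pairedI)
    qed
    then have o1: "openin ?B {p \<in> topspace ?B. ?\<tau> p \<in> W}"
      using W by (rule openin_continuous_map_preimage)
    have o2: "openin (prod_topology (subtopology (base E) U') F) ((U \<inter> U') \<times> topspace F)"
    proof -
      have "openin (subtopology (base E) U') (U \<inter> U')"
        using chart_base[OF c] by (auto simp: openin_subtopology)
      then show ?thesis by (simp add: openin_prod_Times_iff)
    qed
    have B: "?B = subtopology (prod_topology (subtopology (base E) U') F) ((U \<inter> U') \<times> topspace F)"
      by (simp add: subtopology_Times subtopology_subtopology Int_absorb1)
    have "openin (prod_topology (subtopology (base E) U') F) {p \<in> topspace ?B. ?\<tau> p \<in> W}"
      by (rule openin_trans_full[OF _ o2]) (use o1 in \<open>simp only: B[symmetric]\<close>)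
    moreover have "{p \<in> topspace (prod_topology (subtopology (base E) U') F). chart_map h' p \<in> chart_map h ` W} =
        {p \<in> topspace ?B. ?\<tau> p \<in> W}"
    proof -
      have key: "chart_map h' (x, t) = chart_map h (?\<tau> (x, t))" "act (inv (h x) \<circ> h' x) t \<in> topspace F"
        if "x \<in> U" "x \<in> U'" "t \<in> topspace F" for x t
      proof -
        note x = chart_subset[OF c that(1)] chart_iso[OF c that(1)] chart_iso[OF c' that(2)]
        have a: "inv (h x) \<circ> h' x \<in> aut" using x iso_trans by blast
        show "act (inv (h x) \<circ> h' x) t \<in> topspace F" using act_in[OF a that(3)] .
        show "chart_map h' (x, t) = chart_map h (?\<tau> (x, t))"
          using tr_act[OF x(1,2) a that(3)] iso_factor[OF x(1) x(3) x(2)] by (simp add: chart_map_def)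
      qed
      show ?thesis
      proof (intro set_eqI iffI)
        fix p assume p: "p \<in> {p \<in> topspace (prod_topology (subtopology (base E) U') F). chart_map h' p \<in> chart_map h ` W}"
        obtain x t where xt: "p = (x, t)" by fastforce
        from p xt obtain s where s: "(x, s) \<in> W" "tr x (h' x) t = tr x (h x) s"
          by (auto simp: chart_map_def)
        have x: "x \<in> U" "x \<in> U'" "x \<in> topspace (base E)" "t \<in> topspace F" "s \<in> topspace F"
          using s W_sub p xt by auto
        have "tr x (h x) s = tr x (h x) (act (inv (h x) \<circ> h' x) t)"
          using key(1)[OF x(1,2,4)] s(2) by (simp add: chart_map_def)
        then have "s = act (inv (h x) \<circ> h' x) t"
          using tr_inj[OF x(3) chart_iso[OF c x(1)] x(5) key(2)[OF x(1,2,4)]] by blast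
        then show "p \<in> {p \<in> topspace ?B. ?\<tau> p \<in> W}"
          using s x xt by simp
      next
        fix p assume "p \<in> {p \<in> topspace ?B. ?\<tau> p \<in> W}"
        then show "p \<in> {p \<in> topspace (prod_topology (subtopology (base E) U') F). chart_map h' p \<in> chart_map h ` W}"
          using key(1) by (cases p) auto
      qed
    qed
    ultimately show "openin (prod_topology (subtopology (base E) U') F)
        {p \<in> topspace (prod_topology (subtopology (base E) U') F). chart_map h' p \<in> chart_map h ` W}" by simp
  qed
qed

lemma chart_map_image:
  assumes "chart isos E U h"
  shows "chart_map h ` topspace (prod_topology (subtopology (base E) U) F) = topspace total \<inter> U \<times> UNIV"
proof -
  have "tr x (h x) ` topspace F = G x" if "x \<in> U" for x
    using tr_bij[OF chart_subset[OF assms that] chart_iso[OF assms that]] by (simp add: bij_betw_def)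
  then show ?thesis
    by (fastforce simp: chart_map_def topspace_total image_iff)
qed

lemma chart_map_cover:
  assumes "p \<in> topspace total"
  shows "\<exists>(U, h)\<in>{(U, h). chart isos E U h}. p \<in> chart_map h ` topspace (prod_topology (subtopology (base E) U) F)"
proof -
  have "fst p \<in> topspace (base E)" using assms by (auto simp: topspace_total)
  then obtain U h where "fst p \<in> U" "chart isos E U h"
    using local_charts by blast
  then have "p \<in> chart_map h ` topspace (prod_topology (subtopology (base E) U) F)"
    using chart_map_image[of U h] assms by (cases p) auto
  then show ?thesis using \<open>chart isos E U h\<close> by blast
qed

lemma chart_map_homeomorphic:
  assumes c: "chart isos E U h"
  shows "homeomorphic_map (prod_topology (subtopology (base E) U) F) (subtopology total (U \<times> UNIV)) (chart_map h)"
proof (rule bijective_open_imp_homeomorphic_map)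
  show "continuous_map (prod_topology (subtopology (base E) U) F) (subtopology total (U \<times> UNIV)) (chart_map h)"
    using chart_map_continuous[OF c] chart_map_image[OF c] by (auto simp: continuous_map_in_subtopology)
  show "open_map (prod_topology (subtopology (base E) U) F) (subtopology total (U \<times> UNIV)) (chart_map h)"
    by (rule open_map_into_subtopology[OF chart_map_open[OF c]]) (use chart_map_image[OF c] in auto)
  show "chart_map h ` topspace (prod_topology (subtopology (base E) U) F) = topspace (subtopology total (U \<times> UNIV))"
    using chart_map_image[OF c] by simp
  show "inj_on (chart_map h) (topspace (prod_topology (subtopology (base E) U) F))"
  proof (rule inj_onI)
    fix p p' assume p: "p \<in> topspace (prod_topology (subtopology (base E) U) F)"
      "p' \<in> topspace (prod_topology (subtopology (base E) U) F)" "chart_map h p = chart_map h p'"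
    then show "p = p'"
      using tr_inj[of "fst p" "h (fst p)" "snd p" "snd p'"] chart_iso[OF c]
      by (cases p; cases p') (simp add: chart_map_def)
  qed
qed

lemma continuous_map_total_fst: "continuous_map total (base E) fst"
proof (rule continuous_map_from_open_cover[where I = "{(U, h). chart isos E U h}" and p = "\<lambda>(U, h). chart_map h"
      and X = "\<lambda>(U, h). prod_topology (subtopology (base E) U) F"])
  fix i assume "i \<in> {(U, h). chart isos E U h}"
  then obtain U h where i: "i = (U, h)" "chart isos E U h" by auto
  have "continuous_map (prod_topology (subtopology (base E) U) F) (base E) fst"
    using continuous_map_fst continuous_map_into_fulltopology by blast
  then show "continuous_map (case i of (U, h) \<Rightarrow> prod_topology (subtopology (base E) U) F) (base E)
      (\<lambda>x. fst ((case i of (U, h) \<Rightarrow> chart_map h) x))"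
    by (simp add: i chart_map_def case_prod_unfold)
  show "open_map (case i of (U, h) \<Rightarrow> prod_topology (subtopology (base E) U) F) total (case i of (U, h) \<Rightarrow> chart_map h)"
    using i chart_map_open by simp
qed (use chart_map_cover in fastforce)

end

context frame_structure
begin

sublocale frames: associated_bundle isos E aut "top_of_set aut" "\<lambda>x. isos (fibre E x)" "(\<circ>)" "\<lambda>x f g. f \<circ> g"
proof
  show "continuous_map (prod_topology (top_of_set aut) (top_of_set aut)) (top_of_set aut) (\<lambda>(g, t). g \<circ> t)"
    by (rule aut_comp_continuous)
  show "g \<circ> (inv g \<circ> t) = t" if "g \<in> aut" for g t
    using aut_bij[OF that] by (simp add: fun_eq_iff bij_is_surj surj_f_inv_f)
  show "bij_betw ((\<circ>) f) (topspace (top_of_set aut)) (isos (fibre E x))"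
    if x: "x \<in> topspace (base E)" "f \<in> isos (fibre E x)" for x f
  proof (rule bij_betw_byWitness[where f' = "\<lambda>f'. inv f \<circ> f'"])
    show "\<forall>a\<in>topspace (top_of_set aut). inv f \<circ> (f \<circ> a) = a"
      using inv_iso_comp[OF x] by blast
    show "\<forall>f'\<in>isos (fibre E x). f \<circ> (inv f \<circ> f') = f'"
      using iso_factor[OF x(1) _ x(2)] by metis
    show "(\<circ>) f ` topspace (top_of_set aut) \<subseteq> isos (fibre E x)"
      using iso_comp[OF x] by auto
    show "(\<circ>) (inv f) ` isos (fibre E x) \<subseteq> topspace (top_of_set aut)"
      using iso_trans[OF x(1) _ x(2)] by auto
  qed
qed (simp_all add: o_assoc)

lemma total_space_frame_bundle: "total_space (frame_bundle aut isos E) = frames.total"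
  by (simp add: frame_bundle_def frames.total_def)

lemma frames_topspace: "(x, f) \<in> topspace frames.total \<longleftrightarrow> x \<in> topspace (base E) \<and> f \<in> isos (fibre E x)"
  by (auto simp: frames.topspace_total)

lemma chart_frame_coordinate:
  assumes c: "chart isos E U h"
  shows "continuous_map (subtopology frames.total (U \<times> UNIV)) (top_of_set aut) (\<lambda>e. inv (h (fst e)) \<circ> snd e)"
proof (rule continuous_compose_quotient_map)
  let ?X = "prod_topology (subtopology (base E) U) (top_of_set aut)"
  show "quotient_map ?X (subtopology frames.total (U \<times> UNIV)) (frames.chart_map h)"
    using frames.chart_map_homeomorphic[OF c] by (simp add: homeomorphic_map_def)
  have "continuous_map ?X (top_of_set aut) snd" by (rule continuous_map_snd)
  then show "continuous_map ?X (top_of_set aut) ((\<lambda>e. inv (h (fst e)) \<circ> snd e) \<circ> frames.chart_map h)"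
  proof (rule continuous_map_eq)
    fix p assume "p \<in> topspace ?X"
    then have "fst p \<in> U" by auto
    then have "inv (h (fst p)) \<circ> (h (fst p) \<circ> snd p) = snd p"
      using inv_iso_comp[OF chart_subset[OF c] chart_iso[OF c]] by blast
    then show "snd p = ((\<lambda>e. inv (h (fst e)) \<circ> snd e) \<circ> frames.chart_map h) p"
      by (simp add: frames.chart_map_def case_prod_unfold)
  qed
qed

end

context associated_bundle
begin

text \<open>
  Presents the associated bundle as a quotient of frames times model fibre.
\<close>

definition quot :: "('b \<times> ('m \<Rightarrow> 'e)) \<times> 'p \<Rightarrow> 'b \<times> 'q" where
  "quot = (\<lambda>((x, f), t). (x, tr x f t))"

lemma quot_chart:
  assumes "chart isos E U h" "x \<in> U" "g \<in> aut" "t \<in> topspace F"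
  shows "quot (frames.chart_map h (x, g), t) = chart_map h (x, act g t)"
  using tr_act[OF chart_subset[OF assms(1,2)] chart_iso[OF assms(1,2)] assms(3,4)]
  by (simp add: quot_def frames.chart_map_def chart_map_def)

lemma act_map_continuous:
  "continuous_map (prod_topology (prod_topology B (top_of_set aut)) F) (prod_topology B F) (\<lambda>((x, g), t). (x, act g t))"
proof -
  let ?X = "prod_topology (prod_topology B (top_of_set aut)) F"
  have f: "continuous_map ?X (prod_topology B (top_of_set aut)) fst" by (rule continuous_map_fst)
  have "continuous_map ?X (top_of_set aut) (\<lambda>p. snd (fst p))"
    using continuous_map_compose[OF f continuous_map_snd] by (simp add: o_def)
  then have "continuous_map ?X (prod_topology (top_of_set aut) F) (\<lambda>p. (snd (fst p), snd p))"
    by (intro continuous_map_pairedI continuous_map_snd)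
  from continuous_map_compose[OF this act_continuous]
  have "continuous_map ?X F (\<lambda>p. act (snd (fst p)) (snd p))" by (simp add: o_def)
  moreover have "continuous_map ?X B (\<lambda>p. fst (fst p))"
    using continuous_map_compose[OF f continuous_map_fst] by (simp add: o_def)
  ultimately show ?thesis by (simp add: case_prod_unfold continuous_map_pairedI)
qed

lemma act_inv': "g \<in> aut \<Longrightarrow> t \<in> topspace F \<Longrightarrow> act (inv g) (act g t) = t"
  using act_inv[of "inv g" t] aut_inv[of g] aut_bij[of g] by (simp add: inv_inv_eq)

text \<open>
  The image of an open set is the union, over all \<open>g\<close>, of preimages of it under the sections
  \<open>t \<mapsto> (g, g\<inverse> t)\<close>.
\<close>

lemma act_map_open:
  "open_map (prod_topology (prod_topology B (top_of_set aut)) F) (prod_topology B F) (\<lambda>((x, g), t). (x, act g t))"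
  unfolding open_map_def
proof (intro allI impI)
  let ?X = "prod_topology (prod_topology B (top_of_set aut)) F"
  fix W assume W: "openin ?X W"
  let ?s = "\<lambda>g p. ((fst p, g), act (inv g) (snd p))"
  have "(\<lambda>((x, g), t). (x, act g t)) ` W = (\<Union>g\<in>aut. {p \<in> topspace (prod_topology B F). ?s g p \<in> W})"
  proof (intro set_eqI iffI)
    fix p assume "p \<in> (\<lambda>((x, g), t). (x, act g t)) ` W"
    then obtain x g t where p: "p = (x, act g t)" "((x, g), t) \<in> W" by auto
    then have "x \<in> topspace B" "g \<in> aut" "t \<in> topspace F"
      using openin_subset[OF W] by auto
    then show "p \<in> (\<Union>g\<in>aut. {p \<in> topspace (prod_topology B F). ?s g p \<in> W})"
      using p act_in act_inv' by (intro UN_I[of g]) simp_all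
  next
    fix p assume "p \<in> (\<Union>g\<in>aut. {p \<in> topspace (prod_topology B F). ?s g p \<in> W})"
    then obtain g where g: "g \<in> aut" "p \<in> topspace (prod_topology B F)" "?s g p \<in> W" by blast
    then have "p = (fst p, act g (act (inv g) (snd p)))"
      using act_inv by (cases p) auto
    then show "p \<in> (\<lambda>((x, g), t). (x, act g t)) ` W"
      using g(3) by (intro image_eqI[of _ _ "?s g p"]) auto
  qed
  also have "openin (prod_topology B F) \<dots>"
  proof (rule openin_Union)
    fix S assume "S \<in> (\<lambda>g. {p \<in> topspace (prod_topology B F). ?s g p \<in> W}) ` aut"
    then obtain g where g: "g \<in> aut" "S = {p \<in> topspace (prod_topology B F). ?s g p \<in> W}" by blast
    have "continuous_map (prod_topology B F) (prod_topology (top_of_set aut) F) (\<lambda>p. (inv g, snd p))"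
      using aut_inv[OF g(1)] by (intro continuous_map_pairedI continuous_map_snd) simp
    from continuous_map_compose[OF this act_continuous]
    have "continuous_map (prod_topology B F) F (\<lambda>p. act (inv g) (snd p))" by (simp add: o_def)
    then have "continuous_map (prod_topology B F) ?X (?s g)"
      using g(1) by (intro continuous_map_pairedI continuous_map_fst) simp_all
    then show "openin (prod_topology B F) S"
      unfolding g(2) using W by (rule openin_continuous_map_preimage)
  qed
  finally show "openin (prod_topology B F) ((\<lambda>((x, g), t). (x, act g t)) ` W)" .
qed

lemma quot_cover:
  assumes "p \<in> topspace (prod_topology frames.total F)"
  shows "\<exists>i\<in>{(U, h). chart isos E U h}. p \<in> (\<lambda>(a, t). (frames.chart_map (snd i) a, t)) `
    topspace (prod_topology (prod_topology (subtopology (base E) (fst i)) (top_of_set aut)) F)"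
proof -
  have "fst p \<in> topspace frames.total" using assms by auto
  then obtain U h where "chart isos E U h"
    "fst p \<in> frames.chart_map h ` topspace (prod_topology (subtopology (base E) U) (top_of_set aut))"
    using frames.chart_map_cover by blast
  then show ?thesis
    using assms by (intro bexI[of _ "(U, h)"]) (cases p, auto simp: image_iff)
qed

text \<open>
  Over a chart, the quotient map is the action map of \<open>aut\<close> on \<open>F\<close>.
\<close>

lemma quot_continuous: "continuous_map (prod_topology frames.total F) total quot"
proof (rule continuous_map_from_open_cover[where I = "{(U, h). chart isos E U h}",
      OF _ quot_cover])
  fix i assume "i \<in> {(U, h). chart isos E U h}"
  then have c: "chart isos E (fst i) (snd i)" by auto
  let ?X = "prod_topology (prod_topology (subtopology (base E) (fst i)) (top_of_set aut)) F"
  show "open_map ?X (prod_topology frames.total F) (\<lambda>(a, t). (frames.chart_map (snd i) a, t))"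
    by (intro open_map_prod frames.chart_map_open[OF c] open_map_id)
  from continuous_map_compose[OF act_map_continuous chart_map_continuous[OF c]]
  show "continuous_map ?X total (\<lambda>x. quot ((\<lambda>(a, t). (frames.chart_map (snd i) a, t)) x))"
    by (rule continuous_map_eq) (auto simp: quot_chart[OF c])
qed

lemma quot_open: "open_map (prod_topology frames.total F) total quot"
proof (rule open_map_from_cover[where I = "{(U, h). chart isos E U h}", OF _ quot_cover])
  fix i assume "i \<in> {(U, h). chart isos E U h}"
  then have c: "chart isos E (fst i) (snd i)" by auto
  let ?X = "prod_topology (prod_topology (subtopology (base E) (fst i)) (top_of_set aut)) F"
  show "continuous_map ?X (prod_topology frames.total F) (\<lambda>(a, t). (frames.chart_map (snd i) a, t))"
    by (intro continuous_map_prod frames.chart_map_continuous[OF c]) simp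
  from open_map_compose[OF act_map_open chart_map_open[OF c]]
  show "open_map ?X total (\<lambda>x. quot ((\<lambda>(a, t). (frames.chart_map (snd i) a, t)) x))"
    by (rule open_map_eq) (auto simp: quot_chart[OF c])
qed

lemma quot_surj: "quot ` topspace (prod_topology frames.total F) = topspace total"
proof (intro set_eqI iffI)
  fix p assume "p \<in> quot ` topspace (prod_topology frames.total F)"
  then show "p \<in> topspace total"
    using continuous_map_image_subset_topspace[OF quot_continuous] by blast
next
  fix p assume "p \<in> topspace total"
  then obtain x a where p: "p = (x, a)" "x \<in> topspace (base E)" "a \<in> G x" by (auto simp: topspace_total)
  obtain U h where U: "x \<in> U" "chart isos E U h" using local_charts[OF p(2)] by blast
  note f = chart_iso[OF U(2,1)]
  obtain t where "t \<in> topspace F" "a = tr x (h x) t"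
    using tr_bij[OF p(2) f] p(3) by (auto simp: bij_betw_def)
  then show "p \<in> quot ` topspace (prod_topology frames.total F)"
    using p f by (intro image_eqI[of _ _ "((x, h x), t)"]) (auto simp: quot_def frames.topspace_total)
qed

lemma quot_move:
  assumes "e \<in> topspace frames.total" "g \<in> aut" "t \<in> topspace F"
  shows "quot ((fst e, snd e \<circ> g), t) = quot (e, act g t)"
  using assms tr_act by (cases e) (auto simp: quot_def frames.topspace_total)

text \<open>
  The group element is the one that takes one frame to the other.
\<close>

lemma quot_eqD:
  assumes e: "e \<in> topspace frames.total" "e' \<in> topspace frames.total"
    and t: "t \<in> topspace F" "t' \<in> topspace F" and eq: "quot (e, t) = quot (e', t')"
  shows "\<exists>g\<in>aut. e' = (fst e, snd e \<circ> g) \<and> t = act g t'"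
proof -
  obtain x f f' where ee: "e = (x, f)" "e' = (x, f')"
    using eq by (cases e; cases e') (auto simp: quot_def)
  have x: "x \<in> topspace (base E)" and f: "f \<in> isos (fibre E x)" "f' \<in> isos (fibre E x)"
    using e by (auto simp: ee frames.topspace_total)
  let ?g = "inv f \<circ> f'"
  have g: "?g \<in> aut" by (rule iso_trans[OF x f(2,1)])
  have f': "f' = f \<circ> ?g" by (rule iso_factor[OF x f(2,1)])
  have "tr x f t = tr x f' t'" using eq by (simp add: ee quot_def)
  also have "\<dots> = tr x f (act ?g t')" by (subst f') (rule tr_act[OF x f(1) g t(2)])
  finally have "t = act ?g t'" using tr_inj[OF x f(1) t(1) act_in[OF g t(2)]] by blast
  then show ?thesis using g f' by (auto simp: ee)
qed

end

lemma (in frame_structure) frame_action_continuous: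
  "continuous_map (prod_topology frames.total (top_of_set aut)) frames.total (\<lambda>(e, g). (fst e, snd e \<circ> g))"
  using frames.quot_continuous by (simp add: frames.quot_def case_prod_unfold)

section \<open>Countably many coordinate systems from a partition of unity\<close>

text \<open>
  Milnor's device. If \<open>p\<close> is nonnegative with total sum 1, then positivity forces every value of
  \<open>p\<close> on \<open>S\<close> to be strictly larger than every value outside.
\<close>

definition dominance :: "('i \<Rightarrow> real) \<Rightarrow> 'i set \<Rightarrow> real" where
  "dominance p S = max 0 (Min (p ` S) + sum p S - 1)"

lemma dominance_nonneg: "0 \<le> dominance p S"
  by (simp add: dominance_def)

lemma dominance_positiveD:
  assumes S: "finite S" "S \<noteq> {}" "S \<subseteq> A" and A: "finite {a \<in> A. p a \<noteq> 0}" "(\<Sum>a | a \<in> A \<and> p a \<noteq> 0. p a) = 1"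
    and nn: "\<And>a. a \<in> A \<Longrightarrow> 0 \<le> p a" and pos: "dominance p S > 0" and i: "i \<in> S"
  shows "p i > 0" and "\<And>j. j \<in> A - S \<Longrightarrow> p j < p i"
proof -
  have le: "sum p B \<le> 1" if "finite B" "B \<subseteq> A" for B
  proof -
    have "sum p B = sum p (B \<inter> {a. p a \<noteq> 0})"
      using that by (intro sum.mono_neutral_right) auto
    also have "\<dots> \<le> sum p {a \<in> A. p a \<noteq> 0}"
      using that A(1) nn by (intro sum_mono2) auto
    finally show ?thesis using A(2) by simp
  qed
  have m: "Min (p ` S) + sum p S > 1" "Min (p ` S) \<le> p i"
    using pos i S by (auto simp: dominance_def)
  then show "p i > 0" using le[OF S(1,3)] by linarith
  fix j assume j: "j \<in> A - S"
  then have "p j + sum p S \<le> 1" using le[of "insert j S"] S by simp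
  then show "p j < p i" using m by linarith
qed

text \<open>
  An index in one set but not in the other would have to have a value both larger and smaller than
  that of an index with the opposite property.
\<close>

lemma dominance_unique:
  assumes "finite S" "finite S'" "card S = card S'" "S \<noteq> {}" "S \<subseteq> A" "S' \<subseteq> A"
    and A: "finite {a \<in> A. p a \<noteq> 0}" "(\<Sum>a | a \<in> A \<and> p a \<noteq> 0. p a) = 1"
    and nn: "\<And>a. a \<in> A \<Longrightarrow> 0 \<le> p a" and pos: "dominance p S > 0" "dominance p S' > 0"
  shows "S = S'"
proof (rule ccontr)
  assume ne: "S \<noteq> S'"
  then obtain i where i: "i \<in> S" "i \<notin> S'"
    using card_subset_eq[of S' S] assms(1-3) by auto
  obtain j where j: "j \<in> S'" "j \<notin> S"
    using ne card_subset_eq[of S S'] assms(1-3) by auto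
  have "p j < p i"
    by (rule dominance_positiveD(2)[OF assms(1,4,5) A nn pos(1) i(1)]) (use j assms in auto)
  moreover have "p i < p j"
    by (rule dominance_positiveD(2)[OF assms(2) _ assms(6) A nn pos(2) j(1)]) (use i j assms in auto)
  ultimately show False by simp
qed

text \<open>
  On its support \<open>p\<close> sums to 1, so its dominance there is its smallest positive value.
\<close>

lemma dominance_support:
  assumes "finite {a \<in> A. p a \<noteq> 0}" "(\<Sum>a | a \<in> A \<and> p a \<noteq> 0. p a) = 1" and "\<And>a. a \<in> A \<Longrightarrow> 0 \<le> p a"
  shows "dominance p {a \<in> A. p a \<noteq> 0} > 0" "{a \<in> A. p a \<noteq> 0} \<noteq> {}"
proof -
  show ne: "{a \<in> A. p a \<noteq> 0} \<noteq> {}" using assms(2) by (metis sum.empty zero_neq_one)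
  have "Min (p ` {a \<in> A. p a \<noteq> 0}) \<in> p ` {a \<in> A. p a \<noteq> 0}"
    using assms(1) ne by (intro Min_in) auto
  then obtain a where "a \<in> A" "p a \<noteq> 0" "Min (p ` {a \<in> A. p a \<noteq> 0}) = p a" by auto
  then show "dominance p {a \<in> A. p a \<noteq> 0} > 0"
    using assms(2,3) by (force simp: dominance_def)
qed

lemma continuous_map_Min:
  fixes f :: "'i \<Rightarrow> 'a \<Rightarrow> real"
  assumes "finite S" "S \<noteq> {}" "\<And>i. i \<in> S \<Longrightarrow> continuous_map X euclideanreal (f i)"
  shows "continuous_map X euclideanreal (\<lambda>x. Min ((\<lambda>i. f i x) ` S))"
  using assms
proof (induction S rule: finite_ne_induct)
  case (insert i S)
  have "(\<lambda>x. Min ((\<lambda>i. f i x) ` insert i S)) = (\<lambda>x. min (f i x) (Min ((\<lambda>i. f i x) ` S)))"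
    using insert.hyps by (auto simp: fun_eq_iff)
  then show ?case using insert by (simp add: continuous_map_real_min)
qed simp

text \<open>
  The n-th function adds up the dominance functions of all sets with \<open>n + 1\<close> elements; at every
  point at most one of them is positive. So although the partition of unity may be uncountable,
  countably many functions suffice, and each has a positivity set that falls apart into disjoint
  open pieces, one for each \<open>S\<close>.
\<close>

lemma countable_partition:
  fixes \<pi> :: "'i \<Rightarrow> 'b \<Rightarrow> real"
  assumes cont: "\<And>i. i \<in> A \<Longrightarrow> continuous_map B euclideanreal (\<pi> i)"
    and nn: "\<And>i x. i \<in> A \<Longrightarrow> x \<in> topspace B \<Longrightarrow> 0 \<le> \<pi> i x"
    and lf: "\<And>x. x \<in> topspace B \<Longrightarrow> \<exists>V. openin B V \<and> x \<in> V \<and> finite {i \<in> A. \<exists>y\<in>V. \<pi> i y \<noteq> 0}"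
    and one: "\<And>x. x \<in> topspace B \<Longrightarrow> (\<Sum>i | i \<in> A \<and> \<pi> i x \<noteq> 0. \<pi> i x) = 1"
  obtains u :: "nat \<Rightarrow> 'b \<Rightarrow> real" and \<S> :: "nat \<Rightarrow> 'i set set"
  where "\<And>n. continuous_map B euclideanreal (u n)" and "\<And>n x. 0 \<le> u n x"
    and "\<And>x. x \<in> topspace B \<Longrightarrow> \<exists>n. u n x > 0"
    and "\<And>n S. S \<in> \<S> n \<Longrightarrow> S \<noteq> {} \<and> S \<subseteq> A"
    and "\<And>n S. S \<in> \<S> n \<Longrightarrow> openin B {x \<in> topspace B. dominance (\<lambda>i. \<pi> i x) S > 0}"
    and "\<And>n S x i. S \<in> \<S> n \<Longrightarrow> x \<in> topspace B \<Longrightarrow> dominance (\<lambda>i. \<pi> i x) S > 0 \<Longrightarrow> i \<in> S \<Longrightarrow> \<pi> i x > 0"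
    and "\<And>n x. x \<in> topspace B \<Longrightarrow> u n x > 0 \<Longrightarrow> \<exists>!S. S \<in> \<S> n \<and> dominance (\<lambda>i. \<pi> i x) S > 0"
proof -
  define \<S> where "\<S> n = {S. S \<subseteq> A \<and> finite S \<and> card S = Suc n}" for n
  let ?d = "\<lambda>S x. dominance (\<lambda>i. \<pi> i x) S"
  define u where "u n x = (\<Sum>S | S \<in> \<S> n \<and> ?d S x \<noteq> 0. ?d S x)" for n x
  have \<S>: "S \<subseteq> A" "finite S" "S \<noteq> {}" if "S \<in> \<S> n" for S n using that by (auto simp: \<S>_def)
  have fin: "finite {i \<in> A. \<pi> i x \<noteq> 0}" if x: "x \<in> topspace B" for x
  proof -
    obtain V where "x \<in> V" "finite {i \<in> A. \<exists>y\<in>V. \<pi> i y \<noteq> 0}" using lf[OF x] by blast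
    then show ?thesis by (rule_tac finite_subset) auto
  qed
  have d_cont: "continuous_map B euclideanreal (?d S)" if "S \<in> \<S> n" for S n
    unfolding dominance_def using \<S>[OF that] cont
    by (intro continuous_map_real_max continuous_map_diff continuous_map_add continuous_map_sum continuous_map_Min) auto
  have d_pos: "\<pi> i x > 0" if "S \<in> \<S> n" "x \<in> topspace B" "?d S x > 0" "i \<in> S" for S n x i
    by (rule dominance_positiveD(1)[where A = A and p = "\<lambda>i. \<pi> i x" and S = S]) (use \<S>[OF that(1)] fin nn one that in auto)
  have uniq: "S = S'" if "S \<in> \<S> n" "S' \<in> \<S> n" "x \<in> topspace B" "?d S x > 0" "?d S' x > 0" for S S' n x
    by (rule dominance_unique[where A = A and p = "\<lambda>i. \<pi> i x"]) (use that fin nn one in \<open>auto simp: \<S>_def\<close>)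
  have ex: "\<exists>S\<in>\<S> n. ?d S x > 0" if "u n x > 0" for n x
  proof (rule ccontr)
    assume "\<not> ?thesis"
    then have "{S. S \<in> \<S> n \<and> ?d S x \<noteq> 0} = {}"
      using dominance_nonneg by (force simp: order.order_iff_strict)
    then show False using that by (simp add: u_def)
  qed
  have u_cont: "continuous_map B euclideanreal (u n)" for n
  proof (rule continuous_map_locally)
    fix x assume x: "x \<in> topspace B"
    obtain V where V: "openin B V" "x \<in> V" "finite {i \<in> A. \<exists>y\<in>V. \<pi> i y \<noteq> 0}" using lf[OF x] by blast
    let ?J = "{i \<in> A. \<exists>y\<in>V. \<pi> i y \<noteq> 0}"
    have "continuous_map (subtopology B V) euclideanreal (u n)"
    proof (rule continuous_map_eq)
      show "continuous_map (subtopology B V) euclideanreal (\<lambda>y. \<Sum>S | S \<in> \<S> n \<and> S \<subseteq> ?J. ?d S y)"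
      proof (intro continuous_map_sum continuous_map_from_subtopology)
        show "finite {S \<in> \<S> n. S \<subseteq> ?J}" using V(3) by (auto intro: finite_subset[of _ "Pow ?J"])
      qed (use d_cont in blast)
      fix y assume "y \<in> topspace (subtopology B V)"
      then have y: "y \<in> topspace B" "y \<in> V" by auto
      have "S \<subseteq> ?J" if "S \<in> \<S> n" "?d S y \<noteq> 0" for S
      proof -
        have "?d S y > 0" using that(2) dominance_nonneg[of "\<lambda>i. \<pi> i y" S] by linarith
        then have "\<pi> i y > 0" if "i \<in> S" for i using d_pos[OF \<open>S \<in> \<S> n\<close> y(1) _ that] by blast
        then have "i \<in> A \<and> (\<exists>y\<in>V. \<pi> i y \<noteq> 0)" if "i \<in> S" for i
          using that \<S>(1)[OF \<open>S \<in> \<S> n\<close>] y(2) by (intro conjI bexI[of _ y]) force+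
        then show ?thesis by blast
      qed
      note active = this
      have "finite {S. S \<in> \<S> n \<and> S \<subseteq> ?J}"
        by (rule finite_subset[of _ "Pow ?J"]) (use V(3) in auto)
      then show "(\<Sum>S | S \<in> \<S> n \<and> S \<subseteq> ?J. ?d S y) = u n y"
        unfolding u_def by (rule sum.mono_neutral_right) (use active in blast)+
    qed
    then show "\<exists>T. openin B T \<and> x \<in> T \<and> continuous_map (subtopology B T) euclideanreal (u n)"
      using V by blast
  qed
  have cov: "\<exists>n. u n x > 0" if x: "x \<in> topspace B" for x
  proof -
    let ?S = "{i \<in> A. \<pi> i x \<noteq> 0}"
    have S: "?d ?S x > 0" "?S \<noteq> {}"
      by (rule dominance_support; use fin nn one x in auto)+
    then have mem: "?S \<in> \<S> (card ?S - 1)"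
      using fin[OF x] by (auto simp: \<S>_def card_gt_0_iff)
    have "{S'. S' \<in> \<S> (card ?S - 1) \<and> ?d S' x \<noteq> 0} = {?S}"
      using uniq[OF _ mem x _ S(1)] mem S(1) dominance_nonneg by (force simp: order.order_iff_strict)
    then have "u (card ?S - 1) x = ?d ?S x" by (simp add: u_def)
    then show ?thesis using S(1) by (intro exI[of _ "card ?S - 1"]) simp
  qed
  show thesis
  proof (rule that[of u \<S>])
    show "openin B {x \<in> topspace B. ?d S x > 0}" if "S \<in> \<S> n" for n S
      by (rule openin_positive[OF d_cont[OF that]])
    show "\<exists>!S. S \<in> \<S> n \<and> ?d S x > 0" if "x \<in> topspace B" "u n x > 0" for n x
      using ex[OF that(2)] uniq that by blast
    show "0 \<le> u n x" for n x
      unfolding u_def by (intro sum_nonneg dominance_nonneg)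
    show "S \<noteq> {} \<and> S \<subseteq> A" if "S \<in> \<S> n" for n S
      using \<S>[OF that] by blast
  qed (rule u_cont cov d_pos; assumption)+
qed

context frame_structure
begin

text \<open>
  On the piece that belongs to \<open>S\<close> the chart of a chosen member of \<open>S\<close> is available; comparing a
  frame with this chart gives its coordinate. The pieces are disjoint and open, so the coordinates
  fit together.
\<close>

lemma numerable_frame_coordinates:
  assumes "numerable isos E"
  obtains u :: "nat \<Rightarrow> 'b \<Rightarrow> real" and b :: "nat \<Rightarrow> 'b \<times> ('m \<Rightarrow> 'e) \<Rightarrow> 'm \<Rightarrow> 'm"
  where "\<And>n. continuous_map (base E) euclideanreal (u n)" and "\<And>n x. 0 \<le> u n x"
    and "\<And>x. x \<in> topspace (base E) \<Longrightarrow> \<exists>n. u n x > 0"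
    and "\<And>n. continuous_map (subtopology frames.total {e \<in> topspace frames.total. u n (fst e) > 0}) (top_of_set aut) (b n)"
    and "\<And>n x f g. b n (x, f \<circ> g) = b n (x, f) \<circ> g"
proof -
  obtain \<U> and \<pi> :: "'b set \<Rightarrow> 'b \<Rightarrow> real" where partition:
    "(\<forall>U\<in>\<U>. \<exists>h. chart isos E U h) \<and>
     (\<forall>U\<in>\<U>. continuous_map (base E) euclideanreal (\<pi> U) \<and>
       (\<forall>x\<in>topspace (base E). 0 \<le> \<pi> U x) \<and>
       base E closure_of {x \<in> topspace (base E). \<pi> U x \<noteq> 0} \<subseteq> U) \<and>
     (\<forall>x\<in>topspace (base E). \<exists>V. openin (base E) V \<and> x \<in> V \<and>
       finite {U \<in> \<U>. \<exists>y\<in>V. \<pi> U y \<noteq> 0}) \<and>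
     (\<forall>x\<in>topspace (base E). (\<Sum>U | U \<in> \<U> \<and> \<pi> U x \<noteq> 0. \<pi> U x) = 1)"
    using assms unfolding numerable_def by (elim exE)
  have charts: "\<exists>h. chart isos E U h" and \<pi>_cont: "continuous_map (base E) euclideanreal (\<pi> U)"
    and supp: "base E closure_of {x \<in> topspace (base E). \<pi> U x \<noteq> 0} \<subseteq> U" if "U \<in> \<U>" for U
    using partition that by simp_all
  have \<pi>_nn: "0 \<le> \<pi> U x" if "U \<in> \<U>" "x \<in> topspace (base E)" for U x
    using partition that by simp
  have lf: "\<exists>V. openin (base E) V \<and> x \<in> V \<and> finite {U \<in> \<U>. \<exists>y\<in>V. \<pi> U y \<noteq> 0}"
    and one: "(\<Sum>U | U \<in> \<U> \<and> \<pi> U x \<noteq> 0. \<pi> U x) = 1" if "x \<in> topspace (base E)" for x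
    using partition that by simp_all
  obtain h where h: "\<And>U. U \<in> \<U> \<Longrightarrow> chart isos E U (h U)" using charts by metis
  have supp': "x \<in> U" if "U \<in> \<U>" "x \<in> topspace (base E)" "\<pi> U x > 0" for U x
    using supp[OF that(1)] closure_of_subset[of "{x \<in> topspace (base E). \<pi> U x \<noteq> 0}" "base E"] that by auto
  show thesis
  proof (rule countable_partition[of \<U> "base E" \<pi>])
    show "continuous_map (base E) euclideanreal (\<pi> U)" if "U \<in> \<U>" for U
      by (rule \<pi>_cont[OF that])
    show "0 \<le> \<pi> U x" if "U \<in> \<U>" "x \<in> topspace (base E)" for U x
      by (rule \<pi>_nn[OF that])
    show "\<exists>V. openin (base E) V \<and> x \<in> V \<and> finite {U \<in> \<U>. \<exists>y\<in>V. \<pi> U y \<noteq> 0}"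
      and "(\<Sum>U | U \<in> \<U> \<and> \<pi> U x \<noteq> 0. \<pi> U x) = 1" if "x \<in> topspace (base E)" for x
      by (rule lf[OF that], rule one[OF that])
    fix u :: "nat \<Rightarrow> 'b \<Rightarrow> real" and \<S> :: "nat \<Rightarrow> 'b set set set" assume u: "\<And>n. continuous_map (base E) euclideanreal (u n)" "\<And>n x. 0 \<le> u n x"
      "\<And>x. x \<in> topspace (base E) \<Longrightarrow> \<exists>n. u n x > 0"
    and \<S>: "\<And>n S. S \<in> \<S> n \<Longrightarrow> S \<noteq> {} \<and> S \<subseteq> \<U>"
      "\<And>n S. S \<in> \<S> n \<Longrightarrow> openin (base E) {x \<in> topspace (base E). dominance (\<lambda>i. \<pi> i x) S > 0}"
      "\<And>n S x i. S \<in> \<S> n \<Longrightarrow> x \<in> topspace (base E) \<Longrightarrow> dominance (\<lambda>i. \<pi> i x) S > 0 \<Longrightarrow> i \<in> S \<Longrightarrow> \<pi> i x > 0"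
      "\<And>n x. x \<in> topspace (base E) \<Longrightarrow> u n x > 0 \<Longrightarrow> \<exists>!S. S \<in> \<S> n \<and> dominance (\<lambda>i. \<pi> i x) S > 0"
    define sel where "sel S = (SOME U. U \<in> S)" for S :: "'b set set"
    \<comment> \<open>Well defined only where \<open>u n\<close> is positive, where the dominating set of size \<open>n + 1\<close> is unique;
       there it is locally constant.\<close>
    define V where "V n x = sel (THE S. S \<in> \<S> n \<and> dominance (\<lambda>i. \<pi> i x) S > 0)" for n x
    define b where "b n e = inv (h (V n (fst e)) (fst e)) \<circ> snd e" for n and e :: "'b \<times> ('m \<Rightarrow> 'e)"
    show thesis
    proof (rule that[OF u])
      fix n
      show "continuous_map (subtopology frames.total {e \<in> topspace frames.total. u n (fst e) > 0}) (top_of_set aut) (b n)"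
      proof (rule continuous_map_locally)
        let ?D = "{e \<in> topspace frames.total. u n (fst e) > 0}"
        fix e assume "e \<in> topspace (subtopology frames.total ?D)"
        then have e: "e \<in> topspace frames.total" "u n (fst e) > 0" "fst e \<in> topspace (base E)"
          by (auto simp: frames.topspace_total)
        then obtain S where S: "S \<in> \<S> n" "dominance (\<lambda>i. \<pi> i (fst e)) S > 0" using \<S>(4) by blast
        let ?O = "{x \<in> topspace (base E). dominance (\<lambda>i. \<pi> i x) S > 0}"
        let ?T = "{e \<in> topspace frames.total. fst e \<in> ?O} \<inter> ?D"
        have sel: "sel S \<in> S" unfolding sel_def using \<S>(1)[OF S(1)] by (simp add: some_in_eq)
        then have selU: "sel S \<in> \<U>" using \<S>(1)[OF S(1)] by blast
        have V: "V n x = sel S" if "x \<in> ?O" "u n x > 0" for x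
        proof -
          have "(THE S. S \<in> \<S> n \<and> dominance (\<lambda>i. \<pi> i x) S > 0) = S"
            using \<S>(4)[of x n] that S by (intro the1_equality) auto
          then show ?thesis by (simp add: V_def)
        qed
        have sub: "?T \<subseteq> sel S \<times> UNIV"
          using supp'[OF selU] \<S>(3)[OF S(1) _ _ sel] by auto
        have "openin frames.total {e \<in> topspace frames.total. fst e \<in> ?O}"
          by (rule openin_continuous_map_preimage[OF frames.continuous_map_total_fst \<S>(2)[OF S(1)]])
        then have "openin (subtopology frames.total ?D) ?T"
          by (auto simp: openin_subtopology)
        moreover have "continuous_map (subtopology (subtopology frames.total ?D) ?T) (top_of_set aut) (b n)"
        proof (rule continuous_map_eq)
          have "subtopology (subtopology frames.total ?D) ?T = subtopology frames.total ?T"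
            by (simp add: subtopology_subtopology Int_absorb1)
          then show "continuous_map (subtopology (subtopology frames.total ?D) ?T) (top_of_set aut)
              (\<lambda>e. inv (h (sel S) (fst e)) \<circ> snd e)"
            using continuous_map_from_subtopology_mono[OF chart_frame_coordinate[OF h[OF selU]] sub] by simp
        qed (use V in \<open>auto simp: b_def\<close>)
        ultimately show "\<exists>T. openin (subtopology frames.total ?D) T \<and> e \<in> T \<and>
            continuous_map (subtopology (subtopology frames.total ?D) T) (top_of_set aut) (b n)"
          using e S by (intro exI[of _ ?T]) auto
      qed
    qed (simp_all add: b_def o_assoc)
  qed
  qed
end

section \<open>Frames of Hermitian spaces and of matrix algebras\<close>

lemma coordinate_space_simps [simp]:
  "elems coordinate_space = UNIV" "vadd coordinate_space = (+)" "vscale coordinate_space = (*s)"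
  "herm coordinate_space = hermitian_product"
  by (simp_all add: coordinate_space_def hermitian_product_def fun_eq_iff)

lemma matrix_algebra_simps [simp]:
  "elems matrix_algebra = UNIV" "vadd matrix_algebra = (+)" "vscale matrix_algebra = (\<lambda>c M. mat c ** M)"
  "amult matrix_algebra = (**)" "aone matrix_algebra = mat 1" "astar matrix_algebra = adjoint_matrix"
  by (simp_all add: matrix_algebra_def fun_eq_iff adjoint_matrix_def vec_eq_iff mat_mult_component)

lemma unitary_isos_iff:
  "f \<in> unitary_isos coordinate_space V \<longleftrightarrow> bij_betw f UNIV (elems V) \<and>
     (\<forall>v w. f (v + w) = vadd V (f v) (f w)) \<and> (\<forall>c v. f (c *s v) = vscale V c (f v)) \<and>
     (\<forall>v w. herm V (f v) (f w) = hermitian_product v w)"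
  by (auto simp: unitary_isos_def linear_maps_def bij_betw_def PiE_def extensional_def)

lemma star_isos_iff:
  "f \<in> star_isos matrix_algebra X \<longleftrightarrow> bij_betw f UNIV (elems X) \<and>
     (\<forall>A B. f (A + B) = vadd X (f A) (f B)) \<and> (\<forall>c A. f (mat c ** A) = vscale X c (f A)) \<and>
     (\<forall>A B. f (A ** B) = amult X (f A) (f B)) \<and> f (mat 1) = aone X \<and>
     (\<forall>A. f (adjoint_matrix A) = astar X (f A))"
  by (auto simp: star_isos_def star_homs_def linear_maps_def bij_betw_def PiE_def extensional_def)

lemma star_iso_simps:
  assumes "f \<in> star_isos matrix_algebra X"
  shows "f (A + B) = vadd X (f A) (f B)" and "f (mat c ** A) = vscale X c (f A)"
    and "f (A ** B) = amult X (f A) (f B)" and "f (mat 1) = aone X"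
    and "f (adjoint_matrix A) = astar X (f A)" and "bij_betw f UNIV (elems X)"
  using assms unfolding star_isos_iff by blast+

lemma star_hom_simps:
  assumes "f \<in> star_homs matrix_algebra matrix_algebra"
  shows "f (A + B) = f A + f B" and "f (mat c ** A) = mat c ** f A"
    and "f (A ** B) = f A ** f B" and "f (mat 1) = mat 1"
    and "f (adjoint_matrix A) = adjoint_matrix (f A)"
  using assms unfolding star_homs_matrix_iff by blast+

lemma star_hom_comp:
  assumes f: "f \<in> star_homs matrix_algebra matrix_algebra" and g: "g \<in> star_homs matrix_algebra matrix_algebra"
  shows "f \<circ> g \<in> star_homs matrix_algebra matrix_algebra"
  unfolding star_homs_matrix_iff comp_apply
proof (intro conjI allI)
  fix A B c
  show "f (g (A + B)) = f (g A) + f (g B)" by (simp only: star_hom_simps(1)[OF f] star_hom_simps(1)[OF g])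
  show "f (g (mat c ** A)) = mat c ** f (g A)" by (simp only: star_hom_simps(2)[OF f] star_hom_simps(2)[OF g])
  show "f (g (A ** B)) = f (g A) ** f (g B)" by (simp only: star_hom_simps(3)[OF f] star_hom_simps(3)[OF g])
  show "f (g (mat 1)) = mat 1" by (simp only: star_hom_simps(4)[OF f] star_hom_simps(4)[OF g])
  show "f (g (adjoint_matrix A)) = adjoint_matrix (f (g A))"
    by (simp only: star_hom_simps(5)[OF f] star_hom_simps(5)[OF g])
qed

lemma hermitian_product_axis: "hermitian_product (M *v axis i 1) (axis j 1) = cnj (M $ j $ i)"
  by (simp add: hermitian_product_def matrix_vector_mult_def axis_def if_distrib if_distribR cong: if_cong)

lemma hermitian_product_adjoint: "hermitian_product (adjoint_matrix M *v v) w = hermitian_product v (M *v w)"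
  by (simp add: hermitian_product_def matrix_vector_mult_def adjoint_matrix_def cnj_sum
      sum_distrib_left sum_distrib_right mult_ac) (rule sum.swap)

lemma matrix_eq_hermitian:
  assumes "\<And>v w. hermitian_product (M *v v) w = hermitian_product (N *v v) w"
  shows "M = N"
proof -
  have "M $ j $ i = N $ j $ i" for i j
    using assms[of "axis i 1" "axis j 1"] unfolding hermitian_product_axis by simp
  then show ?thesis by (simp add: vec_eq_iff)
qed

lemma matrix_of_linear:
  fixes f :: "complex^'n::finite \<Rightarrow> complex^'n"
  assumes "\<And>v w. f (v + w) = f v + f w" "\<And>c v. f (c *s v) = c *s f v"
  shows "matrix f *v v = f v"
proof -
  have "Vector_Spaces.linear (*s) (*s) f"
    using assms by unfold_locales (simp_all add: vec.scale_right_distrib vec.scale_left_distrib)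
  then show ?thesis by (rule matrix_works)
qed

lemma unitary_automorphisms:
  "unitary_isos coordinate_space coordinate_space = (*v) ` (unitary_matrices :: (complex^'n::finite^'n) set)"
proof (intro set_eqI iffI)
  fix f :: "complex^'n \<Rightarrow> complex^'n"
  assume f: "f \<in> unitary_isos coordinate_space coordinate_space"
  then have m: "matrix f *v v = f v" for v
    by (intro matrix_of_linear) (simp_all add: unitary_isos_iff)
  have "hermitian_product (adjoint_matrix (matrix f) ** matrix f *v v) w = hermitian_product (mat 1 *v v) w" for v w
    using f by (simp add: m hermitian_product_adjoint unitary_isos_iff flip: matrix_vector_mul_assoc)
  then have "adjoint_matrix (matrix f) ** matrix f = mat 1" by (rule matrix_eq_hermitian)
  then have "matrix f \<in> unitary_matrices" by (simp add: unitary_matrices_def)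
  moreover have "f = (*v) (matrix f)" using m by (simp add: fun_eq_iff)
  ultimately show "f \<in> (*v) ` unitary_matrices" by blast
next
  fix f :: "complex^'n \<Rightarrow> complex^'n"
  assume "f \<in> (*v) ` unitary_matrices"
  then obtain u where u: "u \<in> unitary_matrices" "f = (*v) u" by blast
  have "bij ((*v) u)"
    by (rule bij_betw_byWitness[where f' = "(*v) (adjoint_matrix u)"])
      (simp_all add: matrix_vector_mul_assoc unitary_left[OF u(1)] unitary_right[OF u(1)])
  moreover have "hermitian_product (u *v v) (u *v w) = hermitian_product v w" for v w
    using hermitian_product_adjoint[of u "u *v v" w] by (simp add: matrix_vector_mul_assoc unitary_left[OF u(1)])
  ultimately show "f \<in> unitary_isos coordinate_space coordinate_space"
    by (simp add: unitary_isos_iff u(2) matrix_vector_right_distrib vector_scalar_commute)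
qed

lemma unitary_iso_comp:
  assumes "f \<in> unitary_isos coordinate_space V" "g \<in> unitary_isos coordinate_space coordinate_space"
  shows "f \<circ> g \<in> unitary_isos coordinate_space V"
  using assms by (auto simp: unitary_isos_iff intro: bij_betw_trans)

lemma bij_betw_UNIV_inv:
  assumes "bij_betw f UNIV S" "bij_betw f' UNIV S"
  shows "bij (inv f' \<circ> f)" "f' (inv f' (f v)) = f v"
proof -
  show "bij (inv f' \<circ> f)"
    using bij_betw_trans[OF assms(1) bij_betw_inv_into[OF assms(2)]] .
  show "f' (inv f' (f v)) = f v"
    using assms by (auto simp: bij_betw_def intro!: f_inv_into_f)
qed

lemma unitary_iso_inv_comp:
  fixes f f' :: "complex^'n::finite \<Rightarrow> 'e"
  assumes f: "f \<in> unitary_isos coordinate_space V" and f': "f' \<in> unitary_isos coordinate_space V"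
  shows "inv f' \<circ> f \<in> unitary_isos coordinate_space coordinate_space"
proof -
  have b: "bij_betw f UNIV (elems V)" "bij_betw f' UNIV (elems V)" using f f' by (auto simp: unitary_isos_iff)
  note k = bij_betw_UNIV_inv[OF b]
  have inj: "f' v = f' w \<Longrightarrow> v = w" for v w using b by (auto simp: bij_betw_def inj_def)
  have eqs: "f (v + w) = vadd V (f v) (f w)" "f (c *s v) = vscale V c (f v)" "herm V (f v) (f w) = hermitian_product v w"
    "f' (v + w) = vadd V (f' v) (f' w)" "f' (c *s v) = vscale V c (f' v)" "herm V (f' v) (f' w) = hermitian_product v w" for v w c
    using f f' by (simp_all add: unitary_isos_iff)
  show ?thesis
    unfolding unitary_isos_iff coordinate_space_simps
  proof (intro conjI allI)
    show "(inv f' \<circ> f) (v + w) = (inv f' \<circ> f) v + (inv f' \<circ> f) w" for v w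
      by (rule inj) (simp only: comp_apply k(2) eqs(4), simp only: eqs(1))
    show "(inv f' \<circ> f) (c *s v) = c *s (inv f' \<circ> f) v" for c v
      by (rule inj) (simp only: comp_apply k(2) eqs(5), simp only: eqs(2))
    show "hermitian_product ((inv f' \<circ> f) v) ((inv f' \<circ> f) w) = hermitian_product v w" for v w
      by (simp only: eqs(6)[symmetric] comp_apply k(2)) (simp only: eqs(3) eqs(6))
  qed (use k in simp)
qed

lemma star_iso_comp:
  assumes f: "f \<in> star_isos matrix_algebra X" and g: "g \<in> star_isos matrix_algebra matrix_algebra"
  shows "f \<circ> g \<in> star_isos matrix_algebra X"
proof -
  have b: "bij_betw (\<lambda>A. f (g A)) UNIV (elems X)"
    using bij_betw_trans[of g UNIV UNIV f "elems X"] star_iso_simps(6)[OF f] star_iso_simps(6)[OF g] by (simp add: o_def)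
  have g': "g \<in> star_homs matrix_algebra matrix_algebra" using g by (simp add: star_isos_def)
  show ?thesis
    unfolding star_isos_iff comp_def
  proof (intro conjI allI b)
    fix A B c
    show "f (g (A + B)) = vadd X (f (g A)) (f (g B))" by (simp only: star_iso_simps(1)[OF f] star_hom_simps(1)[OF g'])
    show "f (g (mat c ** A)) = vscale X c (f (g A))" by (simp only: star_iso_simps(2)[OF f] star_hom_simps(2)[OF g'])
    show "f (g (A ** B)) = amult X (f (g A)) (f (g B))" by (simp only: star_iso_simps(3)[OF f] star_hom_simps(3)[OF g'])
    show "f (g (mat 1)) = aone X" by (simp only: star_iso_simps(4)[OF f] star_hom_simps(4)[OF g'])
    show "f (g (adjoint_matrix A)) = astar X (f (g A))"
      by (simp only: star_iso_simps(5)[OF f] star_hom_simps(5)[OF g'])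
  qed
qed

lemma star_iso_inv_comp:
  assumes f: "f \<in> star_isos matrix_algebra X" and f': "f' \<in> star_isos matrix_algebra X"
  shows "inv f' \<circ> f \<in> star_isos matrix_algebra matrix_algebra"
proof -
  have b: "bij_betw f UNIV (elems X)" "bij_betw f' UNIV (elems X)" using f f' by (auto simp: star_isos_iff)
  note k = bij_betw_UNIV_inv[OF b]
  have inj: "f' v = f' w \<Longrightarrow> v = w" for v w using b by (auto simp: bij_betw_def inj_def)
  note eqs = star_iso_simps[OF f] and eqs' = star_iso_simps[OF f']
  show ?thesis
    unfolding star_isos_iff matrix_algebra_simps
  proof (intro conjI allI)
    show "(inv f' \<circ> f) (A + B) = (inv f' \<circ> f) A + (inv f' \<circ> f) B" for A B
      by (rule inj) (simp only: comp_apply k(2) eqs'(1), simp only: eqs(1))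
    show "(inv f' \<circ> f) (mat c ** A) = mat c ** (inv f' \<circ> f) A" for c A
      by (rule inj) (simp only: comp_apply k(2) eqs'(2), simp only: eqs(2))
    show "(inv f' \<circ> f) (A ** B) = (inv f' \<circ> f) A ** (inv f' \<circ> f) B" for A B
      by (rule inj) (simp only: comp_apply k(2) eqs'(3), simp only: eqs(3))
    show "(inv f' \<circ> f) (mat 1) = mat 1"
      by (rule inj) (simp only: comp_apply k(2) eqs'(4), simp only: eqs(4))
    show "(inv f' \<circ> f) (adjoint_matrix A) = adjoint_matrix ((inv f' \<circ> f) A)" for A
      by (rule inj) (simp only: comp_apply k(2) eqs'(5), simp only: eqs(5))
  qed (use k in simp)
qed

lemma conjugation_star_iso:
  assumes "g \<in> unitary_matrices"
  shows "conjugation g \<in> star_isos matrix_algebra matrix_algebra"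
proof -
  have "bij (conjugation g)"
    by (rule bij_betw_byWitness[where f' = "conjugation (adjoint_matrix g)"])
      (simp_all add: unitary_left[OF assms] unitary_right[OF assms] flip: conjugation_mult)
  moreover have "conjugation g (mat c ** A) = mat c ** conjugation g A" for c A
    unfolding conjugation_def mat_left_commute[of g] by (simp only: matrix_mul_assoc)
  moreover have "conjugation g (A ** B) = conjugation g A ** conjugation g B" for A B
    unfolding conjugation_def by (simp add: unitary_cancel assms flip: matrix_mul_assoc)
  ultimately show ?thesis
    using assms by (simp add: star_isos_iff)
      (simp add: conjugation_def matrix_add_ldistrib matrix_add_rdistrib' unitary_right adjoint_mult matrix_mul_assoc)
qed

text \<open>
  Compare the standard amplification with its composite with the automorphism; both are
  amplifications.
\<close>

lemma star_automorphisms: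
  "star_isos matrix_algebra matrix_algebra = conjugation ` (unitary_matrices :: (complex^'n::finite^'n) set)"
proof (intro set_eqI iffI)
  fix \<alpha> :: "complex^'n^'n \<Rightarrow> complex^'n^'n"
  assume \<alpha>: "\<alpha> \<in> star_isos matrix_algebra matrix_algebra"
  have amp: "amplification (mat 1 :: complex^('n \<times> 'n)^('n \<times> 'n)) \<in> star_homs matrix_algebra matrix_algebra"
    by (rule amplification_star_hom) simp
  have hom: "\<alpha> \<in> star_homs matrix_algebra matrix_algebra" using \<alpha> by (simp add: star_isos_def)
  have "amplification (mat 1 :: complex^('n \<times> 'n)^('n \<times> 'n)) \<circ> \<alpha> \<in> star_homs matrix_algebra matrix_algebra"
    by (rule star_hom_comp[OF amp hom])
  then obtain w :: "complex^('n \<times> 'n)^('n \<times> 'n)" where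
    w: "w \<in> unitary_matrices" "amplification (mat 1) \<circ> \<alpha> = amplification w"
    by (rule star_hom_amplification)
  then have "amplification w M = amplification (mat 1) (\<alpha> M)" for M by (metis comp_apply)
  from amplification_intertwined_inner[OF unitary_one w(1) hom this]
  show "\<alpha> \<in> conjugation ` unitary_matrices" by blast
qed (use conjugation_star_iso in blast)

text \<open>
  The endomorphism of \<open>V\<close> that has the matrix \<open>M\<close> in the frame \<open>f\<close>.
\<close>

definition inner_extension :: "'e hermitian_space \<Rightarrow> (complex^'k::finite \<Rightarrow> 'e) \<Rightarrow> complex^'k^'k \<Rightarrow> 'e \<Rightarrow> 'e" where
  "inner_extension V f M = (\<lambda>e\<in>elems V. f (M *v inv f e))"

lemma inner_extension_apply:
  assumes "f \<in> unitary_isos coordinate_space V"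
  shows "inner_extension V f M (f v) = f (M *v v)"
proof -
  have "inj f" "f v \<in> elems V" using assms by (auto simp: unitary_isos_iff bij_betw_def)
  then show ?thesis by (simp add: inner_extension_def)
qed

lemma endomorphism_eqI:
  assumes "f \<in> unitary_isos coordinate_space V" "S \<in> extensional (elems V)" "S' \<in> extensional (elems V)"
    and "\<And>v. S (f v) = S' (f v)"
  shows "S = S'"
proof (rule extensionalityI[OF assms(2,3)])
  fix e assume e: "e \<in> elems V"
  have "elems V = range f" using assms(1) by (simp add: unitary_isos_iff bij_betw_def)
  then obtain v where "e = f v" using e by blast
  then show "S e = S' e" using assms(4) by simp
qed

lemma inner_extension_linear:
  assumes f: "f \<in> unitary_isos coordinate_space V"
  shows "inner_extension V f M \<in> linear_maps V V"
proof -
  have img: "elems V = range f" using f by (auto simp: unitary_isos_iff bij_betw_def)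
  have eqs: "vadd V (f v) (f w) = f (v + w)" "vscale V c (f v) = f (c *s v)" for v w c
    using f by (simp_all add: unitary_isos_iff)
  show ?thesis
    unfolding linear_maps_def img
    by (auto simp: eqs inner_extension_apply[OF f] matrix_vector_right_distrib vector_scalar_commute PiE_def)
      (simp add: inner_extension_def img)
qed

lemma inner_extension_surj:
  assumes f: "f \<in> unitary_isos coordinate_space V" and S: "S \<in> linear_maps V V"
  obtains M where "S = inner_extension V f M"
proof
  have img: "elems V = range f" and inj: "inj f" using f by (auto simp: unitary_isos_iff bij_betw_def)
  have eqs: "f (v + w) = vadd V (f v) (f w)" "f (c *s v) = vscale V c (f v)" for v w c
    using f by (simp_all add: unitary_isos_iff)
  have Sf: "S (f v) \<in> range f" for v using S by (auto simp: linear_maps_def img)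
  have S_eqs: "S (vadd V (f v) (f w)) = vadd V (S (f v)) (S (f w))" "S (vscale V c (f v)) = vscale V c (S (f v))" for v w c
    using S by (auto simp: linear_maps_def img)
  define k where "k v = inv f (S (f v))" for v
  have fk: "f (k v) = S (f v)" for v using Sf by (simp add: k_def f_inv_into_f)
  have "matrix k *v v = k v" for v
  proof (rule matrix_of_linear)
    show "k (v + w) = k v + k w" for v w
      using inj by (rule injD) (simp add: fk eqs S_eqs)
    show "k (c *s v) = c *s k v" for c v
      using inj by (rule injD) (simp add: fk eqs S_eqs)
  qed
  then have "S (f v) = inner_extension V f (matrix k) (f v)" for v
    by (simp only: inner_extension_apply[OF f] fk)
  moreover have "S \<in> extensional (elems V)" using S by (simp add: linear_maps_def PiE_def)
  ultimately show "S = inner_extension V f (matrix k)"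
    by (intro endomorphism_eqI[OF f]) (auto simp: inner_extension_def)
qed

lemma inner_extension_inj:
  assumes f: "f \<in> unitary_isos coordinate_space V" and "inner_extension V f M = inner_extension V f N"
  shows "M = N"
proof -
  have "f (M *v v) = f (N *v v)" for v
    using arg_cong[OF assms(2), of "\<lambda>S. S (f v)"] by (simp add: inner_extension_apply[OF f])
  then have "M *v v = N *v v" for v using f by (auto simp: unitary_isos_iff bij_betw_def inj_def)
  then show ?thesis by (simp add: matrix_eq)
qed

lemma endomorphism_algebra_simps:
  "elems (endomorphism_algebra V) = linear_maps V V"
  "vadd (endomorphism_algebra V) = (\<lambda>S T. \<lambda>v\<in>elems V. vadd V (S v) (T v))"
  "vscale (endomorphism_algebra V) = (\<lambda>c T. \<lambda>v\<in>elems V. vscale V c (T v))"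
  "amult (endomorphism_algebra V) = (\<lambda>S T. compose (elems V) S T)"
  "aone (endomorphism_algebra V) = (\<lambda>v\<in>elems V. v)"
  "astar (endomorphism_algebra V) = (\<lambda>T. THE S. S \<in> linear_maps V V \<and>
       (\<forall>v\<in>elems V. \<forall>w\<in>elems V. herm V (S v) w = herm V v (T w)))"
  by (simp_all add: endomorphism_algebra_def)

text \<open>
  A unitary frame turns the adjoint defined by the Hermitian form into the conjugate transpose;
  the definite description in the endomorphism algebra is resolved by nondegeneracy of the form.
\<close>

lemma inner_extension_star_iso:
  assumes f: "f \<in> unitary_isos coordinate_space V"
  shows "inner_extension V f \<in> star_isos matrix_algebra (endomorphism_algebra V)"
proof -
  have img: "elems V = range f" and inj: "inj f" using f by (auto simp: unitary_isos_iff bij_betw_def)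
  have eqs: "vadd V (f v) (f w) = f (v + w)" "vscale V c (f v) = f (c *s v)" "herm V (f v) (f w) = hermitian_product v w" for v w c
    using f by (simp_all add: unitary_isos_iff)
  have ext: "inner_extension V f M \<in> extensional (elems V)" for M by (simp add: inner_extension_def)
  have mem: "f v \<in> elems V" for v by (simp add: img)
  note app = inner_extension_apply[OF f]
  show ?thesis
    unfolding star_isos_iff endomorphism_algebra_simps
  proof (intro conjI allI)
    show "bij_betw (inner_extension V f) UNIV (linear_maps V V)"
    proof (rule bij_betw_imageI)
      show "inj (inner_extension V f)"
        using inner_extension_inj[OF f] by (rule injI)
      show "range (inner_extension V f) = linear_maps V V"
      proof (intro set_eqI iffI)
        fix S assume "S \<in> linear_maps V V"
        then show "S \<in> range (inner_extension V f)" using inner_extension_surj[OF f] by (metis rangeI)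
      qed (use inner_extension_linear[OF f] in auto)
    qed
    show "inner_extension V f (A + B) = (\<lambda>v\<in>elems V. vadd V (inner_extension V f A v) (inner_extension V f B v))" for A B
      by (rule endomorphism_eqI[OF f]) (simp_all add: ext app mem eqs matrix_vector_mult_add_rdistrib)
    show "inner_extension V f (mat c ** A) = (\<lambda>v\<in>elems V. vscale V c (inner_extension V f A v))" for c A
    proof (rule endomorphism_eqI[OF f])
      have "mat c ** A *v v = c *s (A *v v)" for v
        by (simp add: vec_eq_iff matrix_vector_mult_def mat_mult_component sum_distrib_left mult.assoc)
      then show "inner_extension V f (mat c ** A) (f v) = (\<lambda>v\<in>elems V. vscale V c (inner_extension V f A v)) (f v)" for v
        by (simp add: app mem eqs)
    qed (simp_all add: ext)
    show "inner_extension V f (A ** B) = compose (elems V) (inner_extension V f A) (inner_extension V f B)" for A B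
      by (rule endomorphism_eqI[OF f]) (simp_all add: ext app mem compose_def matrix_vector_mul_assoc)
    show "inner_extension V f (mat 1) = (\<lambda>v\<in>elems V. v)"
      by (rule endomorphism_eqI[OF f]) (simp_all add: ext app mem)
    fix A
    have "(THE S. S \<in> linear_maps V V \<and> (\<forall>v\<in>elems V. \<forall>w\<in>elems V. herm V (S v) w = herm V v (inner_extension V f A w)))
        = inner_extension V f (adjoint_matrix A)"
    proof (rule the_equality)
      show "inner_extension V f (adjoint_matrix A) \<in> linear_maps V V \<and>
          (\<forall>v\<in>elems V. \<forall>w\<in>elems V. herm V (inner_extension V f (adjoint_matrix A) v) w = herm V v (inner_extension V f A w))"
        using inner_extension_linear[OF f] by (auto simp: img app eqs hermitian_product_adjoint)
      fix S assume S: "S \<in> linear_maps V V \<and> (\<forall>v\<in>elems V. \<forall>w\<in>elems V. herm V (S v) w = herm V v (inner_extension V f A w))"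
      then obtain N where N: "S = inner_extension V f N" using inner_extension_surj[OF f] by blast
      have "hermitian_product (N *v v) w = hermitian_product (adjoint_matrix A *v v) w" for v w
      proof -
        have "herm V (inner_extension V f N (f v)) (f w) = herm V (f v) (inner_extension V f A (f w))"
          using S mem unfolding N by blast
        then show ?thesis by (simp only: app eqs hermitian_product_adjoint)
      qed
      then show "S = inner_extension V f (adjoint_matrix A)"
        unfolding N using matrix_eq_hermitian by metis
    qed
    then show "inner_extension V f (adjoint_matrix A) = (THE S. S \<in> linear_maps V V \<and>
        (\<forall>v\<in>elems V. \<forall>w\<in>elems V. herm V (S v) w = herm V v (inner_extension V f A w)))" by simp
  qed
qed

lemma inner_extension_comp:
  assumes f: "f \<in> unitary_isos coordinate_space V" and u: "u \<in> unitary_matrices"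
  shows "inner_extension V (f \<circ> (*v) u) M = inner_extension V f (conjugation u M)"
proof -
  have fu: "f \<circ> (*v) u \<in> unitary_isos coordinate_space V"
    using unitary_iso_comp[OF f] u unitary_automorphisms by blast
  show ?thesis
  proof (rule endomorphism_eqI[OF fu])
    fix v
    have "inner_extension V (f \<circ> (*v) u) M ((f \<circ> (*v) u) v) = f (u *v (M *v v))"
      by (subst inner_extension_apply[OF fu]) simp
    also have "\<dots> = f (conjugation u M *v (u *v v))"
      using u by (simp add: conjugation_def matrix_vector_mul_assoc unitary_cancel)
    finally show "inner_extension V (f \<circ> (*v) u) M ((f \<circ> (*v) u) v) = inner_extension V f (conjugation u M) ((f \<circ> (*v) u) v)"
      by (simp add: inner_extension_apply[OF f])
  qed (simp_all add: inner_extension_def)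
qed

section \<open>Endomorphism bundles and bundles of homomorphisms\<close>

lemma prod_top_of_set_euclidean: "prod_topology (top_of_set S) euclidean = top_of_set (S \<times> UNIV)"
  by (metis prod_topology_subtopology_eu subtopology_UNIV)

text \<open>
  For linear maps in finite dimension, pointwise convergence is locally uniform, because the
  values on a basis determine the map.
\<close>

lemma evaluation_continuous:
  fixes L :: "('a::euclidean_space \<Rightarrow> 'b::real_normed_vector) set"
  assumes L: "\<And>f. f \<in> L \<Longrightarrow> linear f"
  shows "continuous_on (L \<times> UNIV) (\<lambda>(f, x). f x)"
proof -
  have "f x = (\<Sum>b\<in>Basis. (x \<bullet> b) *\<^sub>R f b)" if "f \<in> L" for f x
  proof -
    have "f x = f (\<Sum>b\<in>Basis. (x \<bullet> b) *\<^sub>R b)" by (simp add: euclidean_representation)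
    then show ?thesis using L[OF that] by (simp add: linear_sum linear_scale o_def)
  qed
  moreover have "continuous_on (L \<times> UNIV) (\<lambda>p. \<Sum>b\<in>Basis. (snd p \<bullet> b) *\<^sub>R fst p b)"
  proof (intro continuous_intros)
    fix b :: 'a
    show "continuous_on (L \<times> UNIV) (\<lambda>p. fst p b)"
      by (rule continuous_on_compose2[OF continuous_on_product_coordinates[of b]]) (auto intro: continuous_intros)
  qed
  ultimately show ?thesis
    by (subst continuous_on_cong[OF refl, where g = "\<lambda>p. \<Sum>b\<in>Basis. (snd p \<bullet> b) *\<^sub>R fst p b"]) auto
qed

lemma composition_continuous:
  fixes L :: "('a::euclidean_space \<Rightarrow> 'b::real_normed_vector) set" and L' :: "('c \<Rightarrow> 'a) set"
  assumes L: "\<And>f. f \<in> L \<Longrightarrow> linear f"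
  shows "continuous_on (L \<times> L') (\<lambda>(f, g). f \<circ> g)"
proof (rule continuous_on_coordinatewise_then_product)
  fix v
  have "continuous_on (L \<times> L') (\<lambda>p. snd p v)"
    by (rule continuous_on_compose2[OF continuous_on_product_coordinates[of v]]) (auto intro: continuous_intros)
  then have "continuous_on (L \<times> L') (\<lambda>p. (fst p, snd p v))"
    by (intro continuous_intros)
  moreover have "continuous_on ((\<lambda>p. (fst p, snd p v)) ` (L \<times> L')) (\<lambda>(f, x). f x)"
    by (rule continuous_on_subset[OF evaluation_continuous[OF L]]) auto
  ultimately have "continuous_on (L \<times> L') ((\<lambda>(f, x). f x) \<circ> (\<lambda>p. (fst p, snd p v)))"
    by (rule continuous_on_compose)
  then show "continuous_on (L \<times> L') (\<lambda>p. (case p of (f, g) \<Rightarrow> f \<circ> g) v)"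
    by (simp add: case_prod_unfold o_def)
qed

lemma matrix_vector_linear: "linear ((*v) (u :: complex^'n::finite^'m::finite))"
proof (rule linearI)
  show "u *v (r *\<^sub>R x) = r *\<^sub>R (u *v x)" for r x
    by (simp add: vec_eq_iff matrix_vector_mult_def scaleR_sum_right)
qed (simp add: matrix_vector_right_distrib)

lemma star_hom_linear:
  assumes "f \<in> star_homs (matrix_algebra :: (complex^'n::finite^'n) star_algebra) (matrix_algebra :: (complex^'m::finite^'m) star_algebra)"
  shows "linear f"
proof (rule linearI)
  have s: "r *\<^sub>R A = mat (of_real r) ** A" for r and A :: "complex^'p::finite^'p"
    by (simp add: vec_eq_iff mat_mult_component) (simp add: scaleR_conv_of_real)
  show "f (r *\<^sub>R A) = r *\<^sub>R f A" for r A
    unfolding s by (rule star_hom_simps(2)[OF assms])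
qed (rule star_hom_simps(1)[OF assms])

lemma star_iso_linear:
  "f \<in> star_isos matrix_algebra matrix_algebra \<Longrightarrow> linear f"
  by (rule star_hom_linear) (simp add: star_isos_def)

lemma id_unitary_iso: "id \<in> unitary_isos coordinate_space coordinate_space"
proof -
  have "id = (*v) (mat 1 :: complex^'n::finite^'n)" by (simp add: fun_eq_iff)
  then show ?thesis unfolding unitary_automorphisms by (metis image_eqI unitary_one)
qed

lemma id_star_iso: "id \<in> star_isos matrix_algebra matrix_algebra"
proof -
  have "id = conjugation (mat 1 :: complex^'n::finite^'n)" by (simp add: fun_eq_iff)
  then show ?thesis unfolding star_automorphisms by (metis image_eqI unitary_one)
qed

lemma unitary_frame_structure:
  assumes "locally_trivial (unitary_isos (coordinate_space :: (complex^'k::finite) hermitian_space)) \<xi>"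
  shows "frame_structure (unitary_isos (coordinate_space :: (complex^'k) hermitian_space)) \<xi>
    (unitary_isos coordinate_space coordinate_space)"
proof
  let ?aut = "unitary_isos (coordinate_space :: (complex^'k) hermitian_space) (coordinate_space :: (complex^'k) hermitian_space)"
  show "\<exists>U h. x \<in> U \<and> chart (unitary_isos (coordinate_space :: (complex^'k) hermitian_space)) \<xi> U h"
    if "x \<in> topspace (base \<xi>)" for x
    using assms that by (simp add: locally_trivial_def)
  show "inj f" if "f \<in> unitary_isos (coordinate_space :: (complex^'k) hermitian_space) V" for f and V :: "'c hermitian_space"
    using that by (auto simp: unitary_isos_iff bij_betw_def)
  show "range f = range f'" if "f \<in> unitary_isos coordinate_space V" "f' \<in> unitary_isos coordinate_space V"
    for f f' :: "complex^'k \<Rightarrow> 'c" and V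
    using that by (auto simp: unitary_isos_iff bij_betw_def)
  show "bij g" if "g \<in> ?aut" for g using that by (simp add: unitary_isos_iff)
  show "inv g \<in> ?aut" if "g \<in> ?aut" for g
    using unitary_iso_inv_comp[OF id_unitary_iso that] by simp
  have "linear f" if "f \<in> ?aut" for f
    using that matrix_vector_linear unfolding unitary_automorphisms by blast
  then have "continuous_on (?aut \<times> ?aut) (\<lambda>(f, g). f \<circ> g)"
    by (rule composition_continuous)
  moreover have "f \<circ> g \<in> ?aut" if "f \<in> ?aut" "g \<in> ?aut" for f g using that by (rule unitary_iso_comp)
  ultimately show "continuous_map (prod_topology (top_of_set ?aut) (top_of_set ?aut)) (top_of_set ?aut) (\<lambda>(g, g'). g \<circ> g')"
    by (auto simp: continuous_map_in_subtopology)
qed (auto intro: unitary_iso_comp unitary_iso_inv_comp)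

lemma star_frame_structure:
  assumes "locally_trivial (star_isos (matrix_algebra :: (complex^'k::finite^'k) star_algebra)) A"
  shows "frame_structure (star_isos (matrix_algebra :: (complex^'k^'k) star_algebra)) A
    (star_isos matrix_algebra matrix_algebra)"
proof
  let ?aut = "star_isos (matrix_algebra :: (complex^'k^'k) star_algebra) (matrix_algebra :: (complex^'k^'k) star_algebra)"
  show "\<exists>U h. x \<in> U \<and> chart (star_isos (matrix_algebra :: (complex^'k^'k) star_algebra)) A U h"
    if "x \<in> topspace (base A)" for x
    using assms that by (simp add: locally_trivial_def)
  show "inj f" if "f \<in> star_isos (matrix_algebra :: (complex^'k^'k) star_algebra) V" for f and V :: "'c star_algebra"
    using star_iso_simps(6)[OF that] by (simp add: bij_betw_def)
  show "range f = range f'" if "f \<in> star_isos matrix_algebra V" "f' \<in> star_isos matrix_algebra V"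
    for f f' :: "complex^'k^'k \<Rightarrow> 'c" and V
    using that[THEN star_iso_simps(6)] by (simp add: bij_betw_def)
  show "bij g" if "g \<in> ?aut" for g using star_iso_simps(6)[OF that] by simp
  show "inv g \<in> ?aut" if "g \<in> ?aut" for g
    using star_iso_inv_comp[OF id_star_iso that] by simp
  have "continuous_on (?aut \<times> ?aut) (\<lambda>(f, g). f \<circ> g)"
    by (rule composition_continuous) (rule star_iso_linear)
  moreover have "f \<circ> g \<in> ?aut" if "f \<in> ?aut" "g \<in> ?aut" for f g using that by (rule star_iso_comp)
  ultimately show "continuous_map (prod_topology (top_of_set ?aut) (top_of_set ?aut)) (top_of_set ?aut) (\<lambda>(g, g'). g \<circ> g')"
    by (auto simp: continuous_map_in_subtopology)
qed (auto intro: star_iso_comp star_iso_inv_comp)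

lemma matrix_of_mult [simp]: "matrix ((*v) u) = u" for u :: "complex^'n::finite^'m::finite"
  by (rule matrix_of_matrix_vector_mul)

lemma continuous_on_matrix: "continuous_on S (\<lambda>g. matrix g :: complex^'n::finite^'m::finite)"
proof -
  have "continuous_on S (\<lambda>g :: complex^'n \<Rightarrow> complex^'m. g (axis j 1) $ i)" for i j
    by (intro continuous_on_component continuous_on_subset[OF continuous_on_product_coordinates]) simp
  then show ?thesis unfolding matrix_def by (intro continuous_on_vec_lambda)
qed

lemma unitary_aut_matrix:
  assumes "g \<in> unitary_isos coordinate_space (coordinate_space :: (complex^'n::finite) hermitian_space)"
  shows "matrix g \<in> unitary_matrices" "g = (*v) (matrix g)" "matrix (inv g) = adjoint_matrix (matrix g)"
proof -
  obtain u where u: "u \<in> unitary_matrices" "g = (*v) u" using assms unfolding unitary_automorphisms by blast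
  then show "matrix g \<in> unitary_matrices" "g = (*v) (matrix g)" by simp_all
  have "inv g = (*v) (adjoint_matrix u)"
    unfolding u(2) by (rule inv_equality) (simp_all add: matrix_vector_mul_assoc unitary_left[OF u(1)] unitary_right[OF u(1)])
  then show "matrix (inv g) = adjoint_matrix (matrix g)" by (simp add: u(2))
qed

lemma End_associated_bundle:
  assumes "locally_trivial (unitary_isos (coordinate_space :: (complex^'k::finite) hermitian_space)) \<xi>"
  shows "associated_bundle (unitary_isos (coordinate_space :: (complex^'k) hermitian_space)) \<xi>
    (unitary_isos coordinate_space coordinate_space) euclidean
    (\<lambda>x. elems (endomorphism_algebra (fibre \<xi> x))) (\<lambda>g. conjugation (matrix g)) (\<lambda>x. inner_extension (fibre \<xi> x))"
proof -
  interpret frame_structure "unitary_isos (coordinate_space :: (complex^'k) hermitian_space)" \<xi>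
    "unitary_isos coordinate_space coordinate_space"
    by (rule unitary_frame_structure[OF assms])
  let ?aut = "unitary_isos (coordinate_space :: (complex^'k) hermitian_space) (coordinate_space :: (complex^'k) hermitian_space)"
  show ?thesis
  proof
    have "continuous_on (?aut \<times> UNIV) (\<lambda>p. conjugation (matrix (fst p)) (snd p))"
      unfolding conjugation_def
      by (intro continuous_on_matrix_mult continuous_on_adjoint continuous_on_snd continuous_on_id
          continuous_on_compose2[OF continuous_on_matrix continuous_on_fst[OF continuous_on_id] subset_UNIV])
    then show "continuous_map (prod_topology (top_of_set ?aut) euclidean) euclidean (\<lambda>(g, t). conjugation (matrix g) t)"
      by (simp add: case_prod_unfold prod_top_of_set_euclidean)
    show "conjugation (matrix g) (conjugation (matrix (inv g)) t) = t" if "g \<in> ?aut" for g t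
      using unitary_aut_matrix[OF that] by (simp add: unitary_right flip: conjugation_mult)
    show "inner_extension (fibre \<xi> x) (f \<circ> g) t = inner_extension (fibre \<xi> x) f (conjugation (matrix g) t)"
      if "f \<in> unitary_isos coordinate_space (fibre \<xi> x)" "g \<in> ?aut" for x f g t
      using inner_extension_comp[OF that(1) unitary_aut_matrix(1)[OF that(2)]] unitary_aut_matrix(2)[OF that(2)] by metis
    show "bij_betw (inner_extension (fibre \<xi> x) f) (topspace euclidean) (elems (endomorphism_algebra (fibre \<xi> x)))"
      if "f \<in> unitary_isos coordinate_space (fibre \<xi> x)" for x and f
      using star_iso_simps(6)[OF inner_extension_star_iso[OF that]] by simp
  qed
qed

lemma End_chart:
  assumes lt: "locally_trivial (unitary_isos (coordinate_space :: (complex^'k::finite) hermitian_space)) \<xi>"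
    and c: "chart (unitary_isos (coordinate_space :: (complex^'k) hermitian_space)) \<xi> U h"
  shows "chart (star_isos (matrix_algebra :: (complex^'k^'k) star_algebra)) (End_bundle TYPE('k) \<xi>) U
    (\<lambda>x. inner_extension (fibre \<xi> x) (h x))"
proof -
  interpret associated_bundle "unitary_isos (coordinate_space :: (complex^'k) hermitian_space)" \<xi>
    "unitary_isos coordinate_space coordinate_space" euclidean "\<lambda>x. elems (endomorphism_algebra (fibre \<xi> x))"
    "\<lambda>g. conjugation (matrix g)" "\<lambda>x. inner_extension (fibre \<xi> x)"
    by (rule End_associated_bundle[OF lt])
  have total: "total_space (End_bundle TYPE('k) \<xi>) = total"
    unfolding total_def by (simp add: End_bundle_def inner_extension_def[abs_def])
  show ?thesis
    unfolding chart_def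
  proof (intro conjI ballI)
    show "openin (base (End_bundle TYPE('k) \<xi>)) U"
      using chart_base[OF c] by (simp add: End_bundle_def)
    show "inner_extension (fibre \<xi> x) (h x) \<in> star_isos matrix_algebra (fibre (End_bundle TYPE('k) \<xi>) x)" if "x \<in> U" for x
      using inner_extension_star_iso[OF chart_iso[OF c that]] by (simp add: End_bundle_def)
    show "homeomorphic_map (prod_topology (subtopology (base (End_bundle TYPE('k) \<xi>)) U) euclidean)
       (subtopology (total_space (End_bundle TYPE('k) \<xi>)) (U \<times> UNIV)) (\<lambda>(x, v). (x, inner_extension (fibre \<xi> x) (h x) v))"
      using chart_map_homeomorphic[OF c] unfolding total by (simp add: End_bundle_def chart_map_def)
  qed
qed

lemma End_locally_trivial:
  assumes lt: "locally_trivial (unitary_isos (coordinate_space :: (complex^'k::finite) hermitian_space)) \<xi>"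
  shows "locally_trivial (star_isos (matrix_algebra :: (complex^'k^'k) star_algebra)) (End_bundle TYPE('k) \<xi>)"
proof -
  interpret associated_bundle "unitary_isos (coordinate_space :: (complex^'k) hermitian_space)" \<xi>
    "unitary_isos coordinate_space coordinate_space" euclidean "\<lambda>x. elems (endomorphism_algebra (fibre \<xi> x))"
    "\<lambda>g. conjugation (matrix g)" "\<lambda>x. inner_extension (fibre \<xi> x)"
    by (rule End_associated_bundle[OF lt])
  have total: "total_space (End_bundle TYPE('k) \<xi>) = total"
    unfolding total_def by (simp add: End_bundle_def inner_extension_def[abs_def])
  have base: "base (End_bundle TYPE('k) \<xi>) = base \<xi>" by (simp add: End_bundle_def)
  show ?thesis
    unfolding locally_trivial_def total base
    using continuous_map_total_fst local_charts End_chart[OF lt] by blast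
qed

text \<open>
  The homomorphism on \<open>X\<close> that corresponds to \<open>\<phi>\<close> on the model under the frame \<open>f\<close>.
\<close>

definition hom_transport :: "'a star_algebra \<Rightarrow> ('m \<Rightarrow> 'a) \<Rightarrow> ('m \<Rightarrow> 'b) \<Rightarrow> 'a \<Rightarrow> 'b" where
  "hom_transport X f \<phi> = (\<lambda>a\<in>elems X. \<phi> (inv f a))"

lemma hom_transport_apply:
  assumes "f \<in> star_isos matrix_algebra X"
  shows "hom_transport X f \<phi> (f M) = \<phi> M"
  using star_iso_simps(6)[OF assms] by (auto simp: hom_transport_def bij_betw_def)

lemma hom_transport_bij:
  fixes f :: "complex^'n::finite^'n \<Rightarrow> 'a"
  assumes f: "f \<in> star_isos matrix_algebra X"
  shows "bij_betw (hom_transport X f) (star_homs matrix_algebra (matrix_algebra :: (complex^'m::finite^'m) star_algebra))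
    (star_homs X matrix_algebra)"
proof (rule bij_betw_byWitness[where f' = "\<lambda>\<psi>. \<psi> \<circ> f"])
  note fs = star_iso_simps[OF f]
  have img: "elems X = range f" using fs(6) by (simp add: bij_betw_def)
  note app = hom_transport_apply[OF f]
  show "\<forall>\<phi>\<in>star_homs matrix_algebra (matrix_algebra :: (complex^'m^'m) star_algebra). hom_transport X f \<phi> \<circ> f = \<phi>"
    by (simp add: fun_eq_iff app)
  show "\<forall>\<psi>\<in>star_homs X (matrix_algebra :: (complex^'m^'m) star_algebra). hom_transport X f (\<psi> \<circ> f) = \<psi>"
  proof
    fix \<psi> :: "'a \<Rightarrow> complex^'m^'m" assume "\<psi> \<in> star_homs X matrix_algebra"
    then have "\<psi> \<in> extensional (elems X)" by (simp add: star_homs_def linear_maps_def PiE_def)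
    moreover have "hom_transport X f (\<psi> \<circ> f) a = \<psi> a" if "a \<in> elems X" for a
      using that unfolding img by (auto simp: app)
    ultimately show "hom_transport X f (\<psi> \<circ> f) = \<psi>"
      by (intro extensionalityI[of _ "elems X"]) (simp_all add: hom_transport_def)
  qed
  show "hom_transport X f ` star_homs matrix_algebra (matrix_algebra :: (complex^'m^'m) star_algebra) \<subseteq> star_homs X matrix_algebra"
  proof clarify
    fix \<phi> :: "complex^'n^'n \<Rightarrow> complex^'m^'m" assume \<phi>: "\<phi> \<in> star_homs matrix_algebra matrix_algebra"
    note \<phi>s = star_hom_simps[OF \<phi>]
    have ext: "hom_transport X f \<phi> \<in> extensional (elems X)" by (simp add: hom_transport_def)
    show "hom_transport X f \<phi> \<in> star_homs X matrix_algebra"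
      unfolding star_homs_def linear_maps_def mem_Collect_eq matrix_algebra_simps PiE_def
    proof (intro conjI ballI allI IntI ext)
      fix a b c assume "a \<in> elems X" "b \<in> elems X"
      then obtain M N where MN: "a = f M" "b = f N" unfolding img by blast
      show "hom_transport X f \<phi> (vadd X a b) = hom_transport X f \<phi> a + hom_transport X f \<phi> b"
        unfolding MN fs(1)[symmetric] app by (rule \<phi>s)
      show "hom_transport X f \<phi> (amult X a b) = hom_transport X f \<phi> a ** hom_transport X f \<phi> b"
        unfolding MN fs(3)[symmetric] app by (rule \<phi>s)
    next
      fix a c assume "a \<in> elems X"
      then obtain M where M: "a = f M" unfolding img by blast
      show "hom_transport X f \<phi> (vscale X c a) = mat c ** hom_transport X f \<phi> a"
        unfolding M fs(2)[symmetric] app by (rule \<phi>s)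
      show "hom_transport X f \<phi> (astar X a) = adjoint_matrix (hom_transport X f \<phi> a)"
        unfolding M fs(5)[symmetric] app by (rule \<phi>s)
    next
      show "hom_transport X f \<phi> (aone X) = mat 1"
        unfolding fs(4)[symmetric] app by (rule \<phi>s)
    qed simp
  qed
  show "(\<lambda>\<psi>. \<psi> \<circ> f) ` star_homs X (matrix_algebra :: (complex^'m^'m) star_algebra) \<subseteq> star_homs matrix_algebra matrix_algebra"
  proof clarify
    fix \<psi> :: "'a \<Rightarrow> complex^'m^'m" assume \<psi>: "\<psi> \<in> star_homs X matrix_algebra"
    have mem: "f M \<in> elems X" for M by (simp add: img)
    have \<psi>s: "\<psi> (vadd X (f M) (f N)) = \<psi> (f M) + \<psi> (f N)" "\<psi> (vscale X c (f M)) = mat c ** \<psi> (f M)"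
      "\<psi> (amult X (f M) (f N)) = \<psi> (f M) ** \<psi> (f N)" "\<psi> (aone X) = mat 1"
      "\<psi> (astar X (f M)) = adjoint_matrix (\<psi> (f M))" for M N c
      using \<psi> mem by (simp_all add: star_homs_def linear_maps_def)
    show "\<psi> \<circ> f \<in> star_homs matrix_algebra matrix_algebra"
      unfolding star_homs_matrix_iff comp_apply
    proof (intro conjI allI)
      fix A B c
      show "\<psi> (f (A + B)) = \<psi> (f A) + \<psi> (f B)" unfolding fs(1) by (rule \<psi>s)
      show "\<psi> (f (mat c ** A)) = mat c ** \<psi> (f A)" unfolding fs(2) by (rule \<psi>s)
      show "\<psi> (f (A ** B)) = \<psi> (f A) ** \<psi> (f B)" unfolding fs(3) by (rule \<psi>s)
      show "\<psi> (f (mat 1)) = mat 1" unfolding fs(4) by (rule \<psi>s)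
      show "\<psi> (f (adjoint_matrix A)) = adjoint_matrix (\<psi> (f A))" unfolding fs(5) by (rule \<psi>s)
    qed
  qed
qed

lemma hom_transport_comp:
  assumes f: "f \<in> star_isos matrix_algebra X" and \<alpha>: "\<alpha> \<in> star_isos matrix_algebra matrix_algebra"
  shows "hom_transport X (f \<circ> \<alpha>) \<phi> = hom_transport X f (\<phi> \<circ> inv \<alpha>)"
proof (rule extensionalityI[of _ "elems X"])
  fix a assume "a \<in> elems X"
  then obtain M where "a = f M" using star_iso_simps(6)[OF f] by (auto simp: bij_betw_def)
  moreover have "M = \<alpha> (inv \<alpha> M)" using star_iso_simps(6)[OF \<alpha>] by (simp add: bij_betw_def f_inv_into_f)
  ultimately have a: "a = (f \<circ> \<alpha>) (inv \<alpha> M)" "a = f M" by simp_all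
  show "hom_transport X (f \<circ> \<alpha>) \<phi> a = hom_transport X f (\<phi> \<circ> inv \<alpha>) a"
    using hom_transport_apply[OF star_iso_comp[OF f \<alpha>], of \<phi> "inv \<alpha> M"] hom_transport_apply[OF f, of "\<phi> \<circ> inv \<alpha>" M]
    unfolding a(1)[symmetric] a(2)[symmetric] by simp
qed (simp_all add: hom_transport_def)

text \<open>
  The trace pairing of matrices is invariant under automorphisms; hence the inverse depends
  continuously on the automorphism for pointwise convergence.
\<close>

lemma star_automorphism_inverse:
  assumes "\<alpha> \<in> star_isos (matrix_algebra :: (complex^'n::finite^'n) star_algebra) (matrix_algebra :: (complex^'n^'n) star_algebra)"
  shows "inv \<alpha> M $ i $ j = trace (\<alpha> (matrix_unit j i) ** M)"
proof -
  obtain g where g: "g \<in> unitary_matrices" "\<alpha> = conjugation g"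
    using assms unfolding star_automorphisms by blast
  have "inv \<alpha> = conjugation (adjoint_matrix g)"
    unfolding g(2) by (rule inv_equality) (simp_all add: unitary_left[OF g(1)] unitary_right[OF g(1)] flip: conjugation_mult)
  then have "inv \<alpha> M $ i $ j = (adjoint_matrix g ** M ** g) $ i $ j" by (simp add: conjugation_def)
  also have "\<dots> = trace (matrix_unit j i ** (adjoint_matrix g ** M ** g))"
    by (simp add: trace_def matrix_unit_mult_left)
  also have "\<dots> = trace (g ** (matrix_unit j i ** (adjoint_matrix g ** M)))"
    by (subst trace_mul_sym[of g]) (simp only: matrix_mul_assoc)
  also have "\<dots> = trace (\<alpha> (matrix_unit j i) ** M)"
    by (simp only: g(2) conjugation_def matrix_mul_assoc)
  finally show ?thesis .
qed

lemma continuous_on_star_inverse: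
  "continuous_on (star_isos (matrix_algebra :: (complex^'n::finite^'n) star_algebra) (matrix_algebra :: (complex^'n^'n) star_algebra)) inv"
proof (rule continuous_on_coordinatewise_then_product)
  let ?aut = "star_isos (matrix_algebra :: (complex^'n::finite^'n) star_algebra) (matrix_algebra :: (complex^'n^'n) star_algebra)"
  fix M :: "complex^'n^'n"
  have c: "continuous_on ?aut (\<lambda>\<alpha>. \<alpha> E)" for E
    by (rule continuous_on_subset[OF continuous_on_product_coordinates]) simp
  have "continuous_on ?aut (\<lambda>\<alpha>. \<chi> i j. trace (\<alpha> (matrix_unit j i) ** M))"
    unfolding trace_def
    by (intro continuous_on_vec_lambda continuous_on_sum continuous_on_component continuous_on_matrix_mult c continuous_on_const)
  then show "continuous_on ?aut (\<lambda>\<alpha>. inv \<alpha> M)"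
  proof (rule continuous_on_eq)
    fix \<alpha> assume "\<alpha> \<in> ?aut"
    from star_automorphism_inverse[OF this]
    show "(\<chi> i j. trace (\<alpha> (matrix_unit j i) ** M)) = inv \<alpha> M" by (simp add: vec_eq_iff)
  qed
qed

lemma H_associated_bundle:
  assumes "locally_trivial (star_isos (matrix_algebra :: (complex^'k::finite^'k) star_algebra)) A"
  shows "associated_bundle (star_isos (matrix_algebra :: (complex^'k^'k) star_algebra)) A
    (star_isos matrix_algebra matrix_algebra)
    (top_of_set (star_homs matrix_algebra (matrix_algebra :: (complex^'m::finite^'m) star_algebra)))
    (\<lambda>x. star_homs (fibre A x) matrix_algebra) (\<lambda>\<alpha> \<phi>. \<phi> \<circ> inv \<alpha>) (\<lambda>x. hom_transport (fibre A x))"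
proof -
  interpret frame_structure "star_isos (matrix_algebra :: (complex^'k^'k) star_algebra)" A
    "star_isos matrix_algebra matrix_algebra"
    by (rule star_frame_structure[OF assms])
  let ?aut = "star_isos (matrix_algebra :: (complex^'k^'k) star_algebra) (matrix_algebra :: (complex^'k^'k) star_algebra)"
  let ?F = "star_homs (matrix_algebra :: (complex^'k^'k) star_algebra) (matrix_algebra :: (complex^'m^'m) star_algebra)"
  have inv_hom: "inv \<alpha> \<in> star_homs matrix_algebra matrix_algebra" if "\<alpha> \<in> ?aut" for \<alpha>
    using aut_inv[OF that] by (simp add: star_isos_def)
  show ?thesis
  proof
    have "continuous_on (?aut \<times> ?F) (\<lambda>p. (snd p, inv (fst p)))"
      by (intro continuous_on_Pair continuous_on_snd continuous_on_id
          continuous_on_compose2[OF continuous_on_star_inverse continuous_on_fst[OF continuous_on_id]]) auto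
    moreover have "continuous_on ((\<lambda>p. (snd p, inv (fst p))) ` (?aut \<times> ?F)) (\<lambda>(f, g). f \<circ> g)"
      by (rule continuous_on_subset[OF composition_continuous[of ?F UNIV, OF star_hom_linear]]) auto
    ultimately have "continuous_on (?aut \<times> ?F) ((\<lambda>(f, g). f \<circ> g) \<circ> (\<lambda>p. (snd p, inv (fst p))))"
      by (rule continuous_on_compose)
    moreover have "\<phi> \<circ> inv \<alpha> \<in> ?F" if "\<alpha> \<in> ?aut" "\<phi> \<in> ?F" for \<alpha> \<phi>
      by (rule star_hom_comp[OF that(2) inv_hom[OF that(1)]])
    ultimately show "continuous_map (prod_topology (top_of_set ?aut) (top_of_set ?F)) (top_of_set ?F) (\<lambda>(\<alpha>, \<phi>). \<phi> \<circ> inv \<alpha>)"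
      by (auto simp: continuous_map_in_subtopology case_prod_unfold o_def)
    show "\<phi> \<circ> inv (inv \<alpha>) \<circ> inv \<alpha> = \<phi>" if "\<alpha> \<in> ?aut" for \<alpha> and \<phi> :: "complex^'k^'k \<Rightarrow> complex^'m^'m"
      using aut_bij[OF that] by (simp add: fun_eq_iff inv_inv_eq bij_is_surj surj_f_inv_f)
    show "hom_transport (fibre A x) (f \<circ> \<alpha>) \<phi> = hom_transport (fibre A x) f (\<phi> \<circ> inv \<alpha>)"
      if "f \<in> star_isos matrix_algebra (fibre A x)" "\<alpha> \<in> ?aut" for x f \<alpha> and \<phi> :: "complex^'k^'k \<Rightarrow> complex^'m^'m"
      by (rule hom_transport_comp[OF that])
    show "bij_betw (hom_transport (fibre A x) f) (topspace (top_of_set ?F)) (star_homs (fibre A x) matrix_algebra)"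
      if "f \<in> star_isos matrix_algebra (fibre A x)" for x f
      using hom_transport_bij[OF that] by simp
  qed
qed

lemma inner_extension_frame:
  assumes f: "f \<in> unitary_isos coordinate_space V"
    and g: "g \<in> unitary_isos coordinate_space (coordinate_space :: (complex^'k::finite) hermitian_space)"
  shows "inner_extension V (f \<circ> g) = inner_extension V f \<circ> conjugation (matrix g)"
  using inner_extension_comp[OF f unitary_aut_matrix(1)[OF g]]
  unfolding unitary_aut_matrix(2)[OF g, symmetric] by (simp add: fun_eq_iff)

text \<open>
  The homomorphism bundle of the endomorphism bundle, described directly by the frames of the
  vector bundle: the unitary group acts on homomorphisms through conjugation.
\<close>

lemma End_H_associated_bundle:
  assumes "locally_trivial (unitary_isos (coordinate_space :: (complex^'k::finite) hermitian_space)) \<xi>"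
  shows "associated_bundle (unitary_isos (coordinate_space :: (complex^'k) hermitian_space)) \<xi>
    (unitary_isos coordinate_space coordinate_space)
    (top_of_set (star_homs matrix_algebra (matrix_algebra :: (complex^'m::finite^'m) star_algebra)))
    (\<lambda>x. star_homs (endomorphism_algebra (fibre \<xi> x)) matrix_algebra)
    (\<lambda>g \<phi>. \<phi> \<circ> conjugation (adjoint_matrix (matrix g)))
    (\<lambda>x f. hom_transport (endomorphism_algebra (fibre \<xi> x)) (inner_extension (fibre \<xi> x) f))"
proof -
  interpret frame_structure "unitary_isos (coordinate_space :: (complex^'k) hermitian_space)" \<xi>
    "unitary_isos coordinate_space coordinate_space"
    by (rule unitary_frame_structure[OF assms])
  let ?aut = "unitary_isos (coordinate_space :: (complex^'k) hermitian_space) (coordinate_space :: (complex^'k) hermitian_space)"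
  let ?F = "star_homs (matrix_algebra :: (complex^'k^'k) star_algebra) (matrix_algebra :: (complex^'m^'m) star_algebra)"
  show ?thesis
  proof
    have mat: "matrix g \<in> unitary_matrices" if "g \<in> ?aut" for g by (rule unitary_aut_matrix(1)[OF that])
    have "continuous_on (?aut \<times> ?F) (\<lambda>p. conjugation (adjoint_matrix (matrix (fst p))))"
    proof (rule continuous_on_coordinatewise_then_product)
      show "continuous_on (?aut \<times> ?F) (\<lambda>p. conjugation (adjoint_matrix (matrix (fst p))) M)" for M
        unfolding conjugation_def
        by (intro continuous_on_matrix_mult continuous_on_adjoint continuous_on_const
          continuous_on_compose2[OF continuous_on_matrix continuous_on_fst[OF continuous_on_id] subset_UNIV])
    qed
    then have "continuous_on (?aut \<times> ?F) (\<lambda>p. (snd p, conjugation (adjoint_matrix (matrix (fst p)))))"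
      by (intro continuous_on_Pair continuous_on_snd continuous_on_id)
    moreover have "continuous_on ((\<lambda>p. (snd p, conjugation (adjoint_matrix (matrix (fst p))))) ` (?aut \<times> ?F)) (\<lambda>(f, g). f \<circ> g)"
      by (rule continuous_on_subset[OF composition_continuous[of ?F UNIV, OF star_hom_linear]]) auto
    ultimately have "continuous_on (?aut \<times> ?F) ((\<lambda>(f, g). f \<circ> g) \<circ> (\<lambda>p. (snd p, conjugation (adjoint_matrix (matrix (fst p))))))"
      by (rule continuous_on_compose)
    moreover have "\<phi> \<circ> conjugation (adjoint_matrix (matrix g)) \<in> ?F" if "g \<in> ?aut" "\<phi> \<in> ?F" for g \<phi>
      using conjugation_star_iso[OF unitary_adjoint[OF mat[OF that(1)]]]
      by (intro star_hom_comp[OF that(2)]) (simp add: star_isos_def)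
    ultimately show "continuous_map (prod_topology (top_of_set ?aut) (top_of_set ?F)) (top_of_set ?F)
        (\<lambda>(g, \<phi>). \<phi> \<circ> conjugation (adjoint_matrix (matrix g)))"
      by (auto simp: continuous_map_in_subtopology case_prod_unfold o_def)
    show "\<phi> \<circ> conjugation (adjoint_matrix (matrix (inv g))) \<circ> conjugation (adjoint_matrix (matrix g)) = \<phi>"
      if "g \<in> ?aut" for g and \<phi> :: "complex^'k^'k \<Rightarrow> complex^'m^'m"
      using unitary_right[OF mat[OF that]] unitary_aut_matrix(3)[OF that]
      by (simp add: fun_eq_iff flip: conjugation_mult)
    show "hom_transport (endomorphism_algebra (fibre \<xi> x)) (inner_extension (fibre \<xi> x) (f \<circ> g)) \<phi> =
        hom_transport (endomorphism_algebra (fibre \<xi> x)) (inner_extension (fibre \<xi> x) f)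
          (\<phi> \<circ> conjugation (adjoint_matrix (matrix g)))"
      if f: "f \<in> unitary_isos coordinate_space (fibre \<xi> x)" and g: "g \<in> ?aut"
      for x f g and \<phi> :: "complex^'k^'k \<Rightarrow> complex^'m^'m"
    proof -
      have "inv (conjugation (matrix g)) = conjugation (adjoint_matrix (matrix g))"
        by (rule inv_equality) (simp_all add: unitary_left[OF mat[OF g]] unitary_right[OF mat[OF g]] flip: conjugation_mult)
      then show ?thesis
        using hom_transport_comp[OF inner_extension_star_iso[OF f] conjugation_star_iso[OF mat[OF g]]]
        by (simp add: inner_extension_frame[OF f g])
    qed
    show "bij_betw (hom_transport (endomorphism_algebra (fibre \<xi> x)) (inner_extension (fibre \<xi> x) f))
        (topspace (top_of_set ?F)) (star_homs (endomorphism_algebra (fibre \<xi> x)) matrix_algebra)"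
      if "f \<in> unitary_isos coordinate_space (fibre \<xi> x)" for x f
      using hom_transport_bij[OF inner_extension_star_iso[OF that]] by simp
  qed
qed

lemma H_total_space:
  fixes A :: "('c, 'f, 'f star_algebra) fibre_bundle"
  assumes lt: "locally_trivial (star_isos (matrix_algebra :: (complex^'k::finite^'k) star_algebra)) A"
  shows "total_space (H_bundle TYPE('k) TYPE('l::finite) A) =
    associated_bundle.total (star_isos (matrix_algebra :: (complex^'k^'k) star_algebra)) A
      (top_of_set (star_homs matrix_algebra (matrix_algebra :: (complex^('k \<times> 'l)^('k \<times> 'l)) star_algebra)))
      (\<lambda>x. star_homs (fibre A x) matrix_algebra) (\<lambda>x. hom_transport (fibre A x))"
  unfolding associated_bundle.total_def[OF H_associated_bundle[OF lt]]
  by (simp add: H_bundle_def hom_transport_def[abs_def])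

text \<open>
  Both sides carry final topologies, but the left one refers to all charts of the endomorphism
  bundle, not only to those induced by charts of \<open>\<xi>\<close>. They agree because the latter are open
  embeddings for both topologies and cover.
\<close>

lemma End_H_total_space:
  fixes \<xi> :: "('b, 'e, 'e hermitian_space) fibre_bundle"
  assumes lt: "locally_trivial (unitary_isos (coordinate_space :: (complex^'k::finite) hermitian_space)) \<xi>"
  shows "total_space (H_bundle TYPE('k) TYPE('l::finite) (End_bundle TYPE('k) \<xi>)) =
    associated_bundle.total (unitary_isos (coordinate_space :: (complex^'k) hermitian_space)) \<xi>
      (top_of_set (star_homs matrix_algebra (matrix_algebra :: (complex^('k \<times> 'l)^('k \<times> 'l)) star_algebra)))
      (\<lambda>x. star_homs (endomorphism_algebra (fibre \<xi> x)) matrix_algebra)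
      (\<lambda>x f. hom_transport (endomorphism_algebra (fibre \<xi> x)) (inner_extension (fibre \<xi> x) f))"
proof -
  let ?F = "top_of_set (star_homs matrix_algebra (matrix_algebra :: (complex^('k \<times> 'l)^('k \<times> 'l)) star_algebra)) ::
    (complex^'k^'k \<Rightarrow> complex^('k \<times> 'l)^('k \<times> 'l)) topology"
  let ?I = "{(U, h). chart (unitary_isos (coordinate_space :: (complex^'k) hermitian_space)) \<xi> U h}"
  interpret L: associated_bundle "star_isos (matrix_algebra :: (complex^'k^'k) star_algebra)" "End_bundle TYPE('k) \<xi>"
    "star_isos matrix_algebra matrix_algebra" ?F
    "\<lambda>x. star_homs (fibre (End_bundle TYPE('k) \<xi>) x) matrix_algebra" "\<lambda>\<alpha> \<phi>. \<phi> \<circ> inv \<alpha>"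
    "\<lambda>x. hom_transport (fibre (End_bundle TYPE('k) \<xi>) x)"
    by (rule H_associated_bundle[OF End_locally_trivial[OF lt]])
  interpret R: associated_bundle "unitary_isos (coordinate_space :: (complex^'k) hermitian_space)" \<xi>
    "unitary_isos coordinate_space coordinate_space" ?F
    "\<lambda>x. star_homs (endomorphism_algebra (fibre \<xi> x)) matrix_algebra"
    "\<lambda>g \<phi>. \<phi> \<circ> conjugation (adjoint_matrix (matrix g))"
    "\<lambda>x f. hom_transport (endomorphism_algebra (fibre \<xi> x)) (inner_extension (fibre \<xi> x) f)"
    by (rule End_H_associated_bundle[OF lt])
  have base: "base (End_bundle TYPE('k) \<xi>) = base \<xi>"
    and fibre: "fibre (End_bundle TYPE('k) \<xi>) x = endomorphism_algebra (fibre \<xi> x)" for x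
    by (simp_all add: End_bundle_def)
  have cm: "L.chart_map (\<lambda>x. inner_extension (fibre \<xi> x) (h x)) = R.chart_map h" for h
    unfolding L.chart_map_def R.chart_map_def by (simp only: fibre)
  have "L.total = R.total"
  proof (rule topology_eq_by_cover[where I = ?I and X = "\<lambda>i. prod_topology (subtopology (base \<xi>) (fst i)) ?F"
        and p = "\<lambda>i. R.chart_map (snd i)"])
    fix i assume "i \<in> ?I"
    then have c: "chart (unitary_isos (coordinate_space :: (complex^'k) hermitian_space)) \<xi> (fst i) (snd i)" by auto
    show "open_map (prod_topology (subtopology (base \<xi>) (fst i)) ?F) L.total (R.chart_map (snd i)) \<and>
        continuous_map (prod_topology (subtopology (base \<xi>) (fst i)) ?F) L.total (R.chart_map (snd i))"
      using L.chart_map_open[OF End_chart[OF lt c]] L.chart_map_continuous[OF End_chart[OF lt c]]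
      unfolding cm base by blast
    show "open_map (prod_topology (subtopology (base \<xi>) (fst i)) ?F) R.total (R.chart_map (snd i)) \<and>
        continuous_map (prod_topology (subtopology (base \<xi>) (fst i)) ?F) R.total (R.chart_map (snd i))"
      using R.chart_map_open[OF c] R.chart_map_continuous[OF c] by blast
  next
    show *: "\<exists>i\<in>?I. y \<in> R.chart_map (snd i) ` topspace (prod_topology (subtopology (base \<xi>) (fst i)) ?F)"
      if "y \<in> topspace R.total" for y
      using R.chart_map_cover[OF that] by (metis (no_types, lifting) case_prod_unfold)
    have tops: "topspace L.total = topspace R.total"
      using L.topspace_total R.topspace_total by (simp only: base fibre)
    fix y assume "y \<in> topspace L.total"
    then have "y \<in> topspace R.total" unfolding tops .
    then show "\<exists>i\<in>?I. y \<in> R.chart_map (snd i) ` topspace (prod_topology (subtopology (base \<xi>) (fst i)) ?F)"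
      by (rule *)
  qed
  then show ?thesis
    unfolding H_total_space[OF End_locally_trivial[OF lt]] .
qed

text \<open>
  After moving \<open>w\<close> by \<open>g \<otimes> 1\<close> the two amplifications agree, so the two unitary
  matrices differ by an element of the commutant of all \<open>M \<otimes> 1\<close>.
\<close>

lemma amplification_fibre:
  assumes w: "w \<in> unitary_matrices" "w' \<in> unitary_matrices" and g: "g \<in> unitary_matrices"
    and eq: "\<And>M. amplification w' M = amplification w (conjugation g M)"
  obtains h where "h \<in> unitary_matrices" "w' = w ** kronecker g h"
proof -
  have k: "kronecker g (mat 1 :: complex^'b^'b) \<in> unitary_matrices" by (rule kronecker_unitary[OF g unitary_one])
  define u where "u = w ** kronecker g (mat 1)"
  have u: "u \<in> unitary_matrices" unfolding u_def by (rule unitary_mult[OF w(1) k])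
  define v where "v = adjoint_matrix u ** w'"
  have v: "v \<in> unitary_matrices" unfolding v_def by (intro unitary_mult unitary_adjoint u w)
  have amp: "amplification w' M = amplification u M" for M
    unfolding u_def by (simp add: eq amplification_kronecker)
  have "v ** kronecker M (mat 1) = kronecker M (mat 1) ** v" for M
  proof -
    have "adjoint_matrix u ** amplification w' M ** w' = adjoint_matrix u ** amplification u M ** w'"
      by (simp only: amp)
    then show ?thesis
      using u w by (simp add: amplification_def conjugation_def matrix_mul_assoc unitary_cancel unitary_left v_def)
  qed
  then obtain h where h: "v = kronecker (mat 1) h" by (rule commutant_amplification)
  have "kronecker (mat 1 :: complex^'a^'a) (adjoint_matrix h ** h) = kronecker (mat 1) (mat 1)"
    using v by (simp add: h unitary_matrices_def kronecker_adjoint kronecker_mult kronecker_mat)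
  then have "h \<in> unitary_matrices" by (auto simp: unitary_matrices_def dest: kronecker_one_inj)
  moreover have "w' = w ** kronecker g h"
  proof -
    have "w' = u ** v" using u by (simp add: v_def unitary_cancel)
    also have "\<dots> = w ** (kronecker g (mat 1) ** kronecker (mat 1) h)"
      by (simp only: u_def h matrix_mul_assoc)
    finally show ?thesis by (simp add: kronecker_mult)
  qed
  ultimately show thesis by (rule that)
qed

lemma amplification_continuous:
  "continuous_map (top_of_set unitary_matrices) (top_of_set (star_homs matrix_algebra matrix_algebra)) amplification"
proof -
  have "continuous_on unitary_matrices (\<lambda>w :: complex^('a::finite \<times> 'b::finite)^('a \<times> 'b). amplification w)"
  proof (rule continuous_on_coordinatewise_then_product)
    show "continuous_on unitary_matrices (\<lambda>w :: complex^('a \<times> 'b)^('a \<times> 'b). amplification w M)" for M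
      unfolding amplification_def conjugation_def by (intro continuous_intros)
  qed
  then show ?thesis
    using amplification_star_hom by (auto simp: continuous_map_in_subtopology)
qed

lemma amplification_image:
  "amplification ` unitary_matrices = star_homs matrix_algebra matrix_algebra"
  using amplification_star_hom star_hom_amplification by blast

text \<open>
  The map from a compact space to a Hausdorff space is closed, hence a quotient map; and the
  saturation of an open set is the union of its translates under \<open>U(l)\<close>.
\<close>

lemma amplification_open:
  "open_map (top_of_set unitary_matrices) (top_of_set (star_homs matrix_algebra matrix_algebra))
    (amplification :: complex^('k::finite \<times> 'l::finite)^('k \<times> 'l) \<Rightarrow> _)"
proof -
  let ?W = "top_of_set (unitary_matrices :: (complex^('k \<times> 'l)^('k \<times> 'l)) set)"
  let ?F = "top_of_set (star_homs (matrix_algebra :: (complex^'k^'k) star_algebra) (matrix_algebra :: (complex^('k \<times> 'l)^('k \<times> 'l)) star_algebra))"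
  have "compact_space ?W" by (simp add: compact_space_subtopology compact_unitary_matrices)
  moreover have "Hausdorff_space ?F"
  proof (rule Hausdorff_space_subtopology)
    have "Hausdorff_space (product_topology (\<lambda>_ :: complex^'k^'k. euclidean :: (complex^('k \<times> 'l)^('k \<times> 'l)) topology) UNIV)"
      by (simp add: Hausdorff_space_product_topology)
    then show "Hausdorff_space (euclidean :: (complex^'k^'k \<Rightarrow> complex^('k \<times> 'l)^('k \<times> 'l)) topology)"
      by (simp add: euclidean_product_topology)
  qed
  ultimately have "closed_map ?W ?F amplification"
    using amplification_continuous by (intro continuous_imp_closed_map)
  then have quot: "quotient_map ?W ?F amplification"
    using amplification_continuous amplification_image by (intro continuous_closed_imp_quotient_map) auto
  show ?thesis
    unfolding open_map_def
  proof (intro allI impI)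
    fix O' assume O': "openin ?W O'"
    have sub: "O' \<subseteq> unitary_matrices" using openin_subset[OF O'] by simp
    have "{w \<in> topspace ?W. amplification w \<in> amplification ` O'} =
        (\<Union>h\<in>unitary_matrices. {w \<in> topspace ?W. w ** kronecker (mat 1) h \<in> O'})"
    proof (intro set_eqI iffI)
      fix w assume "w \<in> {w \<in> topspace ?W. amplification w \<in> amplification ` O'}"
      then obtain w' where w: "w \<in> unitary_matrices" "w' \<in> O'" "amplification w = amplification w'" by auto
      then have "amplification w' M = amplification w (conjugation (mat 1) M)" for M by simp
      then obtain h where "h \<in> unitary_matrices" "w' = w ** kronecker (mat 1) h"
        using amplification_fibre[OF w(1) _ unitary_one] w(2) sub by blast
      then show "w \<in> (\<Union>h\<in>unitary_matrices. {w \<in> topspace ?W. w ** kronecker (mat 1) h \<in> O'})"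
        using w by auto
    next
      fix w assume "w \<in> (\<Union>h\<in>unitary_matrices. {w \<in> topspace ?W. w ** kronecker (mat 1) h \<in> O'})"
      then obtain h where h: "h \<in> unitary_matrices" "w \<in> topspace ?W" "w ** kronecker (mat 1) h \<in> O'" by blast
      have "amplification (w ** kronecker (mat 1) h) = amplification w"
        by (simp add: fun_eq_iff amplification_kronecker[OF h(1)])
      then show "w \<in> {w \<in> topspace ?W. amplification w \<in> amplification ` O'}"
        using h by (metis (mono_tags, lifting) image_eqI mem_Collect_eq)
    qed
    also have "openin ?W \<dots>"
    proof (rule openin_Union)
      fix S assume "S \<in> (\<lambda>h. {w \<in> topspace ?W. w ** kronecker (mat 1) h \<in> O'}) ` unitary_matrices"
      then obtain h :: "complex^'l^'l" where h: "h \<in> unitary_matrices" "S = {w \<in> topspace ?W. w ** kronecker (mat 1) h \<in> O'}" by blast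
      have "continuous_map ?W ?W (\<lambda>w. w ** kronecker (mat 1) h)"
        using unitary_mult[OF _ kronecker_unitary[OF unitary_one h(1)]]
        by (auto simp: continuous_map_in_subtopology intro!: continuous_intros)
      then show "openin ?W S" unfolding h(2) using O' by (rule openin_continuous_map_preimage)
    qed
    finally have pre: "openin ?W {w \<in> topspace ?W. amplification w \<in> amplification ` O'}" .
    have "amplification ` O' \<subseteq> topspace ?F"
      using sub amplification_star_hom by auto
    moreover have "\<forall>U\<subseteq>topspace ?F. openin ?W {w \<in> topspace ?W. amplification w \<in> U} = openin ?F U"
      using quot unfolding quotient_map_def by (rule conjunct2)
    ultimately have "openin ?W {w \<in> topspace ?W. amplification w \<in> amplification ` O'} = openin ?F (amplification ` O')"
      by (elim allE[of _ "amplification ` O'"] mp)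
    with pre show "openin ?F (amplification ` O')" by (rule iffD1[rotated])
  qed
qed

section \<open>Quotients of products with the unitary group\<close>

lemma continuous_map_on_fst: "continuous_map X Z f \<Longrightarrow> continuous_map (prod_topology X Y) Z (\<lambda>p. f (fst p))"
  by (rule continuous_map_compose_lambda[OF continuous_map_fst])

lemma continuous_map_on_snd: "continuous_map Y Z f \<Longrightarrow> continuous_map (prod_topology X Y) Z (\<lambda>p. f (snd p))"
  by (rule continuous_map_compose_lambda[OF continuous_map_snd])

lemma continuous_map_subtopology_compose:
  assumes "continuous_map Z X g" and "continuous_map (subtopology X {x \<in> topspace X. P x}) Y b"
    and "\<And>z. z \<in> topspace Z \<Longrightarrow> z \<in> D \<Longrightarrow> P (g z)"
  shows "continuous_map (subtopology Z D) Y (\<lambda>z. b (g z))"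
proof (rule continuous_map_compose_lambda[OF _ assms(2)])
  have "g z \<in> topspace X" if "z \<in> topspace Z" for z
    using continuous_map_image_subset_topspace[OF assms(1)] that by blast
  then show "continuous_map (subtopology Z D) (subtopology X {x \<in> topspace X. P x}) g"
    using assms(1,3) by (auto simp: continuous_map_in_subtopology continuous_map_from_subtopology)
qed

lemma continuous_map_euclidean_binary:
  fixes h :: "'a::topological_space \<Rightarrow> 'b::topological_space \<Rightarrow> 'c::topological_space"
  assumes "continuous_map X euclidean f" "continuous_map X euclidean g"
    and "continuous_on UNIV (\<lambda>p. h (fst p) (snd p))"
  shows "continuous_map X euclidean (\<lambda>x. h (f x) (g x))"
proof -
  have "continuous_map X euclidean (\<lambda>x. (f x, g x))"
    using assms(1,2) by (simp add: continuous_map_pairedI flip: prod_topology_euclidean)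
  from continuous_map_compose_lambda[OF this, of euclidean "\<lambda>p. h (fst p) (snd p)"] show ?thesis
    using assms(3) by simp
qed

lemma continuous_map_into_unitary:
  "continuous_map X (top_of_set unitary_matrices) f \<longleftrightarrow>
     continuous_map X euclidean f \<and> (\<forall>x\<in>topspace X. f x \<in> unitary_matrices)"
  by (auto simp: continuous_map_in_subtopology)

text \<open>
  Near a zero of \<open>v\<close> the product is squeezed between zero and \<open>v\<close>.
\<close>

lemma continuous_map_times_bounded:
  fixes v f :: "'a \<Rightarrow> real"
  assumes v: "continuous_map X euclideanreal v" "\<And>x. x \<in> topspace X \<Longrightarrow> 0 \<le> v x"
    and f: "continuous_map (subtopology X {x \<in> topspace X. v x > 0}) euclideanreal f"
    and bound: "\<And>x. x \<in> topspace X \<Longrightarrow> v x > 0 \<Longrightarrow> 0 \<le> f x \<and> f x \<le> 1"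
  shows "continuous_map X euclideanreal (\<lambda>x. v x * f x)"
  unfolding continuous_map_upper_lower_semicontinuous_lt
proof (intro allI conjI)
  let ?P = "{x \<in> topspace X. v x > 0}"
  have oP: "openin X ?P" by (rule openin_positive[OF v(1)])
  have c: "continuous_map (subtopology X ?P) euclideanreal (\<lambda>x. v x * f x)"
    by (rule continuous_map_real_mult[OF continuous_map_from_subtopology[OF v(1)] f])
  have part: "openin X {x \<in> ?P. v x * f x \<in> B}" if "open B" for B
  proof -
    have "openin (subtopology X ?P) {x \<in> topspace (subtopology X ?P). v x * f x \<in> B}"
      by (rule openin_continuous_map_preimage[OF c]) (simp add: that)
    moreover have "{x \<in> topspace (subtopology X ?P). v x * f x \<in> B} = {x \<in> ?P. v x * f x \<in> B}" by auto
    ultimately have "openin (subtopology X ?P) {x \<in> ?P. v x * f x \<in> B}" by (simp only:)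
    then show ?thesis using oP by (rule openin_trans_full)
  qed
  fix a :: real
  have zero: "v x = 0" if "x \<in> topspace X" "x \<notin> ?P" for x using v(2)[OF that(1)] that by auto
  have nn: "0 \<le> v x * f x" if "x \<in> topspace X" for x
    using v(2)[OF that] bound[OF that] by (cases "v x = 0") auto
  show "openin X {x \<in> topspace X. a < v x * f x}"
  proof (cases "a < 0")
    case True
    then have "{x \<in> topspace X. a < v x * f x} = topspace X" using nn by fastforce
    then show ?thesis by simp
  next
    case False
    then have "{x \<in> topspace X. a < v x * f x} = {x \<in> ?P. v x * f x \<in> {a<..}}"
      using zero by fastforce
    then show ?thesis using part[of "{a<..}"] by simp
  qed
  show "openin X {x \<in> topspace X. v x * f x < a}"
  proof (cases "a \<le> 0")
    case True
    then have "{x \<in> topspace X. v x * f x < a} = {}" using nn by fastforce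
    then show ?thesis by (metis openin_empty)
  next
    case False
    have "v x * f x < a" if "x \<in> topspace X" "v x < a" for x
    proof (cases "x \<in> ?P")
      case True
      then have "v x * f x \<le> v x * 1" using bound[OF that(1)] by (intro mult_left_mono) auto
      then show ?thesis using that by simp
    qed (use zero[OF that(1)] False in simp)
    then have "{x \<in> topspace X. v x * f x < a} = {x \<in> topspace X. v x \<in> {..<a}} \<union> {x \<in> ?P. v x * f x \<in> {..<a}}"
      using zero False by fastforce
    moreover have "openin X {x \<in> topspace X. v x \<in> {..<a}}"
      by (rule openin_continuous_map_preimage[OF v(1)]) simp
    ultimately show ?thesis using part[of "{..<a}"] by (simp only: openin_Un open_lessThan)
  qed
qed

lemma quotient_map_lift:
  assumes "quotient_map X Y f" "continuous_map X Z h"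
    and "\<And>x y. x \<in> topspace X \<Longrightarrow> y \<in> topspace X \<Longrightarrow> f x = f y \<Longrightarrow> h x = h y"
  shows "\<exists>g. continuous_map Y Z g \<and> (\<forall>x\<in>topspace X. g (f x) = h x)"
  by (rule quotient_map_lift_exists[OF assms]) blast+

text \<open>
  The product of an open quotient map with the identity of the interval is again an open quotient
  map, so the homotopy descends.
\<close>

lemma quotient_homotopy:
  assumes Q: "continuous_map X T Q" "open_map X T Q" "Q ` topspace X = topspace T"
    and H: "continuous_map (prod_topology (top_of_set {0..1::real}) X) T' H"
    and fib: "\<And>t x x'. t \<in> {0..1} \<Longrightarrow> x \<in> topspace X \<Longrightarrow> x' \<in> topspace X \<Longrightarrow> Q x = Q x' \<Longrightarrow> H (t, x) = H (t, x')"
    and f: "\<And>x. x \<in> topspace X \<Longrightarrow> f (Q x) = H (0, x)" and g: "\<And>x. x \<in> topspace X \<Longrightarrow> g (Q x) = H (1, x)"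
  shows "homotopic_with (\<lambda>_. True) T T' f g"
proof -
  let ?I = "top_of_set {0..1::real}"
  have cont: "continuous_map (prod_topology ?I X) (prod_topology ?I T) (\<lambda>(t, x). (t, Q x))"
    by (rule continuous_map_prod[OF _ Q(1)]) simp
  have opn: "open_map (prod_topology ?I X) (prod_topology ?I T) (\<lambda>(t, x). (t, Q x))"
    by (rule open_map_prod[OF open_map_id Q(2)])
  have "(\<lambda>(t, x). (t, Q x)) ` topspace (prod_topology ?I X) = topspace (prod_topology ?I T)"
  proof (intro set_eqI iffI)
    fix z assume "z \<in> topspace (prod_topology ?I T)"
    then obtain t x where "z = (t, Q x)" "t \<in> {0..1}" "x \<in> topspace X"
      unfolding topspace_prod_topology Q(3)[symmetric] by auto
    then show "z \<in> (\<lambda>(t, x). (t, Q x)) ` topspace (prod_topology ?I X)"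
      by (intro image_eqI[of _ _ "(t, x)"]) auto
  qed (use Q(3) in auto)
  then have quot: "quotient_map (prod_topology ?I X) (prod_topology ?I T) (\<lambda>(t, x). (t, Q x))"
    using cont opn by (intro continuous_open_imp_quotient_map) auto
  have fib': "H z = H z'" if "z \<in> topspace (prod_topology ?I X)" "z' \<in> topspace (prod_topology ?I X)"
    "(\<lambda>(t, x). (t, Q x)) z = (\<lambda>(t, x). (t, Q x)) z'" for z z'
    using that fib[of "fst z" "snd z" "snd z'"] by (cases z; cases z') auto
  have "\<exists>k. continuous_map (prod_topology ?I T) T' k \<and>
      (\<forall>z\<in>topspace (prod_topology ?I X). k ((\<lambda>(t, x). (t, Q x)) z) = H z)"
    by (rule quotient_map_lift[OF quot H]) (rule fib')
  then obtain k where k: "continuous_map (prod_topology ?I T) T' k"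
    and kH: "\<forall>z\<in>topspace (prod_topology ?I X). k ((\<lambda>(t, x). (t, Q x)) z) = H z"
    by (elim exE conjE)
  show ?thesis
  proof (subst homotopic_with, simp, intro exI[of _ k] conjI ballI)
    fix y assume "y \<in> topspace T"
    then obtain x where x: "x \<in> topspace X" "y = Q x" using Q(3) by blast
    show "k (0, y) = f y" using kH[rule_format, of "(0, x)"] x f by simp
    show "k (1, y) = g y" using kH[rule_format, of "(1, x)"] x g by simp
  qed (use k in auto)
qed

text \<open>
  A contractible space \<open>X\<close> with a continuous right action \<open>R\<close> of \<open>U(k)\<close>, and an open map \<open>q\<close> that
  presents \<open>T\<close> as the quotient of \<open>X \<times> U(kl)\<close> by \<open>U(k) \<times> U(l)\<close>; here \<open>U(l)\<close> acts on the second
  factor only. On the frames of a matrix bundle, which are an example, scalars act trivially.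
\<close>

locale unitary_space =
  fixes X :: "'x topology" and R :: "complex^'k::finite^'k \<Rightarrow> 'x \<Rightarrow> 'x"
    and q :: "'x \<times> (complex^('k \<times> 'l::finite)^('k \<times> 'l)) \<Rightarrow> 't" and T :: "'t topology"
  assumes action_continuous:
      "continuous_map (prod_topology (top_of_set unitary_matrices) X) X (\<lambda>(g, x). R g x)"
    and action_mult: "x \<in> topspace X \<Longrightarrow> g \<in> unitary_matrices \<Longrightarrow> g' \<in> unitary_matrices \<Longrightarrow>
      R g' (R g x) = R (g ** g') x"
    and action_one: "x \<in> topspace X \<Longrightarrow> R (mat 1) x = x"
    and contractible: "contractible_space X" and nonempty: "topspace X \<noteq> {}"
    and quotient_continuous: "continuous_map (prod_topology X (top_of_set unitary_matrices)) T q"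
    and quotient_open: "open_map (prod_topology X (top_of_set unitary_matrices)) T q"
    and quotient_image: "q ` (topspace X \<times> unitary_matrices) = topspace T"
    and quotient_move: "x \<in> topspace X \<Longrightarrow> w \<in> unitary_matrices \<Longrightarrow> g \<in> unitary_matrices \<Longrightarrow>
      h \<in> unitary_matrices \<Longrightarrow> q (R g x, w ** kronecker g h) = q (x, w)"
    and quotient_eqD: "x \<in> topspace X \<Longrightarrow> x' \<in> topspace X \<Longrightarrow> w \<in> unitary_matrices \<Longrightarrow> w' \<in> unitary_matrices \<Longrightarrow>
      q (x, w) = q (x', w') \<Longrightarrow>
      \<exists>g\<in>unitary_matrices. \<exists>h\<in>unitary_matrices. x' = R g x \<and> w' = w ** kronecker g h"
begin

lemma action_in: "x \<in> topspace X \<Longrightarrow> g \<in> unitary_matrices \<Longrightarrow> R g x \<in> topspace X"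
  using continuous_map_image_subset_topspace[OF action_continuous] by auto

text \<open>
  Unitary coordinates \<open>a\<close> on \<open>Z\<close> trivialise the action on \<open>X\<close> if translation in \<open>Z\<close> multiplies
  them, up to elements acting trivially, by the group element.
\<close>

lemma action_chart:
  assumes u: "continuous_map Z euclideanreal u" "\<And>z. z \<in> topspace Z \<Longrightarrow> 0 \<le> u z"
    and a: "continuous_map (subtopology Z {z \<in> topspace Z. u z > 0}) (top_of_set unitary_matrices) a"
    and rel: "\<And>z z' \<gamma>. (z, z', \<gamma>) \<in> Rel \<Longrightarrow> u z' = u z"
      "\<And>z z' \<gamma> x. (z, z', \<gamma>) \<in> Rel \<Longrightarrow> u z > 0 \<Longrightarrow> x \<in> topspace X \<Longrightarrow> R (a z') x = \<gamma> (R (a z) x)"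
  shows "equivariant_chart Z X Rel u (\<lambda>z. R (a z)) (\<lambda>z. R (adjoint_matrix (a z)))"
proof -
  let ?Z = "subtopology Z {z \<in> topspace Z. u z > 0}"
  have a_in: "a z \<in> unitary_matrices" if "z \<in> topspace Z" "u z > 0" for z
    using continuous_map_image_subset_topspace[OF a] that by auto
  have cont: "continuous_map (prod_topology ?Z X) X (\<lambda>(z, x). R (c z) x)"
    if "continuous_map ?Z (top_of_set unitary_matrices) c" for c
  proof -
    have "continuous_map (prod_topology ?Z X) (prod_topology (top_of_set unitary_matrices) X) (\<lambda>p. (c (fst p), snd p))"
      by (intro continuous_map_pairedI continuous_map_on_fst that continuous_map_snd)
    from continuous_map_compose_lambda[OF this action_continuous] show ?thesis
      by (simp add: case_prod_unfold)
  qed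
  have adj: "continuous_map ?Z (top_of_set unitary_matrices) (\<lambda>z. adjoint_matrix (a z))"
  proof (rule continuous_map_compose_lambda[OF a])
    show "continuous_map (top_of_set unitary_matrices) (top_of_set unitary_matrices) adjoint_matrix"
      by (auto simp: continuous_map_in_subtopology unitary_adjoint intro!: continuous_intros)
  qed
  have "R (a z) (R (adjoint_matrix (a z)) x) = x" "R (adjoint_matrix (a z)) (R (a z) x) = x"
    if "z \<in> topspace Z" "u z > 0" "x \<in> topspace X" for z x
    using a_in[OF that(1,2)] that(3)
    by (simp_all add: action_mult unitary_adjoint unitary_left unitary_right action_one)
  then show ?thesis
    unfolding equivariant_chart_def using u cont[OF a] cont[OF adj] rel by blast
qed

end

definition scale_vector :: "complex \<Rightarrow> (nat \<Rightarrow> complex) \<Rightarrow> nat \<Rightarrow> complex" where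
  "scale_vector c z = (\<lambda>i. c * z i)"

lemma scale_vector_in:
  "z \<in> topspace punctured_space \<Longrightarrow> c \<noteq> 0 \<Longrightarrow> scale_vector c z \<in> topspace punctured_space"
  by (simp add: topspace_punctured_space scale_vector_def)

lemma complex_line_scale:
  "z \<in> topspace punctured_space \<Longrightarrow> c \<noteq> 0 \<Longrightarrow> complex_line (scale_vector c z) = complex_line z"
  using complex_line_eq_iff[of z "scale_vector c z"] by (auto simp: scale_vector_def)

text \<open>
  The same for the scalar action on sequences, with phases as coordinates.
\<close>

lemma scalar_chart:
  assumes u: "continuous_map Z euclideanreal u" "\<And>z. z \<in> topspace Z \<Longrightarrow> 0 \<le> u z"
    and a: "continuous_map (subtopology Z {z \<in> topspace Z. u z > 0}) euclidean a"
      "\<And>z. z \<in> topspace Z \<Longrightarrow> u z > 0 \<Longrightarrow> norm (a z) = 1"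
    and rel: "\<And>z z' \<gamma>. (z, z', \<gamma>) \<in> Rel \<Longrightarrow> u z' = u z"
      "\<And>z z' \<gamma>. (z, z', \<gamma>) \<in> Rel \<Longrightarrow> u z > 0 \<Longrightarrow> \<exists>c. a z' = c * a z \<and> \<gamma> = scale_vector c"
  shows "equivariant_chart Z punctured_space Rel u (\<lambda>z. scale_vector (a z)) (\<lambda>z. scale_vector (cnj (a z)))"
proof -
  let ?Z = "subtopology Z {z \<in> topspace Z. u z > 0}"
  have cont: "continuous_map (prod_topology ?Z punctured_space) punctured_space (\<lambda>(z, s). scale_vector (c z) s)"
    if c: "continuous_map ?Z euclidean c" "\<And>z. z \<in> topspace Z \<Longrightarrow> u z > 0 \<Longrightarrow> c z \<noteq> 0" for c
  proof -
    have "continuous_map ?Z (top_of_set (- {0})) c"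
      using c by (auto simp: continuous_map_in_subtopology)
    then have "continuous_map (prod_topology ?Z punctured_space) (prod_topology (top_of_set (- {0})) punctured_space)
        (\<lambda>p. (c (fst p), snd p))"
      by (intro continuous_map_pairedI continuous_map_on_fst continuous_map_snd)
    from continuous_map_compose_lambda[OF this continuous_map_scale_punctured] show ?thesis
      by (simp add: case_prod_unfold scale_vector_def)
  qed
  have nz: "a z \<noteq> 0" "cnj (a z) \<noteq> 0" if "z \<in> topspace Z" "u z > 0" for z using a(2)[OF that] by auto
  have cnj: "continuous_map ?Z euclidean (\<lambda>z. cnj (a z))"
    by (rule continuous_map_compose_lambda[OF a(1)]) (simp add: continuous_intros)
  have unit: "a z * cnj (a z) = 1" if "z \<in> topspace Z" "u z > 0" for z
    using a(2)[OF that] complex_norm_square[of "a z"] by simp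
  have inv: "scale_vector (a z) (scale_vector (cnj (a z)) s) = s" "scale_vector (cnj (a z)) (scale_vector (a z) s) = s"
    if "z \<in> topspace Z" "u z > 0" for z s
    using unit[OF that] by (simp_all add: scale_vector_def mult.assoc[symmetric] mult.commute)
  have "scale_vector (a z') s = \<gamma> (scale_vector (a z) s)" if "(z, z', \<gamma>) \<in> Rel" "u z > 0" for z z' \<gamma> s
    using rel(2)[OF that] by (auto simp: scale_vector_def mult.assoc)
  then show ?thesis
    unfolding equivariant_chart_def
    using u cont[OF a(1) nz(1)] cont[OF cnj nz(2)] inv rel(1) by blast
qed

lemma unitary_entry_bound:
  fixes M :: "complex^'n::finite^'n"
  assumes "M \<in> unitary_matrices"
  shows "norm (M $ i $ j) \<le> 1" and "\<exists>i j. M $ i $ j \<noteq> 0"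
proof -
  have "(\<Sum>a\<in>UNIV. cnj (M $ a $ j) * M $ a $ j) = 1" for j
    using arg_cong[OF unitary_left[OF assms], of "\<lambda>N. N $ j $ j"]
    by (simp add: matrix_matrix_mult_def adjoint_matrix_def mat_def)
  then have "complex_of_real (\<Sum>a\<in>UNIV. (norm (M $ a $ j))\<^sup>2) = 1" for j
    by (simp only: sum_cnj_mult)
  then have sum: "(\<Sum>a\<in>UNIV. (norm (M $ a $ j))\<^sup>2) = 1" for j
    by (simp only: of_real_eq_1_iff)
  have "(norm (M $ i $ j))\<^sup>2 \<le> (\<Sum>a\<in>UNIV. (norm (M $ a $ j))\<^sup>2)"
    by (rule member_le_sum) auto
  then show "norm (M $ i $ j) \<le> 1"
    unfolding sum by (simp add: abs_square_le_1)
  show "\<exists>i j. M $ i $ j \<noteq> 0"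
  proof (rule ccontr)
    assume "\<not> ?thesis"
    then show False using sum[of undefined] by simp
  qed
qed

section \<open>Equivariant maps between the two quotients\<close>

lemma punctured_space_nonempty: "topspace punctured_space \<noteq> {}"
proof -
  have "(\<lambda>i. if i = 0 then 1 else 0) \<in> topspace punctured_space"
    by (auto simp: topspace_punctured_space)
  then show ?thesis by blast
qed

lemma det_mat: "det (mat c :: 'a::comm_ring_1^'n::finite^'n) = c ^ CARD('n)"
  by (subst det_diagonal) (auto simp: mat_def)

text \<open>
  The data from which the equivalence is built: \<open>f\<close> are the local coordinates on \<open>U(kl)\<close> provided
  by coprimality, which transform with the character \<open>det(g)\<^sup>a det(h)\<^sup>b\<close>, and \<open>c\<close> are local
  coordinates on \<open>X\<close>. On \<open>Y\<close> scalars act trivially, so there the character can be ignored.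
\<close>

locale coprime_comparison =
  X: unitary_space X R q T + Y: unitary_space Y S p T'
  for X :: "'x topology" and R :: "complex^'k::finite^'k \<Rightarrow> 'x \<Rightarrow> 'x"
    and q :: "'x \<times> (complex^('k \<times> 'l::finite)^('k \<times> 'l)) \<Rightarrow> 't" and T :: "'t topology"
    and Y :: "'y topology" and S :: "complex^'k^'k \<Rightarrow> 'y \<Rightarrow> 'y"
    and p :: "'y \<times> (complex^('k \<times> 'l)^('k \<times> 'l)) \<Rightarrow> 's" and T' :: "'s topology" +
  fixes a b :: nat and u :: "nat \<Rightarrow> complex^('k \<times> 'l)^('k \<times> 'l) \<Rightarrow> real"
    and f :: "nat \<Rightarrow> complex^('k \<times> 'l)^('k \<times> 'l) \<Rightarrow> complex^'k^'k"
    and v :: "nat \<Rightarrow> 'x \<Rightarrow> real" and c :: "nat \<Rightarrow> 'x \<Rightarrow> complex^'k^'k"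
  assumes bezout: "CARD('l) * b = CARD('k) * a + 1"
    and u_continuous: "continuous_on UNIV (u m)" and u_nonneg: "0 \<le> u m w"
    and u_cover: "w \<in> unitary_matrices \<Longrightarrow> \<exists>m. u m w > 0"
    and f_continuous: "continuous_on {w. u m w > 0} (f m)"
    and f_unitary: "u m w > 0 \<Longrightarrow> f m w \<in> unitary_matrices"
    and u_kronecker: "g \<in> unitary_matrices \<Longrightarrow> h \<in> unitary_matrices \<Longrightarrow> u m (w ** kronecker g h) = u m w"
    and f_kronecker: "g \<in> unitary_matrices \<Longrightarrow> h \<in> unitary_matrices \<Longrightarrow>
      f m (w ** kronecker g h) = mat (det g ^ a * det h ^ b) ** f m w ** g"
    and v_continuous: "continuous_map X euclideanreal (v m)" and v_nonneg: "x \<in> topspace X \<Longrightarrow> 0 \<le> v m x"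
    and v_cover: "x \<in> topspace X \<Longrightarrow> \<exists>m. v m x > 0"
    and c_continuous: "continuous_map (subtopology X {x \<in> topspace X. v m x > 0}) (top_of_set unitary_matrices) (c m)"
    and v_action: "x \<in> topspace X \<Longrightarrow> g \<in> unitary_matrices \<Longrightarrow> v m (R g x) = v m x"
    and c_action: "x \<in> topspace X \<Longrightarrow> g \<in> unitary_matrices \<Longrightarrow> c m (R g x) = c m x ** g"
    and S_scalar: "norm z = 1 \<Longrightarrow> S (mat z ** g) = S g"
begin

definition W :: "(complex^('k \<times> 'l)^('k \<times> 'l)) topology" where
  "W = top_of_set unitary_matrices"

text \<open>
  The character through which \<open>U(k) \<times> U(l)\<close> acts on the sequence space.
\<close>

definition \<kappa> :: "complex^'k^'k \<Rightarrow> complex^'l^'l \<Rightarrow> complex" where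
  "\<kappa> g h = det g ^ a * det h ^ b"

lemma topspace_W [simp]: "topspace W = unitary_matrices"
  by (simp add: W_def)

lemma norm_\<kappa>: "g \<in> unitary_matrices \<Longrightarrow> h \<in> unitary_matrices \<Longrightarrow> norm (\<kappa> g h) = 1"
  by (simp add: \<kappa>_def norm_mult norm_power norm_det_unitary)

lemma \<kappa>_nonzero: "g \<in> unitary_matrices \<Longrightarrow> h \<in> unitary_matrices \<Longrightarrow> \<kappa> g h \<noteq> 0"
  using norm_\<kappa>[of g h] by auto

lemma move_in: "w \<in> unitary_matrices \<Longrightarrow> g \<in> unitary_matrices \<Longrightarrow> h \<in> unitary_matrices \<Longrightarrow>
    w ** kronecker g h \<in> unitary_matrices"
  by (intro unitary_mult kronecker_unitary)

lemma f_move: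
  "g \<in> unitary_matrices \<Longrightarrow> h \<in> unitary_matrices \<Longrightarrow> f m (w ** kronecker g h) = mat (\<kappa> g h) ** (f m w ** g)"
  by (simp add: f_kronecker \<kappa>_def matrix_mul_assoc)

lemma u_W: "continuous_map W euclideanreal (u m)"
  unfolding W_def by (simp add: continuous_on_subset[OF u_continuous])

lemma f_W: "continuous_map (subtopology W {w \<in> topspace W. u m w > 0}) (top_of_set unitary_matrices) (f m)"
  using f_continuous[of m] f_unitary[of m]
  by (auto simp: W_def subtopology_subtopology continuous_map_in_subtopology intro: continuous_on_subset)

lemma Y_scaled_action:
  assumes "norm z = 1" "y \<in> topspace Y" "g \<in> unitary_matrices" "g' \<in> unitary_matrices"
  shows "S (mat z ** (g ** g')) y = S g' (S g y)"
  using assms by (simp add: S_scalar Y.action_mult)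

text \<open>
  The coordinates \<open>f\<close> of \<open>U(kl)\<close> transform by \<open>g\<close> up to a scalar, and scalars act trivially on
  \<open>Y\<close>.
\<close>

lemma equivariant_map_to_Y:
  obtains s where "continuous_map W Y s"
    and "\<And>w g h. w \<in> unitary_matrices \<Longrightarrow> g \<in> unitary_matrices \<Longrightarrow> h \<in> unitary_matrices \<Longrightarrow>
      s (w ** kronecker g h) = S g (s w)"
proof -
  let ?Rel = "{(w, w ** kronecker g h, S g) | w g (h :: complex^'l^'l).
    w \<in> unitary_matrices \<and> g \<in> unitary_matrices \<and> h \<in> unitary_matrices}"
  have chart: "equivariant_chart W Y ?Rel (u m) (\<lambda>w. S (f m w)) (\<lambda>w. S (adjoint_matrix (f m w)))" for m
    by (rule Y.action_chart[OF u_W u_nonneg f_W])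
      (auto simp: u_kronecker f_move norm_\<kappa> Y_scaled_action f_unitary)
  obtain s where s: "continuous_map W Y s" "\<And>w w' \<gamma>. (w, w', \<gamma>) \<in> ?Rel \<Longrightarrow> s w' = \<gamma> (s w)"
    by (rule equivariant_map_exists[OF Y.contractible Y.nonempty chart]) (use move_in u_cover in auto)
  show thesis by (rule that[OF s(1)]) (rule s(2), blast)
qed

text \<open>
  The coordinates of \<open>U(kl)\<close> and of \<open>X\<close> differ by a unitary matrix that transforms by the scalar
  \<open>\<kappa> g h\<close> alone; the phase of any nonzero entry is a coordinate for the scalar action.
\<close>

lemma equivariant_map_to_lines:
  obtains l where "continuous_map (prod_topology X W) punctured_space l"
    and "\<And>x w g h. x \<in> topspace X \<Longrightarrow> w \<in> unitary_matrices \<Longrightarrow> g \<in> unitary_matrices \<Longrightarrow> h \<in> unitary_matrices \<Longrightarrow>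
      l (R g x, w ** kronecker g h) = scale_vector (\<kappa> g h) (l (x, w))"
proof -
  let ?Z = "prod_topology X W"
  let ?Rel = "{((x, w), (R g x, w ** kronecker g h), scale_vector (\<kappa> g h)) | x w g (h :: complex^'l^'l).
    x \<in> topspace X \<and> w \<in> unitary_matrices \<and> g \<in> unitary_matrices \<and> h \<in> unitary_matrices}"
  \<comment> \<open>The unitary matrix by which the coordinates of \<open>w\<close> and \<open>x\<close> differ.\<close>
  define N where "N n m = (\<lambda>(x, w). f m w ** adjoint_matrix (c n x))" for n m
  define t where "t n m = (\<lambda>(x, w). v n x * u m w)" for n m
  \<comment> \<open>Bounded entries make this continuous on all of \<open>X \<times> W\<close>.\<close>
  define r where "r n m i j z = t n m z * norm (N n m z $ i $ j)" for n m i j and z :: "'x \<times> (complex^('k \<times> 'l)^('k \<times> 'l))"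
  have t_cont: "continuous_map ?Z euclideanreal (t n m)" for n m
    unfolding t_def case_prod_unfold
    by (rule continuous_map_real_mult[OF continuous_map_on_fst[OF v_continuous] continuous_map_on_snd[OF u_W]])
  have t_nonneg: "0 \<le> t n m z" if "z \<in> topspace ?Z" for n m z
    using that v_nonneg u_nonneg by (auto simp: t_def)
  have t_pos: "v n x > 0 \<and> u m w > 0" if "(x, w) \<in> topspace ?Z" "t n m (x, w) > 0" for n m x w
    using that v_nonneg[of x n] u_nonneg[of m w] by (auto simp: t_def zero_less_mult_iff)
  have N_cont: "continuous_map (subtopology ?Z {z \<in> topspace ?Z. t n m z > 0}) (top_of_set unitary_matrices) (N n m)" for n m
  proof -
    let ?D = "subtopology ?Z {z \<in> topspace ?Z. t n m z > 0}"
    have "continuous_map ?D (top_of_set unitary_matrices) (\<lambda>z. f m (snd z))"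
      by (rule continuous_map_subtopology_compose[OF continuous_map_snd f_W]) (use t_pos in auto)
    moreover have "continuous_map ?D (top_of_set unitary_matrices) (\<lambda>z. c n (fst z))"
      by (rule continuous_map_subtopology_compose[OF continuous_map_fst c_continuous]) (use t_pos in auto)
    moreover have "continuous_on UNIV (\<lambda>p :: (complex^'k^'k) \<times> (complex^'k^'k). fst p ** adjoint_matrix (snd p))"
      by (intro continuous_intros)
    ultimately show ?thesis
      unfolding continuous_map_into_unitary N_def case_prod_unfold
      by (simp add: continuous_map_euclidean_binary[where h = "\<lambda>M N. M ** adjoint_matrix N"] unitary_mult unitary_adjoint)
  qed
  have N_unitary: "N n m z \<in> unitary_matrices" if "z \<in> topspace ?Z" "t n m z > 0" for n m z
    using N_cont[of n m] that unfolding continuous_map_into_unitary by auto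
  have entry_cont: "continuous_map (subtopology ?Z {z \<in> topspace ?Z. t n m z > 0}) euclidean (\<lambda>z. N n m z $ i $ j)" for n m i j
    by (rule continuous_map_compose_lambda[OF N_cont]) (simp add: continuous_intros)
  have r_cont: "continuous_map ?Z euclideanreal (r n m i j)" for n m i j
    unfolding r_def
  proof (rule continuous_map_times_bounded[OF t_cont t_nonneg])
    show "continuous_map (subtopology ?Z {z \<in> topspace ?Z. t n m z > 0}) euclideanreal (\<lambda>z. norm (N n m z $ i $ j))"
      by (rule continuous_map_compose_lambda[OF entry_cont]) (simp add: continuous_intros)
    show "0 \<le> norm (N n m z $ i $ j) \<and> norm (N n m z $ i $ j) \<le> 1" if "z \<in> topspace ?Z" "t n m z > 0" for z
      using unitary_entry_bound(1)[OF N_unitary[OF that]] by simp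
  qed
  have r_pos: "t n m z > 0 \<and> N n m z $ i $ j \<noteq> 0" if "z \<in> topspace ?Z" "r n m i j z > 0" for n m i j z
    using that t_nonneg[OF that(1), of n m] by (auto simp: r_def zero_less_mult_iff)
  have N_move: "N n m (R g x, w ** kronecker g h) $ i $ j = \<kappa> g h * N n m (x, w) $ i $ j"
    if "x \<in> topspace X" "g \<in> unitary_matrices" "h \<in> unitary_matrices" for n m i j x w g h
  proof -
    have "N n m (R g x, w ** kronecker g h) = mat (\<kappa> g h) ** (f m w ** g ** adjoint_matrix g ** adjoint_matrix (c n x))"
      by (simp add: N_def f_move c_action adjoint_mult matrix_mul_assoc that)
    then show ?thesis
      using that(2) by (simp add: N_def unitary_cancel mat_mult_component)
  qed
  have t_move: "t n m (R g x, w ** kronecker g h) = t n m (x, w)"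
    if "x \<in> topspace X" "g \<in> unitary_matrices" "h \<in> unitary_matrices" for n m x w g h
    using that by (simp add: t_def u_kronecker v_action)
  have chart: "equivariant_chart ?Z punctured_space ?Rel (r n m i j)
      (\<lambda>z. scale_vector (sgn (N n m z $ i $ j))) (\<lambda>z. scale_vector (cnj (sgn (N n m z $ i $ j))))" for n m i j
  proof (rule scalar_chart[OF r_cont])
    show "0 \<le> r n m i j z" if "z \<in> topspace ?Z" for z using t_nonneg[OF that] by (simp add: r_def)
    have "continuous_map (subtopology ?Z {z \<in> topspace ?Z. r n m i j z > 0}) (top_of_set (- {0})) (\<lambda>z. N n m z $ i $ j)"
    proof -
      have "{z \<in> topspace ?Z. r n m i j z > 0} \<subseteq> {z \<in> topspace ?Z. t n m z > 0}" using r_pos by auto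
      from continuous_map_from_subtopology_mono[OF entry_cont this] show ?thesis
        using r_pos by (auto simp: continuous_map_in_subtopology)
    qed
    then show "continuous_map (subtopology ?Z {z \<in> topspace ?Z. r n m i j z > 0}) euclidean (\<lambda>z. sgn (N n m z $ i $ j))"
      by (rule continuous_map_compose_lambda) (auto intro!: continuous_intros)
    show "norm (sgn (N n m z $ i $ j)) = 1" if "z \<in> topspace ?Z" "r n m i j z > 0" for z
      using r_pos[OF that] by (simp add: norm_sgn)
    show "r n m i j z' = r n m i j z" if "(z, z', \<gamma>) \<in> ?Rel" for z z' \<gamma>
      using that by (auto simp: r_def t_move N_move norm_mult norm_\<kappa>)
    show "\<exists>d. sgn (N n m z' $ i $ j) = d * sgn (N n m z $ i $ j) \<and> \<gamma> = scale_vector d"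
      if rel: "(z, z', \<gamma>) \<in> ?Rel" for z z' \<gamma>
    proof -
      obtain x w g h where z: "z = (x, w)" "z' = (R g x, w ** kronecker g h)" "\<gamma> = scale_vector (\<kappa> g h)"
        "x \<in> topspace X" "g \<in> unitary_matrices" "h \<in> unitary_matrices" using rel by blast
      have "sgn (\<kappa> g h) = \<kappa> g h" using norm_\<kappa>[OF z(5,6)] by (simp add: sgn_div_norm)
      then show ?thesis
        using z by (intro exI[of _ "\<kappa> g h"]) (simp add: N_move sgn_mult)
    qed
  qed
  obtain e :: "nat \<Rightarrow> nat \<times> nat \<times> 'k \<times> 'k" where e: "surj e"
    using surj_from_nat by blast
  define r' where "r' k = (case e k of (n, m, i, j) \<Rightarrow> r n m i j)" for k
  define \<theta> where "\<theta> k z = (case e k of (n, m, i, j) \<Rightarrow> scale_vector (sgn (N n m z $ i $ j)))" for k z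
  define \<theta>' where "\<theta>' k z = (case e k of (n, m, i, j) \<Rightarrow> scale_vector (cnj (sgn (N n m z $ i $ j))))" for k z
  have chart': "equivariant_chart ?Z punctured_space ?Rel (r' k) (\<theta> k) (\<theta>' k)" for k
    unfolding r'_def \<theta>_def[abs_def] \<theta>'_def[abs_def] by (cases "e k") (simp add: chart)
  have cover: "\<exists>k. r' k z > 0" if z: "z \<in> topspace ?Z" for z
  proof -
    obtain x w where xw: "z = (x, w)" "x \<in> topspace X" "w \<in> unitary_matrices" using z by auto
    obtain n m where nm: "v n x > 0" "u m w > 0" using v_cover[OF xw(2)] u_cover[OF xw(3)] by blast
    then have t: "t n m z > 0" by (simp add: t_def xw)
    obtain i j where "N n m z $ i $ j \<noteq> 0"
      using unitary_entry_bound(2)[OF N_unitary[OF z t]] by blast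
    moreover obtain k where "e k = (n, m, i, j)" using e by (metis surjD)
    ultimately have "r' k z > 0" using t by (simp add: r'_def r_def)
    then show ?thesis by blast
  qed
  obtain l where l: "continuous_map ?Z punctured_space l" "\<And>z z' \<gamma>. (z, z', \<gamma>) \<in> ?Rel \<Longrightarrow> l z' = \<gamma> (l z)"
  proof (rule equivariant_map_exists[OF contractible_punctured_space punctured_space_nonempty, where u = r'])
    show "equivariant_chart ?Z punctured_space ?Rel (r' k) (\<theta> k) (\<theta>' k)" for k by (rule chart')
    show "\<exists>k. r' k z > 0" if "z \<in> topspace ?Z" for z by (rule cover[OF that])
  qed (use X.action_in move_in in auto)
  show thesis by (rule that[OF l(1)]) (rule l(2), blast)
qed

lemma scale_in:
  "\<sigma> \<in> topspace punctured_space \<Longrightarrow> r > 0 \<Longrightarrow> g \<in> unitary_matrices \<Longrightarrow> h \<in> unitary_matrices \<Longrightarrow>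
    scale_vector (of_real r * \<kappa> g h) \<sigma> \<in> topspace punctured_space"
  by (rule scale_vector_in) (simp_all add: \<kappa>_nonzero)

text \<open>
  A scale invariant function that detects whether the i-th coordinate is nonzero.
\<close>

definition \<rho> :: "nat \<Rightarrow> (nat \<Rightarrow> complex) \<Rightarrow> real" where
  "\<rho> i \<sigma> = norm (\<sigma> i) / l1_norm \<sigma>"

lemma coordinate_P: "continuous_map punctured_space euclidean (\<lambda>\<sigma>. \<sigma> i)"
  unfolding punctured_space_def by (rule continuous_map_from_subtopology[OF continuous_map_coordinate])

lemma l1_norm_P: "continuous_map punctured_space euclideanreal l1_norm"
  unfolding punctured_space_def by (rule continuous_map_from_subtopology[OF continuous_map_l1_norm])

lemma \<rho>_continuous: "continuous_map punctured_space euclideanreal (\<rho> i)"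
  unfolding \<rho>_def
proof (rule continuous_map_real_divide)
  show "continuous_map punctured_space euclideanreal (\<lambda>\<sigma>. norm (\<sigma> i))"
    by (rule continuous_map_compose_lambda[OF coordinate_P]) (simp add: continuous_intros)
  show "l1_norm \<sigma> \<noteq> 0" if "\<sigma> \<in> topspace punctured_space" for \<sigma> using l1_norm_pos[OF that] by simp
qed (rule l1_norm_P)

lemma \<rho>_nonneg: "\<sigma> \<in> topspace punctured_space \<Longrightarrow> 0 \<le> \<rho> i \<sigma>"
  using l1_norm_pos[of \<sigma>] by (simp add: \<rho>_def)

lemma \<rho>_pos_iff: "\<sigma> \<in> topspace punctured_space \<Longrightarrow> \<rho> i \<sigma> > 0 \<longleftrightarrow> \<sigma> i \<noteq> 0"
  using l1_norm_pos[of \<sigma>] by (auto simp: \<rho>_def zero_less_divide_iff)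

lemma \<rho>_scale: "d \<noteq> 0 \<Longrightarrow> \<rho> i (scale_vector d \<sigma>) = \<rho> i \<sigma>"
  using l1_norm_scale[of d \<sigma>] by (simp add: \<rho>_def scale_vector_def norm_mult)

lemma sgn_scale:
  assumes "r > 0" "g \<in> unitary_matrices" "h \<in> unitary_matrices"
  shows "sgn (scale_vector (of_real r * \<kappa> g h) \<sigma> i) = \<kappa> g h * sgn (\<sigma> i)"
proof -
  have "sgn (\<kappa> g h) = \<kappa> g h" using norm_\<kappa>[OF assms(2,3)] by (simp add: sgn_div_norm)
  then show ?thesis using assms(1) by (simp add: scale_vector_def sgn_mult sgn_of_real)
qed

lemma sgn_coordinate:
  "continuous_map (subtopology punctured_space {\<sigma> \<in> topspace punctured_space. \<rho> i \<sigma> > 0}) euclidean (\<lambda>\<sigma>. sgn (\<sigma> i))"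
proof -
  have "continuous_map (subtopology punctured_space {\<sigma> \<in> topspace punctured_space. \<rho> i \<sigma> > 0}) (top_of_set (- {0})) (\<lambda>\<sigma>. \<sigma> i)"
    using continuous_map_from_subtopology[OF coordinate_P] \<rho>_pos_iff by (auto simp: continuous_map_in_subtopology)
  then show ?thesis
    by (rule continuous_map_compose_lambda) (auto intro!: continuous_intros)
qed

text \<open>
  Dividing the coordinate of \<open>U(kl)\<close> by the phase of a nonzero coordinate of the vector cancels
  \<open>\<kappa> g h\<close>, so the result transforms by \<open>g\<close> exactly. A positive factor \<open>r\<close> does not change the
  phase, so invariance under positive scalings comes for free.
\<close>

lemma equivariant_map_to_X:
  obtains n where "continuous_map (prod_topology W punctured_space) X n"
    and "\<And>w \<sigma> g h r. w \<in> unitary_matrices \<Longrightarrow> \<sigma> \<in> topspace punctured_space \<Longrightarrow> g \<in> unitary_matrices \<Longrightarrow>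
      h \<in> unitary_matrices \<Longrightarrow> r > 0 \<Longrightarrow>
      n (w ** kronecker g h, scale_vector (of_real r * \<kappa> g h) \<sigma>) = R g (n (w, \<sigma>))"
proof -
  let ?Z = "prod_topology W punctured_space"
  let ?Rel = "{((w, \<sigma>), (w ** kronecker g h, scale_vector (of_real r * \<kappa> g h) \<sigma>), R g) | w \<sigma> g (h :: complex^'l^'l) r.
    w \<in> unitary_matrices \<and> \<sigma> \<in> topspace punctured_space \<and> g \<in> unitary_matrices \<and> h \<in> unitary_matrices \<and> r > 0}"
  define t where "t m i = (\<lambda>(w, \<sigma>). u m w * \<rho> i \<sigma>)" for m i
  define d where "d m i = (\<lambda>(w, \<sigma> :: nat \<Rightarrow> complex). mat (cnj (sgn (\<sigma> i))) ** f m w)" for m i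
  have t_cont: "continuous_map ?Z euclideanreal (t m i)" for m i
    unfolding t_def case_prod_unfold
    by (rule continuous_map_real_mult[OF continuous_map_on_fst[OF u_W] continuous_map_on_snd[OF \<rho>_continuous]])
  have t_nonneg: "0 \<le> t m i z" if "z \<in> topspace ?Z" for m i z
    using that \<rho>_nonneg u_nonneg by (auto simp: t_def)
  have t_pos: "u m w > 0 \<and> \<rho> i \<sigma> > 0" if "(w, \<sigma>) \<in> topspace ?Z" "t m i (w, \<sigma>) > 0" for m i w \<sigma>
    using that u_nonneg[of m w] \<rho>_nonneg[of \<sigma> i] by (auto simp: t_def zero_less_mult_iff)
  have d_cont: "continuous_map (subtopology ?Z {z \<in> topspace ?Z. t m i z > 0}) (top_of_set unitary_matrices) (d m i)" for m i
    unfolding continuous_map_into_unitary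
  proof
    let ?D = "subtopology ?Z {z \<in> topspace ?Z. t m i z > 0}"
    have "continuous_map ?D (top_of_set unitary_matrices) (\<lambda>z. f m (fst z))"
      by (rule continuous_map_subtopology_compose[OF continuous_map_fst f_W]) (use t_pos in auto)
    then have f: "continuous_map ?D euclidean (\<lambda>z. f m (fst z))" by (simp add: continuous_map_into_unitary)
    have "continuous_map ?D euclidean (\<lambda>z. sgn (snd z i))"
      by (rule continuous_map_subtopology_compose[OF continuous_map_snd sgn_coordinate]) (use t_pos in auto)
    moreover note f
    moreover have "continuous_on UNIV (\<lambda>p :: complex \<times> (complex^'k^'k). mat (cnj (fst p)) ** snd p)"
    proof -
      have "(\<lambda>p :: complex \<times> (complex^'k^'k). mat (cnj (fst p)) ** snd p) = (\<lambda>p. \<chi> i j. cnj (fst p) * snd p $ i $ j)"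
        by (simp add: fun_eq_iff vec_eq_iff mat_mult_component)
      then show ?thesis by (simp only:) (intro continuous_intros)
    qed
    ultimately show "continuous_map ?D euclidean (d m i)"
      unfolding d_def case_prod_unfold
      by (rule continuous_map_euclidean_binary[where h = "\<lambda>z M. mat (cnj z) ** M"])
    show "\<forall>z\<in>topspace ?D. d m i z \<in> unitary_matrices"
    proof
      fix z assume "z \<in> topspace ?D"
      then obtain w \<sigma> where z: "z = (w, \<sigma>)" "(w, \<sigma>) \<in> topspace ?Z" "t m i (w, \<sigma>) > 0" by (cases z) auto
      then have "\<sigma> i \<noteq> 0" using t_pos[OF z(2,3)] \<rho>_pos_iff by auto
      then have "mat (cnj (sgn (\<sigma> i))) \<in> (unitary_matrices :: (complex^'k^'k) set)"
        by (simp add: unitary_mat norm_sgn)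
      then show "d m i z \<in> unitary_matrices"
        unfolding z(1) d_def case_prod_conv using f_unitary t_pos[OF z(2,3)] by (intro unitary_mult) auto
    qed
  qed
  have d_unitary: "d m i z \<in> unitary_matrices" if "z \<in> topspace ?Z" "t m i z > 0" for m i z
    using d_cont[of m i] that unfolding continuous_map_into_unitary by auto
  have chart: "equivariant_chart ?Z X ?Rel (t m i) (\<lambda>z. R (d m i z)) (\<lambda>z. R (adjoint_matrix (d m i z)))" for m i
  proof (rule X.action_chart[OF t_cont t_nonneg d_cont])
    show "t m i z' = t m i z" if "(z, z', \<gamma>) \<in> ?Rel" for z z' \<gamma>
      using that by (auto simp: t_def u_kronecker \<rho>_scale \<kappa>_nonzero)
    show "R (d m i z') x = \<gamma> (R (d m i z) x)" if rel: "(z, z', \<gamma>) \<in> ?Rel" and pos: "t m i z > 0" and x: "x \<in> topspace X" for z z' \<gamma> x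
    proof -
      obtain w \<sigma> g h r where z: "z = (w, \<sigma>)" "z' = (w ** kronecker g h, scale_vector (of_real r * \<kappa> g h) \<sigma>)" "\<gamma> = R g"
        "w \<in> unitary_matrices" "\<sigma> \<in> topspace punctured_space" and g: "g \<in> unitary_matrices" "h \<in> unitary_matrices" and r: "r > 0"
        using rel by blast
      have "cnj (\<kappa> g h) * \<kappa> g h = 1"
        using norm_\<kappa>[OF g] sum_cnj_mult[of "\<lambda>_. \<kappa> g h" "{0}"] by simp
      then have unit: "cnj (\<kappa> g h) * cnj (sgn (\<sigma> i)) * \<kappa> g h = cnj (sgn (\<sigma> i))" by (simp add: mult.commute mult.left_commute)
      have "d m i z' = mat (cnj (\<kappa> g h) * cnj (sgn (\<sigma> i))) ** (mat (\<kappa> g h) ** (f m w ** g))"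
        unfolding z d_def case_prod_conv sgn_scale[OF r g] f_move[OF g] by simp
      also have "\<dots> = mat (cnj (\<kappa> g h) * cnj (sgn (\<sigma> i)) * \<kappa> g h) ** f m w ** g"
        by (simp only: matrix_mul_assoc mat_mult_mat)
      also have "\<dots> = d m i z ** g" unfolding unit by (simp add: z d_def)
      finally show ?thesis
        using X.action_mult[OF x d_unitary g(1)] pos z(1,3,4,5) by simp
    qed
  qed
  obtain e :: "nat \<Rightarrow> nat \<times> nat" where e: "surj e"
    using surj_from_nat by blast
  have cover: "\<exists>k. t (fst (e k)) (snd (e k)) z > 0" if z: "z \<in> topspace ?Z" for z
  proof -
    obtain w \<sigma> where ws: "z = (w, \<sigma>)" "w \<in> unitary_matrices" "\<sigma> \<in> topspace punctured_space" using z by auto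
    obtain m where "u m w > 0" using u_cover[OF ws(2)] by blast
    moreover obtain i where "\<sigma> i \<noteq> 0" using ws(3) by (auto simp: topspace_punctured_space)
    moreover obtain k where "e k = (m, i)" using e by (metis surjD)
    ultimately show ?thesis using \<rho>_pos_iff[OF ws(3)] by (intro exI[of _ k]) (simp add: t_def ws)
  qed
  obtain n where n: "continuous_map ?Z X n" "\<And>z z' \<gamma>. (z, z', \<gamma>) \<in> ?Rel \<Longrightarrow> n z' = \<gamma> (n z)"
  proof (rule equivariant_map_exists[OF X.contractible X.nonempty, where u = "\<lambda>k. t (fst (e k)) (snd (e k))"])
    show "equivariant_chart ?Z X ?Rel (t (fst (e k)) (snd (e k))) (\<lambda>z. R (d (fst (e k)) (snd (e k)) z))
      (\<lambda>z. R (adjoint_matrix (d (fst (e k)) (snd (e k)) z)))" for k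
      by (rule chart)
    show "\<exists>k. t (fst (e k)) (snd (e k)) z > 0" if "z \<in> topspace ?Z" for z
      by (rule cover[OF that])
  qed (use scale_in move_in in auto)
  show thesis by (rule that[OF n(1)]) (rule n(2), blast)
qed

end

section \<open>Equivariant homotopies and the homotopy equivalence\<close>

context coprime_comparison
begin

text \<open>
  For \<open>X\<close> its own coordinates serve as charts.
\<close>

lemma homotopy_to_fst:
  assumes \<phi>: "continuous_map (prod_topology X W) X \<phi>"
    and equi: "\<And>x w g h. x \<in> topspace X \<Longrightarrow> w \<in> unitary_matrices \<Longrightarrow> g \<in> unitary_matrices \<Longrightarrow> h \<in> unitary_matrices \<Longrightarrow>
      \<phi> (R g x, w ** kronecker g h) = R g (\<phi> (x, w))"
  obtains H where "continuous_map (prod_topology (top_of_set {0..1::real}) (prod_topology X W)) X H"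
    and "\<And>x w. x \<in> topspace X \<Longrightarrow> w \<in> unitary_matrices \<Longrightarrow> H (0, (x, w)) = \<phi> (x, w)"
    and "\<And>x w. x \<in> topspace X \<Longrightarrow> w \<in> unitary_matrices \<Longrightarrow> H (1, (x, w)) = x"
    and "\<And>t x w g h. t \<in> {0..1} \<Longrightarrow> x \<in> topspace X \<Longrightarrow> w \<in> unitary_matrices \<Longrightarrow> g \<in> unitary_matrices \<Longrightarrow> h \<in> unitary_matrices \<Longrightarrow>
      H (t, (R g x, w ** kronecker g h)) = R g (H (t, (x, w)))"
proof -
  let ?Z = "prod_topology X W"
  let ?Rel = "{((x, w), (R g x, w ** kronecker g h), R g) | x w g (h :: complex^'l^'l).
    x \<in> topspace X \<and> w \<in> unitary_matrices \<and> g \<in> unitary_matrices \<and> h \<in> unitary_matrices}"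
  have c_unitary: "c m x \<in> unitary_matrices" if "x \<in> topspace X" "v m x > 0" for m x
    using c_continuous[of m] that unfolding continuous_map_into_unitary by auto
  have chart: "equivariant_chart ?Z X ?Rel (\<lambda>z. v m (fst z)) (\<lambda>z. R (c m (fst z))) (\<lambda>z. R (adjoint_matrix (c m (fst z))))" for m
  proof (rule X.action_chart)
    show "continuous_map ?Z euclideanreal (\<lambda>z. v m (fst z))" by (rule continuous_map_on_fst[OF v_continuous])
    show "0 \<le> v m (fst z)" if "z \<in> topspace ?Z" for z using that by (auto simp: v_nonneg)
    show "continuous_map (subtopology ?Z {z \<in> topspace ?Z. v m (fst z) > 0}) (top_of_set unitary_matrices) (\<lambda>z. c m (fst z))"
      by (rule continuous_map_subtopology_compose[OF continuous_map_fst c_continuous]) auto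
    show "v m (fst z') = v m (fst z)" if "(z, z', \<gamma>) \<in> ?Rel" for z z' \<gamma>
      using that by (auto simp: v_action)
    show "R (c m (fst z')) x = \<gamma> (R (c m (fst z)) x)"
      if "(z, z', \<gamma>) \<in> ?Rel" "v m (fst z) > 0" "x \<in> topspace X" for z z' \<gamma> x
      using that c_unitary by (auto simp: c_action X.action_mult)
  qed
  obtain H where H: "continuous_map (prod_topology (top_of_set {0..1::real}) ?Z) X H"
    "\<And>z. z \<in> topspace ?Z \<Longrightarrow> H (0, z) = \<phi> z" "\<And>z. z \<in> topspace ?Z \<Longrightarrow> H (1, z) = fst z"
    "\<And>t z z' \<gamma>. t \<in> {0..1} \<Longrightarrow> (z, z', \<gamma>) \<in> ?Rel \<Longrightarrow> H (t, z') = \<gamma> (H (t, z))"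
  proof (rule equivariant_maps_homotopic[OF X.contractible X.nonempty, where u = "\<lambda>m z. v m (fst z)"])
    show "equivariant_chart ?Z X ?Rel (\<lambda>z. v m (fst z)) (\<lambda>z. R (c m (fst z))) (\<lambda>z. R (adjoint_matrix (c m (fst z))))" for m
      by (rule chart)
    show "z \<in> topspace ?Z \<and> z' \<in> topspace ?Z" if "(z, z', \<gamma>) \<in> ?Rel" for z z' \<gamma>
      using that X.action_in move_in by auto
    show "\<exists>m. v m (fst z) > 0" if "z \<in> topspace ?Z" for z using that by (auto simp: v_cover)
    show "continuous_map ?Z X \<phi>" by (rule \<phi>)
    show "\<phi> z' = \<gamma> (\<phi> z)" if "(z, z', \<gamma>) \<in> ?Rel" for z z' \<gamma> using that equi by auto
    show "continuous_map ?Z X fst" by (rule continuous_map_fst)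
    show "fst z' = \<gamma> (fst z)" if "(z, z', \<gamma>) \<in> ?Rel" for z z' \<gamma> using that by auto
  qed (rule that, assumption, blast+)
  show thesis
    by (rule that[OF H(1)]) (use H(2,3) in simp_all, rule H(4), simp, blast)
qed

text \<open>
  For \<open>Y\<close> the coordinates of \<open>U(kl)\<close> serve as charts, because scalars act trivially.
\<close>

lemma homotopy_to_Y:
  assumes \<phi>: "continuous_map W Y \<phi>"
    and equi: "\<And>w g h. w \<in> unitary_matrices \<Longrightarrow> g \<in> unitary_matrices \<Longrightarrow> h \<in> unitary_matrices \<Longrightarrow>
      \<phi> (w ** kronecker g h) = S g (\<phi> w)"
  obtains H where "continuous_map (prod_topology (top_of_set {0..1::real}) (prod_topology Y W)) Y H"
    and "\<And>y w. y \<in> topspace Y \<Longrightarrow> w \<in> unitary_matrices \<Longrightarrow> H (0, (y, w)) = \<phi> w"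
    and "\<And>y w. y \<in> topspace Y \<Longrightarrow> w \<in> unitary_matrices \<Longrightarrow> H (1, (y, w)) = y"
    and "\<And>t y w g h. t \<in> {0..1} \<Longrightarrow> y \<in> topspace Y \<Longrightarrow> w \<in> unitary_matrices \<Longrightarrow> g \<in> unitary_matrices \<Longrightarrow> h \<in> unitary_matrices \<Longrightarrow>
      H (t, (S g y, w ** kronecker g h)) = S g (H (t, (y, w)))"
proof -
  let ?Z = "prod_topology Y W"
  let ?Rel = "{((y, w), (S g y, w ** kronecker g h), S g) | y w g (h :: complex^'l^'l).
    y \<in> topspace Y \<and> w \<in> unitary_matrices \<and> g \<in> unitary_matrices \<and> h \<in> unitary_matrices}"
  have chart: "equivariant_chart ?Z Y ?Rel (\<lambda>z. u m (snd z)) (\<lambda>z. S (f m (snd z))) (\<lambda>z. S (adjoint_matrix (f m (snd z))))" for m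
  proof (rule Y.action_chart)
    show "continuous_map ?Z euclideanreal (\<lambda>z. u m (snd z))" by (rule continuous_map_on_snd[OF u_W])
    show "0 \<le> u m (snd z)" for z by (rule u_nonneg)
    show "continuous_map (subtopology ?Z {z \<in> topspace ?Z. u m (snd z) > 0}) (top_of_set unitary_matrices) (\<lambda>z. f m (snd z))"
      by (rule continuous_map_subtopology_compose[OF continuous_map_snd f_W]) auto
    show "u m (snd z') = u m (snd z)" if "(z, z', \<gamma>) \<in> ?Rel" for z z' \<gamma>
      using that by (auto simp: u_kronecker)
    show "S (f m (snd z')) y = \<gamma> (S (f m (snd z)) y)"
      if "(z, z', \<gamma>) \<in> ?Rel" "u m (snd z) > 0" "y \<in> topspace Y" for z z' \<gamma> y
      using that by (auto simp: f_move norm_\<kappa> Y_scaled_action f_unitary)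
  qed
  obtain H where H: "continuous_map (prod_topology (top_of_set {0..1::real}) ?Z) Y H"
    "\<And>z. z \<in> topspace ?Z \<Longrightarrow> H (0, z) = \<phi> (snd z)" "\<And>z. z \<in> topspace ?Z \<Longrightarrow> H (1, z) = fst z"
    "\<And>t z z' \<gamma>. t \<in> {0..1} \<Longrightarrow> (z, z', \<gamma>) \<in> ?Rel \<Longrightarrow> H (t, z') = \<gamma> (H (t, z))"
  proof (rule equivariant_maps_homotopic[OF Y.contractible Y.nonempty, where u = "\<lambda>m z. u m (snd z)"])
    show "equivariant_chart ?Z Y ?Rel (\<lambda>z. u m (snd z)) (\<lambda>z. S (f m (snd z))) (\<lambda>z. S (adjoint_matrix (f m (snd z))))" for m
      by (rule chart)
    show "z \<in> topspace ?Z \<and> z' \<in> topspace ?Z" if "(z, z', \<gamma>) \<in> ?Rel" for z z' \<gamma>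
      using that Y.action_in move_in by auto
    show "\<exists>m. u m (snd z) > 0" if "z \<in> topspace ?Z" for z using that by (auto simp: u_cover)
    show "continuous_map ?Z Y (\<lambda>z. \<phi> (snd z))" by (rule continuous_map_on_snd[OF \<phi>])
    show "\<phi> (snd z') = \<gamma> (\<phi> (snd z))" if "(z, z', \<gamma>) \<in> ?Rel" for z z' \<gamma> using that equi by auto
    show "continuous_map ?Z Y fst" by (rule continuous_map_fst)
    show "fst z' = \<gamma> (fst z)" if "(z, z', \<gamma>) \<in> ?Rel" for z z' \<gamma> using that by auto
  qed (rule that, assumption, blast+)
  show thesis
    by (rule that[OF H(1)]) (use H(2,3) in simp_all, rule H(4), simp, blast)
qed

text \<open>
  The endpoint is the vector divided by its norm rather than the vector itself, because homotopies
  must be invariant under positive scalings of the argument; the line it spans is the same.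
\<close>

lemma homotopy_to_normalization:
  assumes \<phi>: "continuous_map (prod_topology W punctured_space) punctured_space \<phi>"
    and equi: "\<And>w \<sigma> g h r. w \<in> unitary_matrices \<Longrightarrow> \<sigma> \<in> topspace punctured_space \<Longrightarrow> g \<in> unitary_matrices \<Longrightarrow>
      h \<in> unitary_matrices \<Longrightarrow> r > 0 \<Longrightarrow>
      \<phi> (w ** kronecker g h, scale_vector (of_real r * \<kappa> g h) \<sigma>) = scale_vector (\<kappa> g h) (\<phi> (w, \<sigma>))"
  obtains H where "continuous_map (prod_topology (top_of_set {0..1::real}) (prod_topology W punctured_space)) punctured_space H"
    and "\<And>w \<sigma>. w \<in> unitary_matrices \<Longrightarrow> \<sigma> \<in> topspace punctured_space \<Longrightarrow> H (0, (w, \<sigma>)) = \<phi> (w, \<sigma>)"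
    and "\<And>w \<sigma>. w \<in> unitary_matrices \<Longrightarrow> \<sigma> \<in> topspace punctured_space \<Longrightarrow>
      H (1, (w, \<sigma>)) = scale_vector (1 / of_real (l1_norm \<sigma>)) \<sigma>"
    and "\<And>t w \<sigma> g h r. t \<in> {0..1} \<Longrightarrow> w \<in> unitary_matrices \<Longrightarrow> \<sigma> \<in> topspace punctured_space \<Longrightarrow> g \<in> unitary_matrices \<Longrightarrow>
      h \<in> unitary_matrices \<Longrightarrow> r > 0 \<Longrightarrow>
      H (t, (w ** kronecker g h, scale_vector (of_real r * \<kappa> g h) \<sigma>)) = scale_vector (\<kappa> g h) (H (t, (w, \<sigma>)))"
proof -
  let ?Z = "prod_topology W punctured_space"
  let ?Rel = "{((w, \<sigma>), (w ** kronecker g h, scale_vector (of_real r * \<kappa> g h) \<sigma>), scale_vector (\<kappa> g h)) | w \<sigma> g (h :: complex^'l^'l) r.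
    w \<in> unitary_matrices \<and> \<sigma> \<in> topspace punctured_space \<and> g \<in> unitary_matrices \<and> h \<in> unitary_matrices \<and> r > 0}"
  let ?N = "\<lambda>z :: (complex^('k \<times> 'l)^('k \<times> 'l)) \<times> (nat \<Rightarrow> complex). \<lambda>i. snd z i / complex_of_real (l1_norm (snd z))"
  have chart: "equivariant_chart ?Z punctured_space ?Rel (\<lambda>z. \<rho> i (snd z))
      (\<lambda>z. scale_vector (sgn (snd z i))) (\<lambda>z. scale_vector (cnj (sgn (snd z i))))" for i
  proof (rule scalar_chart)
    show "continuous_map ?Z euclideanreal (\<lambda>z. \<rho> i (snd z))" by (rule continuous_map_on_snd[OF \<rho>_continuous])
    show "0 \<le> \<rho> i (snd z)" if "z \<in> topspace ?Z" for z using that by (auto simp: \<rho>_nonneg)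
    show "continuous_map (subtopology ?Z {z \<in> topspace ?Z. \<rho> i (snd z) > 0}) euclidean (\<lambda>z. sgn (snd z i))"
      by (rule continuous_map_subtopology_compose[OF continuous_map_snd sgn_coordinate]) auto
    show "norm (sgn (snd z i)) = 1" if "z \<in> topspace ?Z" "\<rho> i (snd z) > 0" for z
      using that \<rho>_pos_iff[of "snd z" i] by (auto simp: norm_sgn)
    show "\<rho> i (snd z') = \<rho> i (snd z)" if "(z, z', \<gamma>) \<in> ?Rel" for z z' \<gamma>
      using that by (auto simp: \<rho>_scale \<kappa>_nonzero)
    show "\<exists>d. sgn (snd z' i) = d * sgn (snd z i) \<and> \<gamma> = scale_vector d" if "(z, z', \<gamma>) \<in> ?Rel" for z z' \<gamma>
      using that sgn_scale by auto
  qed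
  have N_move: "?N z' = \<gamma> (?N z)" if "(z, z', \<gamma>) \<in> ?Rel" for z z' \<gamma>
  proof -
    obtain w \<sigma> g h r where z: "z = (w, \<sigma>)" "z' = (w ** kronecker g h, scale_vector (of_real r * \<kappa> g h) \<sigma>)"
      "\<gamma> = scale_vector (\<kappa> g h)" and g: "g \<in> unitary_matrices" "h \<in> unitary_matrices" and r: "r > (0 :: real)"
      using \<open>(z, z', \<gamma>) \<in> ?Rel\<close> by blast
    have "l1_norm (scale_vector (of_real r * \<kappa> g h) \<sigma>) = r * l1_norm \<sigma>"
      using r norm_\<kappa>[OF g] by (simp add: scale_vector_def l1_norm_scale norm_mult)
    then show ?thesis using r by (simp add: z scale_vector_def fun_eq_iff)
  qed
  obtain H where H: "continuous_map (prod_topology (top_of_set {0..1::real}) ?Z) punctured_space H"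
    "\<And>z. z \<in> topspace ?Z \<Longrightarrow> H (0, z) = \<phi> z" "\<And>z. z \<in> topspace ?Z \<Longrightarrow> H (1, z) = ?N z"
    "\<And>t z z' \<gamma>. t \<in> {0..1} \<Longrightarrow> (z, z', \<gamma>) \<in> ?Rel \<Longrightarrow> H (t, z') = \<gamma> (H (t, z))"
  proof (rule equivariant_maps_homotopic[OF contractible_punctured_space punctured_space_nonempty, where u = "\<lambda>i z. \<rho> i (snd z)"])
    show "equivariant_chart ?Z punctured_space ?Rel (\<lambda>z. \<rho> i (snd z))
      (\<lambda>z. scale_vector (sgn (snd z i))) (\<lambda>z. scale_vector (cnj (sgn (snd z i))))" for i
      by (rule chart)
    show "z \<in> topspace ?Z \<and> z' \<in> topspace ?Z" if "(z, z', \<gamma>) \<in> ?Rel" for z z' \<gamma>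
      using that scale_in move_in by auto
    show "\<exists>i. \<rho> i (snd z) > 0" if "z \<in> topspace ?Z" for z
    proof -
      have z: "snd z \<in> topspace punctured_space" using that by auto
      then obtain i where "snd z i \<noteq> 0" by (auto simp: topspace_punctured_space)
      then show ?thesis using \<rho>_pos_iff[OF z] by blast
    qed
    show "continuous_map ?Z punctured_space \<phi>" by (rule \<phi>)
    show "\<phi> z' = \<gamma> (\<phi> z)" if "(z, z', \<gamma>) \<in> ?Rel" for z z' \<gamma> using that equi by auto
    show "continuous_map ?Z punctured_space ?N" by (rule continuous_map_on_snd[OF continuous_map_normalize])
    show "?N z' = \<gamma> (?N z)" if "(z, z', \<gamma>) \<in> ?Rel" for z z' \<gamma> by (rule N_move[OF that])
  qed (rule that, assumption, blast+)
  show thesis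
  proof (rule that[OF H(1)])
    fix w :: "complex^('k \<times> 'l)^('k \<times> 'l)" and \<sigma> :: "nat \<Rightarrow> complex"
    assume ws: "w \<in> unitary_matrices" "\<sigma> \<in> topspace punctured_space"
    show "H (0, (w, \<sigma>)) = \<phi> (w, \<sigma>)" using H(2) ws by simp
    show "H (1, (w, \<sigma>)) = scale_vector (1 / of_real (l1_norm \<sigma>)) \<sigma>"
      using H(3)[of "(w, \<sigma>)"] ws by (simp add: scale_vector_def)
    fix t :: real and g :: "complex^'k^'k" and h :: "complex^'l^'l" and r :: real
    assume "t \<in> {0..1}" "g \<in> unitary_matrices" "h \<in> unitary_matrices" "r > 0"
    then show "H (t, (w ** kronecker g h, scale_vector (of_real r * \<kappa> g h) \<sigma>)) = scale_vector (\<kappa> g h) (H (t, (w, \<sigma>)))"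
      using ws by (intro H(4)) blast+
  qed
qed

text \<open>
  Equality of lines leaves an arbitrary scalar \<open>d\<close> between the two vectors. Its phase is produced
  by changing \<open>(g, h)\<close> to \<open>(\<zeta> g, \<zeta>\<^sup>* h)\<close>, which does not affect \<open>w\<close> and \<open>y\<close> but multiplies the
  character by \<open>\<zeta>\<^sup>*\<close>, since \<open>l b = k a + 1\<close>.
\<close>

lemma fibre_of_product:
  assumes y: "y \<in> topspace Y" "y' \<in> topspace Y" and w: "w \<in> unitary_matrices" "w' \<in> unitary_matrices"
    and \<sigma>: "\<sigma> \<in> topspace punctured_space"
    and eq: "p (y, w) = p (y', w')" "complex_line \<sigma> = complex_line \<sigma>'"
  obtains g h r where "g \<in> unitary_matrices" "h \<in> unitary_matrices" "r > (0 :: real)" "y' = S g y"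
    "w' = w ** kronecker g h" "\<sigma>' = scale_vector (of_real r * \<kappa> g h) \<sigma>"
proof -
  obtain g h where g: "g \<in> unitary_matrices" "h \<in> unitary_matrices" and y': "y' = S g y" and w': "w' = w ** kronecker g h"
    using Y.quotient_eqD[OF y w eq(1)] by blast
  obtain d where d: "d \<noteq> 0" "\<sigma>' = scale_vector d \<sigma>"
    using eq(2) complex_line_eq_iff[OF \<sigma>] by (auto simp: scale_vector_def)
  \<comment> \<open>Chosen such that \<open>\<zeta>\<^sup>* \<kappa>(g, h)\<close> is the phase of \<open>d\<close>.\<close>
  define \<zeta> where "\<zeta> = cnj (sgn d) * \<kappa> g h"
  have \<zeta>: "norm \<zeta> = 1" using d(1) norm_\<kappa>[OF g] by (simp add: \<zeta>_def norm_mult norm_sgn)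
  have unit: "cnj z * z = 1" if "norm z = 1" for z :: complex
    using that sum_cnj_mult[of "\<lambda>_. z" "{0}"] by simp
  have inverse: "\<zeta> * cnj \<zeta> = 1" using unit[OF \<zeta>] by (simp add: mult.commute)
  let ?g = "mat \<zeta> ** g" and ?h = "mat (cnj \<zeta>) ** h"
  have mem: "?g \<in> unitary_matrices" "?h \<in> unitary_matrices"
    using g \<zeta> by (simp_all add: unitary_mult unitary_mat)
  have "kronecker ?g ?h = kronecker g h"
    by (simp add: kronecker_mult[symmetric] kronecker_mat inverse)
  moreover have "S ?g = S g" by (rule S_scalar[OF \<zeta>])
  moreover have "\<kappa> ?g ?h = sgn d"
  proof -
    have "\<kappa> ?g ?h = (\<zeta> ^ (CARD('k) * a) * cnj \<zeta> ^ (CARD('l) * b)) * \<kappa> g h"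
      by (simp add: \<kappa>_def det_mul det_mat power_mult_distrib mult_ac flip: power_mult)
    also have "\<zeta> ^ (CARD('k) * a) * cnj \<zeta> ^ (CARD('l) * b) = (\<zeta> * cnj \<zeta>) ^ (CARD('k) * a) * cnj \<zeta>"
      by (simp add: bezout power_mult_distrib)
    also have "\<dots> * \<kappa> g h = sgn d * (cnj (\<kappa> g h) * \<kappa> g h)"
      unfolding inverse by (simp add: \<zeta>_def)
    also have "\<dots> = sgn d" using unit[OF norm_\<kappa>[OF g]] by simp
    finally show ?thesis .
  qed
  moreover have "of_real (norm d) * sgn d = d" using d(1) by (simp add: sgn_div_norm scaleR_conv_of_real)
  ultimately show thesis
    using that[OF mem, of "norm d"] d y' w' by simp
qed

text \<open>
  With equivariant maps \<open>s\<close>, \<open>l\<close>, \<open>n\<close> as above, the two maps are \<open>[x, w] \<mapsto> ([s w, w], [l(x, w)])\<close>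
  and \<open>([y, w], [\<sigma>]) \<mapsto> [n(w, \<sigma>), w]\<close>. Both composites keep \<open>w\<close>, and the equivariant homotopies
  into \<open>X\<close>, \<open>Y\<close> and the sequence space deform them to the identity.
\<close>

theorem homotopy_equivalence: "T homotopy_equivalent_space prod_topology T' CP_infinity"
proof -
  let ?I = "top_of_set {0..1::real}" and ?P = punctured_space
  let ?Z = "prod_topology X W" and ?Z' = "prod_topology (prod_topology Y W) ?P" and ?T' = "prod_topology T' CP_infinity"
  let ?Q = "\<lambda>(z, \<sigma>). (p z, complex_line \<sigma>)"
  obtain s where s: "continuous_map W Y s"
    and s_move: "\<And>w g h. w \<in> unitary_matrices \<Longrightarrow> g \<in> unitary_matrices \<Longrightarrow> h \<in> unitary_matrices \<Longrightarrow>
      s (w ** kronecker g h) = S g (s w)"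
    by (rule equivariant_map_to_Y) blast
  obtain l where l: "continuous_map ?Z ?P l"
    and l_move: "\<And>x w g h. x \<in> topspace X \<Longrightarrow> w \<in> unitary_matrices \<Longrightarrow> g \<in> unitary_matrices \<Longrightarrow> h \<in> unitary_matrices \<Longrightarrow>
      l (R g x, w ** kronecker g h) = scale_vector (\<kappa> g h) (l (x, w))"
    by (rule equivariant_map_to_lines) blast
  obtain n where n: "continuous_map (prod_topology W ?P) X n"
    and n_move: "\<And>w \<sigma> g h r. w \<in> unitary_matrices \<Longrightarrow> \<sigma> \<in> topspace ?P \<Longrightarrow> g \<in> unitary_matrices \<Longrightarrow>
      h \<in> unitary_matrices \<Longrightarrow> r > 0 \<Longrightarrow>
      n (w ** kronecker g h, scale_vector (of_real r * \<kappa> g h) \<sigma>) = R g (n (w, \<sigma>))"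
    by (rule equivariant_map_to_X) blast
  have s_in: "s w \<in> topspace Y" if "w \<in> unitary_matrices" for w
    using continuous_map_image_subset_topspace[OF s] that by auto
  have l_in: "l (x, w) \<in> topspace ?P" if "x \<in> topspace X" "w \<in> unitary_matrices" for x w
    using continuous_map_image_subset_topspace[OF l] that by auto
  have n_in: "n (w, \<sigma>) \<in> topspace X" if "w \<in> unitary_matrices" "\<sigma> \<in> topspace ?P" for w \<sigma>
    using continuous_map_image_subset_topspace[OF n] that by auto
  have q_cont: "continuous_map ?Z T q" and q_open: "open_map ?Z T q"
    using X.quotient_continuous X.quotient_open by (simp_all only: W_def)
  have q_image: "q ` topspace ?Z = topspace T"
    using X.quotient_image by simp
  have p_cont: "continuous_map (prod_topology Y W) T' p" and p_open: "open_map (prod_topology Y W) T' p"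
    using Y.quotient_continuous Y.quotient_open by (simp_all only: W_def)
  have Q_cont: "continuous_map ?Z' ?T' ?Q"
    by (rule continuous_map_prod[OF p_cont continuous_map_complex_line])
  have Q_open: "open_map ?Z' ?T' ?Q"
    by (rule open_map_prod[OF p_open open_map_complex_line])
  have Q_image: "?Q ` topspace ?Z' = topspace ?T'"
  proof -
    have "?Q ` (A \<times> B) = p ` A \<times> complex_line ` B" for A B by force
    then show ?thesis
      using Y.quotient_image by (simp add: topspace_CP_infinity)
  qed
  have line_in: "complex_line (scale_vector d \<sigma>) = complex_line \<sigma>" if "\<sigma> \<in> topspace ?P" "d \<noteq> 0" for d \<sigma>
    using that by (rule complex_line_scale)

  obtain H1 where H1: "continuous_map (prod_topology ?I ?Z) X H1"
    and H1_0: "\<And>x w. x \<in> topspace X \<Longrightarrow> w \<in> unitary_matrices \<Longrightarrow> H1 (0, (x, w)) = n (w, l (x, w))"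
    and H1_1: "\<And>x w. x \<in> topspace X \<Longrightarrow> w \<in> unitary_matrices \<Longrightarrow> H1 (1, (x, w)) = x"
    and H1_move: "\<And>t x w g h. t \<in> {0..1} \<Longrightarrow> x \<in> topspace X \<Longrightarrow> w \<in> unitary_matrices \<Longrightarrow> g \<in> unitary_matrices \<Longrightarrow> h \<in> unitary_matrices \<Longrightarrow>
      H1 (t, (R g x, w ** kronecker g h)) = R g (H1 (t, (x, w)))"
  proof (rule homotopy_to_fst)
    have "continuous_map ?Z (prod_topology W ?P) (\<lambda>z. (snd z, l z))"
      by (rule continuous_map_pairedI[OF continuous_map_snd l])
    from continuous_map_compose_lambda[OF this n]
    show "continuous_map ?Z X (\<lambda>z. n (snd z, l z))" .
    show "n (snd (R g x, w ** kronecker g h), l (R g x, w ** kronecker g h)) = R g (n (snd (x, w), l (x, w)))"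
      if "x \<in> topspace X" "w \<in> unitary_matrices" "g \<in> unitary_matrices" "h \<in> unitary_matrices" for x w g h
      using n_move[OF that(2) l_in[OF that(1,2)] that(3,4), of 1] that by (simp add: l_move)
  qed (rule that, assumption, simp_all)
  obtain H2 where H2: "continuous_map (prod_topology ?I (prod_topology Y W)) Y H2"
    and H2_0: "\<And>y w. y \<in> topspace Y \<Longrightarrow> w \<in> unitary_matrices \<Longrightarrow> H2 (0, (y, w)) = s w"
    and H2_1: "\<And>y w. y \<in> topspace Y \<Longrightarrow> w \<in> unitary_matrices \<Longrightarrow> H2 (1, (y, w)) = y"
    and H2_move: "\<And>t y w g h. t \<in> {0..1} \<Longrightarrow> y \<in> topspace Y \<Longrightarrow> w \<in> unitary_matrices \<Longrightarrow> g \<in> unitary_matrices \<Longrightarrow> h \<in> unitary_matrices \<Longrightarrow>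
      H2 (t, (S g y, w ** kronecker g h)) = S g (H2 (t, (y, w)))"
    by (rule homotopy_to_Y[OF s s_move]) (assumption+, blast)
  obtain H3 where H3: "continuous_map (prod_topology ?I (prod_topology W ?P)) ?P H3"
    and H3_0: "\<And>w \<sigma>. w \<in> unitary_matrices \<Longrightarrow> \<sigma> \<in> topspace ?P \<Longrightarrow> H3 (0, (w, \<sigma>)) = l (n (w, \<sigma>), w)"
    and H3_1: "\<And>w \<sigma>. w \<in> unitary_matrices \<Longrightarrow> \<sigma> \<in> topspace ?P \<Longrightarrow>
      H3 (1, (w, \<sigma>)) = scale_vector (1 / of_real (l1_norm \<sigma>)) \<sigma>"
    and H3_move: "\<And>t w \<sigma> g h r. t \<in> {0..1} \<Longrightarrow> w \<in> unitary_matrices \<Longrightarrow> \<sigma> \<in> topspace ?P \<Longrightarrow> g \<in> unitary_matrices \<Longrightarrow>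
      h \<in> unitary_matrices \<Longrightarrow> r > 0 \<Longrightarrow>
      H3 (t, (w ** kronecker g h, scale_vector (of_real r * \<kappa> g h) \<sigma>)) = scale_vector (\<kappa> g h) (H3 (t, (w, \<sigma>)))"
  proof (rule homotopy_to_normalization)
    have "continuous_map (prod_topology W ?P) ?Z (\<lambda>z. (n z, fst z))"
      by (rule continuous_map_pairedI[OF n continuous_map_fst])
    from continuous_map_compose_lambda[OF this l]
    show "continuous_map (prod_topology W ?P) ?P (\<lambda>z. l (n z, fst z))" .
    show "l (n (w ** kronecker g h, scale_vector (of_real r * \<kappa> g h) \<sigma>), fst (w ** kronecker g h, scale_vector (of_real r * \<kappa> g h) \<sigma>)) =
        scale_vector (\<kappa> g h) (l (n (w, \<sigma>), fst (w, \<sigma>)))"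
      if "w \<in> unitary_matrices" "\<sigma> \<in> topspace ?P" "g \<in> unitary_matrices" "h \<in> unitary_matrices" "r > 0" for w \<sigma> g h r
      using that by (simp add: n_move l_move n_in)
  qed (rule that, assumption, simp_all)
  have H1_in: "H1 (t, (x, w)) \<in> topspace X" if "t \<in> {0..1}" "x \<in> topspace X" "w \<in> unitary_matrices" for t x w
    using continuous_map_image_subset_topspace[OF H1] that by auto
  have H2_in: "H2 (t, (y, w)) \<in> topspace Y" if "t \<in> {0..1}" "y \<in> topspace Y" "w \<in> unitary_matrices" for t y w
    using continuous_map_image_subset_topspace[OF H2] that by auto
  have H3_in: "H3 (t, (w, \<sigma>)) \<in> topspace ?P" if "t \<in> {0..1}" "w \<in> unitary_matrices" "\<sigma> \<in> topspace ?P" for t w \<sigma>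
    using continuous_map_image_subset_topspace[OF H3] that by auto

  have "\<exists>F. continuous_map T ?T' F \<and> (\<forall>z\<in>topspace ?Z. F (q z) = (p (s (snd z), snd z), complex_line (l z)))"
  proof (rule quotient_map_lift)
    show "quotient_map ?Z T q"
      by (rule continuous_open_imp_quotient_map[OF q_cont q_open q_image])
    have "continuous_map ?Z (prod_topology Y W) (\<lambda>z. (s (snd z), snd z))"
      by (rule continuous_map_pairedI[OF continuous_map_on_snd[OF s] continuous_map_snd])
    from continuous_map_pairedI[OF continuous_map_compose_lambda[OF this p_cont]
        continuous_map_compose_lambda[OF l continuous_map_complex_line]]
    show "continuous_map ?Z ?T' (\<lambda>z. (p (s (snd z), snd z), complex_line (l z)))" .
    fix z z' assume z: "z \<in> topspace ?Z" "z' \<in> topspace ?Z" "q z = q z'"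
    obtain x w x' w' where xw: "z = (x, w)" "z' = (x', w')" by (cases z; cases z')
    have mem: "x \<in> topspace X" "x' \<in> topspace X" "w \<in> unitary_matrices" "w' \<in> unitary_matrices" using z xw by auto
    obtain g h where g: "g \<in> unitary_matrices" "h \<in> unitary_matrices" "x' = R g x" "w' = w ** kronecker g h"
      using X.quotient_eqD[OF mem] z(3) xw by blast
    have "p (s w', w') = p (s w, w)" "complex_line (l (x', w')) = complex_line (l (x, w))"
      using g mem by (simp_all add: s_move Y.quotient_move s_in l_move line_in l_in \<kappa>_nonzero)
    then show "(p (s (snd z), snd z), complex_line (l z)) = (p (s (snd z'), snd z'), complex_line (l z'))"
      by (simp add: xw)
  qed
  then obtain F where F: "continuous_map T ?T' F"
    and F_eq: "\<forall>z\<in>topspace ?Z. F (q z) = (p (s (snd z), snd z), complex_line (l z))"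
    by (elim exE conjE)
  have F_q: "F (q (x, w)) = (p (s w, w), complex_line (l (x, w)))" if "x \<in> topspace X" "w \<in> unitary_matrices" for x w
    using F_eq[rule_format, of "(x, w)"] that by simp
  have fibre: "\<exists>y w \<sigma> g h r. z = ((y, w), \<sigma>) \<and> z' = ((S g y, w ** kronecker g h), scale_vector (of_real r * \<kappa> g h) \<sigma>) \<and>
      y \<in> topspace Y \<and> w \<in> unitary_matrices \<and> \<sigma> \<in> topspace ?P \<and> g \<in> unitary_matrices \<and> h \<in> unitary_matrices \<and> r > (0 :: real)"
    if z: "z \<in> topspace ?Z'" "z' \<in> topspace ?Z'" "?Q z = ?Q z'" for z z'
  proof -
    obtain y w \<sigma> y' w' \<sigma>' where yw: "z = ((y, w), \<sigma>)" "z' = ((y', w'), \<sigma>')"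
      by (metis surj_pair)
    have mem: "y \<in> topspace Y" "y' \<in> topspace Y" "w \<in> unitary_matrices" "w' \<in> unitary_matrices" "\<sigma> \<in> topspace ?P"
      using z yw by auto
    have eq: "p (y, w) = p (y', w')" "complex_line \<sigma> = complex_line \<sigma>'" using z(3) yw by auto
    obtain g h r where "g \<in> unitary_matrices" "h \<in> unitary_matrices" "r > (0 :: real)" "y' = S g y"
      "w' = w ** kronecker g h" "\<sigma>' = scale_vector (of_real r * \<kappa> g h) \<sigma>"
      by (rule fibre_of_product[OF mem eq])
    then show ?thesis using yw mem by blast
  qed
  have "\<exists>G. continuous_map ?T' T G \<and> (\<forall>z\<in>topspace ?Z'. G (?Q z) = q (n (snd (fst z), snd z), snd (fst z)))"
  proof (rule quotient_map_lift)
    show "quotient_map ?Z' ?T' ?Q"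
      by (rule continuous_open_imp_quotient_map[OF Q_cont Q_open Q_image])
    have w: "continuous_map ?Z' W (\<lambda>z. snd (fst z))"
      by (rule continuous_map_on_fst[OF continuous_map_snd])
    have "continuous_map ?Z' X (\<lambda>z. n (snd (fst z), snd z))"
      by (rule continuous_map_compose_lambda[OF continuous_map_pairedI[OF w continuous_map_snd] n])
    from continuous_map_compose_lambda[OF continuous_map_pairedI[OF this w] q_cont]
    show "continuous_map ?Z' T (\<lambda>z. q (n (snd (fst z), snd z), snd (fst z)))" .
    fix z z' assume "z \<in> topspace ?Z'" "z' \<in> topspace ?Z'" "?Q z = ?Q z'"
    from fibre[OF this]
    show "q (n (snd (fst z), snd z), snd (fst z)) = q (n (snd (fst z'), snd z'), snd (fst z'))"
      by (elim exE conjE) (simp add: n_move X.quotient_move n_in)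
  qed
  then obtain G where G: "continuous_map ?T' T G"
    and G_eq: "\<forall>z\<in>topspace ?Z'. G (?Q z) = q (n (snd (fst z), snd z), snd (fst z))"
    by (elim exE conjE)
  have G_Q: "G (p (y, w), complex_line \<sigma>) = q (n (w, \<sigma>), w)"
    if "y \<in> topspace Y" "w \<in> unitary_matrices" "\<sigma> \<in> topspace ?P" for y w \<sigma>
    using G_eq[rule_format, of "((y, w), \<sigma>)"] that by simp

  have GF: "homotopic_with (\<lambda>_. True) T T (G \<circ> F) id"
  proof (rule quotient_homotopy[OF q_cont q_open q_image])
    have "continuous_map (prod_topology ?I ?Z) W (\<lambda>z. snd (snd z))"
      by (rule continuous_map_on_snd[OF continuous_map_snd])
    from continuous_map_compose_lambda[OF continuous_map_pairedI[OF H1 this] q_cont]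
    show "continuous_map (prod_topology ?I ?Z) T (\<lambda>z. q (H1 z, snd (snd z)))" .
    fix z assume "z \<in> topspace ?Z"
    then obtain x w where xw: "z = (x, w)" "x \<in> topspace X" "w \<in> unitary_matrices" by auto
    show "(G \<circ> F) (q z) = q (H1 (0, z), snd (snd (0, z)))"
      using xw by (simp add: F_q G_Q s_in l_in H1_0)
    show "id (q z) = q (H1 (1, z), snd (snd (1, z)))"
      using xw by (simp add: H1_1)
  next
    fix t :: real and z z' assume t: "t \<in> {0..1}" and z: "z \<in> topspace ?Z" "z' \<in> topspace ?Z" "q z = q z'"
    obtain x w x' w' where xw: "z = (x, w)" "z' = (x', w')" by (cases z; cases z')
    have mem: "x \<in> topspace X" "x' \<in> topspace X" "w \<in> unitary_matrices" "w' \<in> unitary_matrices" using z xw by auto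
    obtain g h where g: "g \<in> unitary_matrices" "h \<in> unitary_matrices" "x' = R g x" "w' = w ** kronecker g h"
      using X.quotient_eqD[OF mem] z(3) xw by blast
    show "q (H1 (t, z), snd (snd (t, z))) = q (H1 (t, z'), snd (snd (t, z')))"
      using g t mem H1_move[OF t mem(1,3) g(1,2)] by (simp only: xw snd_conv X.quotient_move[OF H1_in[OF t]])
  qed
  have FG: "homotopic_with (\<lambda>_. True) ?T' ?T' (F \<circ> G) id"
  proof (rule quotient_homotopy[OF Q_cont Q_open Q_image])
    let ?J = "prod_topology ?I ?Z'"
    let ?h2 = "\<lambda>z :: real \<times> ('y \<times> (complex^('k \<times> 'l)^('k \<times> 'l))) \<times> (nat \<Rightarrow> complex). H2 (fst z, fst (snd z))"
    let ?h3 = "\<lambda>z :: real \<times> ('y \<times> (complex^('k \<times> 'l)^('k \<times> 'l))) \<times> (nat \<Rightarrow> complex).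
      H3 (fst z, (snd (fst (snd z)), snd (snd z)))"
    let ?h = "\<lambda>z. (p (?h2 z, snd (fst (snd z))), complex_line (?h3 z))"
    have yw: "continuous_map ?J (prod_topology Y W) (\<lambda>z. fst (snd z))"
      by (rule continuous_map_on_snd[OF continuous_map_fst])
    have w: "continuous_map ?J W (\<lambda>z. snd (fst (snd z)))"
      by (rule continuous_map_compose_lambda[OF yw continuous_map_snd])
    have \<sigma>: "continuous_map ?J ?P (\<lambda>z. snd (snd z))"
      by (rule continuous_map_on_snd[OF continuous_map_snd])
    have h2: "continuous_map ?J Y ?h2"
      by (rule continuous_map_compose_lambda[OF continuous_map_pairedI[OF continuous_map_fst yw] H2])
    have h3: "continuous_map ?J ?P ?h3"
      by (rule continuous_map_compose_lambda[OF continuous_map_pairedI[OF continuous_map_fst continuous_map_pairedI[OF w \<sigma>]] H3])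
    show "continuous_map ?J ?T' ?h"
      by (rule continuous_map_pairedI[OF continuous_map_compose_lambda[OF continuous_map_pairedI[OF h2 w] p_cont]
        continuous_map_compose_lambda[OF h3 continuous_map_complex_line]])
    fix z assume "z \<in> topspace ?Z'"
    then obtain y w \<sigma> where z: "z = ((y, w), \<sigma>)" "y \<in> topspace Y" "w \<in> unitary_matrices" "\<sigma> \<in> topspace ?P" by auto
    show "(F \<circ> G) (?Q z) = ?h (0, z)"
      using z by (simp add: G_Q F_q n_in H2_0 H3_0)
    show "id (?Q z) = ?h (1, z)"
      using z l1_norm_pos[of \<sigma>] by (simp add: H2_1 H3_1 line_in)
  next
    fix t :: real and z z' assume t: "t \<in> {0..1}" and z: "z \<in> topspace ?Z'" "z' \<in> topspace ?Z'" "?Q z = ?Q z'"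
    show "(p (H2 (fst (t, z), fst (snd (t, z))), snd (fst (snd (t, z)))),
        complex_line (H3 (fst (t, z), (snd (fst (snd (t, z))), snd (snd (t, z)))))) =
      (p (H2 (fst (t, z'), fst (snd (t, z'))), snd (fst (snd (t, z')))),
        complex_line (H3 (fst (t, z'), (snd (fst (snd (t, z'))), snd (snd (t, z'))))))"
      using fibre[OF z] t
      by (elim exE conjE) (simp add: H2_move H3_move Y.quotient_move H2_in H3_in line_in \<kappa>_nonzero)
  qed
  show ?thesis
    unfolding homotopy_equivalent_space_def using F G GF FG by blast
qed

end

section \<open>The universal bundles\<close>

text \<open>
  Composing the quotient map of an associated bundle with the open map from unitary matrices to
  homomorphisms gives the required presentation. The homomorphism \<open>j\<close> is the standard
  representation for vector bundles and conjugation for matrix bundles.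
\<close>

lemma unitary_space_of_frames:
  fixes j :: "complex^'k::finite^'k \<Rightarrow> 'm::topological_space \<Rightarrow> 'm" and isos :: "'s \<Rightarrow> ('m \<Rightarrow> 'e) set"
    and E :: "('b, 'e, 's) fibre_bundle" and G :: "'b \<Rightarrow> 'q set"
    and tr :: "'b \<Rightarrow> ('m \<Rightarrow> 'e) \<Rightarrow> (complex^'k^'k \<Rightarrow> complex^('k \<times> 'l::finite)^('k \<times> 'l)) \<Rightarrow> 'q"
  assumes assoc: "associated_bundle isos E aut (top_of_set (star_homs matrix_algebra matrix_algebra)) G act tr"
    and j_image: "j ` unitary_matrices = aut" and j_continuous: "continuous_on unitary_matrices j"
    and j_one: "j (mat 1) = id"
    and j_mult: "\<And>g g'. g \<in> unitary_matrices \<Longrightarrow> g' \<in> unitary_matrices \<Longrightarrow> j (g ** g') = j g \<circ> j g'"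
    and act: "\<And>g \<phi>. g \<in> unitary_matrices \<Longrightarrow> act (j g) \<phi> = \<phi> \<circ> conjugation (adjoint_matrix g)"
    and contractible: "contractible_space (total_space (frame_bundle aut isos E))" and base: "topspace (base E) \<noteq> {}"
  shows "unitary_space (total_space (frame_bundle aut isos E)) (\<lambda>g e. (fst e, snd e \<circ> j g))
    (\<lambda>z. associated_bundle.quot tr (fst z, amplification (snd z)))
    (associated_bundle.total isos E (top_of_set (star_homs matrix_algebra matrix_algebra)) G tr)"
proof -
  let ?W = "top_of_set (unitary_matrices :: (complex^('k \<times> 'l)^('k \<times> 'l)) set)"
  let ?F = "top_of_set (star_homs matrix_algebra matrix_algebra) :: (complex^'k^'k \<Rightarrow> complex^('k \<times> 'l)^('k \<times> 'l)) topology"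
  interpret associated_bundle isos E aut ?F G act tr by (rule assoc)
  have X: "total_space (frame_bundle aut isos E) = frames.total" by (rule total_space_frame_bundle)
  have j_in: "j g \<in> aut" if "g \<in> unitary_matrices" for g using j_image that by blast
  have amp_in: "amplification w \<in> topspace ?F" if "w \<in> unitary_matrices" for w :: "complex^('k \<times> 'l)^('k \<times> 'l)"
    using amplification_star_hom[OF that] by simp
  have cont: "continuous_map (prod_topology frames.total ?W) (prod_topology frames.total ?F) (\<lambda>(e, w). (e, amplification w))"
    by (rule continuous_map_prod[OF _ amplification_continuous]) simp
  have opn: "open_map (prod_topology frames.total ?W) (prod_topology frames.total ?F) (\<lambda>(e, w). (e, amplification w))"
    by (rule open_map_prod[OF open_map_id amplification_open])
  show ?thesis
    unfolding X
  proof
    have "continuous_map (top_of_set unitary_matrices) (top_of_set aut) j"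
      using j_continuous j_in by (auto simp: continuous_map_in_subtopology)
    then have "continuous_map (prod_topology (top_of_set unitary_matrices) frames.total) (prod_topology frames.total (top_of_set aut))
        (\<lambda>z. (snd z, j (fst z)))"
      by (rule continuous_map_pairedI[OF continuous_map_snd continuous_map_on_fst])
    from continuous_map_compose_lambda[OF this frame_action_continuous]
    show "continuous_map (prod_topology (top_of_set unitary_matrices) frames.total) frames.total (\<lambda>(g, e). (fst e, snd e \<circ> j g))"
      by (simp add: case_prod_unfold)
    show "(fst (fst e, snd e \<circ> j g), snd (fst e, snd e \<circ> j g) \<circ> j g') = (fst e, snd e \<circ> j (g ** g'))"
      if "g \<in> unitary_matrices" "g' \<in> unitary_matrices" for e :: "'b \<times> ('m \<Rightarrow> 'e)" and g g'
      by (simp add: j_mult[OF that] o_assoc)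
    show "(fst e, snd e \<circ> j (mat 1)) = e" for e :: "'b \<times> ('m \<Rightarrow> 'e)" by (simp add: j_one)
    show "contractible_space frames.total" using contractible by (simp only: X)
    obtain x where x: "x \<in> topspace (base E)" using base by blast
    obtain U h where "x \<in> U" "chart isos E U h" using local_charts[OF x] by blast
    then have "(x, h x) \<in> topspace frames.total" using x chart_iso by (simp add: frames_topspace)
    then show "topspace frames.total \<noteq> {}" by blast
    from continuous_map_compose_lambda[OF cont quot_continuous]
    show "continuous_map (prod_topology frames.total ?W) total (\<lambda>z. quot (fst z, amplification (snd z)))"
      by (simp add: case_prod_unfold)
    from open_map_compose[OF opn quot_open]
    show "open_map (prod_topology frames.total ?W) total (\<lambda>z. quot (fst z, amplification (snd z)))"
      by (simp add: case_prod_unfold o_def)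
    have image: "(\<lambda>z. (fst z, amplification (snd z))) ` (topspace frames.total \<times> unitary_matrices) = topspace (prod_topology frames.total ?F)"
      unfolding topspace_prod_topology topspace_subtopology amplification_image[symmetric] by force
    show "(\<lambda>z. quot (fst z, amplification (snd z))) ` (topspace frames.total \<times> unitary_matrices) = topspace total"
      by (simp only: quot_surj[symmetric] image[symmetric] image_image)
  next
    fix e and w :: "complex^('k \<times> 'l)^('k \<times> 'l)" and g :: "complex^'k^'k" and h :: "complex^'l^'l"
    assume e: "e \<in> topspace frames.total" and w: "w \<in> unitary_matrices" and g: "g \<in> unitary_matrices" "h \<in> unitary_matrices"
    have "act (j g) (amplification (w ** kronecker g h)) = amplification w"
      unfolding act[OF g(1)]
      by (simp add: fun_eq_iff amplification_kronecker[OF g(2)] unitary_right[OF g(1)] flip: conjugation_mult)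
    moreover have "w ** kronecker g h \<in> unitary_matrices" by (intro unitary_mult kronecker_unitary w g)
    ultimately show "quot (fst ((fst e, snd e \<circ> j g), w ** kronecker g h), amplification (snd ((fst e, snd e \<circ> j g), w ** kronecker g h))) =
        quot (fst (e, w), amplification (snd (e, w)))"
      using quot_move[OF e j_in[OF g(1)] amp_in] by simp
  next
    fix e e' and w w' :: "complex^('k \<times> 'l)^('k \<times> 'l)"
    assume e: "e \<in> topspace frames.total" "e' \<in> topspace frames.total" and w: "w \<in> unitary_matrices" "w' \<in> unitary_matrices"
      and eq: "quot (fst (e, w), amplification (snd (e, w))) = quot (fst (e', w'), amplification (snd (e', w')))"
    have "quot (e, amplification w) = quot (e', amplification w')" using eq by simp
    from quot_eqD[OF e amp_in[OF w(1)] amp_in[OF w(2)] this] j_image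
    obtain g where g: "g \<in> unitary_matrices" "e' = (fst e, snd e \<circ> j g)" "amplification w = act (j g) (amplification w')"
      by blast
    have "amplification w' M = amplification w (conjugation g M)" for M
      unfolding g(3) act[OF g(1)] by (simp add: unitary_left[OF g(1)] flip: conjugation_mult)
    then obtain h where "h \<in> unitary_matrices" "w' = w ** kronecker g h"
      by (rule amplification_fibre[OF w g(1)])
    then show "\<exists>g\<in>unitary_matrices. \<exists>h\<in>unitary_matrices. e' = (fst e, snd e \<circ> j g) \<and> w' = w ** kronecker g h"
      using g by blast
  qed
qed

theorem proposition3:
  fixes \<xi> :: "('b, 'e, 'e hermitian_space) fibre_bundle"
    and A :: "('c, 'f, 'f star_algebra) fibre_bundle"
  assumes "coprime CARD('k::finite) CARD('l::finite)"
    and "universal_vector_bundle TYPE('k) \<xi>"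
    and "universal_matrix_bundle TYPE('k) A"
  shows "total_space (H_bundle TYPE('k) TYPE('l) (End_bundle TYPE('k) \<xi>))
    homotopy_equivalent_space prod_topology (total_space (H_bundle TYPE('k) TYPE('l) A)) CP_infinity"
proof -
  let ?U = "unitary_isos (coordinate_space :: (complex^'k) hermitian_space)" and ?aU = "unitary_isos coordinate_space (coordinate_space :: (complex^'k) hermitian_space)"
  let ?M = "star_isos (matrix_algebra :: (complex^'k^'k) star_algebra)" and ?aM = "star_isos matrix_algebra (matrix_algebra :: (complex^'k^'k) star_algebra)"
  have lt_\<xi>: "locally_trivial ?U \<xi>" and num: "numerable ?U \<xi>" and base_\<xi>: "topspace (base \<xi>) \<noteq> {}"
    and contr_\<xi>: "contractible_space (total_space (frame_bundle ?aU ?U \<xi>))"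
    using assms(2) by (simp_all add: universal_vector_bundle_def universal_bundle_def)
  have lt_A: "locally_trivial ?M A" and base_A: "topspace (base A) \<noteq> {}"
    and contr_A: "contractible_space (total_space (frame_bundle ?aM ?M A))"
    using assms(3) by (simp_all add: universal_matrix_bundle_def universal_bundle_def)
  interpret F: frame_structure ?U \<xi> ?aU by (rule unitary_frame_structure[OF lt_\<xi>])
  let ?X = "total_space (frame_bundle ?aU ?U \<xi>)" and ?R = "\<lambda>(g :: complex^'k^'k) (e :: 'b \<times> (complex^'k \<Rightarrow> 'e)). (fst e, snd e \<circ> (*v) g)"
  let ?Y = "total_space (frame_bundle ?aM ?M A)" and ?S = "\<lambda>(g :: complex^'k^'k) (e :: 'c \<times> (complex^'k^'k \<Rightarrow> 'f)). (fst e, snd e \<circ> conjugation g)"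
  have X: "unitary_space ?X ?R
      (\<lambda>z. associated_bundle.quot (\<lambda>x f. hom_transport (endomorphism_algebra (fibre \<xi> x)) (inner_extension (fibre \<xi> x) f))
        (fst z, amplification (snd z)))
      (total_space (H_bundle TYPE('k) TYPE('l) (End_bundle TYPE('k) \<xi>)))"
    unfolding End_H_total_space[OF lt_\<xi>]
  proof (rule unitary_space_of_frames[OF End_H_associated_bundle[OF lt_\<xi>] _ _ _ _ _ contr_\<xi> base_\<xi>])
    show "(*v) ` unitary_matrices = ?aU" by (rule unitary_automorphisms[symmetric])
    show "continuous_on unitary_matrices ((*v) :: complex^'k^'k \<Rightarrow> _)"
      by (rule continuous_on_coordinatewise_then_product)
        (unfold matrix_vector_mult_def, intro continuous_intros)
  qed (simp_all add: fun_eq_iff flip: matrix_vector_mul_assoc)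
  have Y: "unitary_space ?Y ?S
      (\<lambda>z. associated_bundle.quot (\<lambda>x. hom_transport (fibre A x)) (fst z, amplification (snd z)))
      (total_space (H_bundle TYPE('k) TYPE('l) A))"
    unfolding H_total_space[OF lt_A]
  proof (rule unitary_space_of_frames[OF H_associated_bundle[OF lt_A] _ _ _ _ _ contr_A base_A])
    show "conjugation ` unitary_matrices = ?aM" by (rule star_automorphisms[symmetric])
    show "continuous_on unitary_matrices (conjugation :: complex^'k^'k \<Rightarrow> _)"
      by (rule continuous_on_coordinatewise_then_product)
        (unfold conjugation_def, intro continuous_intros)
    show "\<phi> \<circ> inv (conjugation g) = \<phi> \<circ> conjugation (adjoint_matrix g)" if "g \<in> unitary_matrices"
      for g :: "complex^'k^'k" and \<phi> :: "complex^'k^'k \<Rightarrow> complex^('k \<times> 'l)^('k \<times> 'l)"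
    proof -
      have "inv (conjugation g) = conjugation (adjoint_matrix g)"
        by (rule inv_equality) (simp_all add: unitary_left[OF that] unitary_right[OF that] flip: conjugation_mult)
      then show ?thesis by simp
    qed
  qed (simp_all add: fun_eq_iff conjugation_mult)
  obtain a b and u :: "nat \<Rightarrow> complex^('k \<times> 'l)^('k \<times> 'l) \<Rightarrow> real"
    and f :: "nat \<Rightarrow> complex^('k \<times> 'l)^('k \<times> 'l) \<Rightarrow> complex^'k^'k"
  where bezout: "CARD('l) * b = CARD('k) * a + 1"
    and u: "\<And>m. continuous_on UNIV (u m)" "\<And>m w. 0 \<le> u m w" "\<And>w. w \<in> unitary_matrices \<Longrightarrow> \<exists>m. u m w > 0"
    and f: "\<And>m. continuous_on {w. u m w > 0} (f m)" "\<And>m w. u m w > 0 \<Longrightarrow> f m w \<in> unitary_matrices"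
    and move: "\<And>m w g h. g \<in> unitary_matrices \<Longrightarrow> h \<in> unitary_matrices \<Longrightarrow> u m (w ** kronecker g h) = u m w"
      "\<And>m w g h. g \<in> unitary_matrices \<Longrightarrow> h \<in> unitary_matrices \<Longrightarrow>
        f m (w ** kronecker g h) = mat (det g ^ a * det h ^ b) ** f m w ** g"
    by (rule equivariant_frames[OF assms(1)]) blast
  obtain v :: "nat \<Rightarrow> 'b \<Rightarrow> real" and c :: "nat \<Rightarrow> 'b \<times> (complex^'k \<Rightarrow> 'e) \<Rightarrow> complex^'k \<Rightarrow> complex^'k"
  where v: "\<And>m. continuous_map (base \<xi>) euclideanreal (v m)" "\<And>m x. 0 \<le> v m x"
      "\<And>x. x \<in> topspace (base \<xi>) \<Longrightarrow> \<exists>m. v m x > 0"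
    and c: "\<And>m. continuous_map (subtopology F.frames.total {e \<in> topspace F.frames.total. v m (fst e) > 0}) (top_of_set ?aU) (c m)"
    and c_comp: "\<And>m x f g. c m (x, f \<circ> g) = c m (x, f) \<circ> g"
    by (rule F.numerable_frame_coordinates[OF num]) blast
  have total: "?X = F.frames.total" by (rule F.total_space_frame_bundle)
  \<comment> \<open>The value 0 outside the domain of the coordinate makes the equivariance hold everywhere.\<close>
  define c' where "c' m e = (if v m (fst e) > 0 then matrix (c m e) else 0)" for m e
  interpret comparison: coprime_comparison ?X ?R
      "\<lambda>z. associated_bundle.quot (\<lambda>x f. hom_transport (endomorphism_algebra (fibre \<xi> x)) (inner_extension (fibre \<xi> x) f))
        (fst z, amplification (snd z))"
      "total_space (H_bundle TYPE('k) TYPE('l) (End_bundle TYPE('k) \<xi>))" ?Y ?S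
      "\<lambda>z. associated_bundle.quot (\<lambda>x. hom_transport (fibre A x)) (fst z, amplification (snd z))"
      "total_space (H_bundle TYPE('k) TYPE('l) A)" a b u f "\<lambda>m e. v m (fst e)" c'
  proof (rule coprime_comparison.intro[OF X Y], unfold_locales)
    show "continuous_map ?X euclideanreal (\<lambda>e. v m (fst e))" for m
      unfolding total by (rule continuous_map_compose_lambda[OF F.frames.continuous_map_total_fst v(1)])
    show "\<exists>m. v m (fst e) > 0" if "e \<in> topspace ?X" for e
      using that v(3) unfolding total by (cases e) (auto simp: F.frames_topspace)
    show "continuous_map (subtopology ?X {e \<in> topspace ?X. v m (fst e) > 0}) (top_of_set unitary_matrices) (c' m)" for m
    proof (rule continuous_map_eq)
      have "continuous_map (top_of_set ?aU) (top_of_set unitary_matrices) matrix"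
        using unitary_aut_matrix(1) by (auto simp: continuous_map_in_subtopology continuous_on_matrix)
      then show "continuous_map (subtopology ?X {e \<in> topspace ?X. v m (fst e) > 0}) (top_of_set unitary_matrices) (\<lambda>e. matrix (c m e))"
        unfolding total by (rule continuous_map_compose_lambda[OF c])
    qed (simp add: c'_def)
    show "c' m (fst e, snd e \<circ> (*v) g) = c' m e ** g" if "e \<in> topspace ?X" for m e g
    proof (cases "v m (fst e) > 0")
      case True
      then have "c m e \<in> ?aU"
        using continuous_map_image_subset_topspace[OF c[of m]] that by (auto simp: total)
      then obtain k where "c m e = (*v) k" unfolding unitary_automorphisms by blast
      moreover have "c m (fst e, snd e \<circ> (*v) g) = c m e \<circ> (*v) g" by (simp add: c_comp)
      ultimately have "c m (fst e, snd e \<circ> (*v) g) = (*v) (k ** g)"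
        by (simp add: fun_eq_iff matrix_vector_mul_assoc)
      then show ?thesis using True \<open>c m e = (*v) k\<close> by (simp add: c'_def)
    qed (simp add: c'_def)
    show "?S (mat z ** g) = ?S g" if "norm z = 1" for z g
      using conjugation_scalar[OF that, of g] by (simp add: fun_eq_iff)
  qed (use bezout u f move v(2) in auto)
  show ?thesis by (rule comparison.homotopy_equivalence)
qed

end
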